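(* Let $\Sigma$ be a unimodular tropical fan of dimension $d$ which is a tropical homology manifold with integral coefficients. Then for each element $\alpha\in H^{p,p}(\overline\Sigma,\mathbb Z)$ there is a tropical cycle of codimension $p$ in $\overline\Sigma$ whose class in $H_{d-p,d-p}(\overline\Sigma,\mathbb Z)$ is the Poincaré dual of $\alpha$. Moreover, for $p\neq q$, $H_{p,q}(\overline\Sigma,\mathbb Z)$ is trivial. The same statements are true with rational coefficients for a simplicial tropical fan $\Sigma$ which is a tropical homology manifold (with rational coefficients).
   Context: **Fans.** $N$ is a free $\mathbb Z$-module of finite rank, $N_{\mathbb R}=N\otimes\mathbb R$. Cones are strictly convex polyhedral cones, rational with respect to $N$; fans are finite. $\Sigma_k$ is the set of $k$-dimensional cones, $\underline 0=\{0\}$, $|\sigma|=\dim\sigma$, and $\tau\prec\sigma$ means that $\tau$ is a face of $\sigma$ (equality allowed). $N_{\sigma,\mathbb R}$ is the span of $\sigma$, $N_\sigma=N\cap N_{\sigma,\mathbb R}$, $N^\sigma=N/N_\sigma$, $N^\sigma_{\mathbb R}=N_{\mathbb R}/N_{\sigma,\mathbb R}$. If $\tau\prec\sigma$ has codimension one, $e^\tau_\sigma$ is the generator of $N_\sigma/N_\tau\simeq\mathbb Z$ lying in the image of $\sigma$. $\Sigma$ is simplicial if each cone is generated by as many rays as its dimension; unimodular if moreover the primitive vectors of the rays of any cone are part of a basis of $N$. The star fan $\Sigma^\sigma$ is the fan in $N^\sigma_{\mathbb R}$ formed by the projections of the cones $\eta\in\Sigma$ with $\sigma\prec\eta$. **Tropical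 fans and homology manifolds.** A tropical fan is a pair $(\Sigma,\omega)$ with $\Sigma$ rational of pure dimension $d$ and $\omega\colon\Sigma_d\to\mathbb Z\setminus\{0\}$ satisfying $\sum_{\sigma\in\Sigma_d,\,\sigma\succ\tau}\omega(\sigma)e^\tau_\sigma=0$ in $N/N_\tau$ for all $\tau\in\Sigma_{d-1}$. Star fans inherit the orientation of $\Sigma$. For a cone $\sigma$ let $\mathbf F_p(\sigma)=\sum_{\eta\succ\sigma}\bigwedge^pN_\eta\subseteq\bigwedge^pN$, $\mathbf F^p(\sigma)=\mathrm{Hom}(\mathbf F_p(\sigma),\mathbb Z)$, $C^{BM}_{p,q}(\Sigma)=\bigoplus_{\sigma\in\Sigma_q}\mathbf F_p(\sigma)$ with cellular boundary (signed sum of the inclusions $\mathbf F_p(\sigma)\subseteq\mathbf F_p(\tau)$ for $\tau$ a facet of $\sigma$, the signs coming from chosen orientations $\nu_\sigma$, generators of $\bigwedge^{|\sigma|}N_\sigma$), and $H^{BM}_{p,q}(\Sigma)$ its homology. $\Sigma$ satisfies tropical Poincaré duality if $H^{BM}_{p,q}(\Sigma)=0$ for all $p$ and all $q\ne d$, and for all $k$ the map $\mathbf F^k(\underline0)\to H^{BM}_{d-k,d}(\Sigma)$ sending $\alpha$ to the chain with coefficient $\omega(\eta)\kappa_\alpha(\nu_\eta)$ at $\eta\in\Sigma_d$ is an isomorphism ($\kappa_\alpha$ the contraction by $\alpha$). $\Sigma$ is a tropical homology manifold with integral coefficients if all star fans $\Sigma^\sigma$, $\sigma\in\Sigma$, satisfy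 tropical Poincaré duality (equivalently, all open subsets of the support of $\Sigma$ do); it is a tropical homology manifold if this holds with $\mathbb Q$-coefficients. **Canonical compactification.** Let $\mathbb T_+=\mathbb R_{\ge0}\cup\{\infty\}$. For a cone $\sigma$ with dual cone $\sigma^\vee$, $\overline\sigma=\mathrm{Hom}_{\mathbb R_+}(\sigma^\vee,\mathbb T_+)$ (morphisms of $\mathbb R_{+}$-modules); $\overline\Sigma$ is the union of the $\overline\sigma$, glued along $\overline\tau\subseteq\overline\sigma$ for $\tau\prec\sigma$. For $\Sigma$ simplicial, its closed faces are hypercubes $\square^\tau_\sigma\simeq\mathbb T_+^{|\sigma|-|\tau|}$ indexed by pairs $\tau\prec\sigma$: $\square^\tau_\sigma$ is the closure of the copy, in the stratum at infinity $N^\tau_{\mathbb R}$, of the projection of $\sigma$ to $N^\tau_{\mathbb R}$. One has $\square^{\tau'}_{\sigma'}\subseteq\square^\tau_\sigma$ iff $\tau\prec\tau'\prec\sigma'\prec\sigma$; $\square^{\underline0}_\sigma=\overline\sigma$. **Tropical (co)homology of $\overline\Sigma$.** For $\delta=\square^\tau_\sigma$ put $N_\delta=N_\sigma/N_\tau$, $\mathbf F_p(\delta)=\sum_{\eta\succ\sigma}\bigwedge^p(N_\eta/N_\tau)\subseteq\bigwedge^pN^\tau$, $\mathbf F^p(\delta)=\mathrm{Hom}(\mathbf F_p(\delta),\mathbb Z)$. For $\gamma=\square^{\tau'}_{\sigma'}\subseteq\delta=\square^\tau_\sigma$, the projection $N^\tau\to N^{\tau'}$ induces $\mathbf F_p(\delta)\to\mathbf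 F_p(\gamma)$, and dually $\mathbf F^p(\gamma)\to\mathbf F^p(\delta)$. Fix a generator $\nu_\delta$ of $\bigwedge^{\dim\delta}N_\delta$ for every face (equal to $1$ for points and to the primitive generator $e^\tau_\sigma$ in dimension one); $\nu_\sigma=\nu_{\overline\sigma}$. For a codimension-one face $\gamma$ of $\delta=\square^\tau_\sigma$, $\mathrm{sign}(\gamma,\delta)\in\{\pm1\}$ is defined by $n\wedge\nu_\gamma=\mathrm{sign}(\gamma,\delta)\nu_\delta$ if $\gamma=\square^\tau_{\sigma'}$, $n$ any lift of $e^{\sigma'}_\sigma$; and by $e^\tau_{\tau'}\wedge\nu'=-\mathrm{sign}(\gamma,\delta)\nu_\delta$ if $\gamma=\square^{\tau'}_\sigma$, $\nu'$ any lift of $\nu_\gamma$. $C_{p,q}(\overline\Sigma)=\bigoplus_{\dim\delta=q}\mathbf F_p(\delta)$ with $\partial$ the sum of the maps $\mathbf F_p(\delta)\to\mathbf F_p(\gamma)$ multiplied by $\mathrm{sign}(\gamma,\delta)$; $C^{p,\bullet}(\overline\Sigma)$ is the dual cochain complex; $H_{p,q}(\overline\Sigma)=H_q(C_{p,\bullet}(\overline\Sigma))$, $H^{p,q}(\overline\Sigma)=H^q(C^{p,\bullet}(\overline\Sigma))$; rational versions by tensoring the complexes with $\mathbb Q$. **Poincaré dual.** The cup product on $H^{\bullet,\bullet}(\overline\Sigma)$ is induced by $(a\smile b)_{\square^\tau_\eta}=\sum_{\tau\prec\sigma\prec\eta,\,|\sigma|-|\tau|=q}\varepsilon_\sigma\,a_{\square^\tau_\sigma}\wedge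 b_{\square^\sigma_\eta}$ for $a\in C^{p,q}$, $b\in C^{p',q'}$, $|\eta|-|\tau|=q+q'$ (factors transported to $\square^\tau_\eta$ by the maps $\mathbf F^\bullet(\gamma)\to\mathbf F^\bullet(\delta)$; $\nu_{\square^\tau_\sigma}\wedge\nu'=\varepsilon_\sigma\nu_{\square^\tau_\eta}$ with $\nu'$ any lift of $\nu_{\square^\sigma_\eta}$; $\wedge$ induced by the exterior product of restrictions to each $\bigwedge^\bullet(N_\eta/N_\tau)$). The cap product is its adjoint, $\langle b,a\frown z\rangle=\langle a\smile b,z\rangle$ at the chain level. The fundamental class $[\overline\Sigma]\in H_{d,d}(\overline\Sigma)$ is the class of the cycle with component $\omega(\eta)\nu_\eta$ on $\overline\eta$, $\eta\in\Sigma_d$. The Poincaré dual of $\alpha\in H^{p,p}(\overline\Sigma)$ is $\alpha\frown[\overline\Sigma]\in H_{d-p,d-p}(\overline\Sigma)$. **Tropical cycles.** A tropical cycle of dimension $k$ (codimension $d-k$) in $\overline\Sigma$ is a sum of closures in $\overline\Sigma$ of weighted balanced rational polyhedral complexes of pure dimension $k$ contained in the strata (the copies of the star fans $\Sigma^\sigma$ in $N^\sigma_{\mathbb R}$); weights are in $\mathbb Z$, respectively $\mathbb Q$ for rational coefficients. Its class in $H_{k,k}(\overline\Sigma)$ is represented, on a suitable subdivision, by the chain with component $w(P)\nu_P$ on each cell $P$ of weight $w(P)$, $\nu_P$ the canonical generator for the orientation of $P$. In particular a Minkowski weight $w\colon\Sigma_k\to\mathbb Z$ (i.e. $\sum_{\sigma\in\Sigma_k,\,\sigma\succ\tau}w(\sigma)e^\tau_\sigma=0$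 in $N^\tau$ for all $\tau\in\Sigma_{k-1}$) defines a tropical cycle of dimension $k$, whose class is that of the cycle in $C_{k,k}(\overline\Sigma)$ with component $w(\sigma)\nu_\sigma$ on $\overline\sigma$, $\sigma\in\Sigma_k$. *)

theory Defs
  imports
    "HOL-Analysis.Analysis"
    "HOL-Algebra.Elementary_Groups"
    "HOL-Library.Function_Algebras"
begin

section \<open>Spans, lattices and quotients\<close>

text \<open>The coefficient ring \<open>K\<close> is a subring of the reals, \<open>\<int>\<close> or \<open>\<rat>\<close>. All \<open>K\<close>-modules below are
  subsets of real vector spaces.\<close>

definition kspan :: "real set \<Rightarrow> 'v::real_vector set \<Rightarrow> 'v set" where
  "kspan K S = {\<Sum>s\<in>T. c s *\<^sub>R s | T c. finite T \<and> T \<subseteq> S \<and> c ` T \<subseteq> K}"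

text \<open>A free \<open>\<int>\<close>-module \<open>N\<close> of finite rank is a lattice in some \<open>real ^ 'n\<close>, not necessarily of full rank;
  then \<open>N\<^sub>\<real> = span N\<close>.\<close>

definition lattice_basis :: "'v::real_vector set \<Rightarrow> 'v set \<Rightarrow> bool" where
  "lattice_basis N B \<longleftrightarrow> independent B \<and> kspan \<int> B = N"

definition is_lattice :: "'v::euclidean_space set \<Rightarrow> bool" where
  "is_lattice N \<longleftrightarrow> (\<exists>B. lattice_basis N B)"

text \<open>The quotient of a vector space by \<open>span \<tau>\<close> is modelled on the orthogonal complement of
  \<open>\<tau>\<close>, the quotient map being the orthogonal projection. So \<open>proj \<tau> ` N\<close> is
  \<open>N\<^sup>\<tau> = N / N\<^sub>\<tau>\<close>, \<open>proj \<tau> ` (N \<inter> span \<sigma>)\<close> is \<open>N\<^sub>\<sigma> / N\<^sub>\<tau>\<close>, and for \<open>\<tau> \<subseteq> \<rho>\<close> the map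
  \<open>N\<^sup>\<tau> \<rightarrow> N\<^sup>\<rho>\<close> is again \<open>proj \<rho>\<close>.\<close>

definition proj :: "'v::euclidean_space set \<Rightarrow> 'v \<Rightarrow> 'v" where
  "proj \<tau> x = x - closest_point (span \<tau>) x"

lemma proj_decomp: "proj \<tau> x = z"
  if y: "y \<in> span \<tau>" and z: "\<And>w. w \<in> span \<tau> \<Longrightarrow> orthogonal z w" and x: "x = y + z" for x y z
proof -
  have "y = closest_point (span \<tau>) x"
  proof (rule closest_point_unique)
    show "\<forall>w\<in>span \<tau>. dist x y \<le> dist x w"
    proof
      fix w assume w: "w \<in> span \<tau>"
      have "orthogonal z (y - w)"
        using z[OF span_diff[OF y w]] .
      then have "(norm (z + (y - w)))\<^sup>2 = (norm z)\<^sup>2 + (norm (y - w))\<^sup>2"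
        by (rule norm_add_Pythagorean)
      then have "(norm z)\<^sup>2 \<le> (norm (z + (y - w)))\<^sup>2" by simp
      then have "norm z \<le> norm (z + (y - w))"
        by (rule power2_le_imp_le) simp
      then show "dist x y \<le> dist x w"
        by (simp add: dist_norm x algebra_simps)
    qed
  qed (use y in \<open>auto simp: closed_span subspace_imp_convex\<close>)
  then show ?thesis
    by (simp add: proj_def x)
qed

lemma proj_props:
  shows proj_in: "x - proj \<tau> x \<in> span \<tau>"
    and proj_orth: "w \<in> span \<tau> \<Longrightarrow> orthogonal (proj \<tau> x) w"
proof -
  obtain y z where *: "y \<in> span \<tau>" "\<And>w. w \<in> span \<tau> \<Longrightarrow> orthogonal z w" "x = y + z"
    using orthogonal_subspace_decomp_exists[of \<tau> x] by metis
  then have "proj \<tau> x = z" by (rule proj_decomp)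
  with * show "x - proj \<tau> x \<in> span \<tau>" "w \<in> span \<tau> \<Longrightarrow> orthogonal (proj \<tau> x) w"
    by simp_all
qed

lemma proj_unique:
  assumes "x - z \<in> span \<tau>" and "\<And>y. y \<in> \<tau> \<Longrightarrow> orthogonal z y"
  shows "proj \<tau> x = z"
proof (rule proj_decomp[OF assms(1)])
  fix w assume "w \<in> span \<tau>"
  then show "orthogonal z w"
    using assms(2) by (rule orthogonal_to_span)
qed simp

lemma linear_proj: "linear (proj \<tau>)"
proof (rule linearI)
  fix x y
  show "proj \<tau> (x + y) = proj \<tau> x + proj \<tau> y"
  proof (rule proj_unique)
    show "x + y - (proj \<tau> x + proj \<tau> y) \<in> span \<tau>"
      using span_add[OF proj_in[of x \<tau>] proj_in[of y \<tau>]] by (simp add: algebra_simps)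
  qed (simp add: orthogonal_clauses proj_orth span_base)
next
  fix c x
  show "proj \<tau> (c *\<^sub>R x) = c *\<^sub>R proj \<tau> x"
  proof (rule proj_unique)
    show "c *\<^sub>R x - c *\<^sub>R proj \<tau> x \<in> span \<tau>"
      using span_scale[OF proj_in[of x \<tau>], of c] by (simp add: algebra_simps)
  qed (simp add: orthogonal_clauses proj_orth span_base)
qed

lemma proj_eq_0_iff: "proj \<tau> x = 0 \<longleftrightarrow> x \<in> span \<tau>"
  using proj_in[of x \<tau>] by (auto intro: proj_unique simp: orthogonal_clauses)

lemma proj_proj:
  assumes "\<tau> \<subseteq> \<rho>"
  shows "proj \<rho> (proj \<tau> x) = proj \<rho> x"
proof (rule proj_unique)
  have "x - proj \<tau> x \<in> span \<rho>"
    using proj_in[of x \<tau>] span_mono[OF assms] by blast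
  from span_diff[OF proj_in[of x \<rho>] this]
  show "proj \<tau> x - proj \<rho> x \<in> span \<rho>" by (simp add: algebra_simps)
qed (simp add: proj_orth span_base)

lemma proj_zero [simp]: "proj {0} x = x"
  by (rule proj_unique) (auto simp: orthogonal_def span_0)


section \<open>Exterior algebra\<close>

text \<open>The exterior algebra of \<open>real ^ 'n\<close> has the basis \<open>e\<^sub>I\<close> (increasing wedge product of the
  standard basis vectors with index in \<open>I\<close>), \<open>I\<close> a subset of \<open>'n\<close>; it is \<open>(real, 'n set) vec\<close>.\<close>

type_synonym 'n rvec = "(real, 'n) vec"

type_synonym 'n ext = "(real, 'n set) vec"

definition shuffle_sign :: "'i::linorder set \<Rightarrow> 'i set \<Rightarrow> real" where
  "shuffle_sign I J = (- 1) ^ card {(i, j). i \<in> I \<and> j \<in> J \<and> j < i}"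

definition ext_mult :: "'n::{finite,linorder} ext \<Rightarrow> 'n ext \<Rightarrow> 'n ext" (infixr "\<^bold>\<and>" 70) where
  "x \<^bold>\<and> y = (\<chi> L. \<Sum>I\<in>Pow L. shuffle_sign I (L - I) * x $ I * y $ (L - I))"

definition ext_vec :: "'n::{finite,linorder} rvec \<Rightarrow> 'n ext" where
  "ext_vec v = (\<chi> L. \<Sum>i\<in>{i. L = {i}}. v $ i)"

definition ext_one :: "'n::{finite,linorder} ext" where
  "ext_one = axis {} 1"

definition wedge :: "'n::{finite,linorder} rvec list \<Rightarrow> 'n ext" where
  "wedge vs = foldr (\<lambda>v x. ext_vec v \<^bold>\<and> x) vs ext_one"

text \<open>The algebra map induced by a linear map \<open>f\<close>.\<close>

definition ext_map :: "('n::{finite,linorder} rvec \<Rightarrow> 'n rvec) \<Rightarrow> 'n ext \<Rightarrow> 'n ext" where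
  "ext_map f x = (\<Sum>I\<in>UNIV. x $ I *\<^sub>R wedge (map (\<lambda>i. f (axis i 1)) (sorted_list_of_set I)))"

text \<open>\<open>ext_power K \<L> p\<close> is \<open>(\<Sum>\<^bsub>L \<in> \<L>\<^esub> \<And>\<^sup>p L) \<otimes> K\<close> for a family \<open>\<L>\<close> of sublattices.\<close>

definition ext_power ::
  "real set \<Rightarrow> 'n::{finite,linorder} rvec set set \<Rightarrow> nat \<Rightarrow> 'n ext set" where
  "ext_power K \<L> p = kspan K {wedge vs | vs L. L \<in> \<L> \<and> set vs \<subseteq> L \<and> length vs = p}"

definition is_generator ::
  "'n::{finite,linorder} rvec set \<Rightarrow> nat \<Rightarrow> 'n ext \<Rightarrow> bool" where
  "is_generator L k x \<longleftrightarrow> ext_power \<int> {L} k = range (\<lambda>m::int. of_int m *\<^sub>R x)"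

text \<open>\<open>Hom\<^sub>K(S, K)\<close>; homomorphisms are extended by zero outside \<open>S\<close>.\<close>

definition kdual :: "real set \<Rightarrow> 'v::real_vector set \<Rightarrow> ('v \<Rightarrow> real) set" where
  "kdual K S = {\<phi>. (\<forall>x\<in>S. \<forall>y\<in>S. \<phi> (x + y) = \<phi> x + \<phi> y) \<and>
                    (\<forall>c\<in>K. \<forall>x\<in>S. \<phi> (c *\<^sub>R x) = c * \<phi> x) \<and>
                    \<phi> ` S \<subseteq> K \<and> (\<forall>x. x \<notin> S \<longrightarrow> \<phi> x = 0)}"

definition restrict0 :: "'v set \<Rightarrow> ('v \<Rightarrow> real) \<Rightarrow> 'v \<Rightarrow> real" where
  "restrict0 S \<phi> = (\<lambda>x. if x \<in> S then \<phi> x else 0)"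

text \<open>The exterior product of a form \<open>\<alpha>\<close> of degree \<open>p\<close> and a form \<open>\<beta>\<close> of degree \<open>q\<close>: the form whose
  restriction to each \<open>\<And>\<^bsup>p+q\<^esup> L\<close>, \<open>L \<in> \<L>\<close>, is the usual shuffle product.\<close>

definition form_wedge ::
  "real set \<Rightarrow> 'n::{finite,linorder} rvec set set \<Rightarrow> nat \<Rightarrow> nat
     \<Rightarrow> ('n ext \<Rightarrow> real) \<Rightarrow> ('n ext \<Rightarrow> real) \<Rightarrow> 'n ext \<Rightarrow> real" where
  "form_wedge K \<L> p q \<alpha> \<beta> = (THE \<gamma>. \<gamma> \<in> kdual K (ext_power K \<L> (p + q)) \<and>
     (\<forall>L\<in>\<L>. \<forall>vs. set vs \<subseteq> L \<and> length vs = p + q \<longrightarrow>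
        \<gamma> (wedge vs) = (\<Sum>I | I \<subseteq> {..<p + q} \<and> card I = p.
          shuffle_sign I ({..<p + q} - I)
            * \<alpha> (wedge (nths vs I)) * \<beta> (wedge (nths vs ({..<p + q} - I))))))"

text \<open>The contraction \<open>\<kappa>\<^sub>\<alpha>(x) \<in> \<And>\<^sup>m L\<close> of \<open>x \<in> \<And>\<^bsup>k+m\<^esup> L\<close> by a form \<open>\<alpha>\<close> of degree \<open>k\<close>:
  \<open>\<langle>\<beta>, \<kappa>\<^sub>\<alpha>(x)\<rangle> = \<langle>\<alpha> \<and> \<beta>, x\<rangle>\<close> for all \<open>\<beta>\<close>.\<close>

definition contract ::
  "real set \<Rightarrow> 'n::{finite,linorder} rvec set \<Rightarrow> nat \<Rightarrow> nat
     \<Rightarrow> ('n ext \<Rightarrow> real) \<Rightarrow> 'n ext \<Rightarrow> 'n ext" where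
  "contract K L k m \<alpha> x = (THE y. y \<in> ext_power K {L} m \<and>
     (\<forall>\<beta>\<in>kdual K (ext_power K {L} m). \<beta> y = form_wedge K {L} k m \<alpha> \<beta> x))"

text \<open>Comparison of generators \<open>\<nu>\<^sub>\<gamma>\<close>, \<open>\<nu>\<^sub>\<delta>\<close> for a codimension-one face \<open>\<gamma>\<close> of \<open>\<delta>\<close>: \<open>L\<close> is the lattice
  \<open>N\<^sub>\<delta>\<close>. For \<open>\<gamma>\<close> in the same stratum, \<open>\<pi>\<close> is the quotient map by \<open>N\<^sub>\<gamma>\<close> and \<open>e\<close> the primitive inward vector
  of the quotient; for \<open>\<gamma>\<close> at infinity, \<open>e\<close> is the primitive vector in the direction of \<open>\<gamma>\<close>, \<open>\<pi>\<close> the quotient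
  map by \<open>e\<close> and \<open>m\<close> the dimension of \<open>\<gamma>\<close>.\<close>

definition inner_sign ::
  "'n::{finite,linorder} rvec set \<Rightarrow> 'n rvec \<Rightarrow> ('n rvec \<Rightarrow> 'n rvec)
     \<Rightarrow> 'n ext \<Rightarrow> 'n ext \<Rightarrow> real" where
  "inner_sign L e \<pi> \<nu>\<gamma> \<nu>\<delta> = (THE s. s \<in> {1, - 1} \<and>
     (\<exists>n\<in>L. \<pi> n = e \<and> ext_vec n \<^bold>\<and> \<nu>\<gamma> = s *\<^sub>R \<nu>\<delta>))"

definition outer_sign ::
  "'n::{finite,linorder} rvec set \<Rightarrow> 'n rvec \<Rightarrow> ('n rvec \<Rightarrow> 'n rvec) \<Rightarrow> nat
     \<Rightarrow> 'n ext \<Rightarrow> 'n ext \<Rightarrow> real" where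
  "outer_sign L e \<pi> m \<nu>\<gamma> \<nu>\<delta> = (THE s. s \<in> {1, - 1} \<and>
     (\<exists>\<nu>'\<in>ext_power \<int> {L} m. ext_map \<pi> \<nu>' = \<nu>\<gamma> \<and> ext_vec e \<^bold>\<and> \<nu>' = - (s *\<^sub>R \<nu>\<delta>)))"


section \<open>Homology of chain complexes of functions\<close>

definition add_group :: "'a::ab_group_add set \<Rightarrow> 'a monoid" where
  "add_group S = \<lparr>carrier = S, monoid.mult = (+), one = 0\<rparr>"

definition cycles :: "(nat \<Rightarrow> 'a::ab_group_add set) \<Rightarrow> ('a \<Rightarrow> 'a) \<Rightarrow> nat \<Rightarrow> 'a set" where
  "cycles C D q = {c \<in> C q. D c = 0}"

definition homology :: "(nat \<Rightarrow> 'a::ab_group_add set) \<Rightarrow> ('a \<Rightarrow> 'a) \<Rightarrow> nat \<Rightarrow> 'a set monoid" where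
  "homology C D q = add_group (cycles C D q) Mod (D ` C (Suc q))"

definition homology_class ::
  "(nat \<Rightarrow> 'a::ab_group_add set) \<Rightarrow> ('a \<Rightarrow> 'a) \<Rightarrow> nat \<Rightarrow> 'a \<Rightarrow> 'a set" where
  "homology_class C D q c = (D ` C (Suc q)) #>\<^bsub>add_group (cycles C D q)\<^esub> c"

definition cohomology :: "(nat \<Rightarrow> 'a::ab_group_add set) \<Rightarrow> ('a \<Rightarrow> 'a) \<Rightarrow> nat \<Rightarrow> 'a set monoid" where
  "cohomology C D q =
     add_group (cycles C D q) Mod (case q of 0 \<Rightarrow> {0} | Suc r \<Rightarrow> D ` C r)"


section \<open>Fans\<close>

text \<open>For cones, \<open>\<tau> \<prec> \<sigma>\<close> is \<open>\<tau> face_of \<sigma>\<close>, \<open>\<bar>\<sigma>\<bar>\<close> is \<open>dim \<sigma>\<close> and \<open>N\<^sub>\<sigma>\<close> is \<open>N \<inter> span \<sigma>\<close>.\<close>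

definition rational_cone :: "'v::euclidean_space set \<Rightarrow> 'v set \<Rightarrow> bool" where
  "rational_cone N \<sigma> \<longleftrightarrow> (\<exists>V. finite V \<and> V \<subseteq> N \<and> \<sigma> = convex_cone hull V) \<and>
     \<sigma> \<inter> uminus ` \<sigma> = {0}"

definition is_fan :: "'v::euclidean_space set \<Rightarrow> 'v set set \<Rightarrow> bool" where
  "is_fan N \<Sigma> \<longleftrightarrow> finite \<Sigma> \<and> \<Sigma> \<noteq> {} \<and> (\<forall>\<sigma>\<in>\<Sigma>. rational_cone N \<sigma>) \<and>
     (\<forall>\<sigma>\<in>\<Sigma>. \<forall>\<tau>. \<tau> face_of \<sigma> \<and> \<tau> \<noteq> {} \<longrightarrow> \<tau> \<in> \<Sigma>) \<and>
     (\<forall>\<sigma>\<in>\<Sigma>. \<forall>\<eta>\<in>\<Sigma>. \<sigma> \<inter> \<eta> face_of \<sigma> \<and> \<sigma> \<inter> \<eta> face_of \<eta>)"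

definition pure_dim :: "'v::euclidean_space set set \<Rightarrow> nat \<Rightarrow> bool" where
  "pure_dim \<Sigma> d \<longleftrightarrow> (\<forall>\<sigma>\<in>\<Sigma>. \<exists>\<eta>\<in>\<Sigma>. dim \<eta> = d \<and> \<sigma> face_of \<eta>)"

text \<open>If the image of the cone \<open>C\<close> modulo \<open>span \<tau>\<close> is a ray, its primitive generator. In particular
  \<open>primitive N \<tau> \<sigma>\<close> is \<open>e\<^sup>\<tau>\<^sub>\<sigma>\<close> for \<open>\<tau>\<close> a face of codimension one of \<open>\<sigma>\<close>.\<close>

definition primitive :: "'v::euclidean_space set \<Rightarrow> 'v set \<Rightarrow> 'v set \<Rightarrow> 'v" where
  "primitive N \<tau> C = (THE e. e \<in> proj \<tau> ` C \<and>
     proj \<tau> ` (N \<inter> span C) = range (\<lambda>m::int. of_int m *\<^sub>R e))"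

definition rays :: "'v::euclidean_space set \<Rightarrow> 'v set set" where
  "rays \<sigma> = {\<rho>. \<rho> face_of \<sigma> \<and> \<rho> \<noteq> {} \<and> dim \<rho> = 1}"

definition simplicial_fan :: "'v::euclidean_space set set \<Rightarrow> bool" where
  "simplicial_fan \<Sigma> \<longleftrightarrow> (\<forall>\<sigma>\<in>\<Sigma>. \<sigma> = convex_cone hull (\<Union> (rays \<sigma>)) \<and> card (rays \<sigma>) = dim \<sigma>)"

definition unimodular_fan :: "'v::euclidean_space set \<Rightarrow> 'v set set \<Rightarrow> bool" where
  "unimodular_fan N \<Sigma> \<longleftrightarrow> simplicial_fan \<Sigma> \<and>
     (\<forall>\<sigma>\<in>\<Sigma>. \<exists>B. lattice_basis N B \<and> primitive N {0} ` rays \<sigma> \<subseteq> B)"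

definition star_fan :: "'v::euclidean_space set set \<Rightarrow> 'v set \<Rightarrow> 'v set set" where
  "star_fan \<Sigma> \<sigma> = {proj \<sigma> ` \<eta> | \<eta>. \<eta> \<in> \<Sigma> \<and> \<sigma> face_of \<eta>}"

definition star_weight ::
  "'v::euclidean_space set set \<Rightarrow> ('v set \<Rightarrow> int) \<Rightarrow> 'v set \<Rightarrow> 'v set \<Rightarrow> int" where
  "star_weight \<Sigma> \<omega> \<sigma> \<zeta> = \<omega> (THE \<eta>. \<eta> \<in> \<Sigma> \<and> \<sigma> face_of \<eta> \<and> proj \<sigma> ` \<eta> = \<zeta>)"

definition tropical_fan ::
  "'v::euclidean_space set \<Rightarrow> 'v set set \<Rightarrow> nat \<Rightarrow> ('v set \<Rightarrow> int) \<Rightarrow> bool" where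
  "tropical_fan N \<Sigma> d \<omega> \<longleftrightarrow> is_fan N \<Sigma> \<and> pure_dim \<Sigma> d \<and>
     (\<forall>\<sigma>\<in>\<Sigma>. dim \<sigma> = d \<longrightarrow> \<omega> \<sigma> \<noteq> 0) \<and>
     (\<forall>\<tau>\<in>\<Sigma>. Suc (dim \<tau>) = d \<longrightarrow>
        (\<Sum>\<sigma> | \<sigma> \<in> \<Sigma> \<and> dim \<sigma> = d \<and> \<tau> face_of \<sigma>. of_int (\<omega> \<sigma>) *\<^sub>R primitive N \<tau> \<sigma>) = 0)"


section \<open>Borel--Moore homology of fans and tropical homology manifolds\<close>

text \<open>\<open>\<F>\<^sub>p(\<sigma>) \<otimes> K\<close>.\<close>

definition fan_F ::
  "real set \<Rightarrow> 'n::{finite,linorder} rvec set \<Rightarrow> 'n rvec set set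
     \<Rightarrow> nat \<Rightarrow> 'n rvec set \<Rightarrow> 'n ext set" where
  "fan_F K N \<Sigma> p \<sigma> = ext_power K {N \<inter> span \<eta> | \<eta>. \<eta> \<in> \<Sigma> \<and> \<sigma> face_of \<eta>} p"

definition fan_orientation ::
  "'n::{finite,linorder} rvec set \<Rightarrow> 'n rvec set set \<Rightarrow> ('n rvec set \<Rightarrow> 'n ext) \<Rightarrow> bool"
  where
  "fan_orientation N \<Sigma> \<nu> \<longleftrightarrow> (\<forall>\<sigma>\<in>\<Sigma>. is_generator (N \<inter> span \<sigma>) (dim \<sigma>) (\<nu> \<sigma>))"

definition bm_chains ::
  "real set \<Rightarrow> 'n::{finite,linorder} rvec set \<Rightarrow> 'n rvec set set
     \<Rightarrow> nat \<Rightarrow> nat \<Rightarrow> ('n rvec set \<Rightarrow> 'n ext) set" where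
  "bm_chains K N \<Sigma> p q =
     {c. \<forall>\<sigma>. if \<sigma> \<in> \<Sigma> \<and> dim \<sigma> = q then c \<sigma> \<in> fan_F K N \<Sigma> p \<sigma> else c \<sigma> = 0}"

definition bm_boundary ::
  "'n::{finite,linorder} rvec set \<Rightarrow> 'n rvec set set \<Rightarrow> ('n rvec set \<Rightarrow> 'n ext)
     \<Rightarrow> ('n rvec set \<Rightarrow> 'n ext) \<Rightarrow> 'n rvec set \<Rightarrow> 'n ext" where
  "bm_boundary N \<Sigma> \<nu> c \<tau> =
     (\<Sum>\<sigma> | \<sigma> \<in> \<Sigma> \<and> \<tau> \<in> \<Sigma> \<and> \<tau> face_of \<sigma> \<and> dim \<sigma> = Suc (dim \<tau>).
        inner_sign (N \<inter> span \<sigma>) (primitive N \<tau> \<sigma>) (proj \<tau>) (\<nu> \<tau>) (\<nu> \<sigma>) *\<^sub>R c \<sigma>)"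

definition bm_homology where
  "bm_homology K N \<Sigma> \<nu> p q = homology (bm_chains K N \<Sigma> p) (bm_boundary N \<Sigma> \<nu>) q"

definition bm_dual_chain ::
  "real set \<Rightarrow> 'n::{finite,linorder} rvec set \<Rightarrow> 'n rvec set set \<Rightarrow> nat
     \<Rightarrow> ('n rvec set \<Rightarrow> int) \<Rightarrow> ('n rvec set \<Rightarrow> 'n ext)
     \<Rightarrow> nat \<Rightarrow> ('n ext \<Rightarrow> real) \<Rightarrow> 'n rvec set \<Rightarrow> 'n ext" where
  "bm_dual_chain K N \<Sigma> d \<omega> \<nu> k \<alpha> \<eta> =
     (if \<eta> \<in> \<Sigma> \<and> dim \<eta> = d
      then of_int (\<omega> \<eta>) *\<^sub>R contract K (N \<inter> span \<eta>) k (d - k) \<alpha> (\<nu> \<eta>) else 0)"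

text \<open>The property does not depend on the choice of the orientations \<open>\<nu>\<close>, which always exist. For
  \<open>k > d\<close> both groups of the duality map are zero.\<close>

definition tropical_poincare_duality ::
  "real set \<Rightarrow> 'n::{finite,linorder} rvec set \<Rightarrow> 'n rvec set set \<Rightarrow> nat
     \<Rightarrow> ('n rvec set \<Rightarrow> int) \<Rightarrow> bool" where
  "tropical_poincare_duality K N \<Sigma> d \<omega> \<longleftrightarrow> (\<forall>\<nu>. fan_orientation N \<Sigma> \<nu> \<longrightarrow>
     (\<forall>p q. q \<noteq> d \<longrightarrow> trivial_group (bm_homology K N \<Sigma> \<nu> p q)) \<and>
     (\<forall>k\<le>d. (\<lambda>\<alpha>. homology_class (bm_chains K N \<Sigma> (d - k)) (bm_boundary N \<Sigma> \<nu>) d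
                    (bm_dual_chain K N \<Sigma> d \<omega> \<nu> k \<alpha>))
        \<in> iso (add_group (kdual K (fan_F K N \<Sigma> k {0}))) (bm_homology K N \<Sigma> \<nu> (d - k) d)))"

definition tropical_homology_manifold ::
  "real set \<Rightarrow> 'n::{finite,linorder} rvec set \<Rightarrow> 'n rvec set set \<Rightarrow> nat
     \<Rightarrow> ('n rvec set \<Rightarrow> int) \<Rightarrow> bool" where
  "tropical_homology_manifold K N \<Sigma> d \<omega> \<longleftrightarrow> (\<forall>\<sigma>\<in>\<Sigma>.
     tropical_poincare_duality K (proj \<sigma> ` N) (star_fan \<Sigma> \<sigma>) (d - dim \<sigma>) (star_weight \<Sigma> \<omega> \<sigma>))"


section \<open>Tropical homology and cohomology of the canonical compactification\<close>

text \<open>The pair \<open>(\<tau>, \<sigma>)\<close> with \<open>\<tau> \<prec> \<sigma>\<close> stands for the closed face \<open>\<box>\<^sup>\<tau>\<^sub>\<sigma>\<close>.\<close>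

type_synonym 'n face = "'n rvec set \<times> 'n rvec set"

definition faces :: "'n::{finite,linorder} rvec set set \<Rightarrow> 'n face set" where
  "faces \<Sigma> = {(\<tau>, \<sigma>). \<tau> \<in> \<Sigma> \<and> \<sigma> \<in> \<Sigma> \<and> \<tau> face_of \<sigma>}"

definition face_dim :: "'n::{finite,linorder} face \<Rightarrow> nat" where
  "face_dim = (\<lambda>(\<tau>, \<sigma>). dim \<sigma> - dim \<tau>)"

definition face_le :: "'n::{finite,linorder} face \<Rightarrow> 'n face \<Rightarrow> bool" where
  "face_le = (\<lambda>(\<tau>', \<sigma>') (\<tau>, \<sigma>). \<tau> face_of \<tau>' \<and> \<tau>' face_of \<sigma>' \<and> \<sigma>' face_of \<sigma>)"

definition face_lattice :: "'n::{finite,linorder} rvec set \<Rightarrow> 'n face \<Rightarrow> 'n rvec set" where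
  "face_lattice N = (\<lambda>(\<tau>, \<sigma>). proj \<tau> ` (N \<inter> span \<sigma>))"

definition star_lattices ::
  "'n::{finite,linorder} rvec set \<Rightarrow> 'n rvec set set \<Rightarrow> 'n face \<Rightarrow> 'n rvec set set" where
  "star_lattices N \<Sigma> = (\<lambda>(\<tau>, \<sigma>). {proj \<tau> ` (N \<inter> span \<eta>) | \<eta>. \<eta> \<in> \<Sigma> \<and> \<sigma> face_of \<eta>})"

text \<open>\<open>\<F>\<^sub>p(\<delta>) \<otimes> K\<close>.\<close>

definition trop_F ::
  "real set \<Rightarrow> 'n::{finite,linorder} rvec set \<Rightarrow> 'n rvec set set
     \<Rightarrow> nat \<Rightarrow> 'n face \<Rightarrow> 'n ext set" where
  "trop_F K N \<Sigma> p \<delta> = ext_power K (star_lattices N \<Sigma> \<delta>) p"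

definition orientation ::
  "'n::{finite,linorder} rvec set \<Rightarrow> 'n rvec set set \<Rightarrow> ('n face \<Rightarrow> 'n ext) \<Rightarrow> bool" where
  "orientation N \<Sigma> \<nu> \<longleftrightarrow> (\<forall>(\<tau>, \<sigma>)\<in>faces \<Sigma>.
     is_generator (face_lattice N (\<tau>, \<sigma>)) (face_dim (\<tau>, \<sigma>)) (\<nu> (\<tau>, \<sigma>)) \<and>
     (dim \<sigma> = dim \<tau> \<longrightarrow> \<nu> (\<tau>, \<sigma>) = ext_one) \<and>
     (dim \<sigma> = Suc (dim \<tau>) \<longrightarrow> \<nu> (\<tau>, \<sigma>) = ext_vec (primitive N \<tau> \<sigma>)))"

text \<open>For a face \<open>\<gamma> = (\<tau>', \<sigma>')\<close> of \<open>\<delta> = (\<tau>, \<sigma>)\<close> of codimension one, either \<open>\<tau>' = \<tau>\<close> and \<open>\<sigma>'\<close> has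
  codimension one in \<open>\<sigma>\<close>, or \<open>\<sigma>' = \<sigma>\<close> and \<open>\<tau>\<close> has codimension one in \<open>\<tau>'\<close>.\<close>

definition face_sign ::
  "'n::{finite,linorder} rvec set \<Rightarrow> ('n face \<Rightarrow> 'n ext) \<Rightarrow> 'n face \<Rightarrow> 'n face \<Rightarrow> real" where
  "face_sign N \<nu> = (\<lambda>(\<tau>', \<sigma>') (\<tau>, \<sigma>).
     if \<tau>' = \<tau>
     then inner_sign (face_lattice N (\<tau>, \<sigma>)) (primitive N \<sigma>' \<sigma>) (proj \<sigma>') (\<nu> (\<tau>', \<sigma>')) (\<nu> (\<tau>, \<sigma>))
     else outer_sign (face_lattice N (\<tau>, \<sigma>)) (primitive N \<tau> \<tau>') (proj \<tau>') (face_dim (\<tau>', \<sigma>'))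
            (\<nu> (\<tau>', \<sigma>')) (\<nu> (\<tau>, \<sigma>)))"

definition facet_pair :: "'n::{finite,linorder} rvec set set \<Rightarrow> 'n face \<Rightarrow> 'n face \<Rightarrow> bool" where
  "facet_pair \<Sigma> \<gamma> \<delta> \<longleftrightarrow> \<gamma> \<in> faces \<Sigma> \<and> \<delta> \<in> faces \<Sigma> \<and> face_le \<gamma> \<delta> \<and> face_dim \<delta> = Suc (face_dim \<gamma>)"

definition trop_chains ::
  "real set \<Rightarrow> 'n::{finite,linorder} rvec set \<Rightarrow> 'n rvec set set
     \<Rightarrow> nat \<Rightarrow> nat \<Rightarrow> ('n face \<Rightarrow> 'n ext) set" where
  "trop_chains K N \<Sigma> p q =
     {c. \<forall>\<delta>. if \<delta> \<in> faces \<Sigma> \<and> face_dim \<delta> = q then c \<delta> \<in> trop_F K N \<Sigma> p \<delta> else c \<delta> = 0}"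

definition trop_boundary ::
  "'n::{finite,linorder} rvec set \<Rightarrow> 'n rvec set set \<Rightarrow> ('n face \<Rightarrow> 'n ext)
     \<Rightarrow> ('n face \<Rightarrow> 'n ext) \<Rightarrow> 'n face \<Rightarrow> 'n ext" where
  "trop_boundary N \<Sigma> \<nu> c \<gamma> =
     (\<Sum>\<delta> | facet_pair \<Sigma> \<gamma> \<delta>. face_sign N \<nu> \<gamma> \<delta> *\<^sub>R ext_map (proj (fst \<gamma>)) (c \<delta>))"

definition trop_cochains ::
  "real set \<Rightarrow> 'n::{finite,linorder} rvec set \<Rightarrow> 'n rvec set set
     \<Rightarrow> nat \<Rightarrow> nat \<Rightarrow> ('n face \<Rightarrow> 'n ext \<Rightarrow> real) set" where
  "trop_cochains K N \<Sigma> p q =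
     {a. \<forall>\<delta>. if \<delta> \<in> faces \<Sigma> \<and> face_dim \<delta> = q then a \<delta> \<in> kdual K (trop_F K N \<Sigma> p \<delta>) else a \<delta> = 0}"

text \<open>The map \<open>\<F>\<^sup>p(\<gamma>) \<rightarrow> \<F>\<^sup>p(\<delta>)\<close> for \<open>\<gamma>\<close> a face of \<open>\<delta>\<close>.\<close>

definition pull ::
  "real set \<Rightarrow> 'n::{finite,linorder} rvec set \<Rightarrow> 'n rvec set set \<Rightarrow> nat
     \<Rightarrow> 'n face \<Rightarrow> 'n face \<Rightarrow> ('n ext \<Rightarrow> real) \<Rightarrow> 'n ext \<Rightarrow> real" where
  "pull K N \<Sigma> p \<gamma> \<delta> \<phi> = restrict0 (trop_F K N \<Sigma> p \<delta>) (\<lambda>x. \<phi> (ext_map (proj (fst \<gamma>)) x))"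

definition trop_coboundary ::
  "real set \<Rightarrow> 'n::{finite,linorder} rvec set \<Rightarrow> 'n rvec set set \<Rightarrow> ('n face \<Rightarrow> 'n ext)
     \<Rightarrow> nat \<Rightarrow> ('n face \<Rightarrow> 'n ext \<Rightarrow> real) \<Rightarrow> 'n face \<Rightarrow> 'n ext \<Rightarrow> real" where
  "trop_coboundary K N \<Sigma> \<nu> p a \<delta> =
     (\<lambda>x. \<Sum>\<gamma> | facet_pair \<Sigma> \<gamma> \<delta>. face_sign N \<nu> \<gamma> \<delta> * pull K N \<Sigma> p \<gamma> \<delta> (a \<gamma>) x)"

definition trop_homology where
  "trop_homology K N \<Sigma> \<nu> p q = homology (trop_chains K N \<Sigma> p) (trop_boundary N \<Sigma> \<nu>) q"

definition trop_cohomology where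
  "trop_cohomology K N \<Sigma> \<nu> p q =
     cohomology (trop_cochains K N \<Sigma> p) (trop_coboundary K N \<Sigma> \<nu> p) q"


section \<open>Cup product, cap product, Poincare dual\<close>

text \<open>For \<open>a \<in> C\<^bsup>p,q\<^esup>\<close> and \<open>b \<in> C\<^bsup>p',q'\<^esup>\<close>.\<close>

definition cup_sign ::
  "'n::{finite,linorder} rvec set \<Rightarrow> ('n face \<Rightarrow> 'n ext)
     \<Rightarrow> 'n rvec set \<Rightarrow> 'n rvec set \<Rightarrow> 'n rvec set \<Rightarrow> real" where
  "cup_sign N \<nu> \<tau> \<sigma> \<eta> = (THE s. s \<in> {1, - 1} \<and>
     (\<exists>\<nu>'\<in>ext_power \<int> {face_lattice N (\<tau>, \<eta>)} (face_dim (\<sigma>, \<eta>)).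
        ext_map (proj \<sigma>) \<nu>' = \<nu> (\<sigma>, \<eta>) \<and> \<nu> (\<tau>, \<sigma>) \<^bold>\<and> \<nu>' = s *\<^sub>R \<nu> (\<tau>, \<eta>)))"

definition cup ::
  "real set \<Rightarrow> 'n::{finite,linorder} rvec set \<Rightarrow> 'n rvec set set \<Rightarrow> ('n face \<Rightarrow> 'n ext)
     \<Rightarrow> nat \<Rightarrow> nat \<Rightarrow> nat \<Rightarrow> nat
     \<Rightarrow> ('n face \<Rightarrow> 'n ext \<Rightarrow> real) \<Rightarrow> ('n face \<Rightarrow> 'n ext \<Rightarrow> real) \<Rightarrow> 'n face \<Rightarrow> 'n ext \<Rightarrow> real" where
  "cup K N \<Sigma> \<nu> p q p' q' a b = (\<lambda>(\<tau>, \<eta>).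
     if (\<tau>, \<eta>) \<in> faces \<Sigma> \<and> face_dim (\<tau>, \<eta>) = q + q'
     then (\<lambda>x. \<Sum>\<sigma> | \<sigma> \<in> \<Sigma> \<and> \<tau> face_of \<sigma> \<and> \<sigma> face_of \<eta> \<and> face_dim (\<tau>, \<sigma>) = q.
        cup_sign N \<nu> \<tau> \<sigma> \<eta> *
        form_wedge K (star_lattices N \<Sigma> (\<tau>, \<eta>)) p p'
          (pull K N \<Sigma> p (\<tau>, \<sigma>) (\<tau>, \<eta>) (a (\<tau>, \<sigma>)))
          (pull K N \<Sigma> p' (\<sigma>, \<eta>) (\<tau>, \<eta>) (b (\<sigma>, \<eta>))) x)
     else 0)"

definition pairing ::
  "'n::{finite,linorder} rvec set set \<Rightarrow> ('n face \<Rightarrow> 'n ext \<Rightarrow> real) \<Rightarrow> ('n face \<Rightarrow> 'n ext) \<Rightarrow> real"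
  where
  "pairing \<Sigma> a c = (\<Sum>\<delta>\<in>faces \<Sigma>. a \<delta> (c \<delta>))"

text \<open>For \<open>a \<in> C\<^bsup>p,q\<^esup>\<close> and \<open>z \<in> C\<^bsub>p+r,q+s\<^esub>\<close>.\<close>

definition cap ::
  "real set \<Rightarrow> 'n::{finite,linorder} rvec set \<Rightarrow> 'n rvec set set \<Rightarrow> ('n face \<Rightarrow> 'n ext)
     \<Rightarrow> nat \<Rightarrow> nat \<Rightarrow> nat \<Rightarrow> nat
     \<Rightarrow> ('n face \<Rightarrow> 'n ext \<Rightarrow> real) \<Rightarrow> ('n face \<Rightarrow> 'n ext) \<Rightarrow> 'n face \<Rightarrow> 'n ext" where
  "cap K N \<Sigma> \<nu> p q r s a z = (THE c. c \<in> trop_chains K N \<Sigma> r s \<and>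
     (\<forall>b\<in>trop_cochains K N \<Sigma> r s. pairing \<Sigma> b c = pairing \<Sigma> (cup K N \<Sigma> \<nu> p q r s a b) z))"

definition fundamental_cycle ::
  "'n::{finite,linorder} rvec set set \<Rightarrow> nat \<Rightarrow> ('n rvec set \<Rightarrow> int) \<Rightarrow> ('n face \<Rightarrow> 'n ext)
     \<Rightarrow> 'n face \<Rightarrow> 'n ext" where
  "fundamental_cycle \<Sigma> d \<omega> \<nu> = (\<lambda>(\<tau>, \<eta>).
     if \<tau> = {0} \<and> \<eta> \<in> \<Sigma> \<and> dim \<eta> = d then of_int (\<omega> \<eta>) *\<^sub>R \<nu> (\<tau>, \<eta>) else 0)"

text \<open>Poincare dual of \<open>\<alpha> \<in> H\<^bsup>p,p\<^esup>\<close>, a coset of cocycles. The classes of the caps \<open>a \<frown> [\<Sigma>\<bar>]\<close>,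
  \<open>a \<in> \<alpha>\<close>, coincide; the union of these (equal) cosets is that class.\<close>

definition poincare_dual ::
  "real set \<Rightarrow> 'n::{finite,linorder} rvec set \<Rightarrow> 'n rvec set set \<Rightarrow> nat
     \<Rightarrow> ('n rvec set \<Rightarrow> int) \<Rightarrow> ('n face \<Rightarrow> 'n ext) \<Rightarrow> nat
     \<Rightarrow> ('n face \<Rightarrow> 'n ext \<Rightarrow> real) set \<Rightarrow> ('n face \<Rightarrow> 'n ext) set" where
  "poincare_dual K N \<Sigma> d \<omega> \<nu> p \<alpha> =
     (\<Union>a\<in>\<alpha>. homology_class (trop_chains K N \<Sigma> (d - p)) (trop_boundary N \<Sigma> \<nu>) (d - p)
        (cap K N \<Sigma> \<nu> p p (d - p) (d - p) a (fundamental_cycle \<Sigma> d \<omega> \<nu>)))"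


section \<open>The canonical compactification as a topological space\<close>

definition dual_cone :: "'v::euclidean_space set \<Rightarrow> 'v set \<Rightarrow> 'v set" where
  "dual_cone N \<sigma> = {m \<in> span N. \<forall>x\<in>\<sigma>. 0 \<le> m \<bullet> x}"

text \<open>\<open>Hom\<^bsub>\<real>\<^sub>+\<^esub>(\<sigma>\<^sup>\<or>, \<T>\<^sub>+)\<close>.\<close>

definition cone_hom :: "'v::euclidean_space set \<Rightarrow> 'v set \<Rightarrow> ('v \<Rightarrow> ereal) set" where
  "cone_hom N \<sigma> = {f \<in> dual_cone N \<sigma> \<rightarrow>\<^sub>E {0..}.
     (\<forall>m\<in>dual_cone N \<sigma>. \<forall>m'\<in>dual_cone N \<sigma>. f (m + m') = f m + f m') \<and>
     (\<forall>c\<ge>0. \<forall>m\<in>dual_cone N \<sigma>. f (c *\<^sub>R m) = ereal c * f m)}"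

text \<open>Points of the compactification are written \<open>(\<tau>, v)\<close>, with \<open>v\<close> a point of the copy of the star fan of
  \<open>\<tau>\<close> in the stratum \<open>N\<^sup>\<tau>\<^sub>\<real>\<close>. Those of \<open>\<sigma>\<bar>\<close> have \<open>\<tau> \<prec> \<sigma>\<close> and \<open>v \<in> proj \<tau> ` \<sigma>\<close>, and correspond
  bijectively to \<open>Hom\<^bsub>\<real>\<^sub>+\<^esub>(\<sigma>\<^sup>\<or>, \<T>\<^sub>+)\<close> by \<open>point_hom\<close> (see \<open>bij_point_hom\<close>); this is compatible
  with the inclusions \<open>\<tau>\<bar> \<subseteq> \<sigma>\<bar>\<close> given by restriction of homomorphisms.\<close>

definition cone_points :: "'v::euclidean_space set set \<Rightarrow> 'v set \<Rightarrow> ('v set \<times> 'v) set" where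
  "cone_points \<Sigma> \<sigma> = {(\<tau>, v). \<tau> \<in> \<Sigma> \<and> \<tau> face_of \<sigma> \<and> v \<in> proj \<tau> ` \<sigma>}"

definition point_hom :: "'v::euclidean_space set \<Rightarrow> 'v set \<Rightarrow> 'v set \<times> 'v \<Rightarrow> 'v \<Rightarrow> ereal" where
  "point_hom N \<sigma> = (\<lambda>(\<tau>, v). \<lambda>m\<in>dual_cone N \<sigma>. if \<forall>x\<in>\<tau>. m \<bullet> x = 0 then ereal (m \<bullet> v) else \<infinity>)"

text \<open>The topology of \<open>Hom\<^bsub>\<real>\<^sub>+\<^esub>(\<sigma>\<^sup>\<or>, \<T>\<^sub>+)\<close> is that of pointwise convergence.\<close>

definition cone_topology ::
  "'v::euclidean_space set \<Rightarrow> 'v set set \<Rightarrow> 'v set \<Rightarrow> ('v set \<times> 'v) topology" where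
  "cone_topology N \<Sigma> \<sigma> = pullback_topology (cone_points \<Sigma> \<sigma>) (point_hom N \<sigma>)
     (product_topology (\<lambda>_. euclidean) (dual_cone N \<sigma>))"

definition compactification ::
  "'v::euclidean_space set \<Rightarrow> 'v set set \<Rightarrow> ('v set \<times> 'v) topology" where
  "compactification N \<Sigma> = topology (\<lambda>U. U \<subseteq> (\<Union>\<sigma>\<in>\<Sigma>. cone_points \<Sigma> \<sigma>) \<and>
     (\<forall>\<sigma>\<in>\<Sigma>. openin (cone_topology N \<Sigma> \<sigma>) (U \<inter> cone_points \<Sigma> \<sigma>)))"

lemma istopology_compactification:
  "istopology (\<lambda>U. U \<subseteq> (\<Union>\<sigma>\<in>\<Sigma>. cone_points \<Sigma> \<sigma>) \<and>
     (\<forall>\<sigma>\<in>\<Sigma>. openin (cone_topology N \<Sigma> \<sigma>) (U \<inter> cone_points \<Sigma> \<sigma>)))"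
  unfolding istopology_def
proof (intro conjI allI impI ballI, goal_cases)
  case (1 U V)
  then show ?case by blast
next
  case (2 U V \<sigma>)
  have "(U \<inter> V) \<inter> cone_points \<Sigma> \<sigma> = (U \<inter> cone_points \<Sigma> \<sigma>) \<inter> (V \<inter> cone_points \<Sigma> \<sigma>)"
    by blast
  with 2 show ?case by (auto intro: openin_Int)
next
  case (3 \<U>)
  then show ?case by blast
next
  case (4 \<U> \<sigma>)
  have "\<Union>\<U> \<inter> cone_points \<Sigma> \<sigma> = \<Union>((\<lambda>U. U \<inter> cone_points \<Sigma> \<sigma>) ` \<U>)"
    by blast
  moreover have "openin (cone_topology N \<Sigma> \<sigma>) (\<Union>((\<lambda>U. U \<inter> cone_points \<Sigma> \<sigma>) ` \<U>))"
    using 4 by (intro openin_Union) auto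
  ultimately show ?case by simp
qed

lemma openin_compactification:
  "openin (compactification N \<Sigma>) U \<longleftrightarrow> U \<subseteq> (\<Union>\<sigma>\<in>\<Sigma>. cone_points \<Sigma> \<sigma>) \<and>
     (\<forall>\<sigma>\<in>\<Sigma>. openin (cone_topology N \<Sigma> \<sigma>) (U \<inter> cone_points \<Sigma> \<sigma>))"
  unfolding compactification_def topology_inverse'[OF istopology_compactification] ..

lemma topspace_cone_topology: "topspace (cone_topology N \<Sigma> \<sigma>) = cone_points \<Sigma> \<sigma>"
  by (auto simp: cone_topology_def topspace_pullback_topology point_hom_def)

lemma topspace_compactification:
  assumes "is_fan N \<Sigma>"
  shows "topspace (compactification N \<Sigma>) = (\<Union>\<sigma>\<in>\<Sigma>. cone_points \<Sigma> \<sigma>)"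
proof (rule subset_antisym)
  show "topspace (compactification N \<Sigma>) \<subseteq> (\<Union>\<sigma>\<in>\<Sigma>. cone_points \<Sigma> \<sigma>)"
    using openin_topspace[of "compactification N \<Sigma>"] unfolding openin_compactification by blast
  have "(\<Union>\<eta>\<in>\<Sigma>. cone_points \<Sigma> \<eta>) \<inter> cone_points \<Sigma> \<sigma> = topspace (cone_topology N \<Sigma> \<sigma>)"
    if "\<sigma> \<in> \<Sigma>" for \<sigma>
    using that by (auto simp: topspace_cone_topology)
  then have "openin (compactification N \<Sigma>) (\<Union>\<sigma>\<in>\<Sigma>. cone_points \<Sigma> \<sigma>)"
    unfolding openin_compactification by (metis openin_topspace order_refl)
  then show "(\<Union>\<sigma>\<in>\<Sigma>. cone_points \<Sigma> \<sigma>) \<subseteq> topspace (compactification N \<Sigma>)"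
    by (rule openin_subset)
qed

lemma dual_cone_hull:
  assumes "\<sigma> = convex_cone hull V" "m \<in> span N" "\<And>v. v \<in> V \<Longrightarrow> 0 \<le> m \<bullet> v"
  shows "m \<in> dual_cone N \<sigma>"
proof -
  have "convex_cone {x. 0 \<le> m \<bullet> x}"
    unfolding convex_cone_def conic_def
    by (auto simp: convex_halfspace_ge intro: exI[of _ 0])
  then have "convex_cone hull V \<subseteq> {x. 0 \<le> m \<bullet> x}"
    using assms(3) by (intro hull_minimal) auto
  then show ?thesis
    using assms(1,2) by (auto simp: dual_cone_def)
qed

lemma dual_cone_add: "m \<in> dual_cone N \<sigma> \<Longrightarrow> m' \<in> dual_cone N \<sigma> \<Longrightarrow> m + m' \<in> dual_cone N \<sigma>"
  by (auto simp: dual_cone_def span_add inner_add_left)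

lemma dual_cone_scale: "m \<in> dual_cone N \<sigma> \<Longrightarrow> 0 \<le> c \<Longrightarrow> c *\<^sub>R m \<in> dual_cone N \<sigma>"
  by (auto simp: dual_cone_def span_scale)

lemma dual_cone_large:
  assumes V: "finite V" "\<sigma> = convex_cone hull V"
    and m: "m \<in> span N" "\<And>x. x \<in> V \<Longrightarrow> x \<notin> \<tau> \<Longrightarrow> 0 < m \<bullet> x" "\<And>x. x \<in> \<tau> \<Longrightarrow> m \<bullet> x = 0"
    and u: "u \<in> span N" "\<And>x. x \<in> \<tau> \<Longrightarrow> u \<bullet> x = 0"
  shows "\<exists>t\<ge>0. t *\<^sub>R m + u \<in> dual_cone N \<sigma>"
proof -
  define t where "t = (\<Sum>x\<in>V - \<tau>. \<bar>u \<bullet> x\<bar> / (m \<bullet> x))"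
  have pos: "0 \<le> \<bar>u \<bullet> x\<bar> / (m \<bullet> x)" if "x \<in> V - \<tau>" for x
    using m(2)[of x] that by auto
  have "0 \<le> (t *\<^sub>R m + u) \<bullet> x" if x: "x \<in> V" for x
  proof (cases "x \<in> \<tau>")
    case True
    then show ?thesis using m(3) u(2) by (simp add: inner_add_left)
  next
    case False
    with x have "\<bar>u \<bullet> x\<bar> / (m \<bullet> x) \<le> t"
      unfolding t_def using V(1) pos by (intro member_le_sum) auto
    with m(2)[OF x False] have "\<bar>u \<bullet> x\<bar> \<le> t * (m \<bullet> x)"
      by (simp add: pos_divide_le_eq)
    then show ?thesis by (simp add: inner_add_left)
  qed
  moreover have "t *\<^sub>R m + u \<in> span N"
    using m(1) u(1) by (simp add: span_add span_scale)
  moreover have "0 \<le> t"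
    unfolding t_def using pos by (rule sum_nonneg)
  ultimately show ?thesis
    using dual_cone_hull[OF V(2)] by blast
qed

lemma cone_face_support:
  assumes V: "finite V" "\<sigma> = convex_cone hull V" "V \<subseteq> span N"
    and \<tau>: "\<tau> face_of \<sigma>" "\<tau> \<noteq> {}"
  obtains m where "m \<in> dual_cone N \<sigma>" "\<And>x. x \<in> \<sigma> \<Longrightarrow> m \<bullet> x = 0 \<longleftrightarrow> x \<in> \<tau>"
proof -
  have cc: "convex_cone \<sigma>"
    unfolding V(2) by (rule convex_cone_convex_cone_hull)
  have "convex_cone (span N)"
    by (auto simp: convex_cone_def conic_def subspace_imp_convex span_scale intro: span_0)
  then have sub: "\<sigma> \<subseteq> span N"
    unfolding V(2) using V(3) by (intro hull_minimal) auto
  have "polyhedron \<sigma>"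
    unfolding V(2) using V(1) by (rule polyhedron_convex_cone_hull)
  then have "\<tau> exposed_face_of \<sigma>"
    using \<tau>(1) by (simp add: exposed_face_of_polyhedron)
  then obtain a b where ab: "\<sigma> \<subseteq> {x. a \<bullet> x \<le> b}" "\<tau> = \<sigma> \<inter> {x. a \<bullet> x = b}"
    unfolding exposed_face_of_def by blast
  obtain y where y: "y \<in> \<tau>" using \<tau>(2) by blast
  have "0 \<in> \<sigma>" "2 *\<^sub>R y \<in> \<sigma>"
    using cc y ab(2) by (auto simp: convex_cone_contains_0 convex_cone_def conic_def)
  with ab y have "0 \<le> b" "a \<bullet> y = b" "2 * (a \<bullet> y) \<le> b" by auto
  then have b: "b = 0" by simp
  define m where "m = - (a - proj N a)"
  have eq: "m \<bullet> x = - (a \<bullet> x)" if "x \<in> \<sigma>" for x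
    using proj_orth[of x N a] sub that by (auto simp: m_def inner_diff_left orthogonal_def)
  show thesis
  proof (rule that)
    show "m \<in> dual_cone N \<sigma>"
      using ab(1) b eq span_neg[OF proj_in[of a N]] by (auto simp: dual_cone_def m_def)
    show "m \<bullet> x = 0 \<longleftrightarrow> x \<in> \<tau>" if "x \<in> \<sigma>" for x
      using that ab b eq by auto
  qed
qed

lemma inner_proj: "(\<And>x. x \<in> \<tau> \<Longrightarrow> m \<bullet> x = 0) \<Longrightarrow> m \<bullet> proj \<tau> x = m \<bullet> x"
  using orthogonal_to_span[OF proj_in[of x \<tau>], of m]
  by (simp add: orthogonal_def inner_diff_right)

theorem bij_point_hom:
  assumes fan: "is_fan N \<Sigma>" and \<sigma>: "\<sigma> \<in> \<Sigma>"
  shows "bij_betw (point_hom N \<sigma>) (cone_points \<Sigma> \<sigma>) (cone_hom N \<sigma>)"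
proof -
  obtain V where V: "finite V" "\<sigma> = convex_cone hull V" "V \<subseteq> span N"
  proof -
    have "rational_cone N \<sigma>" using fan \<sigma> by (simp add: is_fan_def)
    then obtain V where "finite V" "V \<subseteq> N" "\<sigma> = convex_cone hull V"
      unfolding rational_cone_def by (elim conjE exE)
    then show thesis using that[of V] span_superset[of N] by simp
  qed
  have V\<sigma>: "V \<subseteq> \<sigma>" unfolding V(2) by (rule hull_subset)
  have cc: "convex_cone \<sigma>"
    unfolding V(2) by (rule convex_cone_convex_cone_hull)
  have ne: "\<tau> \<noteq> {}" if "\<tau> \<in> \<Sigma>" for \<tau>
  proof -
    have "rational_cone N \<tau>" using fan that by (simp add: is_fan_def)
    then show ?thesis by (auto simp: rational_cone_def)
  qed
  have "convex_cone (span N)"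
    by (auto simp: convex_cone_def conic_def subspace_imp_convex span_scale intro: span_0)
  then have sub: "\<sigma> \<subseteq> span N"
    unfolding V(2) using V(3) by (intro hull_minimal) auto
  let ?D = "dual_cone N \<sigma>"
  have "inj_on (point_hom N \<sigma>) (cone_points \<Sigma> \<sigma>)"
  proof (rule inj_onI, clarify)
    fix \<tau> v \<tau>' v'
    assume in1: "(\<tau>, v) \<in> cone_points \<Sigma> \<sigma>" and in2: "(\<tau>', v') \<in> cone_points \<Sigma> \<sigma>"
      and eq: "point_hom N \<sigma> (\<tau>, v) = point_hom N \<sigma> (\<tau>', v')"
    have sub_face: "\<tau>2 \<subseteq> \<tau>1"
      if i: "(\<tau>1, v1) \<in> cone_points \<Sigma> \<sigma>" "(\<tau>2, v2) \<in> cone_points \<Sigma> \<sigma>"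
        and e: "point_hom N \<sigma> (\<tau>1, v1) = point_hom N \<sigma> (\<tau>2, v2)" for \<tau>1 v1 \<tau>2 v2
    proof -
      have f: "\<tau>1 face_of \<sigma>" "\<tau>1 \<noteq> {}" "\<tau>2 \<subseteq> \<sigma>" "\<tau>1 \<subseteq> \<sigma>"
        using i ne by (auto simp: cone_points_def dest: face_of_imp_subset)
      obtain m where m: "m \<in> ?D" "\<And>x. x \<in> \<sigma> \<Longrightarrow> m \<bullet> x = 0 \<longleftrightarrow> x \<in> \<tau>1"
        using cone_face_support[OF V f(1,2)] by blast
      have "\<forall>x\<in>\<tau>2. m \<bullet> x = 0"
        using fun_cong[OF e, of m] m f by (auto simp: point_hom_def split: if_splits)
      then show ?thesis using m(2) f(3) by blast
    qed
    have \<tau>: "\<tau>' = \<tau>"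
      using sub_face[OF in1 in2 eq] sub_face[OF in2 in1 eq[symmetric]] by blast
    have f: "\<tau> face_of \<sigma>" "\<tau> \<noteq> {}" "\<tau> \<subseteq> \<sigma>"
      using in1 ne by (auto simp: cone_points_def dest: face_of_imp_subset)
    obtain m where m: "m \<in> ?D" "\<And>x. x \<in> \<sigma> \<Longrightarrow> m \<bullet> x = 0 \<longleftrightarrow> x \<in> \<tau>"
      using cone_face_support[OF V f(1,2)] by blast
    obtain x x' where x: "x \<in> \<sigma>" "x' \<in> \<sigma>" "v = proj \<tau> x" "v' = proj \<tau> x'"
      using in1 in2 \<tau> by (auto simp: cone_points_def)
    define u where "u = v - v'"
    have "u = x - (x - v) - (x' - (x' - v'))" by (simp add: u_def)
    moreover have "x - v \<in> span N" "x' - v' \<in> span N"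
      using proj_in[of _ \<tau>] f(3) sub x by (metis span_mono span_span subset_iff subset_trans)+
    ultimately have uN: "u \<in> span N"
      using sub x by (metis span_diff subset_iff)
    have u\<tau>: "u \<bullet> y = 0" if "y \<in> \<tau>" for y
      using that x by (simp add: u_def inner_diff_left proj_orth[unfolded orthogonal_def] span_base)
    have "0 < m \<bullet> y" if "y \<in> V" "y \<notin> \<tau>" for y
      using m that V\<sigma> by (force simp: dual_cone_def less_le)
    then obtain t where t: "t \<ge> 0" "t *\<^sub>R m + u \<in> ?D"
      using dual_cone_large[OF V(1,2), of m N \<tau> u] m f(3) uN u\<tau> by (auto simp: dual_cone_def)
    have val: "k \<bullet> v = k \<bullet> v'" if "k \<in> ?D" "\<forall>y\<in>\<tau>. k \<bullet> y = 0" for k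
      using fun_cong[OF eq, of k] that \<tau> by (simp add: point_hom_def)
    have m\<tau>: "m \<bullet> y = 0" if "y \<in> \<tau>" for y
      using m(2)[of y] f(3) that by blast
    have "m \<bullet> v = m \<bullet> v'"
      using val[OF m(1)] m\<tau> by blast
    moreover have "(t *\<^sub>R m + u) \<bullet> v = (t *\<^sub>R m + u) \<bullet> v'"
      using m\<tau> u\<tau> by (intro val[OF t(2)]) (simp add: inner_add_left)
    ultimately have "u \<bullet> u = 0"
      by (simp add: u_def inner_add_left inner_diff_right)
    with \<tau> show "\<tau> = \<tau>' \<and> v = v'" by (simp add: u_def)
  qed
  moreover have "point_hom N \<sigma> p \<in> cone_hom N \<sigma>" if "p \<in> cone_points \<Sigma> \<sigma>" for p
  proof -
    obtain \<tau> x where p: "p = (\<tau>, proj \<tau> x)" "x \<in> \<sigma>" "\<tau> face_of \<sigma>"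
      using \<open>p \<in> cone_points \<Sigma> \<sigma>\<close> by (auto simp: cone_points_def)
    have \<tau>\<sigma>: "\<tau> \<subseteq> \<sigma>" using p(3) by (rule face_of_imp_subset)
    have val: "point_hom N \<sigma> p m = (if \<forall>y\<in>\<tau>. m \<bullet> y = 0 then ereal (m \<bullet> x) else \<infinity>)"
      if "m \<in> ?D" for m
      using that by (simp add: p point_hom_def inner_proj)
    have ge: "0 \<le> m \<bullet> y" if "m \<in> ?D" "y \<in> \<sigma>" for m y
      using that by (simp add: dual_cone_def)
    have sum0: "(\<forall>y\<in>\<tau>. (m + m') \<bullet> y = 0) \<longleftrightarrow> (\<forall>y\<in>\<tau>. m \<bullet> y = 0) \<and> (\<forall>y\<in>\<tau>. m' \<bullet> y = 0)"
      if "m \<in> ?D" "m' \<in> ?D" for m m'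
      using ge[OF that(1)] ge[OF that(2)] \<tau>\<sigma>
      by (auto simp: inner_add_left add_nonneg_eq_0_iff subset_iff)
    show ?thesis
      unfolding cone_hom_def
    proof (intro CollectI conjI ballI allI impI)
      have "0 \<le> point_hom N \<sigma> p m" if "m \<in> ?D" for m
        using ge[OF that p(2)] by (simp add: val[OF that])
      then show "point_hom N \<sigma> p \<in> ?D \<rightarrow>\<^sub>E {0..}"
        by (auto simp: p point_hom_def)
    next
      fix m m' assume m: "m \<in> ?D" "m' \<in> ?D"
      show "point_hom N \<sigma> p (m + m') = point_hom N \<sigma> p m + point_hom N \<sigma> p m'"
        unfolding val[OF m(1)] val[OF m(2)] val[OF dual_cone_add[OF m]] sum0[OF m]
        by (simp add: inner_add_left)
    next
      fix c :: real and m assume c: "0 \<le> c" and m: "m \<in> ?D"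
      show "point_hom N \<sigma> p (c *\<^sub>R m) = ereal c * point_hom N \<sigma> p m"
        unfolding val[OF m] val[OF dual_cone_scale[OF m c]]
        using c by (cases "c = 0") auto
    qed
  qed
  moreover have "f \<in> point_hom N \<sigma> ` cone_points \<Sigma> \<sigma>" if f: "f \<in> cone_hom N \<sigma>" for f
  proof -
    have f_ext: "f \<in> ?D \<rightarrow>\<^sub>E {0..}"
      and f_add: "\<And>m m'. m \<in> ?D \<Longrightarrow> m' \<in> ?D \<Longrightarrow> f (m + m') = f m + f m'"
      and f_scale: "\<And>c m. 0 \<le> c \<Longrightarrow> m \<in> ?D \<Longrightarrow> f (c *\<^sub>R m) = ereal c * f m"
      using f by (auto simp: cone_hom_def)
    have f_ge: "0 \<le> f m" if "m \<in> ?D" for m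
      using f_ext that by auto
    define Fin where "Fin = {m \<in> ?D. f m \<noteq> \<infinity>}"
    define \<phi> where "\<phi> m = real_of_ereal (f m)" for m
    have FinD: "m \<in> ?D" if "m \<in> Fin" for m using that by (simp add: Fin_def)
    have f\<phi>: "f m = ereal (\<phi> m)" if "m \<in> Fin" for m
      using that f_ge[of m] by (cases "f m") (auto simp: Fin_def \<phi>_def)
    have \<phi>_ge: "0 \<le> \<phi> m" if "m \<in> Fin" for m
      using f_ge[OF FinD[OF that]] f\<phi>[OF that] by simp
    have D0: "0 \<in> ?D" by (simp add: dual_cone_def span_0)
    have "f 0 = ereal 0 * f 0"
      using f_scale[OF order_refl D0] by (simp only: scaleR_zero_left)
    also have "\<dots> = 0" by (simp flip: zero_ereal_def)
    finally have Fin0: "0 \<in> Fin" using D0 by (simp add: Fin_def)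
    have Fin_add: "m + m' \<in> Fin" "\<phi> (m + m') = \<phi> m + \<phi> m'" if "m \<in> Fin" "m' \<in> Fin" for m m'
    proof -
      have eq: "f (m + m') = ereal (\<phi> m + \<phi> m')"
        using f_add[OF FinD[OF that(1)] FinD[OF that(2)]] f\<phi>[OF that(1)] f\<phi>[OF that(2)] by simp
      show "m + m' \<in> Fin"
        using dual_cone_add[OF FinD[OF that(1)] FinD[OF that(2)]] eq by (simp add: Fin_def)
      show "\<phi> (m + m') = \<phi> m + \<phi> m'"
        unfolding \<phi>_def[of "m + m'"] eq by simp
    qed
    have Fin_scale: "c *\<^sub>R m \<in> Fin" "\<phi> (c *\<^sub>R m) = c * \<phi> m" if "m \<in> Fin" "0 \<le> c" for c m
    proof -
      have eq: "f (c *\<^sub>R m) = ereal (c * \<phi> m)"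
        using f_scale[OF that(2) FinD[OF that(1)]] f\<phi>[OF that(1)] by simp
      show "c *\<^sub>R m \<in> Fin"
        using dual_cone_scale[OF FinD[OF that(1)] that(2)] eq by (simp add: Fin_def)
      show "\<phi> (c *\<^sub>R m) = c * \<phi> m"
        unfolding \<phi>_def[of "c *\<^sub>R m"] eq by simp
    qed
    have Fin_sum: "(\<Sum>i\<in>A. g i) \<in> Fin" "\<phi> (\<Sum>i\<in>A. g i) = (\<Sum>i\<in>A. \<phi> (g i))"
      if "finite A" "\<And>i. i \<in> A \<Longrightarrow> g i \<in> Fin" for A and g :: "'a \<Rightarrow> 'a"
    proof -
      have \<phi>0: "\<phi> 0 = 0" using Fin_scale(2)[OF Fin0, of 0] by simp
      have "(\<Sum>i\<in>A. g i) \<in> Fin \<and> \<phi> (\<Sum>i\<in>A. g i) = (\<Sum>i\<in>A. \<phi> (g i))"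
        using that by (induction A rule: finite_induct) (simp_all add: Fin0 Fin_add \<phi>0)
      then show "(\<Sum>i\<in>A. g i) \<in> Fin" "\<phi> (\<Sum>i\<in>A. g i) = (\<Sum>i\<in>A. \<phi> (g i))" by auto
    qed
    have Fin_ge: "0 \<le> m \<bullet> x" if "m \<in> Fin" "x \<in> \<sigma>" for m x
      using that by (auto simp: Fin_def dual_cone_def)
    define \<tau> where "\<tau> = {x \<in> \<sigma>. \<forall>m\<in>Fin. m \<bullet> x = 0}"
    have "\<tau> face_of \<sigma>"
      unfolding face_of_def
    proof (intro conjI ballI impI)
      show "\<tau> \<subseteq> \<sigma>" by (auto simp: \<tau>_def)
      show "convex \<tau>"
        unfolding convex_alt
      proof (intro ballI allI impI)
        fix x y and u :: real assume xy: "x \<in> \<tau>" "y \<in> \<tau>" and u: "0 \<le> u \<and> u \<le> 1"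
        have "(1 - u) *\<^sub>R x + u *\<^sub>R y \<in> \<sigma>"
          using cc xy u unfolding \<tau>_def convex_cone_def convex_alt by blast
        then show "(1 - u) *\<^sub>R x + u *\<^sub>R y \<in> \<tau>"
          using xy by (simp add: \<tau>_def inner_add_right)
      qed
      fix a b x
      assume abx: "a \<in> \<sigma>" "b \<in> \<sigma>" "x \<in> \<tau>" "x \<in> open_segment a b"
      then obtain u where u: "0 < u" "u < 1" "x = (1 - u) *\<^sub>R a + u *\<^sub>R b"
        by (auto simp: in_segment)
      have "m \<bullet> a = 0 \<and> m \<bullet> b = 0" if m: "m \<in> Fin" for m
      proof -
        have "(1 - u) * (m \<bullet> a) + u * (m \<bullet> b) = 0"
          using abx(3) m u(3) by (simp add: \<tau>_def inner_add_right)
        moreover have "0 \<le> (1 - u) * (m \<bullet> a)" "0 \<le> u * (m \<bullet> b)"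
          using Fin_ge[OF m] abx u by auto
        ultimately have "(1 - u) * (m \<bullet> a) = 0" "u * (m \<bullet> b) = 0" by linarith+
        then show ?thesis using u by simp
      qed
      then show "a \<in> \<tau>" "b \<in> \<tau>" using abx by (auto simp: \<tau>_def)
    qed
    moreover have "0 \<in> \<tau>" using cc by (auto simp: \<tau>_def convex_cone_contains_0)
    ultimately have \<tau>: "\<tau> face_of \<sigma>" "\<tau> \<in> \<Sigma>" "\<tau> \<subseteq> \<sigma>"
      using fan \<sigma> unfolding is_fan_def by (blast, blast, auto simp: \<tau>_def)
    have "\<forall>x\<in>V - \<tau>. \<exists>m\<in>Fin. 0 < m \<bullet> x"
      using Fin_ge V\<sigma> unfolding \<tau>_def by (force simp: less_le)
    then obtain M where M: "\<And>x. x \<in> V - \<tau> \<Longrightarrow> M x \<in> Fin" "\<And>x. x \<in> V - \<tau> \<Longrightarrow> 0 < M x \<bullet> x"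
      by metis
    define m0 where "m0 = (\<Sum>x\<in>V - \<tau>. M x)"
    have m0: "m0 \<in> Fin" unfolding m0_def using V(1) M by (intro Fin_sum) auto
    have m0_pos: "0 < m0 \<bullet> x" if x: "x \<in> V" "x \<notin> \<tau>" for x
    proof -
      have "0 < M x \<bullet> x" using x M by auto
      also have "\<dots> \<le> (\<Sum>y\<in>V - \<tau>. M y \<bullet> x)"
        using x V(1) M Fin_ge V\<sigma> by (intro member_le_sum) auto
      finally show ?thesis by (simp add: m0_def inner_sum_left)
    qed
    have Fin_iff: "m \<in> Fin \<longleftrightarrow> (\<forall>x\<in>\<tau>. m \<bullet> x = 0)" if m: "m \<in> ?D" for m
    proof
      assume "m \<in> Fin" then show "\<forall>x\<in>\<tau>. m \<bullet> x = 0" by (auto simp: \<tau>_def)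
    next
      assume m\<tau>: "\<forall>x\<in>\<tau>. m \<bullet> x = 0"
      obtain t where t: "0 \<le> t" "t *\<^sub>R m0 + - m \<in> ?D"
        using dual_cone_large[OF V(1,2), of m0 N \<tau> "- m"] m0_pos m0 m m\<tau>
        by (auto simp: Fin_def dual_cone_def \<tau>_def span_neg)
      have "f (t *\<^sub>R m0) = f m + f (t *\<^sub>R m0 + - m)"
        using f_add[OF m t(2)] by simp
      moreover have "t *\<^sub>R m0 \<in> Fin" using Fin_scale m0 t by blast
      ultimately have "f m + f (t *\<^sub>R m0 + - m) \<noteq> \<infinity>" by (auto simp: Fin_def)
      then have "f m \<noteq> \<infinity>" by auto
      with m show "m \<in> Fin" by (simp add: Fin_def)
    qed
    obtain B where B: "B \<subseteq> Fin" "independent B" "Fin \<subseteq> span B"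
      using maximal_independent_subset[of Fin] by blast
    have finB: "finite B" using B(2) by (rule independent_imp_finite)
    obtain G where G: "linear G" "\<And>b. b \<in> B \<Longrightarrow> G b = \<phi> b"
      using linear_independent_extend[OF B(2), of \<phi>] by blast
    have G\<phi>: "G m = \<phi> m" if m: "m \<in> Fin" for m
    proof -
      obtain c where c: "m = (\<Sum>b\<in>B. c b *\<^sub>R b)"
        using m B(3) by (auto simp: span_finite[OF finB])
      define P where "P = (\<Sum>b\<in>B. max (c b) 0 *\<^sub>R b)"
      define Q where "Q = (\<Sum>b\<in>B. max (- c b) 0 *\<^sub>R b)"
      have mPQ: "m + Q = P"
        unfolding c P_def Q_def sum.distrib[symmetric] scaleR_add_left[symmetric]
        by (intro sum.cong refl arg_cong2[where f = scaleR]) auto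
      have *: "(\<Sum>b\<in>B. max (g b) 0 *\<^sub>R b) \<in> Fin \<and>
               \<phi> (\<Sum>b\<in>B. max (g b) 0 *\<^sub>R b) = G (\<Sum>b\<in>B. max (g b) 0 *\<^sub>R b)" for g
        using Fin_sum[OF finB, of "\<lambda>b. max (g b) 0 *\<^sub>R b"] Fin_scale B(1) G
        by (auto simp: linear_sum[OF G(1)] linear_scale[OF G(1)] subset_iff intro!: sum.cong)
      have "\<phi> m + \<phi> Q = \<phi> P"
        using Fin_add(2)[OF m, of Q] *[of "\<lambda>b. - c b"] mPQ by (simp add: Q_def)
      moreover have "G m + G Q = G P"
        using linear_add[OF G(1), of m Q] mPQ by simp
      moreover have "\<phi> P = G P" "\<phi> Q = G Q"
        using *[of c] *[of "\<lambda>b. - c b"] by (simp_all add: P_def Q_def)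
      ultimately show ?thesis by simp
    qed
    define w where "w = adjoint G 1"
    have Gw: "G m = m \<bullet> w" for m
      using adjoint_works[OF G(1), of m 1] by (simp add: w_def)
    define Z where "Z = {z. \<forall>m\<in>Fin. m \<bullet> z = 0}"
    have "subspace Z"
      by (auto simp: Z_def subspace_def inner_add_right)
    obtain E where E: "E \<subseteq> Z" "independent E" "Z \<subseteq> span E"
      using maximal_independent_subset[of Z] by blast
    have finE: "finite E" using E(2) by (rule independent_imp_finite)
    define C where "C = convex_cone hull (V \<union> (E \<union> uminus ` E))"
    have C_cc: "convex_cone C" unfolding C_def by (rule convex_cone_convex_cone_hull)
    have "closed C" "convex C"
      unfolding C_def using V(1) finE
      by (auto intro!: closed_convex_cone_hull convex_convex_cone_hull)
    have C_sub: "V \<union> (E \<union> uminus ` E) \<subseteq> C" unfolding C_def by (rule hull_subset)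
    have "w \<in> C"
    proof (rule ccontr)
      assume "w \<notin> C"
      then obtain a b where ab: "a \<bullet> w < b" "\<And>x. x \<in> C \<Longrightarrow> b < a \<bullet> x"
        using separating_hyperplane_closed_point[OF \<open>convex C\<close> \<open>closed C\<close>] by blast
      have "0 \<in> C" using C_cc by (simp add: convex_cone_contains_0)
      then have b: "b < 0" using ab(2)[of 0] by simp
      have a_ge: "0 \<le> a \<bullet> x" if x: "x \<in> C" for x
      proof (rule ccontr)
        assume "\<not> 0 \<le> a \<bullet> x"
        then have neg: "a \<bullet> x < 0" by simp
        have "(b / (a \<bullet> x)) *\<^sub>R x \<in> C"
          using C_cc x b neg unfolding convex_cone_def conic_def by (simp add: divide_nonpos_neg)
        from ab(2)[OF this] neg show False by simp
      qed
      have aE: "a \<bullet> z = 0" if "z \<in> E" for z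
        using a_ge[of z] a_ge[of "- z"] C_sub that by (auto simp: subset_iff)
      have aZ: "a \<bullet> z = 0" if "z \<in> Z" for z
        using orthogonal_to_span[of z E a] that E(3) aE by (auto simp: orthogonal_def)
      have "proj N a \<in> Z"
        using proj_orth[of _ N a] by (auto simp: Z_def Fin_def dual_cone_def orthogonal_def inner_commute)
      then have "a \<bullet> proj N a = 0" by (rule aZ)
      moreover have "(a - proj N a) \<bullet> proj N a = 0"
        using proj_orth[OF proj_in[of a N], of a] by (simp add: orthogonal_def inner_commute)
      ultimately have "proj N a = 0" by (simp add: inner_diff_left)
      then have "a \<in> span N" by (simp add: proj_eq_0_iff)
      moreover have "0 \<le> a \<bullet> v" if "v \<in> V" for v
        using a_ge[of v] C_sub that by blast
      ultimately have aD: "a \<in> ?D" by (intro dual_cone_hull[OF V(2)])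
      have "\<tau> \<subseteq> Z" by (auto simp: \<tau>_def Z_def)
      then have "a \<in> Fin" using aZ Fin_iff[OF aD] by auto
      then have "0 \<le> a \<bullet> w" using \<phi>_ge G\<phi> Gw by simp
      with ab(1) b show False by simp
    qed
    moreover have "C \<subseteq> {x + z | x z. x \<in> \<sigma> \<and> z \<in> Z}"
      unfolding C_def
    proof (rule hull_minimal)
      have "0 \<in> \<sigma>" using cc by (simp add: convex_cone_contains_0)
      have "v \<in> {x + z | x z. x \<in> \<sigma> \<and> z \<in> Z}" if "v \<in> V" for v
        using that V\<sigma> subspace_0[OF \<open>subspace Z\<close>]
        by (intro CollectI exI[of _ v] exI[of _ 0]) auto
      moreover have "v \<in> {x + z | x z. x \<in> \<sigma> \<and> z \<in> Z}" if "v \<in> E \<union> uminus ` E" for v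
        using that E(1) \<open>0 \<in> \<sigma>\<close> subspace_neg[OF \<open>subspace Z\<close>]
        by (intro CollectI exI[of _ 0] exI[of _ v]) auto
      ultimately show "V \<union> (E \<union> uminus ` E) \<subseteq> {x + z | x z. x \<in> \<sigma> \<and> z \<in> Z}" by blast
      have "convex_cone Z"
        using \<open>subspace Z\<close> by (auto simp: convex_cone_def conic_def subspace_imp_convex subspace_scale dest: subspace_0)
      then have "convex_cone (\<Union>x\<in>\<sigma>. \<Union>z\<in>Z. {x + z})"
        using cc by (intro convex_cone_sums)
      moreover have "(\<Union>x\<in>\<sigma>. \<Union>z\<in>Z. {x + z}) = {x + z | x z. x \<in> \<sigma> \<and> z \<in> Z}" by blast
      ultimately show "convex_cone {x + z | x z. x \<in> \<sigma> \<and> z \<in> Z}" by simp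
    qed
    ultimately obtain x z where xz: "x \<in> \<sigma>" "z \<in> Z" "w = x + z" by blast
    have "f = point_hom N \<sigma> (\<tau>, proj \<tau> x)"
    proof
      fix m
      show "f m = point_hom N \<sigma> (\<tau>, proj \<tau> x) m"
      proof (cases "m \<in> ?D")
        case False
        then show ?thesis using f_ext by (auto simp: point_hom_def)
      next
        case D: True
        show ?thesis
        proof (cases "m \<in> Fin")
          case True
          then have "f m = ereal (m \<bullet> x)"
            using f\<phi> G\<phi> Gw xz by (simp add: inner_add_right Z_def)
          then show ?thesis
            using D True Fin_iff[OF D] by (simp add: point_hom_def inner_proj)
        next
          case False
          then show ?thesis
            using D Fin_iff[OF D] by (auto simp: point_hom_def Fin_def)
        qed
      qed
    qed
    moreover have "(\<tau>, proj \<tau> x) \<in> cone_points \<Sigma> \<sigma>"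
      using \<tau> xz by (auto simp: cone_points_def)
    ultimately show ?thesis by blast
  qed
  ultimately show ?thesis
    unfolding bij_betw_def by blast
qed


section \<open>Tropical cycles\<close>

definition rational_polyhedron :: "'v::euclidean_space set \<Rightarrow> 'v set \<Rightarrow> bool" where
  "rational_polyhedron N P \<longleftrightarrow> (\<exists>H. finite H \<and> (\<forall>(m, c)\<in>H. \<forall>n\<in>N. m \<bullet> n \<in> \<int>) \<and>
     P = {x \<in> span N. \<forall>(m, c)\<in>H. m \<bullet> x \<ge> c})"

text \<open>\<open>span (dirs P)\<close> is the linear space tangent to \<open>P\<close>.\<close>

definition dirs :: "'v::euclidean_space set \<Rightarrow> 'v set" where
  "dirs P = {x - y | x y. x \<in> P \<and> y \<in> P}"

text \<open>For a facet \<open>Q\<close> of \<open>P\<close>: the generator of \<open>N\<^sub>P / N\<^sub>Q\<close> pointing from \<open>Q\<close> into \<open>P\<close>.\<close>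

definition facet_normal :: "'v::euclidean_space set \<Rightarrow> 'v set \<Rightarrow> 'v set \<Rightarrow> 'v" where
  "facet_normal N Q P = primitive N (dirs Q) {t *\<^sub>R (x - y) | t x y. 0 \<le> t \<and> x \<in> P \<and> y \<in> Q}"

definition balanced_complex ::
  "real set \<Rightarrow> 'v::euclidean_space set \<Rightarrow> nat \<Rightarrow> 'v set set \<Rightarrow> ('v set \<Rightarrow> real) \<Rightarrow> bool" where
  "balanced_complex K N k Y w \<longleftrightarrow> finite Y \<and>
     (\<forall>P\<in>Y. P \<noteq> {} \<and> rational_polyhedron N P) \<and>
     (\<forall>P\<in>Y. \<forall>F. F face_of P \<and> F \<noteq> {} \<longrightarrow> F \<in> Y) \<and>
     (\<forall>P\<in>Y. \<forall>Q\<in>Y. P \<inter> Q face_of P \<and> P \<inter> Q face_of Q) \<and>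
     (\<forall>Q\<in>Y. \<exists>P\<in>Y. aff_dim P = int k \<and> Q face_of P) \<and>
     (\<forall>P\<in>Y. aff_dim P = int k \<longrightarrow> w P \<in> K) \<and>
     (\<forall>Q\<in>Y. aff_dim Q = int k - 1 \<longrightarrow>
        (\<Sum>P | P \<in> Y \<and> aff_dim P = int k \<and> Q face_of P. w P *\<^sub>R facet_normal N Q P) = 0)"

text \<open>A formal sum of closures of weighted complexes \<open>(Y, w)\<close> in the strata \<open>\<tau>\<close> is the list of the
  triples \<open>(\<tau>, Y, w)\<close>.\<close>

type_synonym 'n cycle =
  "('n rvec set \<times> 'n rvec set set \<times> ('n rvec set \<Rightarrow> real)) list"

definition tropical_cycle ::
  "real set \<Rightarrow> 'n::{finite,linorder} rvec set \<Rightarrow> 'n rvec set set \<Rightarrow> nat \<Rightarrow> 'n cycle \<Rightarrow> bool"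
  where
  "tropical_cycle K N \<Sigma> k Z \<longleftrightarrow> (\<forall>(\<tau>, Y, w)\<in>set Z. \<tau> \<in> \<Sigma> \<and>
     balanced_complex K (proj \<tau> ` N) k Y w \<and> \<Union> Y \<subseteq> \<Union> (star_fan \<Sigma> \<tau>))"

text \<open>Cells of a subdivision of the compactification are closures of polyhedra in the strata. The pair \<open>(\<tau>, P)\<close>
  stands for the closure of the polyhedron \<open>P\<close> of the stratum \<open>\<tau>\<close>; in a subdivision, its faces are the
  non-empty intersections with strata of the closures of the faces of \<open>P\<close>.\<close>

definition cell_closure ::
  "'n::{finite,linorder} rvec set \<Rightarrow> 'n rvec set set \<Rightarrow> 'n face \<Rightarrow> ('n rvec set \<times> 'n rvec) set"
  where
  "cell_closure N \<Sigma> = (\<lambda>(\<tau>, P). compactification N \<Sigma> closure_of ({\<tau>} \<times> P))"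

definition subdivision ::
  "'n::{finite,linorder} rvec set \<Rightarrow> 'n rvec set set \<Rightarrow> 'n face set \<Rightarrow> bool" where
  "subdivision N \<Sigma> X \<longleftrightarrow> finite X \<and>
     (\<forall>(\<tau>, P)\<in>X. \<tau> \<in> \<Sigma> \<and> P \<noteq> {} \<and> rational_polyhedron (proj \<tau> ` N) P \<and>
        (\<exists>\<sigma>\<in>\<Sigma>. \<tau> face_of \<sigma> \<and> rel_interior P \<subseteq> rel_interior (proj \<tau> ` \<sigma>))) \<and>
     (\<forall>(\<tau>, P)\<in>X. \<forall>F. F face_of P \<and> F \<noteq> {} \<longrightarrow>
        (\<forall>\<rho>\<in>\<Sigma>. cell_closure N \<Sigma> (\<tau>, F) `` {\<rho>} = {} \<or>
                   (\<rho>, cell_closure N \<Sigma> (\<tau>, F) `` {\<rho>}) \<in> X)) \<and>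
     (\<forall>(\<tau>, v)\<in>topspace (compactification N \<Sigma>). \<exists>!P. (\<tau>, P) \<in> X \<and> v \<in> rel_interior P)"

definition cell_lattice :: "'n::{finite,linorder} rvec set \<Rightarrow> 'n face \<Rightarrow> 'n rvec set" where
  "cell_lattice N = (\<lambda>(\<tau>, P). proj \<tau> ` N \<inter> span (dirs P))"

definition cell_dim :: "'n::{finite,linorder} face \<Rightarrow> nat" where
  "cell_dim = (\<lambda>(\<tau>, P). nat (aff_dim P))"

definition cell_orientation ::
  "'n::{finite,linorder} rvec set \<Rightarrow> 'n face set \<Rightarrow> ('n face \<Rightarrow> 'n ext) \<Rightarrow> bool" where
  "cell_orientation N X \<mu> \<longleftrightarrow> (\<forall>\<delta>\<in>X. is_generator (cell_lattice N \<delta>) (cell_dim \<delta>) (\<mu> \<delta>) \<and>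
     (cell_dim \<delta> = 0 \<longrightarrow> \<mu> \<delta> = ext_one))"

text \<open>The coefficient groups of a cell are those of the smallest closed face \<open>\<box>\<^sup>\<tau>\<^sub>\<sigma>\<close> containing it: \<open>\<sigma> \<prec> \<eta>\<close> iff
  \<open>P \<subseteq> proj \<tau> ` \<eta>\<close>.\<close>

definition cell_chains ::
  "real set \<Rightarrow> 'n::{finite,linorder} rvec set \<Rightarrow> 'n rvec set set \<Rightarrow> 'n face set
     \<Rightarrow> nat \<Rightarrow> nat \<Rightarrow> ('n face \<Rightarrow> 'n ext) set" where
  "cell_chains K N \<Sigma> X p q = {c. \<forall>\<tau> P. if (\<tau>, P) \<in> X \<and> cell_dim (\<tau>, P) = q
     then c (\<tau>, P) \<in> ext_power K
            {proj \<tau> ` (N \<inter> span \<eta>) | \<eta>. \<eta> \<in> \<Sigma> \<and> \<tau> face_of \<eta> \<and> P \<subseteq> proj \<tau> ` \<eta>} p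
     else c (\<tau>, P) = 0}"

text \<open>Same sign rules as for \<open>face_sign\<close>. If \<open>(\<rho>, Q)\<close> is a codimension-one face of \<open>(\<tau>, P)\<close> at infinity, the
  tangent space of \<open>P\<close> meets \<open>proj \<tau> ` \<rho>\<close> in a ray, and this is the direction in which \<open>Q\<close> is
  reached. Here \<open>N\<^sub>P\<close> need not surject onto \<open>N\<^sub>Q\<close> (only a sublattice of finite index is reached), so the
  lift of the generator is taken with real coefficients and orientations are compared up to a
  positive factor.\<close>

definition outer_orientation ::
  "'n::{finite,linorder} rvec set \<Rightarrow> 'n rvec \<Rightarrow> ('n rvec \<Rightarrow> 'n rvec) \<Rightarrow> nat
     \<Rightarrow> 'n ext \<Rightarrow> 'n ext \<Rightarrow> real" where
  "outer_orientation L e \<pi> m \<nu>\<gamma> \<nu>\<delta> = (THE s. s \<in> {1, - 1} \<and>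
     (\<exists>\<nu>'\<in>ext_power UNIV {L} m. \<exists>t>0. ext_map \<pi> \<nu>' = \<nu>\<gamma> \<and> ext_vec e \<^bold>\<and> \<nu>' = - ((s * t) *\<^sub>R \<nu>\<delta>)))"

definition cell_sign ::
  "'n::{finite,linorder} rvec set \<Rightarrow> ('n face \<Rightarrow> 'n ext) \<Rightarrow> 'n face \<Rightarrow> 'n face \<Rightarrow> real" where
  "cell_sign N \<mu> = (\<lambda>(\<rho>, Q) (\<tau>, P).
     if \<rho> = \<tau>
     then inner_sign (cell_lattice N (\<tau>, P)) (facet_normal (proj \<tau> ` N) Q P) (proj (dirs Q))
            (\<mu> (\<rho>, Q)) (\<mu> (\<tau>, P))
     else outer_orientation (cell_lattice N (\<tau>, P))
            (primitive (proj \<tau> ` N) {0} (proj \<tau> ` \<rho> \<inter> span (dirs P))) (proj \<rho>)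
            (cell_dim (\<rho>, Q)) (\<mu> (\<rho>, Q)) (\<mu> (\<tau>, P)))"

definition cell_boundary ::
  "'n::{finite,linorder} rvec set \<Rightarrow> 'n rvec set set \<Rightarrow> 'n face set \<Rightarrow> ('n face \<Rightarrow> 'n ext)
     \<Rightarrow> ('n face \<Rightarrow> 'n ext) \<Rightarrow> 'n face \<Rightarrow> 'n ext" where
  "cell_boundary N \<Sigma> X \<mu> c \<gamma> =
     (\<Sum>\<delta> | \<gamma> \<in> X \<and> \<delta> \<in> X \<and> cell_closure N \<Sigma> \<gamma> \<subseteq> cell_closure N \<Sigma> \<delta> \<and> cell_dim \<delta> = Suc (cell_dim \<gamma>).
        cell_sign N \<mu> \<gamma> \<delta> *\<^sub>R ext_map (proj (fst \<gamma>)) (c \<delta>))"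

text \<open>The chain on \<open>X\<close> induced by a chain \<open>c\<close> on the compactification: a cell contained in a face \<open>(\<tau>, \<sigma>)\<close> of
  the same dimension, whose orientation is \<open>s\<close> times that of this face, gets the component \<open>s * c (\<tau>, \<sigma>)\<close>.\<close>

definition subdivide_chain ::
  "'n::{finite,linorder} rvec set set \<Rightarrow> ('n face \<Rightarrow> 'n ext) \<Rightarrow> 'n face set \<Rightarrow> ('n face \<Rightarrow> 'n ext)
     \<Rightarrow> ('n face \<Rightarrow> 'n ext) \<Rightarrow> 'n face \<Rightarrow> 'n ext" where
  "subdivide_chain \<Sigma> \<nu> X \<mu> c = (\<lambda>(\<tau>, P). if (\<tau>, P) \<in> X then
     (\<Sum>\<sigma> | (\<tau>, \<sigma>) \<in> faces \<Sigma> \<and> P \<subseteq> proj \<tau> ` \<sigma> \<and> face_dim (\<tau>, \<sigma>) = cell_dim (\<tau>, P).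
        (THE s. s \<in> {1, - 1} \<and> \<mu> (\<tau>, P) = s *\<^sub>R \<nu> (\<tau>, \<sigma>)) *\<^sub>R c (\<tau>, \<sigma>)) else 0)"

definition adapted :: "'n::{finite,linorder} face set \<Rightarrow> 'n cycle \<Rightarrow> bool" where
  "adapted X Z \<longleftrightarrow> (\<forall>(\<tau>, Y, w)\<in>set Z. \<forall>Q\<in>Y. \<forall>P. (\<tau>, P) \<in> X \<and> rel_interior P \<inter> Q \<noteq> {} \<longrightarrow> P \<subseteq> Q)"

definition cycle_chain ::
  "'n::{finite,linorder} face set \<Rightarrow> ('n face \<Rightarrow> 'n ext) \<Rightarrow> nat \<Rightarrow> 'n cycle \<Rightarrow> 'n face \<Rightarrow> 'n ext" where
  "cycle_chain X \<mu> k Z = (\<lambda>(\<tau>, P). if (\<tau>, P) \<in> X \<and> cell_dim (\<tau>, P) = k then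
     (\<Sum>(\<tau>', Y, w)\<leftarrow>Z. if \<tau>' = \<tau> then \<Sum>Q | Q \<in> Y \<and> aff_dim Q = int k \<and> P \<subseteq> Q. w Q else 0)
       *\<^sub>R \<mu> (\<tau>, P) else 0)"

text \<open>\<open>h\<close> is the class in \<open>H\<^bsub>k,k\<^esub>\<close> of the tropical cycle \<open>Z\<close>: on a suitable subdivision, \<open>h\<close> is
  represented by the chain of \<open>Z\<close>.\<close>

definition is_cycle_class ::
  "real set \<Rightarrow> 'n::{finite,linorder} rvec set \<Rightarrow> 'n rvec set set \<Rightarrow> ('n face \<Rightarrow> 'n ext)
     \<Rightarrow> nat \<Rightarrow> 'n cycle \<Rightarrow> ('n face \<Rightarrow> 'n ext) set \<Rightarrow> bool" where
  "is_cycle_class K N \<Sigma> \<nu> k Z h \<longleftrightarrow> h \<in> carrier (trop_homology K N \<Sigma> \<nu> k k) \<and>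
     (\<exists>X \<mu>. subdivision N \<Sigma> X \<and> cell_orientation N X \<mu> \<and> adapted X Z \<and>
        (\<exists>c\<in>h. \<exists>b\<in>cell_chains K N \<Sigma> X k (Suc k).
           subdivide_chain \<Sigma> \<nu> X \<mu> c = cycle_chain X \<mu> k Z + cell_boundary N \<Sigma> X \<mu> b))"

end

theory Submission
 imports Defs
begin

text \<open>Faces \<open>(\<tau>, \<sigma>)\<close> of the compactification filter the complexes \<open>C\<^bsub>p,\<bullet>\<^esub>\<close> in two ways. The graded pieces for
\<open>dim \<tau>\<close> are the Borel--Moore complexes of the star fans of \<open>\<tau>\<close>, whose homology sits in degree
\<open>d - dim \<tau>\<close>, where the coefficients \<open>\<F>\<^sub>p\<close> vanish if \<open>p > d - dim \<tau>\<close>; so \<open>H\<^bsub>p,q\<^esub> = 0\<close> for \<open>q < p\<close>. The graded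
pieces for \<open>dim \<sigma>\<close> are Koszul-like complexes over the sets of rays of \<open>\<sigma>\<close>. Linear forms dual to the rays
contract them in degrees \<open>q > p\<close>; with values in \<open>K\<close>, such forms exist for \<open>K = \<rat>\<close> if the fan is simplicial, for
\<open>K = \<int>\<close> if it is unimodular.

The cap product of a cocycle \<open>a\<close> of degree \<open>(p, p)\<close> with the fundamental class is the chain with component
\<open>\<omega>(\<eta>) a\<^sub>\<sigma>(\<nu>\<^sub>\<sigma>) \<nu>\<close> on \<open>(\<sigma>, \<eta>)\<close>, \<open>dim \<sigma> = p\<close>, \<open>dim \<eta> = d\<close>. This is the chain of the tropical cycle
\<open>\<Sum>\<^sub>\<sigma> a\<^sub>\<sigma>(\<nu>\<^sub>\<sigma>) \<Sigma>\<^sup>\<sigma>\<close>, a combination of the closures of the strata at infinity of codimension \<open>p\<close>.\<close>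

section \<open>Modules over a ring of real numbers\<close>

text \<open>No spectral sequence is used: \<open>filtered_exact\<close> corrects a cycle level by
  level, so each filtration only has to be solved on the lowest level that occurs. In the Koszul
  direction the dual form of one ray gives a homotopy that works at the faces whose \<tau> contains
  that ray. Treating the rays in turn leaves the face with \<tau> = {0}, where the remaining
  coefficient is divisible by all q rays and dies because its degree is p < q. The forms may have
  denominators; what matters is that x(n) \<rho> stays in the lattice of the ray, and this is why
  \<int> asks for unimodularity. All incidence signs reduce to one fact: adding a ray to \<sigma> or
  removing one from \<tau> multiplies \<nu> by the image of that ray, up to a positive factor and a
  sign fixed by the kind of change. On the duality side, \<open>poincare_dual\<close> is a union
  over all representatives of a class, which forces an explicit bounding chain for the cap of a
  coboundary. The closed faces themselves serve as the subdivision; there the chain of the tropical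
  cycle equals the cap product exactly, and the work left is to identify topological closures with
  faces.\<close>

definition real_subring :: "real set \<Rightarrow> bool" where
 "real_subring K \<longleftrightarrow> 1 \<in> K \<and> (\<forall>x\<in>K. \<forall>y\<in>K. x - y \<in> K \<and> x * y \<in> K)"

lemma real_subring_Ints: "real_subring \<int>" and real_subring_Rats: "real_subring \<rat>"
 and real_subring_UNIV: "real_subring UNIV"
 by (auto simp: real_subring_def)

lemma real_subringD:
 assumes "real_subring K"
 shows "1 \<in> K" "0 \<in> K" "x \<in> K \<Longrightarrow> - x \<in> K" "x \<in> K \<Longrightarrow> y \<in> K \<Longrightarrow> x + y \<in> K"
  "x \<in> K \<Longrightarrow> y \<in> K \<Longrightarrow> x - y \<in> K" "x \<in> K \<Longrightarrow> y \<in> K \<Longrightarrow> x * y \<in> K"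
proof -
 have *: "1 \<in> K" "\<And>x y. x \<in> K \<Longrightarrow> y \<in> K \<Longrightarrow> x - y \<in> K" "\<And>x y. x \<in> K \<Longrightarrow> y \<in> K \<Longrightarrow> x * y \<in> K"
  using assms by (auto simp: real_subring_def)
 show 0: "0 \<in> K" using *(2)[OF *(1) *(1)] by simp
 have m: "- x \<in> K" if "x \<in> K" for x using *(2)[OF 0 that] by simp
 then show "x \<in> K \<Longrightarrow> - x \<in> K" .
 show "x \<in> K \<Longrightarrow> y \<in> K \<Longrightarrow> x + y \<in> K" using *(2)[OF _ m, of x y] by simp
qed (use assms in \<open>auto simp: real_subring_def\<close>)

lemma real_subring_Ints_subset:
 assumes "real_subring K" shows "\<int> \<subseteq> K"
proof -
 have "of_nat n \<in> K" for n
  by (induction n) (use real_subringD[OF assms] in auto)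
 then have "of_int z \<in> K" for z
  using real_subringD(3)[OF assms] by (cases z rule: int_cases2) auto
 then show ?thesis by (auto elim!: Ints_cases)
qed

definition kmodule :: "real set \<Rightarrow> 'v::real_vector set \<Rightarrow> bool" where
 "kmodule K M \<longleftrightarrow> 0 \<in> M \<and> (\<forall>x\<in>M. \<forall>y\<in>M. x + y \<in> M) \<and> (\<forall>c\<in>K. \<forall>x\<in>M. c *\<^sub>R x \<in> M)"

lemma kmoduleD:
 assumes "kmodule K M"
 shows "0 \<in> M" "x \<in> M \<Longrightarrow> y \<in> M \<Longrightarrow> x + y \<in> M" "c \<in> K \<Longrightarrow> x \<in> M \<Longrightarrow> c *\<^sub>R x \<in> M"
 using assms by (auto simp: kmodule_def)

lemma kmodule_sum:
 assumes "kmodule K M" "\<And>i. i \<in> A \<Longrightarrow> f i \<in> M"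
 shows "sum f A \<in> M"
 using assms(2) by (induction A rule: infinite_finite_induct) (auto intro: kmoduleD[OF assms(1)])

lemma kmodule_neg:
 assumes "kmodule K M" "real_subring K" "x \<in> M" shows "- x \<in> M"
 using kmoduleD(3)[OF assms(1) _ assms(3), of "-1"] real_subringD[OF assms(2)] by simp

lemma kmodule_diff:
 assumes "kmodule K M" "real_subring K" "x \<in> M" "y \<in> M" shows "x - y \<in> M"
 using kmoduleD(2)[OF assms(1,3) kmodule_neg[OF assms(1,2,4)]] by simp

lemma kmodule_span: "kmodule K (span S)"
 by (auto simp: kmodule_def span_0 span_add span_scale)

lemma kmodule_vimage:
 assumes "linear f" "kmodule K M" shows "kmodule K (f -` M)"
 using assms by (auto simp: kmodule_def linear_0 linear_add linear_scale)

lemma kmodule_Int: "kmodule K M \<Longrightarrow> kmodule K M' \<Longrightarrow> kmodule K (M \<inter> M')"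
 by (auto simp: kmodule_def)

lemma kmodule_image:
 assumes "linear f" "kmodule K M" shows "kmodule K (f ` M)"
 unfolding kmodule_def
proof (intro conjI ballI)
 show "0 \<in> f ` M" using imageI[OF kmoduleD(1)[OF assms(2)], of f] linear_0[OF assms(1)] by simp
 show "x + y \<in> f ` M" if "x \<in> f ` M" "y \<in> f ` M" for x y
  using that imageI[OF kmoduleD(2)[OF assms(2)], of _ _ f] linear_add[OF assms(1)] by (auto simp: image_iff)
 show "c *\<^sub>R x \<in> f ` M" if "c \<in> K" "x \<in> f ` M" for c x
  using that imageI[OF kmoduleD(3)[OF assms(2)], of _ _ f] linear_scale[OF assms(1)] by (auto simp: image_iff)
qed

text \<open>The workhorse for \<open>kspan\<close> and later for \<open>ext_power\<close>: a
  property of all elements is proved by checking that the elements having it form a K-submodule that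
  contains the generators.\<close>

lemma kspan_least:
 assumes "kmodule K M" "S \<subseteq> M" shows "kspan K S \<subseteq> M"
 using assms(2) by (auto simp: kspan_def intro!: kmodule_sum[OF assms(1)] kmoduleD(3)[OF assms(1)])

lemma kspan_superset:
 assumes "1 \<in> K" shows "S \<subseteq> kspan K S"
proof
 fix s assume "s \<in> S"
 then show "s \<in> kspan K S"
  unfolding kspan_def using assms by (intro CollectI exI[of _ "{s}"] exI[of _ "\<lambda>_. 1"]) auto
qed

lemma kmodule_kspan:
 assumes "real_subring K" shows "kmodule K (kspan K S)"
 unfolding kmodule_def
proof (intro conjI ballI)
 show "0 \<in> kspan K S"
  unfolding kspan_def by (intro CollectI exI[of _ "{}"]) auto
next
 fix x y assume "x \<in> kspan K S" "y \<in> kspan K S"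
 then obtain T c T' c' where
  x: "x = (\<Sum>s\<in>T. c s *\<^sub>R s)" "finite T" "T \<subseteq> S" "c ` T \<subseteq> K" and
  y: "y = (\<Sum>s\<in>T'. c' s *\<^sub>R s)" "finite T'" "T' \<subseteq> S" "c' ` T' \<subseteq> K"
  unfolding kspan_def by blast
 define a where "a s = (if s \<in> T then c s else 0) + (if s \<in> T' then c' s else 0)" for s
 have "x + y = (\<Sum>s\<in>T \<union> T'. a s *\<^sub>R s)"
 proof -
  have "x = (\<Sum>s\<in>T \<union> T'. (if s \<in> T then c s else 0) *\<^sub>R s)"
   unfolding x(1) using x(2) y(2) by (intro sum.mono_neutral_cong_left) auto
  moreover have "y = (\<Sum>s\<in>T \<union> T'. (if s \<in> T' then c' s else 0) *\<^sub>R s)"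
   unfolding y(1) using x(2) y(2) by (intro sum.mono_neutral_cong_left) auto
  ultimately show ?thesis by (simp add: a_def scaleR_add_left sum.distrib)
 qed
 moreover have "a ` (T \<union> T') \<subseteq> K"
  using x(4) y(4) real_subringD(2,4)[OF assms] by (auto simp: a_def image_subset_iff)
 ultimately show "x + y \<in> kspan K S"
  unfolding kspan_def using x(2,3) y(2,3) by (intro CollectI exI[of _ "T \<union> T'"] exI[of _ a]) auto
next
 fix k x assume k: "k \<in> K" and "x \<in> kspan K S"
 then obtain T c where x: "x = (\<Sum>s\<in>T. c s *\<^sub>R s)" "finite T" "T \<subseteq> S" "c ` T \<subseteq> K"
  unfolding kspan_def by blast
 then show "k *\<^sub>R x \<in> kspan K S"
  unfolding kspan_def using real_subringD(6)[OF assms k]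
  by (intro CollectI exI[of _ T] exI[of _ "\<lambda>s. k * c s"]) (auto simp: scaleR_sum_right)
qed

lemma kspan_mono:
 assumes "real_subring K" "S \<subseteq> kspan K T" shows "kspan K S \<subseteq> kspan K T"
 using kspan_least[OF kmodule_kspan[OF assms(1)] assms(2)] .

lemma kspan_subset_span: "kspan K S \<subseteq> span S"
 by (rule kspan_least[OF kmodule_span]) (auto simp: span_base)

lemma kspan_mono_ring: "K \<subseteq> K' \<Longrightarrow> kspan K S \<subseteq> kspan K' S"
 unfolding kspan_def by blast

lemma kspan_induct [consumes 2, case_names base zero add scale]:
 assumes "real_subring K" "x \<in> kspan K S"
  and "\<And>s. s \<in> S \<Longrightarrow> P s" "P 0" "\<And>x y. P x \<Longrightarrow> P y \<Longrightarrow> P (x + y)" "\<And>c x. c \<in> K \<Longrightarrow> P x \<Longrightarrow> P (c *\<^sub>R x)"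
 shows "P x"
proof -
 have "kmodule K (Collect P)" using assms(4-6) by (auto simp: kmodule_def)
 from kspan_least[OF this] assms(2,3) show ?thesis by blast
qed

lemma image_kspan:
 assumes "real_subring K" "linear f" shows "f ` kspan K S = kspan K (f ` S)"
proof
 have "kspan K S \<subseteq> f -` kspan K (f ` S)"
  using kspan_superset[OF real_subringD(1)[OF assms(1)], of "f ` S"]
  by (intro kspan_least kmodule_vimage assms kmodule_kspan) auto
 then show "f ` kspan K S \<subseteq> kspan K (f ` S)" by blast
 show "kspan K (f ` S) \<subseteq> f ` kspan K S"
  using kspan_superset[OF real_subringD(1)[OF assms(1)], of S]
  by (intro kspan_least kmodule_image assms kmodule_kspan) auto
qed

section \<open>The exterior algebra\<close>

lemma shuffle_sign_empty [simp]: "shuffle_sign {} J = 1" "shuffle_sign I {} = 1"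
 by (auto simp: shuffle_sign_def)

lemma shuffle_sign_Un_left:
 fixes I I' J :: "'i::{finite,linorder} set"
 assumes "I \<inter> I' = {}"
 shows "shuffle_sign (I \<union> I') J = shuffle_sign I J * shuffle_sign I' J"
proof -
 have "{(i, j). i \<in> I \<union> I' \<and> j \<in> J \<and> j < i} =
   {(i, j). i \<in> I \<and> j \<in> J \<and> j < i} \<union> {(i, j). i \<in> I' \<and> j \<in> J \<and> j < i}" by auto
 moreover have "{(i, j). i \<in> I \<and> j \<in> J \<and> j < i} \<inter> {(i, j). i \<in> I' \<and> j \<in> J \<and> j < i} = {}"
  using assms by auto
 ultimately show ?thesis
  by (simp add: shuffle_sign_def card_Un_disjoint power_add)
qed

lemma shuffle_sign_Un_right:
 fixes I J J' :: "'i::{finite,linorder} set"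
 assumes "J \<inter> J' = {}"
 shows "shuffle_sign I (J \<union> J') = shuffle_sign I J * shuffle_sign I J'"
proof -
 have "{(i, j). i \<in> I \<and> j \<in> J \<union> J' \<and> j < i} =
   {(i, j). i \<in> I \<and> j \<in> J \<and> j < i} \<union> {(i, j). i \<in> I \<and> j \<in> J' \<and> j < i}" by auto
 moreover have "{(i, j). i \<in> I \<and> j \<in> J \<and> j < i} \<inter> {(i, j). i \<in> I \<and> j \<in> J' \<and> j < i} = {}"
  using assms by auto
 ultimately show ?thesis
  by (simp add: shuffle_sign_def card_Un_disjoint power_add)
qed

lemma shuffle_sign_insert_right:
 fixes J :: "'i::{finite,linorder} set"
 assumes "k \<notin> J"
 shows "shuffle_sign I (insert k J) = shuffle_sign I {k} * shuffle_sign I J"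
 using shuffle_sign_Un_right[of "{k}" J I] assms by simp

lemma shuffle_sign_singletons:
 "shuffle_sign {i} {j} = (if j < i then - 1 else 1)"
proof -
 have "{(a, b). a \<in> {i} \<and> b \<in> {j} \<and> b < a} = (if j < i then {(i, j)} else {})" by auto
 then show ?thesis by (simp add: shuffle_sign_def)
qed

lemma shuffle_sign_square [simp]: "shuffle_sign I J * shuffle_sign I J = 1"
 by (simp add: shuffle_sign_def flip: power_mult_distrib)

lemma ext_mult_add_left: "(x + y) \<^bold>\<and> z = x \<^bold>\<and> z + y \<^bold>\<and> z"
 and ext_mult_add_right: "z \<^bold>\<and> (x + y) = z \<^bold>\<and> x + z \<^bold>\<and> y"
 and ext_mult_scale_left: "(c *\<^sub>R x) \<^bold>\<and> z = c *\<^sub>R (x \<^bold>\<and> z)"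
 and ext_mult_scale_right: "z \<^bold>\<and> (c *\<^sub>R x) = c *\<^sub>R (z \<^bold>\<and> x)"
 by (auto simp: ext_mult_def vec_eq_iff algebra_simps sum.distrib sum_distrib_left)

lemma linear_ext_mult_left: "linear (\<lambda>x. x \<^bold>\<and> z)"
 by (rule linearI) (simp_all add: ext_mult_add_left ext_mult_scale_left)

lemma linear_ext_mult_right: "linear (\<lambda>x. z \<^bold>\<and> x)"
 by (rule linearI) (simp_all add: ext_mult_add_right ext_mult_scale_right)

lemma ext_mult_zero [simp]: "0 \<^bold>\<and> z = 0" "z \<^bold>\<and> 0 = 0"
 using linear_0[OF linear_ext_mult_left] linear_0[OF linear_ext_mult_right] by auto

lemma ext_mult_minus: "(- x) \<^bold>\<and> z = - (x \<^bold>\<and> z)" "z \<^bold>\<and> (- x) = - (z \<^bold>\<and> x)"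
 using linear_neg[OF linear_ext_mult_left] linear_neg[OF linear_ext_mult_right] by auto

lemma ext_mult_diff: "(x - y) \<^bold>\<and> z = x \<^bold>\<and> z - y \<^bold>\<and> z" "z \<^bold>\<and> (x - y) = z \<^bold>\<and> x - z \<^bold>\<and> y"
 using linear_diff[OF linear_ext_mult_left] linear_diff[OF linear_ext_mult_right] by auto

lemma ext_vec_add: "ext_vec (v + w) = ext_vec v + ext_vec w"
 and ext_vec_scale: "ext_vec (c *\<^sub>R v) = c *\<^sub>R ext_vec v"
 by (auto simp: ext_vec_def vec_eq_iff sum.distrib sum_distrib_left)

lemma linear_ext_vec: "linear ext_vec"
 by (rule linearI) (simp_all add: ext_vec_add ext_vec_scale)

lemma ext_vec_zero [simp]: "ext_vec 0 = 0"
 using linear_0[OF linear_ext_vec] .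

lemma linear_ext_vec_mult: "linear (\<lambda>v. ext_vec v \<^bold>\<and> x)"
 using linear_compose[OF linear_ext_vec linear_ext_mult_left] by (simp add: o_def)

text \<open>Both coefficients at L are sums over ordered partitions of L into three sets; (M, I)
  \<mapsto> (I, M - I) matches the two ways of nesting. The signs agree because counting inversions
  is additive over disjoint unions in either argument.\<close>

lemma ext_mult_assoc: "(x \<^bold>\<and> y) \<^bold>\<and> z = x \<^bold>\<and> (y \<^bold>\<and> z)"
proof (rule vec_eq_iff[THEN iffD2], rule allI)
 fix L :: "'a set"
 have "((x \<^bold>\<and> y) \<^bold>\<and> z) $ L = (\<Sum>M\<in>Pow L. \<Sum>I\<in>Pow M.
   shuffle_sign M (L - M) * shuffle_sign I (M - I) * x $ I * y $ (M - I) * z $ (L - M))"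
  by (simp add: ext_mult_def sum_distrib_left sum_distrib_right mult_ac)
 also have "\<dots> = (\<Sum>(M, I)\<in>Sigma (Pow L) Pow.
   shuffle_sign M (L - M) * shuffle_sign I (M - I) * x $ I * y $ (M - I) * z $ (L - M))"
  by (simp add: sum.Sigma)
 also have "\<dots> = (\<Sum>(I, J)\<in>Sigma (Pow L) (\<lambda>I. Pow (L - I)).
   shuffle_sign I (L - I) * shuffle_sign J (L - I - J) * x $ I * y $ J * z $ (L - I - J))"
 proof (rule sum.reindex_bij_witness[where i = "\<lambda>(I, J). (I \<union> J, I)" and j = "\<lambda>(M, I). (I, M - I)"])
  fix a assume "a \<in> Sigma (Pow L) Pow"
  then obtain M I where a: "a = (M, I)" "I \<subseteq> M" "M \<subseteq> L" by auto
  have 1: "shuffle_sign M (L - M) = shuffle_sign I (L - M) * shuffle_sign (M - I) (L - M)"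
   using shuffle_sign_Un_left[of I "M - I" "L - M"] a by (simp add: Un_absorb1)
  have "M - I \<union> (L - M) = L - I" using a by auto
  then have 2: "shuffle_sign I (L - I) = shuffle_sign I (M - I) * shuffle_sign I (L - M)"
   using shuffle_sign_Un_right[of "M - I" "L - M" I] by auto
  have 3: "L - I - (M - I) = L - M" using a by auto
  show "(case case a of (M, I) \<Rightarrow> (I, M - I) of (I, J) \<Rightarrow>
    shuffle_sign I (L - I) * shuffle_sign J (L - I - J) * x $ I * y $ J * z $ (L - I - J)) =
   (case a of (M, I) \<Rightarrow> shuffle_sign M (L - M) * shuffle_sign I (M - I) * x $ I * y $ (M - I) * z $ (L - M))"
   by (simp add: a 1 2 3)
 qed auto
 also have "\<dots> = (x \<^bold>\<and> (y \<^bold>\<and> z)) $ L"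
  by (simp add: ext_mult_def sum_distrib_left sum_distrib_right mult_ac sum.Sigma)
 finally show "((x \<^bold>\<and> y) \<^bold>\<and> z) $ L = (x \<^bold>\<and> (y \<^bold>\<and> z)) $ L" .
qed

lemma ext_one_mult [simp]: "ext_one \<^bold>\<and> x = x"
proof (rule vec_eq_iff[THEN iffD2], rule allI)
 fix L :: "'a set"
 have "(ext_one \<^bold>\<and> x) $ L = (\<Sum>I\<in>{{}}. shuffle_sign I (L - I) * ext_one $ I * x $ (L - I))"
  unfolding ext_mult_def vec_lambda_beta
  by (rule sum.mono_neutral_right) (auto simp: ext_one_def axis_def)
 then show "(ext_one \<^bold>\<and> x) $ L = x $ L" by (simp add: ext_one_def axis_def)
qed

lemma mult_ext_one [simp]: "x \<^bold>\<and> ext_one = x"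
proof (rule vec_eq_iff[THEN iffD2], rule allI)
 fix L :: "'a set"
 have "(x \<^bold>\<and> ext_one) $ L = (\<Sum>I\<in>{L}. shuffle_sign I (L - I) * x $ I * ext_one $ (L - I))"
  unfolding ext_mult_def vec_lambda_beta
  by (rule sum.mono_neutral_right) (auto simp: ext_one_def axis_def)
 then show "(x \<^bold>\<and> ext_one) $ L = x $ L" by (simp add: ext_one_def axis_def)
qed

lemma ext_vec_mult_nth:
 "(ext_vec v \<^bold>\<and> y) $ L = (\<Sum>i\<in>L. shuffle_sign {i} (L - {i}) * v $ i * y $ (L - {i}))"
proof -
 have nth: "ext_vec v $ {i} = v $ i" for i
 proof -
  have "{j. {i} = {j}} = {i}" by auto
  then show ?thesis by (simp add: ext_vec_def)
 qed
 have "(ext_vec v \<^bold>\<and> y) $ L = (\<Sum>I\<in>(\<lambda>i. {i}) ` L. shuffle_sign I (L - I) * ext_vec v $ I * y $ (L - I))"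
  unfolding ext_mult_def vec_lambda_beta
 proof (rule sum.mono_neutral_right)
  show "\<forall>I\<in>Pow L - (\<lambda>i. {i}) ` L. shuffle_sign I (L - I) * ext_vec v $ I * y $ (L - I) = 0"
  proof
   fix I assume I: "I \<in> Pow L - (\<lambda>i. {i}) ` L"
   then have "{i. I = {i}} = {}" by auto
   then show "shuffle_sign I (L - I) * ext_vec v $ I * y $ (L - I) = 0"
    by (simp add: ext_vec_def)
  qed
 qed auto
 also have "\<dots> = (\<Sum>i\<in>L. shuffle_sign {i} (L - {i}) * ext_vec v $ {i} * y $ (L - {i}))"
  by (simp add: sum.reindex inj_on_def)
 finally show ?thesis by (simp add: nth)
qed

lemma ext_vec_axis_mult:
 "ext_vec (axis i 1) \<^bold>\<and> axis J 1 = (if i \<in> J then 0 else shuffle_sign {i} J *\<^sub>R axis (insert i J) 1)"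
proof (rule vec_eq_iff[THEN iffD2], rule allI)
 fix L :: "'a set"
 have "(ext_vec (axis i 1) \<^bold>\<and> axis J 1) $ L =
   (\<Sum>k\<in>L. if k = i then shuffle_sign {i} (L - {i}) * axis J 1 $ (L - {i}) else 0)"
  unfolding ext_vec_mult_nth by (rule sum.cong) (auto simp: axis_def)
 also have "\<dots> = (if i \<in> L then shuffle_sign {i} (L - {i}) * axis J 1 $ (L - {i}) else 0)"
  by simp
 also have "\<dots> = (if i \<in> J then 0 else shuffle_sign {i} J *\<^sub>R axis (insert i J) 1) $ L"
 proof (cases "i \<in> J")
  case True
  then have "J \<noteq> L - {i}" by auto
  with True show ?thesis by (simp add: axis_def)
 next
  case False
  then have "i \<in> L \<and> J = L - {i} \<longleftrightarrow> insert i J = L" by auto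
  then show ?thesis using False by (auto simp: axis_def)
 qed
 finally show "(ext_vec (axis i 1) \<^bold>\<and> axis J 1) $ L =
   (if i \<in> J then 0 else shuffle_sign {i} J *\<^sub>R axis (insert i J) 1) $ L" .
qed

text \<open>The cancellation in pairs behind every vanishing double boundary below. The sum equals
  its own negative as a whole, so diagonal pairs need no separate treatment.\<close>

lemma sum_swap_antisymmetric:
 fixes f :: "'a \<times> 'a \<Rightarrow> 'v::real_vector"
 assumes "\<And>a b. (a, b) \<in> P \<Longrightarrow> (b, a) \<in> P \<and> f (b, a) = - f (a, b)"
 shows "sum f P = 0"
proof -
 have P: "prod.swap x \<in> P \<and> - f (prod.swap x) = f x" if "x \<in> P" for x
 proof -
  have "(fst x, snd x) \<in> P" using that by simp
  from assms[OF this] show ?thesis by (simp add: prod.swap_def)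
 qed
 have "sum f P = (\<Sum>x\<in>P. - f x)"
  by (rule sum.reindex_bij_witness[where i = prod.swap and j = prod.swap])
   (use P in \<open>simp_all only: swap_swap\<close>)
 then have "sum f P = - sum f P" by (simp add: sum_negf)
 then have "2 *\<^sub>R sum f P = 0" by (simp add: scaleR_2 eq_neg_iff_add_eq_0)
 then show ?thesis by simp
qed

text \<open>The coefficient at L runs over ordered pairs (i, j) of distinct elements with L = {i,
  j}; exchanging them flips \<open>shuffle_sign {i} {j}\<close>.\<close>

lemma ext_vec_square_zero: "ext_vec v \<^bold>\<and> ext_vec v = 0"
proof (rule vec_eq_iff[THEN iffD2], rule allI)
 fix L :: "'a set"
 let ?f = "\<lambda>(i, j). shuffle_sign {i} {j} * v $ i * v $ j"
 let ?P = "Sigma L (\<lambda>i. {j. L - {i} = {j}})"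
 have "(ext_vec v \<^bold>\<and> ext_vec v) $ L = (\<Sum>i\<in>L. \<Sum>j\<in>{j. L - {i} = {j}}. shuffle_sign {i} {j} * v $ i * v $ j)"
  unfolding ext_vec_mult_nth
  by (rule sum.cong) (auto simp: ext_vec_def sum_distrib_left intro!: sum.cong)
 also have "\<dots> = sum ?f ?P" by (simp add: sum.Sigma)
 finally have 1: "(ext_vec v \<^bold>\<and> ext_vec v) $ L = sum ?f ?P" .
 have P: "prod.swap a \<in> ?P \<and> - ?f (prod.swap a) = ?f a" if a: "a \<in> ?P" for a
 proof -
  obtain i j where ij: "a = (i, j)" "i \<in> L" "L - {i} = {j}" using a by auto
  then have ne: "i \<noteq> j" "j \<in> L" by auto
  have "L - {j} = {i}" using ij(2,3) ne by blast
  then have "prod.swap a \<in> ?P" unfolding ij(1) using ne(2) by simp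
  moreover have "- ?f (prod.swap a) = ?f a"
   unfolding ij(1) using ne(1) by (auto simp: shuffle_sign_singletons)
  ultimately show ?thesis ..
 qed
 have "sum ?f ?P = (\<Sum>a\<in>?P. - ?f a)"
  by (rule sum.reindex_bij_witness[where i = prod.swap and j = prod.swap])
   (use P in \<open>simp_all only: swap_swap\<close>)
 then have "sum ?f ?P = - sum ?f ?P" by (simp add: sum_negf)
 then show "(ext_vec v \<^bold>\<and> ext_vec v) $ L = 0 $ L" using 1 by simp
qed

lemma ext_vec_twice [simp]: "ext_vec v \<^bold>\<and> (ext_vec v \<^bold>\<and> x) = 0"
 by (simp add: ext_vec_square_zero flip: ext_mult_assoc)

lemma ext_vec_anticommute: "ext_vec v \<^bold>\<and> (ext_vec w \<^bold>\<and> x) = - (ext_vec w \<^bold>\<and> (ext_vec v \<^bold>\<and> x))"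
proof -
 have "ext_vec (v + w) \<^bold>\<and> (ext_vec (v + w) \<^bold>\<and> x) = 0" by simp
 then have "ext_vec v \<^bold>\<and> (ext_vec w \<^bold>\<and> x) + ext_vec w \<^bold>\<and> (ext_vec v \<^bold>\<and> x) = 0"
  by (simp only: ext_vec_add ext_mult_add_left ext_mult_add_right ext_vec_twice)
   (simp add: add.commute)
 then show ?thesis by (simp add: eq_neg_iff_add_eq_0)
qed

lemma wedge_Nil [simp]: "wedge [] = ext_one"
 and wedge_Cons [simp]: "wedge (v # vs) = ext_vec v \<^bold>\<and> wedge vs"
 by (simp_all add: wedge_def)

lemma wedge_append: "wedge (us @ vs) = wedge us \<^bold>\<and> wedge vs"
 by (induction us) (simp_all add: ext_mult_assoc)

lemma sorted_list_of_set_Min: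
 fixes I :: "'i::linorder set"
 assumes "finite I" "\<And>j. j \<in> I \<Longrightarrow> i < j"
 shows "sorted_list_of_set (insert i I) = i # sorted_list_of_set I"
proof -
 have "sorted_list_of_set (insert i I) = insort i (sorted_list_of_set I)"
  using assms by (intro sorted_list_of_set_insert) auto
 also have "\<dots> = i # sorted_list_of_set I"
  using assms by (intro insort_is_Cons) (auto intro: less_imp_le)
 finally show ?thesis .
qed

text \<open>Moving the new factor to its sorted place costs one sign for each smaller index, which
  is what \<open>shuffle_sign {i} I\<close> counts. The family g is arbitrary so that the rule
  serves both the standard basis and its image under a linear map.\<close>

lemma ext_vec_mult_sorted_wedge:
 fixes I :: "'n::{finite,linorder} set"
 shows "ext_vec (g i) \<^bold>\<and> wedge (map g (sorted_list_of_set I)) =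
  (if i \<in> I then 0 else shuffle_sign {i} I *\<^sub>R wedge (map g (sorted_list_of_set (insert i I))))"
proof (induction "card I" arbitrary: I)
 case 0
 then show ?case by simp
next
 case (Suc k)
 define m where "m = Min I"
 define J where "J = I - {m}"
 have "I \<noteq> {}" using Suc by auto
 then have m: "m \<in> I" and le: "\<And>j. j \<in> I \<Longrightarrow> m \<le> j" by (simp_all add: m_def)
 have J: "I = insert m J" "m \<notin> J" "card J = k" using m Suc by (auto simp: J_def)
 have lt: "m < j" if "j \<in> J" for j using that le[of j] by (auto simp: J_def less_le)
 have sI: "sorted_list_of_set I = m # sorted_list_of_set J"
  unfolding J(1) by (rule sorted_list_of_set_Min) (auto simp: lt)
 consider "i < m" | "i = m" | "m < i" by force
 then show ?case
 proof cases
  case 1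
  then have lt': "i < j" if "j \<in> I" for j using le[OF that] by simp
  then have "i \<notin> I" by auto
  have "{(a, b). a \<in> {i} \<and> b \<in> I \<and> b < a} = {}" using lt' by force
  then have "shuffle_sign {i} I = 1" unfolding shuffle_sign_def by (simp only: card.empty power_0)
  moreover have "sorted_list_of_set (insert i I) = i # sorted_list_of_set I"
   by (rule sorted_list_of_set_Min) (auto simp: lt')
  ultimately show ?thesis using \<open>i \<notin> I\<close> by simp
 next
  case 2
  then show ?thesis using m sI by simp
 next
  case 3
  have "ext_vec (g i) \<^bold>\<and> wedge (map g (sorted_list_of_set I)) =
    - (ext_vec (g m) \<^bold>\<and> (ext_vec (g i) \<^bold>\<and> wedge (map g (sorted_list_of_set J))))"
   unfolding sI by (simp add: ext_vec_anticommute[of "g i"])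
  also have "\<dots> = (if i \<in> I then 0 else shuffle_sign {i} I *\<^sub>R wedge (map g (sorted_list_of_set (insert i I))))"
  proof (cases "i \<in> J")
   case True
   then show ?thesis using Suc.hyps(1)[OF J(3)[symmetric]] J by simp
  next
   case False
   have "sorted_list_of_set (insert m (insert i J)) = m # sorted_list_of_set (insert i J)"
    by (rule sorted_list_of_set_Min) (use lt 3 in auto)
   moreover have "insert m (insert i J) = insert i I" using J by auto
   moreover have "shuffle_sign {i} I = - shuffle_sign {i} J"
    unfolding J(1) using J(2) 3 by (simp add: shuffle_sign_insert_right shuffle_sign_singletons)
   ultimately show ?thesis
    using Suc.hyps(1)[OF J(3)[symmetric]] J False 3
    by (auto simp: ext_mult_scale_right)
  qed
  finally show ?thesis .
 qed
qed

text \<open>Connects the coordinate description of the exterior algebra with products of vectors; it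
  makes linear maps comparable on wedges only (\<open>ext_linear_eqI\<close>).\<close>

lemma axis_eq_wedge: "axis I 1 = wedge (map (\<lambda>i. axis i 1) (sorted_list_of_set I))"
 for I :: "'n::{finite,linorder} set"
proof (induction "card I" arbitrary: I)
 case 0
 then show ?case by (simp add: ext_one_def)
next
 case (Suc k)
 then obtain i J where I: "I = insert i J" "i \<notin> J" "card J = k"
  by (metis card_Suc_eq)
 have "shuffle_sign {i} J *\<^sub>R axis I 1 = ext_vec (axis i 1) \<^bold>\<and> axis J 1"
  using I by (simp add: ext_vec_axis_mult)
 also have "\<dots> = shuffle_sign {i} J *\<^sub>R wedge (map (\<lambda>i. axis i 1) (sorted_list_of_set I))"
  using ext_vec_mult_sorted_wedge[of "\<lambda>i. axis i 1" i J] I Suc.hyps(1)[of J] by simp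
 finally show ?case
  by (auto simp: shuffle_sign_def)
qed

lemma vec_axis_linear_eqI:
 fixes f g :: "(real, 'i::finite) vec \<Rightarrow> 'b::real_vector"
 assumes "linear f" "linear g" "\<And>i. f (axis i 1) = g (axis i 1)"
 shows "f x = g x"
proof -
 have x: "x = (\<Sum>i\<in>UNIV. x $ i *\<^sub>R axis i 1)"
  by (simp add: vec_eq_iff axis_def sum.delta' if_distrib cong: if_cong)
 show ?thesis
  by (subst (1 2) x)
   (simp add: linear_sum[OF assms(1)] linear_sum[OF assms(2)] linear_scale[OF assms(1)]
    linear_scale[OF assms(2)] assms(3))
qed

lemma ext_linear_eqI:
 fixes f g :: "'n::{finite,linorder} ext \<Rightarrow> 'b::real_vector"
 assumes "linear f" "linear g" "\<And>vs. f (wedge vs) = g (wedge vs)"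
 shows "f x = g x"
 by (rule vec_axis_linear_eqI[OF assms(1,2)]) (simp add: axis_eq_wedge assms(3))

lemma linear_ext_map: "linear (ext_map f)"
 by (rule linearI)
  (simp_all add: ext_map_def scaleR_add_left sum.distrib scaleR_sum_right)

lemmas ext_map_linear = linear_0[OF linear_ext_map] linear_add[OF linear_ext_map] linear_diff[OF linear_ext_map]
 linear_neg[OF linear_ext_map] linear_scale[OF linear_ext_map] linear_sum[OF linear_ext_map]

lemma ext_map_axis: "ext_map f (axis I 1) = wedge (map (\<lambda>i. f (axis i 1)) (sorted_list_of_set I))"
proof -
 have "ext_map f (axis I 1) =
   (\<Sum>J\<in>UNIV. if J = I then wedge (map (\<lambda>i. f (axis i 1)) (sorted_list_of_set J)) else 0)"
  unfolding ext_map_def by (rule sum.cong) (auto simp: axis_def)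
 then show ?thesis by simp
qed

text \<open>Both sides are linear in v and in x, so basis elements suffice; there the product of
  axes and the sorting rule for their images produce the same sign.\<close>

lemma ext_map_mult:
 assumes "linear f"
 shows "ext_map f (ext_vec v \<^bold>\<and> x) = ext_vec (f v) \<^bold>\<and> ext_map f x"
proof (rule vec_axis_linear_eqI[of "\<lambda>v. ext_map f (ext_vec v \<^bold>\<and> x)" "\<lambda>v. ext_vec (f v) \<^bold>\<and> ext_map f x"])
 show "linear (\<lambda>v. ext_map f (ext_vec v \<^bold>\<and> x))"
  using linear_compose[OF linear_ext_vec_mult linear_ext_map] by (simp add: o_def)
 show "linear (\<lambda>v. ext_vec (f v) \<^bold>\<and> ext_map f x)"
  using linear_compose[OF assms linear_ext_vec_mult] by (simp add: o_def)
 fix i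
 show "ext_map f (ext_vec (axis i 1) \<^bold>\<and> x) = ext_vec (f (axis i 1)) \<^bold>\<and> ext_map f x"
 proof (rule vec_axis_linear_eqI[of "\<lambda>x. ext_map f (ext_vec (axis i 1) \<^bold>\<and> x)"
    "\<lambda>x. ext_vec (f (axis i 1)) \<^bold>\<and> ext_map f x"])
  show "linear (\<lambda>x. ext_map f (ext_vec (axis i 1) \<^bold>\<and> x))"
   using linear_compose[OF linear_ext_mult_right linear_ext_map] by (simp add: o_def)
  show "linear (\<lambda>x. ext_vec (f (axis i 1)) \<^bold>\<and> ext_map f x)"
   using linear_compose[OF linear_ext_map linear_ext_mult_right] by (simp add: o_def)
  fix J
  show "ext_map f (ext_vec (axis i 1) \<^bold>\<and> axis J 1) = ext_vec (f (axis i 1)) \<^bold>\<and> ext_map f (axis J 1)"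
   unfolding ext_vec_axis_mult ext_map_axis
   using ext_vec_mult_sorted_wedge[of "\<lambda>i. f (axis i 1)" i J]
   by (auto simp: ext_map_linear ext_map_axis)
 qed
qed

lemma ext_map_one [simp]: "ext_map f ext_one = ext_one"
 using ext_map_axis[of f "{}"] by (simp flip: ext_one_def)

lemma ext_map_wedge:
 assumes "linear f"
 shows "ext_map f (wedge vs) = wedge (map f vs)"
 by (induction vs) (simp_all add: ext_map_mult[OF assms])

lemma ext_map_comp:
 assumes "linear f" "linear g"
 shows "ext_map f (ext_map g x) = ext_map (\<lambda>v. f (g v)) x"
proof (rule ext_linear_eqI[of "\<lambda>x. ext_map f (ext_map g x)" "ext_map (\<lambda>v. f (g v))"])
 have "linear (\<lambda>v. f (g v))" using linear_compose[OF assms(2,1)] by (simp add: o_def)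
 then show "ext_map f (ext_map g (wedge vs)) = ext_map (\<lambda>v. f (g v)) (wedge vs)" for vs
  by (simp add: ext_map_wedge assms o_def)
 show "linear (\<lambda>x. ext_map f (ext_map g x))"
  using linear_compose[OF linear_ext_map linear_ext_map] by (simp add: o_def)
qed (rule linear_ext_map)

lemma ext_map_id [simp]: "ext_map (\<lambda>v. v) x = x"
 by (rule vec_axis_linear_eqI[of _ "\<lambda>x. x"]) (auto simp: linear_ext_map ext_map_axis linear_ident simp flip: axis_eq_wedge)

lemma wedge_mem_zero:
 assumes "v \<in> set vs" shows "ext_vec v \<^bold>\<and> wedge vs = 0"
 using assms
proof (induction vs)
 case (Cons w vs)
 then show ?case by (auto simp: ext_vec_anticommute[of v w])
qed simp

lemma wedge_span_zero:
 assumes "v \<in> span (set vs)" shows "ext_vec v \<^bold>\<and> wedge vs = 0"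
proof -
 have "subspace {v. ext_vec v \<^bold>\<and> wedge vs = 0}"
  by (auto simp: subspace_def ext_vec_add ext_vec_scale ext_mult_add_left ext_mult_scale_left)
 from span_minimal[OF _ this, of "set vs"] assms show ?thesis
  using wedge_mem_zero by blast
qed

lemma wedge_nonzero_imp:
 assumes "wedge vs \<noteq> 0" shows "distinct vs \<and> independent (set vs)"
 using assms
proof (induction vs)
 case (Cons v vs)
 then have "wedge vs \<noteq> 0" "v \<notin> span (set vs)" using wedge_span_zero[of v vs] by auto
 with Cons show ?case by (auto simp: independent_insert span_base)
qed (simp add: independent_empty)

lemma wedge_dim_zero:
 assumes "set vs \<subseteq> S" "dim S < length vs" shows "wedge vs = 0"
proof (rule ccontr)
 assume "wedge vs \<noteq> 0"
 then have "distinct vs" "independent (set vs)" using wedge_nonzero_imp by auto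
 then have "length vs \<le> dim S"
  using independent_card_le_dim[OF assms(1)] by (simp add: distinct_card)
 with assms(2) show False by simp
qed

lemma wedge_axes_nonzero:
 fixes ks :: "'n::{finite,linorder} list"
 assumes "distinct ks" shows "wedge (map (\<lambda>i. axis i 1) ks) \<noteq> 0"
proof -
 have "\<exists>s. s \<noteq> 0 \<and> wedge (map (\<lambda>i. axis i 1::'n rvec) ks) = s *\<^sub>R axis (set ks) 1"
  using assms
 proof (induction ks)
  case Nil
  then show ?case by (intro exI[of _ 1]) (simp add: ext_one_def)
 next
  case (Cons i ks)
  then obtain s where s: "s \<noteq> 0" "wedge (map (\<lambda>i. axis i 1::'n rvec) ks) = s *\<^sub>R axis (set ks) 1"
   by auto
  then show ?case using Cons.prems
   by (intro exI[of _ "s * shuffle_sign {i} (set ks)"])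
    (simp add: ext_mult_scale_right ext_vec_axis_mult shuffle_sign_def)
 qed
 then show ?thesis by (auto simp: axis_eq_0_iff)
qed

text \<open>The vectors can be sent by a linear map to distinct axes, of which there are enough by
  the bound on independent sets; a wedge of distinct axes is a nonzero multiple of a basis element,
  and \<open>ext_map\<close> sends 0 to 0.\<close>

lemma wedge_independent_nonzero:
 fixes vs :: "'n::{finite,linorder} rvec list"
 assumes "distinct vs" "independent (set vs)" shows "wedge vs \<noteq> 0"
proof
 assume 0: "wedge vs = 0"
 have "card (set vs) \<le> card (UNIV :: 'n set)"
  using independent_bound[OF assms(2)] by simp
 then obtain j :: "'n rvec \<Rightarrow> 'n" where j: "inj_on j (set vs)"
  by (meson card_le_inj finite finite_set)
 obtain f :: "'n rvec \<Rightarrow> 'n rvec" where f: "linear f" "\<And>v. v \<in> set vs \<Longrightarrow> f v = axis (j v) 1"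
  using linear_independent_extend[OF assms(2), of "\<lambda>v. axis (j v) 1"] by blast
 have "map f vs = map (\<lambda>i. axis i 1) (map j vs)" using f by simp
 moreover have "distinct (map j vs)" using assms(1) j by (simp add: distinct_map)
 ultimately have "wedge (map f vs) \<noteq> 0" using wedge_axes_nonzero[of "map j vs"] by metis
 moreover have "wedge (map f vs :: 'n rvec list) = 0"
  using ext_map_wedge[OF f(1), of vs] 0 ext_map_linear(1) by metis
 ultimately show False by simp
qed

text \<open>Multilinear expansion over K. The inner induction runs over the combination representing
  the wedge of the tail, and the first factor is then expanded by minimality of
  \<open>kspan\<close>.\<close>

lemma wedge_kspan:
 assumes "real_subring K" "set vs \<subseteq> kspan K S"
 shows "wedge vs \<in> kspan K {wedge ws | ws. set ws \<subseteq> S \<and> length ws = length vs}"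
 using assms(2)
proof (induction vs)
 case Nil
 then show ?case using kspan_superset[OF real_subringD(1)[OF assms(1)]] by force
next
 case (Cons v vs)
 let ?W = "\<lambda>n. {wedge ws | ws. set ws \<subseteq> S \<and> length ws = n}"
 have vs: "wedge vs \<in> kspan K (?W (length vs))" using Cons by simp
 have km: "kmodule K (kspan K (?W (length (v # vs))))" by (rule kmodule_kspan[OF assms(1)])
 have "ext_vec s \<^bold>\<and> wedge vs \<in> kspan K (?W (length (v # vs)))" if s: "s \<in> S" for s
  using assms(1) vs
 proof (induction rule: kspan_induct)
  case (base x)
  then obtain ws where ws: "x = wedge ws" "set ws \<subseteq> S" "length ws = length vs" by blast
  have "ext_vec s \<^bold>\<and> x \<in> ?W (length (v # vs))"
   using ws s by (intro CollectI exI[of _ "s # ws"]) auto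
  then show ?case by (rule subsetD[OF kspan_superset[OF real_subringD(1)[OF assms(1)]]])
 next
  case zero
  show ?case unfolding ext_mult_zero by (rule kmoduleD(1)[OF km])
 next
  case (add x y)
  then show ?case unfolding ext_mult_add_right by (rule kmoduleD(2)[OF km])
 next
  case (scale c x)
  then show ?case unfolding ext_mult_scale_right by (rule kmoduleD(3)[OF km])
 qed
 then have *: "S \<subseteq> (\<lambda>v. ext_vec v \<^bold>\<and> wedge vs) -` kspan K (?W (length (v # vs)))" by blast
 have "kspan K S \<subseteq> (\<lambda>v. ext_vec v \<^bold>\<and> wedge vs) -` kspan K (?W (length (v # vs)))"
  by (rule kspan_least[OF kmodule_vimage[OF linear_ext_vec_mult km] *])
 with Cons.prems show ?case by auto
qed

lemma wedge_permute:
 assumes "mset vs = mset ws" shows "wedge vs = wedge ws \<or> wedge vs = - wedge ws"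
 using assms
proof (induction vs arbitrary: ws)
 case (Cons v vs)
 then have "v \<in> set ws" by (metis list.set_intros(1) mset_eq_setD)
 then obtain xs ys where ws: "ws = xs @ v # ys" by (meson split_list)
 with Cons.prems have "mset vs = mset (xs @ ys)" by simp
 from Cons.IH[OF this] have 1: "wedge (v # vs) = wedge (v # xs @ ys) \<or> wedge (v # vs) = - wedge (v # xs @ ys)"
  by (auto simp: ext_mult_minus)
 have "wedge (v # zs @ ys) = wedge (zs @ v # ys) \<or> wedge (v # zs @ ys) = - wedge (zs @ v # ys)" for zs
 proof (induction zs)
  case (Cons z zs)
  have "wedge (v # (z # zs) @ ys) = - (ext_vec z \<^bold>\<and> wedge (v # zs @ ys))"
   by (simp add: ext_vec_anticommute[of v z])
  with Cons show ?case by (auto simp: ext_mult_minus)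
 qed simp
 from this[of xs] 1 show ?case unfolding ws by (elim disjE) simp_all
qed simp

text \<open>The coefficient is a determinant with entries in K, but no determinant is formed: after
  expansion, a word in ms of full length either has a zero wedge or is a permutation of ms.\<close>

lemma wedge_kspan_top:
 assumes "real_subring K" "set vs \<subseteq> kspan K (set ms)" "length vs = length ms"
 shows "\<exists>c\<in>K. wedge vs = c *\<^sub>R wedge ms"
proof -
 have K: "c \<in> K \<Longrightarrow> c' \<in> K \<Longrightarrow> c + c' \<in> K" "c \<in> K \<Longrightarrow> c' \<in> K \<Longrightarrow> c * c' \<in> K" "1 \<in> K" "-1 \<in> K" "0 \<in> K" for c c'
  using real_subringD[OF assms(1)] by auto
 have km: "kmodule K ((\<lambda>c. c *\<^sub>R wedge ms) ` K)"
 proof -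
  have "kmodule K K" using K by (auto simp: kmodule_def)
  moreover have "linear (\<lambda>c. c *\<^sub>R wedge ms)" by (rule linearI) (auto simp: algebra_simps)
  ultimately show ?thesis by (rule kmodule_image[rotated])
 qed
 have "{wedge ws | ws. set ws \<subseteq> set ms \<and> length ws = length vs} \<subseteq> (\<lambda>c. c *\<^sub>R wedge ms) ` K"
 proof clarify
  fix ws assume ws: "set ws \<subseteq> set ms" "length ws = length vs"
  show "wedge ws \<in> (\<lambda>c. c *\<^sub>R wedge ms) ` K"
  proof (cases "wedge ws = 0")
   case True
   then have "wedge ws = 0 *\<^sub>R wedge ms" by simp
   then show ?thesis using K(5) by (rule image_eqI)
  next
   case False
   then have d: "distinct ws" using wedge_nonzero_imp by blast
   \<comment> \<open>A nonzero wedge has distinct factors; having full length inside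
     \<open>set ms\<close>, they exhaust it, and ms must be distinct too.\<close>
   then have "card (set ws) = length ms" using ws assms(3) by (simp add: distinct_card)
   then have "card (set ms) = length ms" "set ws = set ms"
    using ws(1) card_length[of ms] card_mono[OF finite_set ws(1)] card_subset_eq[OF finite_set ws(1)]
    by auto
   then have "mset ws = mset ms"
    using set_eq_iff_mset_eq_distinct[OF d card_distinct] by blast
   from wedge_permute[OF this] have "wedge ws = 1 *\<^sub>R wedge ms \<or> wedge ws = (-1) *\<^sub>R wedge ms"
    by simp
   then show ?thesis using K(3,4) by blast
  qed
 qed
 from kspan_least[OF km this] wedge_kspan[OF assms(1,2)] show ?thesis by auto
qed

lemma wedge_nth_card:
 "length vs \<noteq> card I \<Longrightarrow> wedge vs $ I = 0"
proof (induction vs arbitrary: I)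
 case Nil
 then show ?case by (auto simp: ext_one_def axis_def)
next
 case (Cons v vs)
 have "wedge vs $ (I - {i}) = 0" if "i \<in> I" for i
 proof (rule Cons.IH)
  have "card I = Suc (card (I - {i}))" using that by (intro card.remove) auto
  with Cons.prems show "length vs \<noteq> card (I - {i})" unfolding list.size by linarith
 qed
 then show ?case by (simp add: ext_vec_mult_nth)
qed

section \<open>Contraction and shuffle products\<close>

text \<open>The interior product by g for the inner product in which the basis elements are
  orthonormal. As an adjoint it is linear at once, and its values are found by pairing.\<close>

definition ext_cut :: "'n::{finite,linorder} rvec \<Rightarrow> 'n ext \<Rightarrow> 'n ext" where
 "ext_cut g = adjoint (\<lambda>x. ext_vec g \<^bold>\<and> x)"

lemma linear_cut: "linear (ext_cut g)"
 unfolding ext_cut_def by (rule adjoint_linear[OF linear_ext_mult_right])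

lemma inner_cut: "x \<bullet> ext_cut g y = (ext_vec g \<^bold>\<and> x) \<bullet> y"
 unfolding ext_cut_def by (rule adjoint_works[OF linear_ext_mult_right])

lemma linear_cut_left: "linear (\<lambda>g. ext_cut g y)"
proof (rule linearI)
 show "ext_cut (g + h) y = ext_cut g y + ext_cut h y" for g h
  by (rule vector_eq_ldot[THEN iffD1])
   (simp add: inner_cut inner_add_right ext_vec_add ext_mult_add_left inner_add_left)
 show "ext_cut (c *\<^sub>R g) y = c *\<^sub>R ext_cut g y" for c g
  by (rule vector_eq_ldot[THEN iffD1])
   (simp add: inner_cut ext_vec_scale ext_mult_scale_left)
qed

lemma cut_axis:
 "ext_cut (axis i 1) (axis I 1) = (if i \<in> I then shuffle_sign {i} (I - {i}) *\<^sub>R axis (I - {i}) 1 else 0)"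
proof (rule vec_eq_iff[THEN iffD2], rule allI)
 fix L :: "'a set"
 have "ext_cut (axis i 1) (axis I 1) $ L = axis L 1 \<bullet> ext_cut (axis i 1) (axis I 1)"
  by (simp add: inner_axis' inner_commute)
 also have "\<dots> = (ext_vec (axis i 1) \<^bold>\<and> axis L 1) \<bullet> axis I 1" by (rule inner_cut)
 also have "\<dots> = (if i \<in> L then 0 else shuffle_sign {i} L * (if insert i L = I then 1 else 0))"
  by (simp add: ext_vec_axis_mult inner_axis_axis)
 also have "\<dots> = (if i \<in> I then shuffle_sign {i} (I - {i}) *\<^sub>R axis (I - {i}) 1 else 0) $ L"
 proof (cases "i \<in> I \<and> L = I - {i}")
  case True
  then have "insert i L = I" "i \<notin> L" by auto
  with True show ?thesis by (simp add: axis_def)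
 next
  case False
  then have "i \<in> L \<or> insert i L \<noteq> I" by auto
  with False show ?thesis by (auto simp: axis_def)
 qed
 finally show "ext_cut (axis i 1) (axis I 1) $ L =
   (if i \<in> I then shuffle_sign {i} (I - {i}) *\<^sub>R axis (I - {i}) 1 else 0) $ L" .
qed

text \<open>The antiderivation rule for one vector factor. Both sides are linear in g, v and x, so
  it is enough to compare them on axes.\<close>

lemma cut_ext_vec_mult: "ext_cut g (ext_vec v \<^bold>\<and> x) = (g \<bullet> v) *\<^sub>R x - ext_vec v \<^bold>\<and> ext_cut g x"
proof (rule vec_axis_linear_eqI[OF linear_cut_left])
 show "linear (\<lambda>g. (g \<bullet> v) *\<^sub>R x - ext_vec v \<^bold>\<and> ext_cut g x)"
  using linear_compose[OF linear_cut_left linear_ext_mult_right[of "ext_vec v"]]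
  by (intro linear_compose_sub) (auto intro!: linearI simp: inner_add_left scaleR_add_left o_def)
 fix i
 show "ext_cut (axis i 1) (ext_vec v \<^bold>\<and> x) = (axis i 1 \<bullet> v) *\<^sub>R x - ext_vec v \<^bold>\<and> ext_cut (axis i 1) x"
 proof (rule vec_axis_linear_eqI[of "\<lambda>v. ext_cut (axis i 1) (ext_vec v \<^bold>\<and> x)"])
  show "linear (\<lambda>v. ext_cut (axis i 1) (ext_vec v \<^bold>\<and> x))"
   using linear_compose[OF linear_ext_vec_mult linear_cut] by (simp add: o_def)
  show "linear (\<lambda>v. (axis i 1 \<bullet> v) *\<^sub>R x - ext_vec v \<^bold>\<and> ext_cut (axis i 1) x)"
   by (intro linear_compose_sub linear_ext_vec_mult)
    (auto intro!: linearI simp: inner_add_right scaleR_add_left)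
  fix j
  show "ext_cut (axis i 1) (ext_vec (axis j 1) \<^bold>\<and> x) =
    (axis i 1 \<bullet> (axis j 1 :: 'a rvec)) *\<^sub>R x - ext_vec (axis j 1) \<^bold>\<and> ext_cut (axis i 1) x"
  proof (rule vec_axis_linear_eqI[of "\<lambda>x. ext_cut (axis i 1) (ext_vec (axis j 1) \<^bold>\<and> x)"])
   show "linear (\<lambda>x. ext_cut (axis i 1) (ext_vec (axis j 1) \<^bold>\<and> x))"
    using linear_compose[OF linear_ext_mult_right linear_cut] by (simp add: o_def)
   show "linear (\<lambda>x. (axis i 1 \<bullet> (axis j 1 :: 'a rvec)) *\<^sub>R x - ext_vec (axis j 1) \<^bold>\<and> ext_cut (axis i 1) x)"
    using linear_compose[OF linear_cut linear_ext_mult_right[of "ext_vec (axis j 1)"]]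
    by (intro linear_compose_sub) (auto intro!: linearI simp: scaleR_add_right o_def)
   fix I
   show "ext_cut (axis i 1) (ext_vec (axis j 1) \<^bold>\<and> axis I 1) =
     (axis i 1 \<bullet> (axis j 1 :: 'a rvec)) *\<^sub>R axis I 1 - ext_vec (axis j 1) \<^bold>\<and> ext_cut (axis i 1) (axis I 1)"
   proof (cases "i = j")
    case True
    have "insert j (I - {j}) = I" if "j \<in> I" using that by auto
    then show ?thesis
     by (auto simp: True ext_vec_axis_mult cut_axis inner_axis_axis ext_mult_scale_right
       linear_0[OF linear_cut] linear_scale[OF linear_cut])
   next
    case ij: False
    show ?thesis
    proof (cases "i \<in> I \<and> j \<notin> I")
     case True
     define J where "J = I - {i}"
     have I: "I = insert i J" "i \<notin> J" "j \<notin> J" using True by (auto simp: J_def)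
     have eq: "insert j (insert i J) - {i} = insert j J" "insert i J - {i} = J" using I ij by auto
     \<comment> \<open>The only case with both operations effective on different indices: inserting
       j and removing i in the two orders differ by one inversion between i and j.\<close>
     have "shuffle_sign {j} I * shuffle_sign {i} (insert j J) =
       - (shuffle_sign {i} J * shuffle_sign {j} J)"
      unfolding I(1) using I(2,3) ij by (auto simp: shuffle_sign_insert_right shuffle_sign_singletons)
     then show ?thesis
      using ij I by (simp add: ext_vec_axis_mult cut_axis inner_axis_axis eq ext_mult_scale_right
       linear_0[OF linear_cut] linear_scale[OF linear_cut] flip: scaleR_minus_left)
    next
     case False
     then show ?thesis
      using ij by (auto simp: ext_vec_axis_mult cut_axis inner_axis_axis ext_mult_scale_right
       linear_0[OF linear_cut] linear_scale[OF linear_cut])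
    qed
   qed
  qed
 qed
qed

lemma cut_one [simp]: "ext_cut g ext_one = 0"
proof -
 have "x \<bullet> ext_cut g ext_one = 0" for x
  unfolding inner_cut by (simp add: ext_one_def inner_axis ext_vec_mult_nth)
 from this[of "ext_cut g ext_one"] show ?thesis by simp
qed

definition grade :: "nat \<Rightarrow> 'n::{finite,linorder} ext set" where
 "grade p = span {wedge us | us. length us = p}"

lemma wedge_grade: "wedge us \<in> grade (length us)"
 unfolding grade_def by (intro span_base) blast

lemma subspace_linear_vimage: "linear f \<Longrightarrow> subspace S \<Longrightarrow> subspace {x. f x \<in> S}"
 by (auto simp: subspace_def linear_0 linear_add linear_scale)

lemma cut_wedge_grade: "ext_cut g (wedge us) \<in> grade (length us - 1)"
proof (induction us)
 case Nil
 then show ?case by (simp add: grade_def span_0)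
next
 case (Cons u us)
 have "ext_vec u \<^bold>\<and> ext_cut g (wedge us) \<in> grade (length us)"
 proof (cases us)
  case Nil
  then show ?thesis by (simp add: grade_def span_0)
 next
  case us: (Cons w ws)
  have "ext_vec u \<^bold>\<and> x \<in> grade (length us)" if "x \<in> grade (length us - 1)" for x
   using that unfolding grade_def
  proof (induction rule: span_induct)
   case base
   show ?case by (rule subspace_linear_vimage[OF linear_ext_mult_right subspace_span])
  next
   case (step x)
   then obtain vs where "x = wedge vs" "length vs = length us - 1" by blast
   then show ?case using us by (intro span_base CollectI exI[of _ "u # vs"]) auto
  qed
  from this[OF Cons.IH] show ?thesis .
 qed
 then show ?case
  using span_diff[OF span_scale[OF wedge_grade[of us, unfolded grade_def]]]
  by (simp add: cut_ext_vec_mult grade_def)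
qed

lemma cut_grade:
 assumes "a \<in> grade p" shows "ext_cut g a \<in> grade (p - 1)"
 using assms unfolding grade_def
proof (induction rule: span_induct)
 case base
 show ?case by (rule subspace_linear_vimage[OF linear_cut subspace_span])
next
 case (step x)
 then show ?case using cut_wedge_grade unfolding grade_def by blast
qed

text \<open>The graded Leibniz rule. The degree of a is recorded by membership in
  \<open>grade p\<close>, so the claim reduces to wedges of length p, where it follows by repeating
  the one-vector rule.\<close>

lemma cut_ext_mult:
 assumes "a \<in> grade p"
 shows "ext_cut g (a \<^bold>\<and> b) = ext_cut g a \<^bold>\<and> b + (-1) ^ p *\<^sub>R (a \<^bold>\<and> ext_cut g b)"
proof -
 define D where "D a = ext_cut g (a \<^bold>\<and> b) - ext_cut g a \<^bold>\<and> b - (-1) ^ p *\<^sub>R (a \<^bold>\<and> ext_cut g b)" for a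
 have "linear D"
  unfolding D_def
  by (rule linearI) (simp_all add: ext_mult_add_left ext_mult_scale_left linear_add[OF linear_cut]
    linear_scale[OF linear_cut] scaleR_add_right scaleR_diff_right algebra_simps)
 have *: "ext_cut g (wedge us \<^bold>\<and> b) = ext_cut g (wedge us) \<^bold>\<and> b + (-1) ^ length us *\<^sub>R (wedge us \<^bold>\<and> ext_cut g b)" for us
  by (induction us) (simp_all add: ext_mult_assoc cut_ext_vec_mult ext_mult_diff ext_mult_scale_left
    ext_mult_scale_right ext_mult_add_left ext_mult_add_right scaleR_add_right algebra_simps)
 have "D a = 0"
  using assms unfolding grade_def
 proof (induction rule: span_induct)
  case base
  show ?case using subspace_linear_vimage[OF \<open>linear D\<close>, of "{0}"] by (simp add: subspace_def)
 next
  case (step x)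
  then show ?case using * by (auto simp: D_def)
 qed
 then show ?thesis by (simp add: D_def algebra_simps)
qed

text \<open>Wedges of different lengths involve basis elements indexed by sets of different sizes,
  so every product of coordinates vanishes.\<close>

lemma inner_wedge_grade:
 assumes "a \<in> grade p" "length us \<noteq> p" shows "a \<bullet> wedge us = 0"
 using assms(1) unfolding grade_def
proof (induction rule: span_induct)
 case base
 have "linear (\<lambda>a. a \<bullet> wedge us)" by (rule linearI) (auto simp: inner_add_left)
 from subspace_linear_vimage[OF this, of "{0}"] show ?case by (simp add: subspace_def)
next
 case (step x)
 then obtain vs where vs: "x = wedge vs" "length vs = p" by blast
 have "wedge vs $ I * wedge us $ I = 0" for I
  using wedge_nth_card[of vs I] wedge_nth_card[of us I] vs(2) assms(2) by (cases "length vs = card I") simp_all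
 then show ?case unfolding vs inner_vec_def by (intro sum.neutral) simp
qed

text \<open>Splits the subsets by whether they contain 0 and shifts the rest, in the form that fits
  position sets of a list with one element put in front.\<close>

lemma sum_Pow_lessThan_Suc:
 fixes f :: "nat set \<Rightarrow> 'a::comm_monoid_add"
 shows "sum f (Pow {..<Suc n}) = (\<Sum>J\<in>Pow {..<n}. f (insert 0 (Suc ` J))) + (\<Sum>J\<in>Pow {..<n}. f (Suc ` J))"
proof -
 let ?A = "(\<lambda>J. insert 0 (Suc ` J)) ` Pow {..<n}" and ?B = "(\<lambda>J. Suc ` J) ` Pow {..<n}"
 have "Pow {..<Suc n} = ?A \<union> ?B"
 proof
  show "Pow {..<Suc n} \<subseteq> ?A \<union> ?B"
  proof
   fix I assume I: "I \<in> Pow {..<Suc n}"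
   define J where "J = {j. Suc j \<in> I}"
   have J: "J \<in> Pow {..<n}" using I by (auto simp: J_def)
   have S: "Suc ` J = I - {0}"
   proof
    show "I - {0} \<subseteq> Suc ` J"
    proof
     fix i assume "i \<in> I - {0}"
     then show "i \<in> Suc ` J" by (cases i) (auto simp: J_def)
    qed
   qed (auto simp: J_def)
   show "I \<in> ?A \<union> ?B"
   proof (cases "0 \<in> I")
    case True
    then have "I = insert 0 (Suc ` J)" using S by auto
    then show ?thesis using J by blast
   next
    case False
    then have "I = Suc ` J" using S by auto
    then show ?thesis using J by blast
   qed
  qed
  show "?A \<union> ?B \<subseteq> Pow {..<Suc n}" by auto
 qed
 moreover have "?A \<inter> ?B = {}" by auto
 ultimately have "sum f (Pow {..<Suc n}) = sum f ?A + sum f ?B"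
  by (simp add: sum.union_disjoint)
 moreover have "inj_on (\<lambda>J. insert 0 (Suc ` J)) (Pow {..<n})"
 proof (rule inj_onI)
  fix x y assume "insert 0 (Suc ` x) = insert 0 (Suc ` y)"
  then have "insert 0 (Suc ` x) - {0} = insert 0 (Suc ` y) - {0}" by simp
  then have "Suc ` x = Suc ` y" by simp
  then show "x = y" by (simp add: inj_image_eq_iff)
 qed
 moreover have "inj_on (\<lambda>J. Suc ` J) (Pow {..<n})"
  by (rule inj_onI) (simp add: inj_image_eq_iff)
 ultimately show ?thesis by (simp add: sum.reindex)
qed

text \<open>Shifting preserves inversions. A new 0 on the left creates none; on the right it lies
  below every element of the left set and adds \<open>card I\<close> of them.\<close>

lemma shuffle_sign_Suc:
 "shuffle_sign (Suc ` I) (Suc ` J) = shuffle_sign I J"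
 "shuffle_sign (insert 0 (Suc ` I)) (Suc ` J) = shuffle_sign I J"
 "finite I \<Longrightarrow> finite J \<Longrightarrow> shuffle_sign (Suc ` I) (insert 0 (Suc ` J)) = (-1) ^ card I * shuffle_sign I J"
proof -
 let ?P = "{(i, j). i \<in> I \<and> j \<in> J \<and> j < i}" and ?s = "\<lambda>(i::nat, j). (Suc i, Suc j)"
 have inj: "inj_on ?s ?P" by (auto simp: inj_on_def)
 have 1: "{(i, j). i \<in> Suc ` I \<and> j \<in> Suc ` J \<and> j < i} = ?s ` ?P" by (auto simp: image_iff)
 show "shuffle_sign (Suc ` I) (Suc ` J) = shuffle_sign I J"
  unfolding shuffle_sign_def 1 by (simp add: card_image[OF inj])
 have "{(i, j). i \<in> insert 0 (Suc ` I) \<and> j \<in> Suc ` J \<and> j < i} = ?s ` ?P" by (auto simp: image_iff)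
 then show "shuffle_sign (insert 0 (Suc ` I)) (Suc ` J) = shuffle_sign I J"
  unfolding shuffle_sign_def by (simp only: card_image[OF inj])
 assume fin: "finite I" "finite J"
 have "{(i, j). i \<in> Suc ` I \<and> j \<in> insert 0 (Suc ` J) \<and> j < i} = ?s ` ?P \<union> (\<lambda>i. (Suc i, 0)) ` I"
  by (auto simp: image_iff)
 moreover have "?s ` ?P \<inter> (\<lambda>i. (Suc i, 0)) ` I = {}" by auto
 moreover have "finite ?P" by (rule finite_subset[of _ "I \<times> J"]) (use fin in auto)
 moreover have "card ((\<lambda>i. (Suc i, 0::nat)) ` I) = card I" by (rule card_image) (auto simp: inj_on_def)
 ultimately have "card {(i, j). i \<in> Suc ` I \<and> j \<in> insert 0 (Suc ` J) \<and> j < i} = card ?P + card I"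
  using fin by (simp add: card_Un_disjoint card_image[OF inj])
 then show "shuffle_sign (Suc ` I) (insert 0 (Suc ` J)) = (-1) ^ card I * shuffle_sign I J"
  unfolding shuffle_sign_def by (simp only: power_add mult.commute)
qed

lemma nths_Cons_Suc:
 "nths (v # vs) (insert 0 (Suc ` J)) = v # nths vs J" "nths (v # vs) (Suc ` J) = nths vs J"
proof -
 have "{j. Suc j \<in> insert 0 (Suc ` J)} = J" "{j. Suc j \<in> Suc ` J} = J" "0 \<notin> Suc ` J" by auto
 then show "nths (v # vs) (insert 0 (Suc ` J)) = v # nths vs J" "nths (v # vs) (Suc ` J) = nths vs J"
  by (simp_all add: nths_Cons)
qed

lemma length_nths_subset:
 assumes "J \<subseteq> {..<length vs}" shows "length (nths vs J) = card J"
proof -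
 have "{i. i < length vs \<and> i \<in> J} = J" using assms by auto
 then show ?thesis by (simp add: length_nths)
qed

text \<open>Identifies the exterior product, read through the inner product, with the shuffle
  product of forms. Splitting off the first vector v is adjoint to \<open>ext_cut v\<close>; the
  shuffles putting v into the left or the right factor are the two terms of the Leibniz
  rule.\<close>

lemma inner_ext_mult_wedge:
 assumes "a \<in> grade p"
 shows "(a \<^bold>\<and> b) \<bullet> wedge vs = (\<Sum>I\<in>Pow {..<length vs}. shuffle_sign I ({..<length vs} - I)
  * (a \<bullet> wedge (nths vs I)) * (b \<bullet> wedge (nths vs ({..<length vs} - I))))"
 using assms
proof (induction vs arbitrary: a b p)
 case Nil
 have "(a \<^bold>\<and> b) $ {} = a $ {} * b $ {}" by (simp add: ext_mult_def)
 then show ?case by (simp add: ext_one_def inner_axis)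
next
 case (Cons v vs)
 let ?n = "length vs"
 have compl: "{..<length (v # vs)} - insert 0 (Suc ` J) = Suc ` ({..<?n} - J)"
  "{..<length (v # vs)} - Suc ` J = insert 0 (Suc ` ({..<?n} - J))" for J
 proof -
  have *: "{..<length (v # vs)} = insert 0 (Suc ` {..<?n})"
   by (simp add: lessThan_Suc_eq_insert_0)
  have "inj Suc" by simp
  then show "{..<length (v # vs)} - insert 0 (Suc ` J) = Suc ` ({..<?n} - J)"
   "{..<length (v # vs)} - Suc ` J = insert 0 (Suc ` ({..<?n} - J))"
   unfolding * by (auto simp: image_set_diff)
 qed
 have adj: "x \<bullet> (ext_vec v \<^bold>\<and> y) = ext_cut v x \<bullet> y" for x y
  using inner_cut[of y v x] by (simp add: inner_commute)
 have "(\<Sum>I\<in>Pow {..<length (v # vs)}. shuffle_sign I ({..<length (v # vs)} - I)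
   * (a \<bullet> wedge (nths (v # vs) I)) * (b \<bullet> wedge (nths (v # vs) ({..<length (v # vs)} - I)))) =
  (\<Sum>J\<in>Pow {..<?n}. shuffle_sign J ({..<?n} - J) * (ext_cut v a \<bullet> wedge (nths vs J))
   * (b \<bullet> wedge (nths vs ({..<?n} - J)))) +
  (\<Sum>J\<in>Pow {..<?n}. shuffle_sign (Suc ` J) (insert 0 (Suc ` ({..<?n} - J))) * (a \<bullet> wedge (nths vs J))
   * (ext_cut v b \<bullet> wedge (nths vs ({..<?n} - J))))"
  unfolding sum_Pow_lessThan_Suc[of _ ?n, folded length_Cons[of v]]
  by (simp only: compl nths_Cons_Suc wedge_Cons adj shuffle_sign_Suc(1,2))
 also have "(\<Sum>J\<in>Pow {..<?n}. shuffle_sign (Suc ` J) (insert 0 (Suc ` ({..<?n} - J))) * (a \<bullet> wedge (nths vs J))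
   * (ext_cut v b \<bullet> wedge (nths vs ({..<?n} - J)))) =
  (-1) ^ p * (\<Sum>J\<in>Pow {..<?n}. shuffle_sign J ({..<?n} - J) * (a \<bullet> wedge (nths vs J))
   * (ext_cut v b \<bullet> wedge (nths vs ({..<?n} - J))))"
  unfolding sum_distrib_left
 proof (rule sum.cong[OF refl])
  fix J assume J: "J \<in> Pow {..<?n}"
  then have fin: "finite J" by (auto intro: finite_subset)
  \<comment> \<open>The sign (-1)^\<open>card J\<close> of an individual term may be replaced by
    (-1)^p, because terms with another cardinality vanish by degree.\<close>
  have "card J = p \<or> a \<bullet> wedge (nths vs J) = 0"
   using inner_wedge_grade[OF Cons.prems, of "nths vs J"] length_nths_subset[of J vs] J by auto
  then show "shuffle_sign (Suc ` J) (insert 0 (Suc ` ({..<?n} - J))) * (a \<bullet> wedge (nths vs J))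
    * (ext_cut v b \<bullet> wedge (nths vs ({..<?n} - J))) =
   (-1) ^ p * (shuffle_sign J ({..<?n} - J) * (a \<bullet> wedge (nths vs J))
    * (ext_cut v b \<bullet> wedge (nths vs ({..<?n} - J))))"
   using fin by (auto simp: shuffle_sign_Suc(3))
 qed
 also have "(\<Sum>J\<in>Pow {..<?n}. shuffle_sign J ({..<?n} - J) * (ext_cut v a \<bullet> wedge (nths vs J))
   * (b \<bullet> wedge (nths vs ({..<?n} - J)))) = (ext_cut v a \<^bold>\<and> b) \<bullet> wedge vs"
  by (rule Cons.IH[OF cut_grade[OF Cons.prems], symmetric])
 also have "(\<Sum>J\<in>Pow {..<?n}. shuffle_sign J ({..<?n} - J) * (a \<bullet> wedge (nths vs J))
   * (ext_cut v b \<bullet> wedge (nths vs ({..<?n} - J)))) = (a \<^bold>\<and> ext_cut v b) \<bullet> wedge vs"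
  by (rule Cons.IH[OF Cons.prems, symmetric])
 also have "(ext_cut v a \<^bold>\<and> b) \<bullet> wedge vs + (-1) ^ p * ((a \<^bold>\<and> ext_cut v b) \<bullet> wedge vs) =
   ext_cut v (a \<^bold>\<and> b) \<bullet> wedge vs"
  by (simp add: cut_ext_mult[OF Cons.prems] inner_add_left)
 finally show ?case by (simp add: adj)
qed

text \<open>\<open>form_wedge\<close> is a definite description, so a functional with the prescribed
  values on wedges has to be exhibited. Representing \<alpha> and \<beta> by elements a and b,
  pairing with their exterior product is such a functional.\<close>

lemma shuffle_product_exists:
 fixes \<alpha> \<beta> :: "'n::{finite,linorder} ext \<Rightarrow> real"
 assumes "linear \<alpha>" "linear \<beta>"
 shows "\<exists>\<gamma>. linear \<gamma> \<and> (\<forall>vs. length vs = p + q \<longrightarrow> \<gamma> (wedge vs) =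
  (\<Sum>I | I \<subseteq> {..<p + q} \<and> card I = p. shuffle_sign I ({..<p + q} - I)
   * \<alpha> (wedge (nths vs I)) * \<beta> (wedge (nths vs ({..<p + q} - I)))))"
proof -
 \<comment> \<open>Only the part of degree p of \<alpha> is kept; a then lies in
   \<open>grade p\<close>, and subsets of other sizes drop out of the shuffle sum.\<close>
 define a :: "'n ext" where "a = (\<chi> I. if card I = p then \<alpha> (axis I 1) else 0)"
 define b :: "'n ext" where "b = (\<chi> I. \<beta> (axis I 1))"
 have repr: "f x = (\<Sum>I\<in>UNIV. f (axis I 1) * x $ I)" if "linear f" for f :: "'n ext \<Rightarrow> real" and x
 proof -
  have "x = (\<Sum>I\<in>UNIV. x $ I *\<^sub>R axis I 1)"
   by (simp add: vec_eq_iff axis_def sum.delta' if_distrib cong: if_cong)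
  then have "f x = f (\<Sum>I\<in>UNIV. x $ I *\<^sub>R axis I 1)" by simp
  also have "\<dots> = (\<Sum>I\<in>UNIV. f (axis I 1) * x $ I)"
   by (simp add: linear_sum[OF that] linear_scale[OF that] mult.commute)
  finally show ?thesis .
 qed
 have b: "b \<bullet> x = \<beta> x" for x
  by (subst repr[OF assms(2)]) (simp add: b_def inner_vec_def)
 have a: "a \<bullet> wedge us = \<alpha> (wedge us)" if "length us = p" for us
 proof -
  have *: "a $ I * wedge us $ I = \<alpha> (axis I 1) * wedge us $ I" for I
   using wedge_nth_card[of us I] that by (auto simp: a_def)
  show ?thesis
   unfolding repr[OF assms(1), of "wedge us"] inner_vec_def inner_real_def
   by (rule sum.cong[OF refl *])
 qed
 have "a = (\<Sum>I | card I = p. \<alpha> (axis I 1) *\<^sub>R axis I 1)"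
  by (simp add: vec_eq_iff a_def axis_def sum.delta' if_distrib cong: if_cong)
 moreover have "axis I 1 \<in> grade p" if "card I = p" for I
  using wedge_grade[of "map (\<lambda>i. axis i 1) (sorted_list_of_set I)"] that by (simp flip: axis_eq_wedge)
 ultimately have ap: "a \<in> grade p"
  unfolding grade_def by (auto intro!: span_sum span_scale)
 have "linear (\<lambda>x. (a \<^bold>\<and> b) \<bullet> x)" by (rule linearI) (auto simp: inner_add_right)
 moreover have "(a \<^bold>\<and> b) \<bullet> wedge vs = (\<Sum>I | I \<subseteq> {..<p + q} \<and> card I = p. shuffle_sign I ({..<p + q} - I)
   * \<alpha> (wedge (nths vs I)) * \<beta> (wedge (nths vs ({..<p + q} - I))))" if n: "length vs = p + q" for vs
 proof -
  have "(a \<^bold>\<and> b) \<bullet> wedge vs = (\<Sum>I\<in>Pow {..<p + q}. shuffle_sign I ({..<p + q} - I)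
    * (a \<bullet> wedge (nths vs I)) * (b \<bullet> wedge (nths vs ({..<p + q} - I))))"
   using inner_ext_mult_wedge[OF ap, of b vs] n by simp
  also have "\<dots> = (\<Sum>I | I \<subseteq> {..<p + q} \<and> card I = p. shuffle_sign I ({..<p + q} - I)
    * (a \<bullet> wedge (nths vs I)) * (b \<bullet> wedge (nths vs ({..<p + q} - I))))"
  proof (rule sum.mono_neutral_right)
   show "\<forall>I\<in>Pow {..<p + q} - {I. I \<subseteq> {..<p + q} \<and> card I = p}. shuffle_sign I ({..<p + q} - I)
     * (a \<bullet> wedge (nths vs I)) * (b \<bullet> wedge (nths vs ({..<p + q} - I))) = 0"
    using inner_wedge_grade[OF ap] length_nths_subset[of _ vs] n by auto
  qed auto
  also have "\<dots> = (\<Sum>I | I \<subseteq> {..<p + q} \<and> card I = p. shuffle_sign I ({..<p + q} - I)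
    * \<alpha> (wedge (nths vs I)) * \<beta> (wedge (nths vs ({..<p + q} - I))))"
   using length_nths_subset[of _ vs] n by (intro sum.cong refl) (simp add: a b)
  finally show ?thesis .
 qed
 ultimately show ?thesis by blast
qed

section \<open>Exterior powers of lattices\<close>

lemma ext_power_wedge:
 assumes "real_subring K" "L \<in> \<L>" "set vs \<subseteq> L"
 shows "wedge vs \<in> ext_power K \<L> (length vs)"
 unfolding ext_power_def
 by (rule subsetD[OF kspan_superset[OF real_subringD(1)[OF assms(1)]]]) (use assms in blast)

lemma kmodule_ext_power: "real_subring K \<Longrightarrow> kmodule K (ext_power K \<L> p)"
 unfolding ext_power_def by (rule kmodule_kspan)

lemma ext_power_least:
 assumes "kmodule K M" "\<And>vs L. L \<in> \<L> \<Longrightarrow> set vs \<subseteq> L \<Longrightarrow> length vs = p \<Longrightarrow> wedge vs \<in> M"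
 shows "ext_power K \<L> p \<subseteq> M"
 unfolding ext_power_def by (rule kspan_least[OF assms(1)]) (use assms(2) in blast)

text \<open>The image of L is allowed to lie in the K-span of a lattice of the second family instead
  of in that lattice: sections of quotient maps have denominators when K is \<rat>.\<close>

lemma ext_map_ext_power:
 assumes "real_subring K" "linear f"
  and "\<And>L. L \<in> \<L> \<Longrightarrow> \<exists>L'\<in>\<L>'. f ` L \<subseteq> kspan K L'"
  and "x \<in> ext_power K \<L> p"
 shows "ext_map f x \<in> ext_power K \<L>' p"
proof -
 have "ext_power K \<L> p \<subseteq> ext_map f -` ext_power K \<L>' p"
 proof (rule ext_power_least)
  show "kmodule K (ext_map f -` ext_power K \<L>' p)"
   by (intro kmodule_vimage linear_ext_map kmodule_ext_power assms)
  fix vs L assume vs: "L \<in> \<L>" "set vs \<subseteq> L" "length vs = p"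
  obtain L' where L': "L' \<in> \<L>'" "f ` L \<subseteq> kspan K L'" using assms(3)[OF vs(1)] by blast
  have "wedge (map f vs) \<in> kspan K {wedge ws | ws. set ws \<subseteq> L' \<and> length ws = length (map f vs)}"
   using vs(2) L'(2) by (intro wedge_kspan[OF assms(1)]) auto
  also have "\<dots> \<subseteq> ext_power K \<L>' p"
  proof (intro kspan_least kmodule_ext_power assms(1) subsetI)
   fix x assume "x \<in> {wedge ws | ws. set ws \<subseteq> L' \<and> length ws = length (map f vs)}"
   then obtain ws where ws: "x = wedge ws" "set ws \<subseteq> L'" "length ws = p" using vs(3) by auto
   then show "x \<in> ext_power K \<L>' p" using ext_power_wedge[OF assms(1) L'(1), of ws] by simp
  qed
  finally show "wedge vs \<in> ext_map f -` ext_power K \<L>' p"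
   by (simp add: ext_map_wedge[OF assms(2)])
 qed
 with assms(4) show ?thesis by blast
qed

lemma ext_power_mono:
 assumes "real_subring K" "\<And>L. L \<in> \<L> \<Longrightarrow> \<exists>L'\<in>\<L>'. L \<subseteq> L'"
 shows "ext_power K \<L> p \<subseteq> ext_power K \<L>' p"
 by (rule ext_power_least[OF kmodule_ext_power[OF assms(1)]])
  (use assms ext_power_wedge in blast)

lemma ext_power_zero:
 assumes "\<And>L. L \<in> \<L> \<Longrightarrow> dim L < p" "x \<in> ext_power K \<L> p"
 shows "x = 0"
proof -
 have "ext_power K \<L> p \<subseteq> {0}"
  by (rule ext_power_least) (use assms(1) wedge_dim_zero in \<open>auto simp: kmodule_def\<close>)
 with assms(2) show ?thesis by blast
qed

lemma ext_power_subset_grade: "ext_power K \<L> p \<subseteq> grade p"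
 by (rule ext_power_least) (use wedge_grade in \<open>auto simp: grade_def kmodule_span\<close>)

lemma ext_power_ring_mono:
 assumes "K \<subseteq> K'" shows "ext_power K \<L> p \<subseteq> ext_power K' \<L> p"
 unfolding ext_power_def by (rule kspan_mono_ring[OF assms])

lemma is_generator_kspan:
 "is_generator (kspan \<int> (set ms)) (length ms) (wedge ms)"
proof -
 have K: "real_subring \<int>" by (rule real_subring_Ints)
 let ?R = "range (\<lambda>m::int. of_int m *\<^sub>R wedge ms)"
 have "ext_power \<int> {kspan \<int> (set ms)} (length ms) \<subseteq> ?R"
 proof (rule ext_power_least)
  have "of_int m *\<^sub>R wedge ms + of_int n *\<^sub>R wedge ms \<in> ?R" for m n
   by (rule image_eqI[of _ _ "m + n"]) (auto simp: scaleR_add_left)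
  moreover have "of_int m *\<^sub>R (of_int n *\<^sub>R wedge ms) \<in> ?R" for m n
   by (rule image_eqI[of _ _ "m * n"]) auto
  moreover have "0 \<in> ?R" by (rule image_eqI[of _ _ 0]) auto
  ultimately show "kmodule \<int> ?R" by (auto simp: kmodule_def elim!: Ints_cases)
  fix vs L assume "L \<in> {kspan \<int> (set ms)}" "set vs \<subseteq> L" "length vs = length ms"
  then show "wedge vs \<in> ?R"
   using wedge_kspan_top[OF K, of vs ms] by (auto elim!: Ints_cases)
 qed
 moreover have "wedge ms \<in> ext_power \<int> {kspan \<int> (set ms)} (length ms)"
  using kspan_superset[of \<int> "set ms"] by (intro ext_power_wedge[OF K]) auto
 then have "?R \<subseteq> ext_power \<int> {kspan \<int> (set ms)} (length ms)"
  by (auto intro!: kmoduleD(3)[OF kmodule_ext_power[OF K]])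
 ultimately show ?thesis unfolding is_generator_def by blast
qed

lemma is_generator_unique:
 assumes "is_generator L k x" "is_generator L k y"
 shows "y = x \<or> y = - x"
proof -
 have "range (\<lambda>m::int. of_int m *\<^sub>R x) = range (\<lambda>m::int. of_int m *\<^sub>R y)"
  using assms by (simp add: is_generator_def)
 moreover have "x = of_int 1 *\<^sub>R x" "y = of_int 1 *\<^sub>R y" by simp_all
 ultimately obtain m n :: int where m: "x = of_int m *\<^sub>R y" and n: "y = of_int n *\<^sub>R x"
  by (metis (no_types, lifting) imageE rangeI)
 show ?thesis
 proof (cases "x = 0")
  case True
  then show ?thesis using n by simp
 next
  case False
  have "x = of_int (m * n) *\<^sub>R x"
   by (subst m, subst n) simp
  then have "of_int (m * n) = (1::real)" using False by (metis scaleR_cancel_right scaleR_one)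
  then have "m * n = 1" by linarith
  then have "n = 1 \<or> n = -1" by (metis mult.commute zmult_eq_1_iff)
  then show ?thesis using n by auto
 qed
qed

lemma is_generator_mem:
 assumes "is_generator L k x" shows "x \<in> ext_power \<int> {L} k"
 using assms unfolding is_generator_def by (metis (no_types, lifting) of_int_1 rangeI scaleR_one)

section \<open>Lattices\<close>

text \<open>Stands in for a basis: T reads off K-valued coordinates and S recovers the vector. Such
  an embedding passes to quotients by an explicit formula
  (\<open>coordinatized_proj_vector\<close>), and over \<int> it still gives the discreteness that
  primitive vectors require.\<close>

definition coordinatized :: "real set \<Rightarrow> 'n::finite rvec set \<Rightarrow> bool" where
 "coordinatized K M \<longleftrightarrow> (\<exists>(T :: 'n rvec \<Rightarrow> 'n rvec) S. linear T \<and> linear S \<and>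
   (\<forall>x\<in>M. S (T x) = x \<and> (\<forall>i. T x $ i \<in> K)))"

lemma coordinatized_ring_mono: "coordinatized K M \<Longrightarrow> K \<subseteq> K' \<Longrightarrow> coordinatized K' M"
 unfolding coordinatized_def by blast

lemma is_lattice_coordinatized:
 fixes N :: "'n::finite rvec set"
 assumes "is_lattice N" shows "kmodule \<int> N" "coordinatized \<int> N"
proof -
 obtain B where B: "independent B" "N = kspan \<int> B"
  using assms by (auto simp: is_lattice_def lattice_basis_def)
 show "kmodule \<int> N" unfolding B(2) by (rule kmodule_kspan[OF real_subring_Ints])
 have "card B \<le> card (UNIV :: 'n set)" and fin: "finite B"
  using independent_bound[OF B(1)] by auto
 then obtain j :: "'n rvec \<Rightarrow> 'n" where j: "inj_on j B"
  by (meson card_le_inj finite)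
 obtain T :: "'n rvec \<Rightarrow> 'n rvec" where T: "linear T" "\<And>b. b \<in> B \<Longrightarrow> T b = axis (j b) 1"
  using linear_independent_extend[OF B(1), of "\<lambda>b. axis (j b) 1"] by blast
 define S :: "'n rvec \<Rightarrow> 'n rvec" where "S y = (\<Sum>b\<in>B. y $ j b *\<^sub>R b)" for y
 have S: "linear S"
  unfolding S_def by (rule linearI) (simp_all add: scaleR_add_left sum.distrib scaleR_sum_right)
 have "S (T b) = b" if "b \<in> B" for b
 proof -
  have "axis (j b) 1 $ j c *\<^sub>R c = (if c = b then b else 0)" if "c \<in> B" for c
   using j \<open>b \<in> B\<close> that by (auto simp: axis_def inj_on_def)
  then have "S (T b) = (\<Sum>c\<in>B. if c = b then b else 0)"
   unfolding S_def T(2)[OF that] by (intro sum.cong) auto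
  then show ?thesis using fin that by simp
 qed
 note ST = this
 have "linear (\<lambda>x. S (T x))" using linear_compose[OF T(1) S] by (simp add: o_def)
 then have "S (T x) = x" if "x \<in> span B" for x
  using linear_ident ST that by (rule linear_eq_on_span)
 moreover have "N \<subseteq> span B" unfolding B(2) by (rule kspan_subset_span)
 moreover have "N \<subseteq> T -` {y. \<forall>i. y $ i \<in> \<int>}"
  unfolding B(2)
  by (rule kspan_least[OF kmodule_vimage[OF T(1)]]) (auto simp: T(2) axis_def kmodule_def)
 ultimately show "coordinatized \<int> N"
  unfolding coordinatized_def using T(1) S by blast
qed

section \<open>Iterated quotients by orthogonal projection\<close>

lemma proj_mem_span:
 fixes x :: "'v::euclidean_space"
 assumes "\<tau> \<subseteq> span W" "x \<in> span W" shows "proj \<tau> x \<in> span W"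
proof -
 have "x - proj \<tau> x \<in> span W" using proj_in[of x \<tau>] span_minimal[OF assms(1) subspace_span] by blast
 from span_diff[OF assms(2) this] show ?thesis by simp
qed

lemma proj_diff: "proj \<tau> (x - y) = proj \<tau> x - proj \<tau> y"
 and proj_add: "proj \<tau> (x + y) = proj \<tau> x + proj \<tau> y"
 and proj_scale: "proj \<tau> (c *\<^sub>R x) = c *\<^sub>R proj \<tau> x"
 and proj_sum: "proj \<tau> (sum f A) = (\<Sum>a\<in>A. proj \<tau> (f a))"
 and proj_0: "proj \<tau> 0 = 0"
 using linear_proj[of \<tau>] by (auto simp: linear_diff linear_add linear_scale linear_sum linear_0)

lemma proj_cong_span:
 fixes \<tau> \<rho> :: "'v::euclidean_space set"
 assumes "span \<tau> = span \<rho>" shows "proj \<tau> = proj \<rho>"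
 using assms by (simp add: proj_def fun_eq_iff)

lemma proj_eqI:
 fixes x y :: "'v::euclidean_space"
 assumes "x - y \<in> span \<tau>" shows "proj \<tau> x = proj \<tau> y"
 using assms proj_diff[of \<tau> x y] by (simp add: proj_eq_0_iff[symmetric])

text \<open>A quotient by several vectors may be taken one vector at a time, the later ones being
  replaced by their images; this is the induction step for
  \<open>coordinatized_proj\<close>.\<close>

lemma proj_insert:
 fixes v :: "'v::euclidean_space"
 shows "proj {proj \<tau> v} (proj \<tau> x) = proj (insert v \<tau>) x"
proof (rule proj_unique)
 have sub: "span \<tau> \<subseteq> span (insert v \<tau>)" by (rule span_mono) auto
 have pv: "proj \<tau> v \<in> span (insert v \<tau>)"
  by (rule proj_mem_span) (auto intro: span_base)
 have "proj \<tau> x - proj (insert v \<tau>) x = (x - proj (insert v \<tau>) x) - (x - proj \<tau> x)" by simp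
 also have "\<dots> \<in> span (insert v \<tau>)" using proj_in sub by (blast intro: span_diff)
 finally have *: "proj \<tau> x - proj (insert v \<tau>) x \<in> span (insert v \<tau>)" .
 then obtain k where k: "proj \<tau> x - proj (insert v \<tau>) x - k *\<^sub>R v \<in> span \<tau>"
  using span_breakdown_eq by blast
 define z where "z = proj \<tau> x - proj (insert v \<tau>) x - k *\<^sub>R proj \<tau> v"
 have "k *\<^sub>R (v - proj \<tau> v) \<in> span \<tau>" by (intro span_scale proj_in)
 from span_add[OF k this] have z1: "z \<in> span \<tau>" by (simp add: z_def algebra_simps)
 have "orthogonal z w" if w: "w \<in> span \<tau>" for w
  unfolding z_def using proj_orth[OF w] proj_orth[OF subsetD[OF sub w]]
  by (simp add: orthogonal_clauses)
 from this[OF z1] have "z = 0" by (simp add: orthogonal_def)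
 then have "proj \<tau> x - proj (insert v \<tau>) x = k *\<^sub>R proj \<tau> v" by (simp add: z_def)
 then show "proj \<tau> x - proj (insert v \<tau>) x \<in> span {proj \<tau> v}" by (simp add: span_base span_scale)
 show "orthogonal (proj (insert v \<tau>) x) y" if "y \<in> {proj \<tau> v}" for y
  using that pv by (auto intro: proj_orth)
qed

text \<open>The new coordinates are the minors pairing the i-th coordinate with all the others, for
  an i with \<open>T v $ i\<close> nonzero. They vanish on v, hence descend to the quotient, and
  they stay in K because K is a ring; division by \<open>T v $ i\<close> occurs only in the
  recovering map.\<close>

lemma coordinatized_proj_vector:
 fixes M :: "'n::finite rvec set"
 assumes K: "real_subring K" and c: "coordinatized K M" and v: "v \<in> M"
 shows "coordinatized K (proj {v} ` M)"
proof (cases "v = 0")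
 case True
 then show ?thesis using c by (simp add: image_def)
next
 case False
 obtain T S :: "'n rvec \<Rightarrow> 'n rvec" where TS: "linear T" "linear S"
  "\<And>x. x \<in> M \<Longrightarrow> S (T x) = x" "\<And>x i. x \<in> M \<Longrightarrow> T x $ i \<in> K"
  using c unfolding coordinatized_def by blast
 have "T v \<noteq> 0" using TS(3)[OF v] False linear_0[OF TS(2)] by metis
 then obtain i where i: "T v $ i \<noteq> 0" by (auto simp: vec_eq_iff)
 define T' :: "'n rvec \<Rightarrow> 'n rvec" where "T' x = (T v $ i) *\<^sub>R T x - (T x $ i) *\<^sub>R T v" for x
 define S' where "S' y = (1 / T v $ i) *\<^sub>R proj {v} (S y)" for y
 have T': "linear T'"
  unfolding T'_def by (rule linearI) (simp_all add: linear_add[OF TS(1)] linear_scale[OF TS(1)] algebra_simps)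
 have S': "linear S'"
  unfolding S'_def by (rule linearI)
   (simp_all add: linear_add[OF TS(2)] linear_scale[OF TS(2)] proj_add proj_scale algebra_simps)
 have T'0: "T' v = 0" by (simp add: T'_def)
 have T'p: "T' (proj {v} x) = T' x" for x
 proof -
  obtain k where "x - proj {v} x = k *\<^sub>R v" using proj_in[of x "{v}"] by (auto simp: span_singleton)
  then have "T' (x - proj {v} x) = 0" by (simp add: linear_scale[OF T'] T'0)
  then show ?thesis by (simp add: linear_diff[OF T'])
 qed
 have "S' (T' (proj {v} x)) = proj {v} x" if x: "x \<in> M" for x
 proof -
  have "S (T' x) = (T v $ i) *\<^sub>R x - (T x $ i) *\<^sub>R v"
   by (simp add: T'_def linear_diff[OF TS(2)] linear_scale[OF TS(2)] TS(3) x v)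
  moreover have "proj {v} v = 0" by (simp add: proj_eq_0_iff span_base)
  ultimately show ?thesis using i by (simp add: T'p S'_def proj_diff proj_scale)
 qed
 moreover have "T' (proj {v} x) $ k \<in> K" if "x \<in> M" for x k
  unfolding T'p using TS(4)[OF that] TS(4)[OF v] real_subringD[OF K] by (simp add: T'_def)
 ultimately show ?thesis unfolding coordinatized_def using T' S' by blast
qed

lemma coordinatized_proj:
 fixes M :: "'n::finite rvec set"
 assumes K: "real_subring K" and c: "coordinatized K M" and "finite V" "V \<subseteq> M"
 shows "coordinatized K (proj V ` M)"
 using assms(3,4)
proof (induction V rule: finite_induct)
 case empty
 have "proj {} x = x" for x :: "'n rvec" by (rule proj_unique) (auto simp: span_0)
 then show ?case using c by simp
next
 case (insert v V)
 have "proj {proj V v} ` proj V ` M = proj (insert v V) ` M"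
  by (simp add: image_image proj_insert)
 moreover have "coordinatized K (proj {proj V v} ` proj V ` M)"
  using insert by (intro coordinatized_proj_vector[OF K]) auto
 ultimately show ?case by simp
qed

section \<open>Primitive vectors and bases of saturated sublattices\<close>

lemma integers_cyclic:
 assumes "kmodule \<int> (A :: real set)" "A \<subseteq> \<int>" "a \<in> A" "a \<noteq> 0"
 shows "\<exists>g\<in>A. 0 < g \<and> A = range (\<lambda>m::int. of_int m * g)"
proof -
 have neg: "- x \<in> A" if "x \<in> A" for x using kmodule_neg[OF assms(1) real_subring_Ints that] .
 define P where "P n \<longleftrightarrow> 0 < n \<and> real n \<in> A" for n :: nat
 have "\<exists>n. P n"
 proof -
  have "\<bar>a\<bar> \<in> A" using assms(3) neg by (auto simp: abs_if)
  moreover obtain z :: int where "a = of_int z" using assms(2,3) by (auto elim: Ints_cases)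
  then have "\<bar>a\<bar> = real (nat \<bar>z\<bar>)" by simp
  ultimately show ?thesis using assms(4) by (intro exI[of _ "nat \<bar>z\<bar>"]) (auto simp: P_def)
 qed
 then have n: "P (LEAST n. P n)" and least: "\<And>m. P m \<Longrightarrow> (LEAST n. P n) \<le> m"
  by (auto intro: LeastI_ex Least_le)
 define n where "n = (LEAST n. P n)"
 have nA: "real n \<in> A" "0 < n" using n by (auto simp: P_def n_def)
 have "A = range (\<lambda>m::int. of_int m * real n)"
 proof
  show "range (\<lambda>m::int. of_int m * real n) \<subseteq> A"
   using kmoduleD(3)[OF assms(1) _ nA(1)] by auto
  show "A \<subseteq> range (\<lambda>m::int. of_int m * real n)"
  proof
   fix x assume x: "x \<in> A"
   then obtain z where z: "x = of_int z" using assms(2) by (auto elim: Ints_cases)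
   define r where "r = z mod int n"
   have "x - of_int (z div int n) * real n \<in> A"
    using kmodule_diff[OF assms(1) real_subring_Ints x] kmoduleD(3)[OF assms(1) _ nA(1)] by auto
   moreover have "x - of_int (z div int n) * real n = of_int r"
   proof -
    have "z - (z div int n) * int n = r" by (simp add: r_def minus_div_mult_eq_mod)
    then have "of_int (z - (z div int n) * int n) = (of_int r :: real)" by simp
    then show ?thesis by (simp add: z)
   qed
   moreover have r: "0 \<le> r" "r < int n" using nA(2) by (auto simp: r_def)
   ultimately have "real (nat r) \<in> A" by simp
   then have "\<not> 0 < nat r" using least[of "nat r", folded n_def] r(2) by (auto simp: P_def)
   then have "z = (z div int n) * int n" using r(1) unfolding r_def
    by (metis div_mult_mod_eq add.right_neutral nat_0_iff neq0_conv order_antisym)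
   then have "x = of_int ((z div int n) * int n)" using z by simp
   then have "x = of_int (z div int n) * real n" by simp
   then show "x \<in> range (\<lambda>m::int. of_int m * real n)" by blast
  qed
 qed
 then show ?thesis using nA by (intro bexI[of _ "real n"]) auto
qed

text \<open>One nonzero coordinate of v embeds M \<inter> span {v} into \<int>, and subgroups of
  \<int> are cyclic. The positive factor t records that the generator points the same way as
  v.\<close>

lemma primitive_multiple:
 fixes M :: "'n::finite rvec set"
 assumes M: "kmodule \<int> M" "coordinatized \<int> M" and v: "v \<in> M" "v \<noteq> 0"
 shows "\<exists>t>0. t *\<^sub>R v \<in> M \<and> M \<inter> span {v} = range (\<lambda>m::int. of_int m *\<^sub>R (t *\<^sub>R v))"
proof -
 obtain T S :: "'n rvec \<Rightarrow> 'n rvec" where TS: "linear T" "linear S"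
  "\<And>x. x \<in> M \<Longrightarrow> S (T x) = x" "\<And>x i. x \<in> M \<Longrightarrow> T x $ i \<in> \<int>"
  using M(2) unfolding coordinatized_def by blast
 have "T v \<noteq> 0" using TS(3)[OF v(1)] v(2) linear_0[OF TS(2)] by metis
 then obtain i where i: "T v $ i \<noteq> 0" by (auto simp: vec_eq_iff)
 define c where "c = T v $ i * T v $ i"
 define A where "A = {t * T v $ i | t. t *\<^sub>R v \<in> M}"
 have A: "A \<subseteq> \<int>"
  using TS(4) by (force simp: A_def linear_scale[OF TS(1)])
 have "kmodule \<int> A"
  unfolding kmodule_def
 proof (intro conjI ballI)
  show "0 \<in> A" using kmoduleD(1)[OF M(1)] by (auto simp: A_def intro!: exI[of _ 0])
  show "x + y \<in> A" if "x \<in> A" "y \<in> A" for x y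
  proof -
   obtain s t where "x = s * T v $ i" "y = t * T v $ i" "s *\<^sub>R v \<in> M" "t *\<^sub>R v \<in> M"
    using \<open>x \<in> A\<close> \<open>y \<in> A\<close> by (auto simp: A_def)
   then show ?thesis using kmoduleD(2)[OF M(1), of "s *\<^sub>R v" "t *\<^sub>R v"]
    by (auto simp: A_def algebra_simps intro!: exI[of _ "s + t"])
  qed
  show "c *\<^sub>R x \<in> A" if "c \<in> \<int>" "x \<in> A" for c x
  proof -
   obtain s where "x = s * T v $ i" "s *\<^sub>R v \<in> M" using \<open>x \<in> A\<close> by (auto simp: A_def)
   then show ?thesis using kmoduleD(3)[OF M(1) that(1), of "s *\<^sub>R v"]
    by (auto simp: A_def intro!: exI[of _ "c * s"])
  qed
 qed
 moreover have "T v $ i \<in> A" using v(1) by (auto simp: A_def intro!: exI[of _ 1])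
 ultimately obtain g where g: "g \<in> A" "0 < g" "A = range (\<lambda>m::int. of_int m * g)"
  using integers_cyclic[OF _ A _ i] by blast
 obtain t0 where t0: "g = t0 * T v $ i" "t0 *\<^sub>R v \<in> M" using g(1) by (auto simp: A_def)
 have t0n: "t0 \<noteq> 0" using t0 g(2) by auto
 have *: "M \<inter> span {v} = range (\<lambda>m::int. of_int m *\<^sub>R (t0 *\<^sub>R v))"
 proof
  show "range (\<lambda>m::int. of_int m *\<^sub>R (t0 *\<^sub>R v)) \<subseteq> M \<inter> span {v}"
   using kmoduleD(3)[OF M(1) _ t0(2)] by (auto simp: span_base span_scale)
  show "M \<inter> span {v} \<subseteq> range (\<lambda>m::int. of_int m *\<^sub>R (t0 *\<^sub>R v))"
  proof
   fix x assume x: "x \<in> M \<inter> span {v}"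
   then obtain s where s: "x = s *\<^sub>R v" by (auto simp: span_singleton)
   then have "s * T v $ i \<in> A" using x by (auto simp: A_def)
   then obtain m :: int where "s * T v $ i = of_int m * g" using g(3) by auto
   then have "s = of_int m * t0" using i t0(1) by simp
   then show "x \<in> range (\<lambda>m::int. of_int m *\<^sub>R (t0 *\<^sub>R v))" using s by auto
  qed
 qed
 show ?thesis
 proof (cases "t0 > 0")
  case True
  then show ?thesis using t0 * by blast
 next
  case False
  \<comment> \<open>The factor t0 is negative when \<open>T v $ i\<close> is; the opposite vector
    generates the same group.\<close>
  have "range (\<lambda>m::int. of_int m *\<^sub>R ((- t0) *\<^sub>R v)) = range (\<lambda>m::int. of_int m *\<^sub>R (t0 *\<^sub>R v))"
  proof -
   have "of_int m *\<^sub>R ((- t0) *\<^sub>R v) = of_int (- m) *\<^sub>R (t0 *\<^sub>R v)" for m :: int by simp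
   then have "range (\<lambda>m::int. of_int m *\<^sub>R ((- t0) *\<^sub>R v)) = (\<lambda>m::int. of_int m *\<^sub>R (t0 *\<^sub>R v)) ` range uminus"
    unfolding image_image by simp
   then show ?thesis by simp
  qed
  moreover have "(- t0) *\<^sub>R v \<in> M"
   using kmodule_neg[OF M(1) real_subring_Ints t0(2)] by simp
  ultimately show ?thesis using * False t0n by (intro exI[of _ "- t0"]) auto
 qed
qed

lemma span_insert_proj:
 fixes v :: "'v::euclidean_space"
 shows "proj {v} x \<in> span (proj {v} ` V) \<longleftrightarrow> x \<in> span (insert v V)"
proof
 assume "proj {v} x \<in> span (proj {v} ` V)"
 then have "proj {v} x \<in> proj {v} ` span V" by (simp add: span_linear_image[OF linear_proj])
 then obtain y where y: "y \<in> span V" "proj {v} x = proj {v} y" by blast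
 then have "x - y \<in> span {v}" using proj_diff[of "{v}" x y] by (simp add: proj_eq_0_iff)
 then have "x - y \<in> span (insert v V)" using span_mono[of "{v}" "insert v V"] by auto
 moreover have "y \<in> span (insert v V)" using y(1) span_mono[of V "insert v V"] by auto
 ultimately show "x \<in> span (insert v V)" using span_add by fastforce
next
 assume "x \<in> span (insert v V)"
 then obtain k where "x - k *\<^sub>R v \<in> span V" using span_breakdown_eq by blast
 then have "proj {v} (x - k *\<^sub>R v) \<in> span (proj {v} ` V)"
  by (simp add: span_linear_image[OF linear_proj])
 moreover have "proj {v} v = 0" by (simp add: proj_eq_0_iff span_base)
 ultimately show "proj {v} x \<in> span (proj {v} ` V)" by (simp add: proj_diff proj_scale)
qed

lemma independent_proj_list:
 fixes v :: "'v::euclidean_space"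
 assumes "distinct (v # vs)" "independent (set (v # vs))"
 shows "distinct (map (proj {v}) vs)" "independent (set (map (proj {v}) vs))"
proof -
 have v: "v \<notin> span (set vs)" "v \<notin> set vs" and vs: "independent (set vs)"
  using assms by (auto simp: independent_insert)
 have inj: "inj_on (proj {v}) (span (set vs))"
 proof (rule inj_onI)
  fix x y assume xy: "x \<in> span (set vs)" "y \<in> span (set vs)" "proj {v} x = proj {v} y"
  then have "x - y \<in> span {v}" using proj_diff[of "{v}" x y] by (simp add: proj_eq_0_iff)
  then obtain k where k: "x - y = k *\<^sub>R v" by (auto simp: span_singleton)
  have "k = 0"
  proof (rule ccontr)
   assume "k \<noteq> 0"
   then have "v = (1 / k) *\<^sub>R (x - y)" by (simp add: k)
   then have "v \<in> span (set vs)" using xy by (auto intro: span_scale span_diff)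
   with v show False by simp
  qed
  with k show "x = y" by simp
 qed
 have "inj_on (proj {v}) (set vs)" by (rule inj_on_subset[OF inj span_superset])
 then show "distinct (map (proj {v}) vs)" using assms(1) by (simp add: distinct_map)
 show "independent (set (map (proj {v}) vs))"
  using linear_independent_injective_image[OF linear_proj vs inj] by simp
qed

text \<open>The saturated sublattice is an extension of its image modulo v by its intersection with
  the line of v. So a basis of the image is lifted and the primitive vector of the line is put in
  front, by induction on the number of vectors.\<close>

lemma lattice_section_basis:
 fixes M :: "'n::finite rvec set"
 assumes "kmodule \<int> M" "coordinatized \<int> M" "set vs \<subseteq> M" "distinct vs" "independent (set vs)"
 shows "\<exists>ms. length ms = length vs \<and> set ms \<subseteq> M \<and> M \<inter> span (set vs) = kspan \<int> (set ms)"
 using assms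
proof (induction "length vs" arbitrary: M vs)
 case 0
 have "kspan \<int> {} = {0 :: 'n rvec}" by (auto simp: kspan_def intro: exI[of _ "{}"])
 then show ?case using kmoduleD(1)[OF 0(2)] 0(1) by auto
next
 case (Suc n vs')
 then obtain v vs where vs': "vs' = v # vs" "length vs = n" by (cases vs') auto
 note Cons = Suc.hyps(1) Suc.prems[unfolded vs'(1)]
 have K: "real_subring \<int>" by (rule real_subring_Ints)
 have vne: "v \<noteq> 0" using Cons(6) dependent_zero[of "set (v # vs)"] by auto
 have vM: "v \<in> M" using Cons(4) by simp
 obtain t where t: "t > 0" "t *\<^sub>R v \<in> M" "M \<inter> span {v} = range (\<lambda>m::int. of_int m *\<^sub>R (t *\<^sub>R v))"
  using primitive_multiple[OF Cons(2,3) vM vne] by blast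
 let ?M = "proj {v} ` M"
 obtain ms1 where ms1: "length ms1 = length vs" "set ms1 \<subseteq> ?M"
  "?M \<inter> span (set (map (proj {v}) vs)) = kspan \<int> (set ms1)"
 proof -
  have "\<exists>ms. length ms = length (map (proj {v}) vs) \<and> set ms \<subseteq> ?M \<and>
    ?M \<inter> span (set (map (proj {v}) vs)) = kspan \<int> (set ms)"
  proof (rule Cons(1))
   show "kmodule \<int> ?M" by (rule kmodule_image[OF linear_proj Cons(2)])
   show "coordinatized \<int> ?M" by (rule coordinatized_proj_vector[OF K Cons(3) vM])
  qed (use Cons(2-) vs'(2) independent_proj_list[of v vs] in auto)
  then show thesis using that by auto
 qed
 define lift where "lift y = (SOME x. x \<in> M \<and> proj {v} x = y)" for y
 have lift: "lift y \<in> M" "proj {v} (lift y) = y" if "y \<in> ?M" for y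
  using someI_ex[of "\<lambda>x. x \<in> M \<and> proj {v} x = y"] that unfolding lift_def by auto
 define ms where "ms = (t *\<^sub>R v) # map lift ms1"
 have proj_ms: "proj {v} ` set (map lift ms1) = set ms1"
  using lift(2) ms1(2) by (force simp: image_image)
 have msM: "set ms \<subseteq> M" using lift(1) ms1(2) t(2) by (auto simp: ms_def)
 have "M \<inter> span (set (v # vs)) = kspan \<int> (set ms)"
 proof
  show "kspan \<int> (set ms) \<subseteq> M \<inter> span (set (v # vs))"
  proof (rule kspan_least)
   show "kmodule \<int> (M \<inter> span (set (v # vs)))"
    by (intro kmodule_Int Cons(2) kmodule_span)
   have "lift y \<in> span (set (v # vs))" if "y \<in> set ms1" for y
   proof -
    have "y \<in> kspan \<int> (set ms1)" using that kspan_superset[of \<int> "set ms1"] by auto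
    then have "y \<in> span (proj {v} ` set vs)" using ms1(3) by auto
    then have "proj {v} (lift y) \<in> span (proj {v} ` set vs)" using lift(2) ms1(2) that by auto
    then show ?thesis by (simp add: span_insert_proj)
   qed
   then show "set ms \<subseteq> M \<inter> span (set (v # vs))"
    using msM by (auto simp: ms_def span_base span_scale)
  qed
  show "M \<inter> span (set (v # vs)) \<subseteq> kspan \<int> (set ms)"
  proof
   fix x assume x: "x \<in> M \<inter> span (set (v # vs))"
   then have "proj {v} x \<in> ?M \<inter> span (set (map (proj {v}) vs))" by (simp add: span_insert_proj)
   then have "proj {v} x \<in> kspan \<int> (proj {v} ` set (map lift ms1))" unfolding ms1(3) proj_ms .
   then obtain y where y: "y \<in> kspan \<int> (set (map lift ms1))" "proj {v} x = proj {v} y"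
    using image_kspan[OF K linear_proj[of "{v}"], of "set (map lift ms1)"] by blast
   have "kspan \<int> (set (map lift ms1)) \<subseteq> M"
    using msM by (intro kspan_least Cons(2)) (auto simp: ms_def)
   then have "x - y \<in> M \<inter> span {v}"
    using x y proj_diff[of "{v}" x y] kmodule_diff[OF Cons(2) K, of x y]
    by (auto simp: proj_eq_0_iff[symmetric])
   then obtain m :: int where "x - y = of_int m *\<^sub>R (t *\<^sub>R v)" using t(3) by blast
   then have "x = of_int m *\<^sub>R (t *\<^sub>R v) + y" by (simp add: algebra_simps)
   moreover have "of_int m *\<^sub>R (t *\<^sub>R v) \<in> kspan \<int> (set ms)"
    by (rule kmoduleD(3)[OF kmodule_kspan[OF K]], simp,
      rule subsetD[OF kspan_superset]) (auto simp: ms_def)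
   moreover have "y \<in> kspan \<int> (set ms)"
    using y(1) kspan_mono[OF K, of "set (map lift ms1)" "set ms"] kspan_superset[of \<int> "set ms"]
    by (auto simp: ms_def)
   ultimately show "x \<in> kspan \<int> (set ms)"
    using kmoduleD(2)[OF kmodule_kspan[OF K]] by metis
  qed
 qed
 then show ?case unfolding vs'(1) using msM ms1(1) by (intro exI[of _ ms]) (auto simp: ms_def)
qed

section \<open>Integral dual forms\<close>

lemma linear_cmult: "linear f \<Longrightarrow> linear (\<lambda>x. c * f x)" for f :: "'v::real_vector \<Rightarrow> real"
 by (rule linearI) (simp_all add: linear_add linear_scale algebra_simps)

text \<open>Integrality can be had at the price of a common factor c. Over \<rat> that factor is
  divided out later; it also suffices for describing a cone by integral inequalities.\<close>

lemma integral_dual_family: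
 fixes M :: "'n::finite rvec set"
 assumes "coordinatized \<int> M" "set vs \<subseteq> M" "distinct vs" "independent (set vs)"
 shows "\<exists>c x. c > 0 \<and> c \<in> \<int> \<and> (\<forall>v\<in>set vs. linear (x v :: _ \<Rightarrow> real) \<and> x v ` M \<subseteq> \<int> \<and>
  (\<forall>w\<in>set vs. x v w = (if w = v then c else 0)))"
 using assms
proof (induction "length vs" arbitrary: M vs)
 case 0
 then show ?case by (intro exI[of _ 1]) simp
next
 case (Suc n vs')
 then obtain v vs where vs': "vs' = v # vs" "length vs = n" by (cases vs') auto
 note Cons = Suc.hyps(1) Suc.prems[unfolded vs'(1)]
 have vne: "v \<noteq> 0" using Cons(5) dependent_zero[of "set (v # vs)"] by auto
 have vM: "v \<in> M" and v: "v \<notin> set vs" using Cons(2-) by auto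
 have p0: "proj {v} v = 0" by (simp add: proj_eq_0_iff span_base)
 have inj: "proj {v} w = proj {v} w' \<longleftrightarrow> w = w'" if "w \<in> set vs" "w' \<in> set vs" for w w'
  using independent_proj_list(1)[OF Cons(4,5)] that by (auto simp: distinct_map inj_on_def)
 have "\<exists>c x. c > 0 \<and> c \<in> \<int> \<and> (\<forall>w\<in>set (map (proj {v}) vs). linear (x w :: _ \<Rightarrow> real) \<and> x w ` proj {v} ` M \<subseteq> \<int> \<and>
   (\<forall>u\<in>set (map (proj {v}) vs). x w u = (if u = w then c else 0)))"
  by (rule Cons(1))
   (use Cons(2-) vs'(2) independent_proj_list[of v vs] coordinatized_proj_vector[OF real_subring_Ints _ vM]
    in auto)
 then obtain c1 x1 where c1pos: "c1 > 0" and c1: "c1 \<in> \<int>" and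
  x1: "\<forall>w\<in>set (map (proj {v}) vs). linear (x1 w :: _ \<Rightarrow> real) \<and> x1 w ` proj {v} ` M \<subseteq> \<int> \<and>
   (\<forall>u\<in>set (map (proj {v}) vs). x1 w u = (if u = w then c1 else 0))"
  by blast
 have 1: "c1 > 0"
  "\<And>w. w \<in> set vs \<Longrightarrow> linear (x1 (proj {v} w) :: _ \<Rightarrow> real)"
  "\<And>w y. w \<in> set vs \<Longrightarrow> y \<in> M \<Longrightarrow> x1 (proj {v} w) (proj {v} y) \<in> \<int>"
  "\<And>w u. w \<in> set vs \<Longrightarrow> u \<in> set vs \<Longrightarrow> x1 (proj {v} w) (proj {v} u) = (if u = w then c1 else 0)"
  using c1pos x1 inj by (simp_all add: image_subset_iff)
 obtain T S :: "'n rvec \<Rightarrow> 'n rvec" where TS: "linear T" "linear S"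
  "\<And>x. x \<in> M \<Longrightarrow> S (T x) = x" "\<And>x i. x \<in> M \<Longrightarrow> T x $ i \<in> \<int>"
  using Cons(2) unfolding coordinatized_def by blast
 have "T v \<noteq> 0" using TS(3)[OF vM] vne linear_0[OF TS(2)] by metis
 then obtain i where i: "T v $ i \<noteq> 0" by (auto simp: vec_eq_iff)
 \<comment> \<open>The sign makes y positive at v, so that the new common factor stays
   positive.\<close>
 define s where "s = (if T v $ i > 0 then 1 else - 1 :: real)"
 define y where "y x = s * T x $ i" for x
 have y: "linear y" "\<And>x. x \<in> M \<Longrightarrow> y x \<in> \<int>" "y v > 0"
  unfolding y_def using TS(4) i
  by (auto intro!: linearI simp: linear_add[OF TS(1)] linear_scale[OF TS(1)] algebra_simps s_def)
 \<comment> \<open>The forms of the quotient, pulled back, already vanish on v. The one for v is y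
   corrected by them so as to vanish on the other vectors; the factors c1 and y v are distributed so
   that all diagonal values become c1 * y v.\<close>
 define x where "x w = (if w = v then (\<lambda>z. c1 * y z - (\<Sum>u\<in>set vs. y u * x1 (proj {v} u) (proj {v} z)))
  else (\<lambda>z. y v * x1 (proj {v} w) (proj {v} z)))" for w
 have lin: "linear (\<lambda>z. x1 (proj {v} w) (proj {v} z))" if "w \<in> set vs" for w
  using linear_compose[OF linear_proj 1(2)[OF that]] by (simp add: o_def)
 have x10: "x1 (proj {v} w) 0 = 0" if "w \<in> set vs" for w using linear_0[OF 1(2)[OF that]] .
 have "linear (x w) \<and> x w ` M \<subseteq> \<int> \<and> (\<forall>u\<in>set (v # vs). x w u = (if u = w then c1 * y v else 0))"
  if w: "w \<in> set (v # vs)" for w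
 proof (cases "w = v")
  case True
  have "linear (x v)"
   unfolding x_def if_P[OF refl]
   by (intro linear_compose_sub linear_compose_sum linear_cmult y(1) ballI lin)
  moreover have "x v z \<in> \<int>" if "z \<in> M" for z
   unfolding x_def if_P[OF refl]
   using Cons(3) by (intro Ints_diff Ints_mult Ints_sum c1 y(2) that 1(3)) auto
  moreover have "x v u = (if u = v then c1 * y v else 0)" if u: "u \<in> set (v # vs)" for u
  proof (cases "u = v")
   case True
   then show ?thesis by (simp add: x_def p0 x10)
  next
   case False
   then have u': "u \<in> set vs" using u by simp
   have "(\<Sum>w\<in>set vs. y w * x1 (proj {v} w) (proj {v} u)) = (\<Sum>w\<in>set vs. if w = u then y u * c1 else 0)"
    using u' by (intro sum.cong) (auto simp: 1(4))
   then show ?thesis using False u' by (simp add: x_def)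
  qed
  ultimately show ?thesis unfolding True by blast
 next
  case False
  then have w': "w \<in> set vs" using w by simp
  have "linear (x w)"
   using False linear_cmult[OF lin[OF w'], of "y v"] by (simp add: x_def)
  moreover have "x w ` M \<subseteq> \<int>"
   using False 1(3)[OF w'] y(2)[OF vM] by (auto simp: x_def)
  moreover have "x w u = (if u = w then c1 * y v else 0)" if "u \<in> set (v # vs)" for u
  proof (cases "u = v")
   case True
   then show ?thesis using False by (auto simp: x_def p0 x10[OF w'])
  next
   case F: False
   then have "u \<in> set vs" using that by simp
   then show ?thesis using False 1(4)[OF w'] by (simp add: x_def)
  qed
  ultimately show ?thesis by blast
 qed
 then show ?case unfolding vs'(1) using 1(1) y(3) by (intro exI[of _ "c1 * y v"] exI[of _ x])
   (simp add: Ints_mult c1 y(2) vM)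
qed

section \<open>Extension of forms to real linear functionals\<close>

text \<open>Provides the pivot for eliminating a coordinate: over \<rat> any element with nonzero
  value will do, over \<int> one whose value generates the image of x.\<close>

lemma kmodule_ratio:
 fixes x :: "'v::real_vector \<Rightarrow> real"
 assumes K: "K = \<int> \<or> K = \<rat>" and S: "kmodule K S" and x: "linear x" "x ` S \<subseteq> K"
  and s: "s \<in> S" "x s \<noteq> 0"
 shows "\<exists>s0\<in>S. x s0 \<noteq> 0 \<and> (\<forall>s\<in>S. x s / x s0 \<in> K)"
 using K
proof
 assume "K = \<rat>"
 then show ?thesis using x(2) s by (intro bexI[of _ s]) (auto intro!: Rats_divide)
next
 assume K: "K = \<int>"
 have "kmodule \<int> (x ` S)" using kmodule_image[OF x(1) S] K by simp
 moreover have "x ` S \<subseteq> \<int>" "x s \<in> x ` S" using x(2) s(1) K by auto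
 ultimately obtain g where g: "g \<in> x ` S" "0 < g" "x ` S = range (\<lambda>m::int. of_int m * g)"
  using integers_cyclic[OF _ _ _ s(2)] by blast
 obtain s0 where s0: "s0 \<in> S" "x s0 = g" using g(1) by blast
 have "x s / g \<in> \<int>" if "s \<in> S" for s
 proof -
  have "x s \<in> range (\<lambda>m::int. of_int m * g)" using that unfolding g(3)[symmetric] by (rule imageI)
  then obtain m :: int where "x s = of_int m * g" by (elim rangeE)
  then show ?thesis using g(2) by simp
 qed
 then show ?thesis using s0 g(2) K by (intro bexI[of _ s0]) auto
qed

text \<open>A K-linear form on a module embedded by finitely many K-valued coordinates is a real
  combination of them. Elimination: the form is adjusted on the kernel of one coordinate by
  induction, and what remains is proportional to that coordinate.\<close>

lemma kmodule_form_extension: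
 fixes x :: "'i \<Rightarrow> 'v::real_vector \<Rightarrow> real"
 assumes K: "K = \<int> \<or> K = \<rat>" and "finite J" "kmodule K S"
  and "\<And>j. j \<in> J \<Longrightarrow> linear (x j)" "\<And>j. j \<in> J \<Longrightarrow> x j ` S \<subseteq> K"
  and "\<And>s. s \<in> S \<Longrightarrow> (\<forall>j\<in>J. x j s = 0) \<Longrightarrow> s = 0"
  and "\<And>s t. s \<in> S \<Longrightarrow> t \<in> S \<Longrightarrow> \<phi> (s + t) = \<phi> s + \<phi> t"
  and "\<And>c s. c \<in> K \<Longrightarrow> s \<in> S \<Longrightarrow> \<phi> (c *\<^sub>R s) = c * \<phi> s"
 shows "\<exists>r. \<forall>s\<in>S. \<phi> s = (\<Sum>j\<in>J. r j * x j s)"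
 using assms(2-)
proof (induction J arbitrary: S rule: finite_induct)
 case empty
 have "\<phi> s = 0" if "s \<in> S" for s
 proof -
  have "0 \<in> K" using K by auto
  then have "\<phi> (0 *\<^sub>R s) = 0" using empty.prems(6)[OF _ that, of 0] by simp
  moreover have "s = 0" using empty.prems(4)[OF that] by simp
  ultimately show ?thesis by simp
 qed
 then show ?case by simp
next
 case (insert i J)
 have sub: "real_subring K" using K real_subring_Ints real_subring_Rats by auto
 define S0 where "S0 = S \<inter> {s. x i s = 0}"
 have lin: "linear (x i)" using insert.prems(2) by simp
 have "kmodule K {s. x i s = 0}"
  by (auto simp: kmodule_def linear_0[OF lin] linear_add[OF lin] linear_scale[OF lin])
 then have S0: "kmodule K S0" unfolding S0_def by (rule kmodule_Int[OF insert.prems(1)])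
 have "\<exists>r. \<forall>s\<in>S0. \<phi> s = (\<Sum>j\<in>J. r j * x j s)"
 proof (rule insert.IH[OF S0])
  show "s = 0" if "s \<in> S0" "\<forall>j\<in>J. x j s = 0" for s
   using insert.prems(4)[of s] that by (simp add: S0_def)
  show "x j ` S0 \<subseteq> K" if "j \<in> J" for j
   using insert.prems(3)[of j] that by (auto simp: S0_def)
 qed (use insert.prems(2,5,6) in \<open>auto simp: S0_def\<close>)
 then obtain r where r: "\<And>s. s \<in> S0 \<Longrightarrow> \<phi> s = (\<Sum>j\<in>J. r j * x j s)" by blast
 \<comment> \<open>The remainder vanishes on the kernel of \<open>x i\<close>; subtracting a
   K-multiple of the pivot moves any s into that kernel, so the remainder is a multiple of
   \<open>x i\<close>.\<close>
 define \<psi> where "\<psi> s = \<phi> s - (\<Sum>j\<in>J. r j * x j s)" for s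
 have \<psi>_diff: "\<psi> (s - c *\<^sub>R t) = \<psi> s - c * \<psi> t" if "s \<in> S" "t \<in> S" "c \<in> K" for s t c
 proof -
  have "(- c) *\<^sub>R t \<in> S" "- c \<in> K"
   using kmoduleD(3)[OF insert.prems(1) real_subringD(3)[OF sub that(3)] that(2)]
    real_subringD(3)[OF sub that(3)] by blast+
  then have "\<phi> (s - c *\<^sub>R t) = \<phi> s - c * \<phi> t"
   using insert.prems(5)[OF that(1), of "(- c) *\<^sub>R t"] insert.prems(6)[of "- c" t] that(2) by simp
  moreover have *: "x j (s - c *\<^sub>R t) = x j s - c * x j t" if "j \<in> J" for j
   using insert.prems(2)[of j] that by (simp add: linear_diff linear_scale)
  have "(\<Sum>j\<in>J. r j * x j (s - c *\<^sub>R t)) = (\<Sum>j\<in>J. r j * x j s) - c * (\<Sum>j\<in>J. r j * x j t)"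
   unfolding sum_distrib_left sum_subtractf[symmetric]
   by (rule sum.cong[OF refl]) (simp add: * right_diff_distrib mult_ac)
  ultimately show ?thesis by (simp add: \<psi>_def algebra_simps)
 qed
 have ins: "(\<Sum>j\<in>insert i J. (r(i := k)) j * x j s) = k * x i s + (\<Sum>j\<in>J. r j * x j s)" for k s
 proof -
  have "(\<Sum>j\<in>J. (r(i := k)) j * x j s) = (\<Sum>j\<in>J. r j * x j s)"
   using insert.hyps(2) by (intro sum.cong) auto
  then show ?thesis using insert.hyps by simp
 qed
 show ?case
 proof (cases "\<exists>s\<in>S. x i s \<noteq> 0")
  case False
  then have "\<phi> s = 0 * x i s + (\<Sum>j\<in>J. r j * x j s)" if "s \<in> S" for s
   using r[of s] that by (simp add: S0_def)
  then show ?thesis unfolding ins[of 0, symmetric] by blast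
 next
  case True
  then obtain s1 where s1: "s1 \<in> S" "x i s1 \<noteq> 0" by blast
  obtain s0 where s0: "s0 \<in> S" "x i s0 \<noteq> 0" "\<And>s. s \<in> S \<Longrightarrow> x i s / x i s0 \<in> K"
   using kmodule_ratio[OF K insert.prems(1) lin _ s1] insert.prems(3)[of i] by auto
  have "\<phi> s = (\<psi> s0 / x i s0) * x i s + (\<Sum>j\<in>J. r j * x j s)" if s: "s \<in> S" for s
  proof -
   let ?c = "x i s / x i s0"
   have c: "- ?c \<in> K" using real_subringD(3)[OF sub s0(3)[OF s]] .
   have "s - ?c *\<^sub>R s0 \<in> S0"
    using kmodule_diff[OF insert.prems(1) sub s kmoduleD(3)[OF insert.prems(1) s0(3)[OF s] s0(1)]] s0(2)
    by (simp add: S0_def linear_diff[OF lin] linear_scale[OF lin])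
   then have "\<psi> (s - ?c *\<^sub>R s0) = 0" by (simp add: \<psi>_def r)
   then have "\<psi> s = ?c * \<psi> s0" using \<psi>_diff[OF s s0(1) s0(3)[OF s]] by simp
   then have "\<phi> s = ?c * \<psi> s0 + (\<Sum>j\<in>J. r j * x j s)" by (simp add: \<psi>_def[of s])
   then show ?thesis by (simp add: mult.commute)
  qed
  then show ?thesis unfolding ins[of "\<psi> s0 / x i s0", symmetric] by blast
 qed
qed

text \<open>Coordinates of M induce coordinates on every sum of exterior powers inside it: wedges of
  vectors with entries in K have entries in K, and S shows that nothing is lost. One T serves all
  families and degrees.\<close>

lemma coordinatized_ext_power:
 fixes M :: "'n::{finite,linorder} rvec set"
 assumes K: "real_subring K" and M: "coordinatized K M"
 shows "\<exists>T. linear T \<and> (\<forall>\<L> p x. \<L> \<subseteq> Pow M \<longrightarrow> x \<in> ext_power K \<L> p \<longrightarrow>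
  (\<forall>I. ext_map T x $ I \<in> K) \<and> (ext_map T x = 0 \<longrightarrow> x = 0))"
proof -
 obtain T S :: "'n rvec \<Rightarrow> 'n rvec" where TS: "linear T" "linear S"
  "\<And>x. x \<in> M \<Longrightarrow> S (T x) = x" "\<And>x i. x \<in> M \<Longrightarrow> T x $ i \<in> K"
  using M unfolding coordinatized_def by blast
 have w: "wedge vs $ I \<in> K" if "\<forall>v\<in>set vs. \<forall>i. v $ i \<in> K" for I and vs :: "'n rvec list"
  using that
 proof (induction vs arbitrary: I)
  case Nil
  then show ?case using real_subringD[OF K] by (simp add: ext_one_def axis_def)
 next
  case (Cons v vs)
  have "kmodule K K" using real_subringD[OF K] by (auto simp: kmodule_def)
  moreover have "shuffle_sign A B \<in> K" for A B :: "'n set"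
   using real_subringD[OF K] minus_one_power_iff[of "card {(i, j). i \<in> A \<and> j \<in> B \<and> j < i}", where 'a = real]
   by (auto simp: shuffle_sign_def)
  ultimately show ?case
   using Cons real_subringD(6)[OF K] by (auto simp: ext_vec_mult_nth intro!: kmodule_sum)
 qed
 show ?thesis
 proof (intro exI[of _ T] conjI allI impI TS(1))
  fix \<L> p x I assume \<L>: "\<L> \<subseteq> Pow M" and x: "x \<in> ext_power K \<L> p"
  have "ext_power K \<L> p \<subseteq> ext_map T -` {y. \<forall>I. y $ I \<in> K}"
  proof (rule ext_power_least)
   show "kmodule K (ext_map T -` {y. \<forall>I. y $ I \<in> K})"
    using real_subringD[OF K] by (intro kmodule_vimage linear_ext_map) (auto simp: kmodule_def)
   fix vs L assume "L \<in> \<L>" "set vs \<subseteq> L" "length vs = p"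
   then have "set vs \<subseteq> M" using \<L> by auto
   then show "wedge vs \<in> ext_map T -` {y. \<forall>I. y $ I \<in> K}"
    using w[of "map T vs"] TS(4) by (simp add: ext_map_wedge[OF TS(1)] subset_iff)
  qed
  then show "ext_map T x $ I \<in> K" using x by auto
 next
  fix \<L> p x assume \<L>: "\<L> \<subseteq> Pow M" and x: "x \<in> ext_power K \<L> p" and 0: "ext_map T x = 0"
  have lin: "linear (\<lambda>y. ext_map S (ext_map T y) - y)"
   by (rule linearI) (simp_all add: ext_map_linear algebra_simps)
  have "ext_power K \<L> p \<subseteq> (\<lambda>y. ext_map S (ext_map T y) - y) -` {0}"
  proof (rule ext_power_least)
   show "kmodule K ((\<lambda>y. ext_map S (ext_map T y) - y) -` {0})"
    by (intro kmodule_vimage lin) (auto simp: kmodule_def)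
   fix vs L assume "L \<in> \<L>" "set vs \<subseteq> L" "length vs = p"
   then have "set vs \<subseteq> M" using \<L> by auto
   then have "map (\<lambda>v. S (T v)) vs = vs" using TS(3) by (intro map_idI) auto
   then show "wedge vs \<in> (\<lambda>y. ext_map S (ext_map T y) - y) -` {0}"
    by (simp add: ext_map_wedge TS(1,2) o_def)
  qed
  then have "ext_map S (ext_map T x) = x" using x by auto
  then show "x = 0" using 0 ext_map_linear(1) by metis
 qed
qed

text \<open>Elements of \<open>kdual\<close> are zero off their module and so are not linear on the
  ambient space; shuffle products are formed with linear functionals extending them.\<close>

lemma kdual_real_extension:
 fixes M :: "'n::{finite,linorder} rvec set"
 assumes K: "K = \<int> \<or> K = \<rat>" and M: "coordinatized K M" and \<L>: "\<L> \<subseteq> Pow M"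
  and \<phi>: "\<phi> \<in> kdual K (ext_power K \<L> p)"
 shows "\<exists>g. linear g \<and> (\<forall>x\<in>ext_power K \<L> p. g x = \<phi> x)"
proof -
 have sub: "real_subring K" using K real_subring_Ints real_subring_Rats by auto
 obtain T where T0: "linear T" "\<forall>\<L> p x. \<L> \<subseteq> Pow M \<longrightarrow> x \<in> ext_power K \<L> p \<longrightarrow>
  (\<forall>I. ext_map T x $ I \<in> K) \<and> (ext_map T x = 0 \<longrightarrow> x = 0)"
  using coordinatized_ext_power[OF sub M] by (elim exE conjE)
 have T: "linear T" "\<And>x I. x \<in> ext_power K \<L> p \<Longrightarrow> ext_map T x $ I \<in> K"
  "\<And>x. x \<in> ext_power K \<L> p \<Longrightarrow> ext_map T x = 0 \<Longrightarrow> x = 0"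
  using T0(1) T0(2)[rule_format, OF \<L>] by simp_all
 have lin: "linear (\<lambda>x. ext_map T x $ I)" for I
  by (rule linearI) (simp_all add: ext_map_linear)
 have "\<exists>r. \<forall>s\<in>ext_power K \<L> p. \<phi> s = (\<Sum>I\<in>UNIV. r I * ext_map T s $ I)"
  by (rule kmodule_form_extension[OF K finite kmodule_ext_power[OF sub] lin])
   (use T \<phi> in \<open>auto simp: kdual_def vec_eq_iff\<close>)
 then obtain r where r: "\<And>s. s \<in> ext_power K \<L> p \<Longrightarrow> \<phi> s = (\<Sum>I\<in>UNIV. r I * ext_map T s $ I)" by blast
 have "linear (\<lambda>s. \<Sum>I\<in>UNIV. r I * ext_map T s $ I)"
  by (rule linearI) (simp_all add: ext_map_linear
    algebra_simps sum.distrib sum_distrib_left)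
 with r show ?thesis by auto
qed

lemma kdual_restrict0:
 assumes "linear g" "g ` S \<subseteq> K" "kmodule K S"
 shows "restrict0 S g \<in> kdual K S"
 using assms kmoduleD[OF assms(3)]
 by (auto simp: kdual_def restrict0_def linear_add linear_scale)

text \<open>Gives uniqueness in definitions by duality, in particular for the cap product.\<close>

lemma kdual_separates:
 fixes M :: "'n::{finite,linorder} rvec set"
 assumes K: "real_subring K" and M: "coordinatized K M" and \<L>: "\<L> \<subseteq> Pow M"
  and x: "x \<in> ext_power K \<L> p" "x \<noteq> 0"
 shows "\<exists>\<phi>\<in>kdual K (ext_power K \<L> p). \<phi> x \<noteq> 0"
proof -
 obtain T where T0: "linear T" "\<forall>\<L> p x. \<L> \<subseteq> Pow M \<longrightarrow> x \<in> ext_power K \<L> p \<longrightarrow>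
  (\<forall>I. ext_map T x $ I \<in> K) \<and> (ext_map T x = 0 \<longrightarrow> x = 0)"
  using coordinatized_ext_power[OF K M] by (elim exE conjE)
 have T: "linear T" "\<And>x I. x \<in> ext_power K \<L> p \<Longrightarrow> ext_map T x $ I \<in> K"
  "\<And>x. x \<in> ext_power K \<L> p \<Longrightarrow> ext_map T x = 0 \<Longrightarrow> x = 0"
  using T0(1) T0(2)[rule_format, OF \<L>] by simp_all
 obtain I where I: "ext_map T x $ I \<noteq> 0" using T(3)[OF x(1)] x(2) by (auto simp: vec_eq_iff)
 have "restrict0 (ext_power K \<L> p) (\<lambda>x. ext_map T x $ I) \<in> kdual K (ext_power K \<L> p)"
  by (rule kdual_restrict0[OF _ _ kmodule_ext_power[OF K]])
   (use T(2) in \<open>auto intro!: linearI simp: ext_map_linear\<close>)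
 then show ?thesis using I x(1) by (intro bexI) (auto simp: restrict0_def)
qed

section \<open>Simplicial cones\<close>

abbreviation ccone :: "'v::real_vector set \<Rightarrow> 'v set" where
 "ccone B \<equiv> convex_cone hull B"

lemma mem_cone_hull_finite:
 assumes "finite B"
 shows "x \<in> ccone B \<longleftrightarrow> (\<exists>c. (\<forall>b\<in>B. 0 \<le> c b) \<and> x = (\<Sum>b\<in>B. c b *\<^sub>R b))"
proof
 let ?C = "{x. \<exists>c. (\<forall>b\<in>B. 0 \<le> c b) \<and> x = (\<Sum>b\<in>B. c b *\<^sub>R b)}"
 have "convex_cone ?C"
  unfolding convex_cone_iff
 proof (intro conjI ballI allI impI)
  show "0 \<in> ?C" by (auto intro!: exI[of _ "\<lambda>_. 0"])
 next
  fix x y assume "x \<in> ?C" "y \<in> ?C"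
  then obtain c c' where "\<forall>b\<in>B. 0 \<le> c b" "\<forall>b\<in>B. 0 \<le> c' b"
   "x = (\<Sum>b\<in>B. c b *\<^sub>R b)" "y = (\<Sum>b\<in>B. c' b *\<^sub>R b)" by blast
  then show "x + y \<in> ?C"
   by (intro CollectI exI[of _ "\<lambda>b. c b + c' b"]) (simp add: scaleR_add_left sum.distrib)
 next
  fix x and k :: real assume "x \<in> ?C" "0 \<le> k"
  then obtain c where "\<forall>b\<in>B. 0 \<le> c b" "x = (\<Sum>b\<in>B. c b *\<^sub>R b)" by blast
  then show "k *\<^sub>R x \<in> ?C" using \<open>0 \<le> k\<close>
   by (intro CollectI exI[of _ "\<lambda>b. k * c b"]) (simp add: scaleR_sum_right)
 qed
 moreover have "B \<subseteq> ?C"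
 proof
  fix b assume b: "b \<in> B"
  have "b = (\<Sum>a\<in>B. (if a = b then 1 else 0) *\<^sub>R a)"
   using assms b by (simp add: if_distrib[of "\<lambda>k. k *\<^sub>R _"] cong: if_cong)
  then show "b \<in> ?C" by (intro CollectI exI[of _ "\<lambda>a. if a = b then 1 else 0"]) auto
 qed
 ultimately have "ccone B \<subseteq> ?C" by (intro hull_minimal)
 then show "x \<in> ccone B \<Longrightarrow> \<exists>c. (\<forall>b\<in>B. 0 \<le> c b) \<and> x = (\<Sum>b\<in>B. c b *\<^sub>R b)" by blast
next
 assume "\<exists>c. (\<forall>b\<in>B. 0 \<le> c b) \<and> x = (\<Sum>b\<in>B. c b *\<^sub>R b)"
 then obtain c where c: "\<forall>b\<in>B. 0 \<le> c b" "x = (\<Sum>b\<in>B. c b *\<^sub>R b)" by blast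
 have "(\<Sum>b\<in>A. c b *\<^sub>R b) \<in> ccone B" if "finite A" "A \<subseteq> B" for A
  using that
 proof (induction A rule: finite_induct)
  case empty
  then show ?case by (simp add: convex_cone_hull_contains_0)
 next
  case (insert a A)
  then have "a \<in> ccone B" by (auto intro: hull_inc)
  then have "c a *\<^sub>R a \<in> ccone B" using c(1) insert.prems by (intro convex_cone_hull_mul) auto
  then show ?case using insert by (simp add: convex_cone_hull_add)
 qed
 then show "x \<in> ccone B" using c(2) assms by simp
qed

lemma independent_coeffs:
 assumes "independent B" "finite B" "(\<Sum>b\<in>B. c b *\<^sub>R b) = (\<Sum>b\<in>B. c' b *\<^sub>R b)" "b \<in> B"
 shows "c b = c' b"
proof -
 have "(\<Sum>b\<in>B. (c b - c' b) *\<^sub>R b) = 0"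
  using assms(3) by (simp add: scaleR_diff_left sum_subtractf)
 from independentD[OF assms(1,2) order_refl this assms(4)] show ?thesis by simp
qed

lemma cone_hull_subset_span: "ccone B \<subseteq> span B"
 by (rule hull_minimal)
  (auto simp: convex_cone_iff span_base span_add span_scale intro: span_0)

lemma span_cone_hull [simp]: "span (ccone B) = span B"
proof
 show "span (ccone B) \<subseteq> span B" by (rule span_minimal[OF cone_hull_subset_span subspace_span])
 show "span B \<subseteq> span (ccone B)" by (rule span_mono) (simp add: hull_subset)
qed

lemma cone_hull_Int_independent:
 assumes "independent B" "finite B" "A \<subseteq> B"
 shows "B \<inter> span A = A"
proof
 show "B \<inter> span A \<subseteq> A"
 proof
  fix b assume b: "b \<in> B \<inter> span A"
  show "b \<in> A"
  proof (rule ccontr)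
   assume "b \<notin> A"
   then have "A \<subseteq> B - {b}" using assms(3) by auto
   then have "b \<in> span (B - {b})" using b span_mono by blast
   then show False using assms(1) b by (auto simp: dependent_def)
  qed
 qed
qed (use assms in \<open>auto intro: span_base\<close>)

text \<open>In the coordinates of B, a convex combination with positive weights of nonnegative
  coefficients vanishes only if both coefficients do; so the ends of a segment through the subcone
  lie in it.\<close>

lemma face_of_simplicial_cone:
 fixes B :: "'v::euclidean_space set"
 assumes B: "independent B" "A \<subseteq> B"
 shows "ccone A face_of ccone B"
proof -
 have fin: "finite B" using B(1) by (rule independent_imp_finite)
 then have finA: "finite A" using B(2) finite_subset by blast
 show ?thesis
  unfolding face_of_def
 proof (intro conjI ballI impI)
  show "ccone A \<subseteq> ccone B" by (rule hull_mono[OF B(2)])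
  show "convex (ccone A)" by (rule convex_convex_cone_hull)
  fix a b x
  assume ab: "a \<in> ccone B" "b \<in> ccone B" and x: "x \<in> ccone A"
   and seg: "x \<in> open_segment a b"
  obtain ca where ca: "\<forall>k\<in>B. 0 \<le> ca k" "a = (\<Sum>k\<in>B. ca k *\<^sub>R k)"
   using ab(1) mem_cone_hull_finite[OF fin] by blast
  obtain cb where cb: "\<forall>k\<in>B. 0 \<le> cb k" "b = (\<Sum>k\<in>B. cb k *\<^sub>R k)"
   using ab(2) mem_cone_hull_finite[OF fin] by blast
  obtain cx where cx: "\<forall>k\<in>A. 0 \<le> cx k" "x = (\<Sum>k\<in>A. cx k *\<^sub>R k)"
   using x mem_cone_hull_finite[OF finA] by blast
  obtain u where u: "0 < u" "u < 1" "x = (1 - u) *\<^sub>R a + u *\<^sub>R b"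
   using seg by (auto simp: in_segment)
  have "(\<Sum>k\<in>B. ((1 - u) * ca k + u * cb k) *\<^sub>R k) = x"
   unfolding u(3) ca(2) cb(2) by (simp add: scaleR_sum_right scaleR_add_left sum.distrib)
  also have "x = (\<Sum>k\<in>B. (if k \<in> A then cx k else 0) *\<^sub>R k)"
   unfolding cx(2) using fin B(2) by (intro sum.mono_neutral_cong_left) auto
  finally have eq: "(\<Sum>k\<in>B. ((1 - u) * ca k + u * cb k) *\<^sub>R k) = (\<Sum>k\<in>B. (if k \<in> A then cx k else 0) *\<^sub>R k)" .
  have 0: "ca k = 0 \<and> cb k = 0" if k: "k \<in> B - A" for k
  proof -
   have "(1 - u) * ca k + u * cb k = 0" using independent_coeffs[OF B(1) fin eq, of k] k by auto
   moreover have "0 \<le> (1 - u) * ca k" "0 \<le> u * cb k" using ca(1) cb(1) k u by auto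
   ultimately have "(1 - u) * ca k = 0" "u * cb k = 0" by linarith+
   then show ?thesis using u by simp
  qed
  have "a = (\<Sum>k\<in>A. ca k *\<^sub>R k)" "b = (\<Sum>k\<in>A. cb k *\<^sub>R k)"
   unfolding ca(2) cb(2) using fin B(2) 0 by (auto intro!: sum.mono_neutral_right)
  then show "a \<in> ccone A" "b \<in> ccone A"
   using ca(1) cb(1) B(2) mem_cone_hull_finite[OF finA] by blast+
 qed
qed

text \<open>x + y is the midpoint of 2x and 2y, and faces of cones are conic; only x = y, where the
  segment degenerates, needs a separate argument.\<close>

lemma face_of_cone_hull_sum:
 fixes F :: "'v::euclidean_space set"
 assumes F: "F face_of C" and C: "convex_cone C" and xy: "x \<in> C" "y \<in> C" "x + y \<in> F"
 shows "x \<in> F"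
proof -
 have con: "conic C" "convex C" using C by (auto simp: convex_cone_def)
 have 0: "0 \<in> C" by (rule convex_cone_contains_0[OF C])
 have cF: "conic F" by (rule face_of_conic[OF con(1) F])
 have x2: "2 *\<^sub>R x \<in> C" "2 *\<^sub>R y \<in> C" using con(1) xy by (auto simp: conic_def)
 show ?thesis
 proof (cases "x = y")
  case True
  then have "x + y = 2 *\<^sub>R x" by (simp add: scaleR_2)
  then have "(1/2) *\<^sub>R (2 *\<^sub>R x) \<in> F" using cF xy(3) unfolding conic_def by (metis divide_nonneg_nonneg zero_le_numeral zero_le_one)
  then show ?thesis by simp
 next
  case False
  have "x + y = (1 - 1/2) *\<^sub>R (2 *\<^sub>R x) + (1/2) *\<^sub>R (2 *\<^sub>R y)" by simp
  then have "x + y \<in> open_segment (2 *\<^sub>R x) (2 *\<^sub>R y)"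
   unfolding in_segment using False by (intro conjI exI[of _ "1/2"]) auto
  then have "2 *\<^sub>R x \<in> F" using F x2 xy(3) unfolding face_of_def by blast
  then have "(1/2) *\<^sub>R (2 *\<^sub>R x) \<in> F" using cF unfolding conic_def by (metis divide_nonneg_nonneg zero_le_numeral zero_le_one)
  then show ?thesis by simp
 qed
qed

text \<open>A generator occurring in a point of the face with positive coefficient is itself in the
  face, as a summand of that point.\<close>

lemma face_of_finite_cone:
 fixes B :: "'v::euclidean_space set"
 assumes "finite B" "F face_of ccone B" "F \<noteq> {}"
 shows "F = ccone (B \<inter> F)"
proof
 let ?C = "ccone B"
 have C: "convex_cone ?C" by (rule convex_cone_convex_cone_hull)
 have "convex_cone F"
  unfolding convex_cone_def
  using assms(3) face_of_imp_convex[OF assms(2)] face_of_conic[OF conic_convex_cone_hull assms(2)] by simp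
 then show "ccone (B \<inter> F) \<subseteq> F" by (intro hull_minimal) auto
 show "F \<subseteq> ccone (B \<inter> F)"
 proof
  fix x assume x: "x \<in> F"
  then have "x \<in> ?C" using face_of_imp_subset[OF assms(2)] by auto
  then obtain c where c: "\<forall>b\<in>B. 0 \<le> c b" "x = (\<Sum>b\<in>B. c b *\<^sub>R b)"
   using mem_cone_hull_finite[OF assms(1)] by blast
  have zero: "c b *\<^sub>R b = 0" if b: "b \<in> B" "b \<notin> F" for b
  proof (rule ccontr)
   assume "c b *\<^sub>R b \<noteq> 0"
   then have pos: "c b > 0" using c(1) b(1) by (auto simp: less_le)
   have "x = c b *\<^sub>R b + (\<Sum>b\<in>B - {b}. c b *\<^sub>R b)" unfolding c(2) by (rule sum.remove[OF assms(1) b(1)])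
   moreover have "c b *\<^sub>R b \<in> ?C" using pos b(1) by (intro convex_cone_hull_mul) (auto intro: hull_inc)
   moreover have "(\<Sum>b\<in>B - {b}. c b *\<^sub>R b) \<in> ?C"
   proof -
    have "(\<Sum>b\<in>B - {b}. c b *\<^sub>R b) \<in> ccone (B - {b})"
     using c(1) assms(1) by (subst mem_cone_hull_finite) auto
    then show ?thesis using hull_mono[of "B - {b}" B convex_cone] by auto
   qed
   ultimately have "c b *\<^sub>R b \<in> F" using face_of_cone_hull_sum[OF assms(2) C] x by metis
   then have "(1 / c b) *\<^sub>R (c b *\<^sub>R b) \<in> F"
    using face_of_conic[OF conic_convex_cone_hull assms(2)] pos unfolding conic_def
    by (metis divide_nonneg_pos zero_le_one)
   then show False using pos b by simp
  qed
  have "x = (\<Sum>b\<in>B \<inter> F. c b *\<^sub>R b)"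
   unfolding c(2) using assms(1) zero by (intro sum.mono_neutral_right) auto
  then show "x \<in> ccone (B \<inter> F)"
   using c(1) assms(1) by (subst mem_cone_hull_finite) auto
 qed
qed

section \<open>Simplicial rational fans\<close>

locale simplicial_lattice_fan =
 fixes N :: "'n::{finite,linorder} rvec set" and \<Sigma> :: "'n rvec set set"
 assumes lattice: "is_lattice N" and fan: "is_fan N \<Sigma>" and simplicial: "simplicial_fan \<Sigma>"
begin

lemma N_module: "kmodule \<int> N" and N_coordinatized: "coordinatized \<int> N"
 using is_lattice_coordinatized[OF lattice] by auto

lemma finite_fan: "finite \<Sigma>"
 using fan by (simp add: is_fan_def)

lemma face_mem: "\<sigma> \<in> \<Sigma> \<Longrightarrow> \<tau> face_of \<sigma> \<Longrightarrow> \<tau> \<noteq> {} \<Longrightarrow> \<tau> \<in> \<Sigma>"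
 and Int_face: "\<sigma> \<in> \<Sigma> \<Longrightarrow> \<eta> \<in> \<Sigma> \<Longrightarrow> \<sigma> \<inter> \<eta> face_of \<sigma>"
 and Int_face': "\<sigma> \<in> \<Sigma> \<Longrightarrow> \<eta> \<in> \<Sigma> \<Longrightarrow> \<sigma> \<inter> \<eta> face_of \<eta>"
 using fan by (auto simp: is_fan_def)

lemma fan_cone:
 assumes "\<sigma> \<in> \<Sigma>"
 shows "convex_cone \<sigma>" "\<sigma> \<inter> uminus ` \<sigma> = {0}" "0 \<in> \<sigma>" "\<exists>V. finite V \<and> V \<subseteq> N \<and> \<sigma> = ccone V"
proof -
 have r: "rational_cone N \<sigma>" using fan assms by (simp add: is_fan_def)
 then show V: "\<exists>V. finite V \<and> V \<subseteq> N \<and> \<sigma> = ccone V" "\<sigma> \<inter> uminus ` \<sigma> = {0}"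
  by (simp_all add: rational_cone_def)
 then show c: "convex_cone \<sigma>" using convex_cone_convex_cone_hull by blast
 then show "0 \<in> \<sigma>" by (rule convex_cone_contains_0)
qed

text \<open>Some lattice vector on the ray, not necessarily the primitive one.\<close>

definition gen :: "'n rvec set \<Rightarrow> 'n rvec" where
 "gen \<rho> = (SOME v. v \<in> N \<and> v \<noteq> 0 \<and> \<rho> = ccone {v})"

definition gens :: "'n rvec set \<Rightarrow> 'n rvec set" where
 "gens \<sigma> = gen ` rays \<sigma>"

lemma gen:
 assumes "\<rho> \<in> \<Sigma>" "dim \<rho> = 1"
 shows "gen \<rho> \<in> N" "gen \<rho> \<noteq> 0" "\<rho> = ccone {gen \<rho>}"
proof -
 obtain V where V: "finite V" "V \<subseteq> N" "\<rho> = ccone V" using fan_cone(4)[OF assms(1)] by blast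
 have "\<not> V \<subseteq> {0}"
 proof
  assume "V \<subseteq> {0}"
  then have "span V \<subseteq> {0}" using span_minimal[of V "{0}"] by (simp add: subspace_def)
  then have "dim \<rho> = 0" using cone_hull_subset_span[of V] V(3) by (metis dim_eq_0 subset_trans)
  then show False using assms(2) by simp
 qed
 then obtain v where v: "v \<in> V" "v \<noteq> 0" by auto
 have v\<rho>: "v \<in> \<rho>" using V(3) v(1) by (simp add: hull_inc)
 have "span \<rho> = span {v}"
 proof -
  have "dim (span {v}) = 1" using v(2) by (simp add: dim_span dim_singleton)
  moreover have "span {v} \<subseteq> span \<rho>" using v\<rho> by (intro span_mono) auto
  ultimately show ?thesis using assms(2) subspace_dim_equal[of "span {v}" "span \<rho>"] by (simp add: dim_span)
 qed
 have "\<rho> = ccone {v}"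
 proof
  show "ccone {v} \<subseteq> \<rho>" using v\<rho> fan_cone(1)[OF assms(1)] by (intro hull_minimal) auto
  show "\<rho> \<subseteq> ccone {v}"
  proof
   fix x assume x: "x \<in> \<rho>"
   then have "x \<in> span {v}" using \<open>span \<rho> = span {v}\<close> span_base by blast
   then obtain t where t: "x = t *\<^sub>R v" by (auto simp: span_singleton)
   have "t \<ge> 0"
   proof (rule ccontr)
    assume "\<not> t \<ge> 0"
    then have "- v = (- 1 / t) *\<^sub>R x" "0 \<le> - 1 / t" using t by auto
    then have "- v \<in> \<rho>" using x fan_cone(1)[OF assms(1)] unfolding convex_cone_def conic_def by metis
    then have "v \<in> \<rho> \<inter> uminus ` \<rho>" using v\<rho> by (auto intro!: image_eqI[of _ _ "- v"])
    then show False using fan_cone(2)[OF assms(1)] v(2) by auto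
   qed
   then show "x \<in> ccone {v}" unfolding t by (intro convex_cone_hull_mul) (auto intro: hull_inc)
  qed
 qed
 then have "\<exists>v. v \<in> N \<and> v \<noteq> 0 \<and> \<rho> = ccone {v}" using v V(2) by blast
 from someI_ex[OF this] show "gen \<rho> \<in> N" "gen \<rho> \<noteq> 0" "\<rho> = ccone {gen \<rho>}"
  unfolding gen_def by auto
qed

lemma rays_fan: "\<sigma> \<in> \<Sigma> \<Longrightarrow> \<rho> \<in> rays \<sigma> \<Longrightarrow> \<rho> \<in> \<Sigma> \<and> dim \<rho> = 1 \<and> \<rho> face_of \<sigma>"
 using face_mem by (auto simp: rays_def)

lemma gens:
 assumes \<sigma>: "\<sigma> \<in> \<Sigma>"
 shows "finite (gens \<sigma>)" "gens \<sigma> \<subseteq> N" "gens \<sigma> \<subseteq> \<sigma>" "independent (gens \<sigma>)"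
  "\<sigma> = ccone (gens \<sigma>)" "card (gens \<sigma>) = dim \<sigma>" "span (gens \<sigma>) = span \<sigma>"
proof -
 have r: "\<rho> \<in> \<Sigma>" "dim \<rho> = 1" "\<rho> face_of \<sigma>" if "\<rho> \<in> rays \<sigma>" for \<rho>
  using rays_fan[OF \<sigma> that] by auto
 have finr: "finite (rays \<sigma>)" using finite_subset[OF _ finite_fan, of "rays \<sigma>"] r by auto
 then show fin: "finite (gens \<sigma>)" by (simp add: gens_def)
 show "gens \<sigma> \<subseteq> N" using gen(1) r by (auto simp: gens_def)
 have g\<rho>: "gen \<rho> \<in> \<rho>" if "\<rho> \<in> rays \<sigma>" for \<rho>
  using gen(3)[OF r(1,2)[OF that]] by (metis hull_inc insertI1)
 show sub: "gens \<sigma> \<subseteq> \<sigma>" using g\<rho> r(3) face_of_imp_subset by (fastforce simp: gens_def)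
 have hull: "\<sigma> = ccone (\<Union> (rays \<sigma>))" and crd: "card (rays \<sigma>) = dim \<sigma>"
  using simplicial \<sigma> by (auto simp: simplicial_fan_def)
 show eq: "\<sigma> = ccone (gens \<sigma>)"
 proof
  show "ccone (gens \<sigma>) \<subseteq> \<sigma>" using sub fan_cone(1)[OF \<sigma>] by (rule hull_minimal)
  have "\<rho> \<subseteq> ccone (gens \<sigma>)" if "\<rho> \<in> rays \<sigma>" for \<rho>
   using gen(3)[OF r(1,2)[OF that]] hull_mono[of "{gen \<rho>}" "gens \<sigma>" convex_cone] that
   by (auto simp: gens_def)
  then have "ccone (\<Union> (rays \<sigma>)) \<subseteq> ccone (gens \<sigma>)"
   by (intro hull_minimal convex_cone_convex_cone_hull) auto
  then show "\<sigma> \<subseteq> ccone (gens \<sigma>)" using hull by simp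
 qed
 show sp: "span (gens \<sigma>) = span \<sigma>" by (subst (2) eq) simp
 \<comment> \<open>At most dim \<sigma> vectors spanning a space of that dimension are independent,
   so the count of rays in \<open>simplicial_fan\<close> already yields a basis.\<close>
 have "card (gens \<sigma>) \<le> dim \<sigma>" using card_image_le[OF finr, of gen] crd by (simp add: gens_def)
 then show ind: "independent (gens \<sigma>)"
  using card_le_dim_spanning[OF sub _ fin] sp span_superset[of \<sigma>] by simp
 show "card (gens \<sigma>) = dim \<sigma>"
  using dim_eq_card[OF sp ind] by simp
qed

lemma gens_face:
 assumes \<sigma>: "\<sigma> \<in> \<Sigma>" and \<tau>: "\<tau> face_of \<sigma>" "\<tau> \<in> \<Sigma>"
 shows "gens \<tau> = gens \<sigma> \<inter> \<tau>"
proof -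
 have "\<rho> face_of \<tau> \<longleftrightarrow> \<rho> face_of \<sigma> \<and> \<rho> \<subseteq> \<tau>" for \<rho>
  using face_of_trans[OF _ \<tau>(1)] face_of_subset[OF _ _ face_of_imp_subset[OF \<tau>(1)]] face_of_imp_subset
  by blast
 then have "rays \<tau> = {\<rho> \<in> rays \<sigma>. \<rho> \<subseteq> \<tau>}"
  by (auto simp: rays_def)
 moreover have "\<rho> \<subseteq> \<tau> \<longleftrightarrow> gen \<rho> \<in> \<tau>" if "\<rho> \<in> rays \<sigma>" for \<rho>
 proof -
  have r: "\<rho> \<in> \<Sigma>" "dim \<rho> = 1" using rays_fan[OF \<sigma> that] by auto
  have "gen \<rho> \<in> \<rho>" using gen(3)[OF r] by (metis hull_inc insertI1)
  moreover have "\<rho> \<subseteq> \<tau>" if "gen \<rho> \<in> \<tau>"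
  proof -
   have "ccone {gen \<rho>} \<subseteq> \<tau>"
    by (rule hull_minimal) (use that fan_cone(1)[OF \<tau>(2)] in auto)
   then show ?thesis using gen(3)[OF r] by simp
  qed
  ultimately show ?thesis by blast
 qed
 ultimately show ?thesis by (auto simp: gens_def)
qed

text \<open>Turns the face order into inclusion of finite sets, the form in which the combinatorics
  of the compactification is handled below.\<close>

lemma face_of_iff_gens:
 assumes "\<sigma> \<in> \<Sigma>" "\<tau> \<in> \<Sigma>"
 shows "\<tau> face_of \<sigma> \<longleftrightarrow> gens \<tau> \<subseteq> gens \<sigma>"
proof
 show "\<tau> face_of \<sigma> \<Longrightarrow> gens \<tau> \<subseteq> gens \<sigma>" using gens_face[OF assms(1) _ assms(2)] by auto
 assume "gens \<tau> \<subseteq> gens \<sigma>"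
 from face_of_simplicial_cone[OF gens(4)[OF assms(1)] this]
 show "\<tau> face_of \<sigma>" using gens(5)[OF assms(1)] gens(5)[OF assms(2)] by simp
qed

lemma gens_inj: "\<sigma> \<in> \<Sigma> \<Longrightarrow> \<tau> \<in> \<Sigma> \<Longrightarrow> gens \<sigma> = gens \<tau> \<Longrightarrow> \<sigma> = \<tau>"
 using gens(5) by metis

text \<open>The converse passage from ray sets to cones: in a simplicial fan every set of rays of a
  cone spans a face, and no further ray appears because the generators are independent.\<close>

lemma cone_subset_gens:
 assumes \<sigma>: "\<sigma> \<in> \<Sigma>" and A: "A \<subseteq> gens \<sigma>"
 shows "ccone A \<in> \<Sigma>" "gens (ccone A) = A"
proof -
 have f: "ccone A face_of \<sigma>"
  by (subst gens(5)[OF \<sigma>]) (rule face_of_simplicial_cone[OF gens(4)[OF \<sigma>] A])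
 show m: "ccone A \<in> \<Sigma>"
  by (rule face_mem[OF \<sigma> f]) (rule convex_cone_hull_nonempty)
 have "gens \<sigma> \<inter> ccone A \<subseteq> A"
  using cone_hull_Int_independent[OF gens(4)[OF \<sigma>] gens(1)[OF \<sigma>] A] cone_hull_subset_span[of A] by auto
 moreover have "A \<subseteq> ccone A" by (rule hull_subset)
 ultimately show "gens (ccone A) = A"
  using gens_face[OF \<sigma> f m] A by blast
qed

lemma zero_cone: "{0} \<in> \<Sigma>" "\<sigma> \<in> \<Sigma> \<Longrightarrow> {0} face_of \<sigma>" "gens {0} = {}"
proof -
 obtain \<sigma>0 where \<sigma>0: "\<sigma>0 \<in> \<Sigma>" using fan by (auto simp: is_fan_def)
 show 1: "{0} \<in> \<Sigma>" "gens {0} = {}" using cone_subset_gens[OF \<sigma>0, of "{}"] by simp_all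
 show "\<sigma> \<in> \<Sigma> \<Longrightarrow> {0} face_of \<sigma>" using face_of_iff_gens[OF _ 1(1)] 1(2) by simp
qed

lemma subset_imp_face:
 assumes "\<sigma> \<in> \<Sigma>" "\<eta> \<in> \<Sigma>" "\<sigma> \<subseteq> \<eta>" shows "\<sigma> face_of \<eta>"
 using Int_face'[OF assms(1,2)] assms(3) by (simp add: Int_absorb2)

lemma proj_gens: "\<sigma> \<in> \<Sigma> \<Longrightarrow> proj (gens \<sigma>) = proj \<sigma>"
 by (rule proj_cong_span) (rule gens(7))

lemma proj_N_module: "kmodule \<int> (proj \<tau> ` N)"
 by (rule kmodule_image[OF linear_proj N_module])

lemma proj_N_coordinatized: "\<tau> \<in> \<Sigma> \<Longrightarrow> coordinatized \<int> (proj \<tau> ` N)"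
 using coordinatized_proj[OF real_subring_Ints N_coordinatized gens(1,2)] proj_gens by metis

text \<open>span \<tau> meets the span of the remaining generators only in 0, by uniqueness of
  coefficients in the basis \<open>gens \<sigma>\<close>.\<close>

lemma independent_proj_gens:
 assumes \<sigma>: "\<sigma> \<in> \<Sigma>" and \<tau>: "\<tau> \<in> \<Sigma>" "\<tau> face_of \<sigma>"
 shows "inj_on (proj \<tau>) (span (gens \<sigma> - gens \<tau>))" "independent (proj \<tau> ` (gens \<sigma> - gens \<tau>))"
  "inj_on (proj \<tau>) (gens \<sigma> - gens \<tau>)"
proof -
 let ?B = "gens \<sigma> - gens \<tau>"
 have sub: "gens \<tau> \<subseteq> gens \<sigma>" using face_of_iff_gens[OF \<sigma> \<tau>(1)] \<tau>(2) by simp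
 have finB: "finite ?B" using gens(1)[OF \<sigma>] by simp
 have indB: "independent ?B" by (rule independent_mono[OF gens(4)[OF \<sigma>]]) auto
 show inj: "inj_on (proj \<tau>) (span ?B)"
 proof (rule inj_onI)
  fix x y assume xy: "x \<in> span ?B" "y \<in> span ?B" "proj \<tau> x = proj \<tau> y"
  then have "x - y \<in> span (gens \<tau>)"
   using proj_diff[of \<tau> x y] gens(7)[OF \<tau>(1)] by (simp add: proj_eq_0_iff)
  moreover have "x - y \<in> span ?B" using xy by (intro span_diff)
  ultimately obtain c k where c: "x - y = (\<Sum>b\<in>gens \<tau>. c b *\<^sub>R b)" and k: "x - y = (\<Sum>b\<in>?B. k b *\<^sub>R b)"
   using span_finite[OF gens(1)[OF \<tau>(1)]] span_finite[OF finB] by auto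
  have c': "x - y = (\<Sum>b\<in>gens \<sigma>. (if b \<in> gens \<tau> then c b else 0) *\<^sub>R b)"
   unfolding c using sub gens(1)[OF \<sigma>] by (intro sum.mono_neutral_cong_left) auto
  have k': "x - y = (\<Sum>b\<in>gens \<sigma>. (if b \<in> ?B then k b else 0) *\<^sub>R b)"
   unfolding k using gens(1)[OF \<sigma>] by (intro sum.mono_neutral_cong_left) auto
  have "(if b \<in> gens \<tau> then c b else 0) = (if b \<in> ?B then k b else 0)" if "b \<in> gens \<sigma>" for b
   using independent_coeffs[OF gens(4,1)[OF \<sigma>] trans[OF c'[symmetric] k'] that] .
  then have "k b = 0" if "b \<in> ?B" for b using that by (metis DiffD1 DiffD2)
  then show "x = y" using k by simp
 qed
 show "independent (proj \<tau> ` ?B)" by (rule linear_independent_injective_image[OF linear_proj indB inj])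
 show "inj_on (proj \<tau>) ?B" by (rule inj_on_subset[OF inj span_superset])
qed

lemma proj_cone:
 assumes \<sigma>: "\<sigma> \<in> \<Sigma>" and \<tau>: "\<tau> \<in> \<Sigma>" "\<tau> face_of \<sigma>"
 shows "proj \<tau> ` \<sigma> = ccone (proj \<tau> ` (gens \<sigma> - gens \<tau>))"
  "span (proj \<tau> ` \<sigma>) = span (proj \<tau> ` (gens \<sigma> - gens \<tau>))"
  "dim (proj \<tau> ` \<sigma>) = dim \<sigma> - dim \<tau>"
proof -
 let ?B = "gens \<sigma> - gens \<tau>"
 have sub: "gens \<tau> \<subseteq> gens \<sigma>" using face_of_iff_gens[OF \<sigma> \<tau>(1)] \<tau>(2) by simp
 have z: "proj \<tau> x = 0" if "x \<in> gens \<tau>" for x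
  using gens(3)[OF \<tau>(1)] that by (auto simp: proj_eq_0_iff intro: span_base)
 have "proj \<tau> ` \<sigma> = ccone (proj \<tau> ` gens \<sigma>)"
  by (subst gens(5)[OF \<sigma>]) (rule convex_cone_hull_linear_image[OF linear_proj, symmetric])
 also have "\<dots> = ccone (proj \<tau> ` ?B)"
 proof
  show "ccone (proj \<tau> ` gens \<sigma>) \<subseteq> ccone (proj \<tau> ` ?B)"
  proof (rule hull_minimal, clarify)
   fix x assume "x \<in> gens \<sigma>"
   then show "proj \<tau> x \<in> ccone (proj \<tau> ` ?B)"
    by (cases "x \<in> gens \<tau>") (auto simp: z convex_cone_hull_contains_0 intro: hull_inc)
  qed (rule convex_cone_convex_cone_hull)
 qed (intro hull_mono image_mono, auto)
 finally show eq: "proj \<tau> ` \<sigma> = ccone (proj \<tau> ` ?B)" .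
 show sp: "span (proj \<tau> ` \<sigma>) = span (proj \<tau> ` ?B)" unfolding eq by simp
 have "dim (proj \<tau> ` \<sigma>) = card (proj \<tau> ` ?B)"
  using sp independent_proj_gens(2)[OF assms] by (metis dim_eq_card)
 also have "\<dots> = card ?B" by (rule card_image[OF independent_proj_gens(3)[OF assms]])
 also have "\<dots> = dim \<sigma> - dim \<tau>"
  using card_Diff_subset[OF gens(1)[OF \<tau>(1)] sub] gens(6)[OF \<sigma>] gens(6)[OF \<tau>(1)] by simp
 finally show "dim (proj \<tau> ` \<sigma>) = dim \<sigma> - dim \<tau>" .
qed

lemma span_cone_sum:
 assumes \<tau>: "\<tau> \<in> \<Sigma>" and "x \<in> span \<tau>"
 shows "\<exists>p\<in>\<tau>. \<exists>q\<in>\<tau>. x = p - q"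
proof -
 have "x \<in> span (gens \<tau>)" using assms gens(7) by simp
 then obtain c where c: "x = (\<Sum>b\<in>gens \<tau>. c b *\<^sub>R b)" using span_finite[OF gens(1)[OF \<tau>]] by auto
 let ?p = "\<Sum>b\<in>gens \<tau>. max (c b) 0 *\<^sub>R b" and ?q = "\<Sum>b\<in>gens \<tau>. max (- c b) 0 *\<^sub>R b"
 have m: "(\<Sum>b\<in>gens \<tau>. max (g b) 0 *\<^sub>R b) \<in> \<tau>" for g
  by (subst gens(5)[OF \<tau>], subst mem_cone_hull_finite[OF gens(1)[OF \<tau>]])
   (rule exI[of _ "\<lambda>b. max (g b) 0"], simp)
 have "x = ?p - ?q"
  unfolding c sum_subtractf[symmetric] scaleR_diff_left[symmetric]
  by (intro sum.cong refl arg_cong2[where f = scaleR]) auto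
 then show ?thesis using m[of c] m[of "\<lambda>b. - c b"] by (intro bexI)
qed

text \<open>If x and y have the same image, then x - y = p - q with p, q in \<tau>. The point x + q
  = y + p has that image too and lies in both cones, since \<tau> is a face of each.\<close>

lemma proj_image_Int:
 assumes "\<sigma> \<in> \<Sigma>" "\<eta> \<in> \<Sigma>" "\<tau> \<in> \<Sigma>" "\<tau> face_of \<sigma>" "\<tau> face_of \<eta>"
 shows "proj \<tau> ` \<sigma> \<inter> proj \<tau> ` \<eta> = proj \<tau> ` (\<sigma> \<inter> \<eta>)"
proof
 show "proj \<tau> ` \<sigma> \<inter> proj \<tau> ` \<eta> \<subseteq> proj \<tau> ` (\<sigma> \<inter> \<eta>)"
 proof
  fix z assume "z \<in> proj \<tau> ` \<sigma> \<inter> proj \<tau> ` \<eta>"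
  then obtain x y where z: "z = proj \<tau> y" and xy: "proj \<tau> x = proj \<tau> y" "x \<in> \<sigma>" "y \<in> \<eta>" by auto
  then have "x - y \<in> span \<tau>" using proj_diff[of \<tau> x y] by (simp add: proj_eq_0_iff)
  then obtain p q where pq: "p \<in> \<tau>" "q \<in> \<tau>" "x - y = p - q" using span_cone_sum[OF assms(3)] by blast
  have sub: "\<tau> \<subseteq> \<sigma>" "\<tau> \<subseteq> \<eta>" using assms(4,5) by (auto dest: face_of_imp_subset)
  have "x + q = y + p" using pq(3) by (simp add: algebra_simps)
  moreover have "x + q \<in> \<sigma>" "y + p \<in> \<eta>"
   using fan_cone(1)[OF assms(1)] fan_cone(1)[OF assms(2)] xy pq sub by (auto intro: convex_cone_add)
  ultimately have "x + q \<in> \<sigma> \<inter> \<eta>" by simp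
  moreover have "proj \<tau> (x + q) = proj \<tau> x"
   using pq(2) by (intro proj_eqI) (simp add: span_base)
  ultimately show "z \<in> proj \<tau> ` (\<sigma> \<inter> \<eta>)" using xy(1) z by (metis imageI)
 qed
qed auto

lemma proj_image_subset_iff:
 assumes "\<sigma> \<in> \<Sigma>" "\<eta> \<in> \<Sigma>" "\<tau> \<in> \<Sigma>" "\<tau> face_of \<sigma>" "\<tau> face_of \<eta>"
 shows "proj \<tau> ` \<sigma> \<subseteq> proj \<tau> ` \<eta> \<longleftrightarrow> \<sigma> face_of \<eta>"
proof
 show "\<sigma> face_of \<eta> \<Longrightarrow> proj \<tau> ` \<sigma> \<subseteq> proj \<tau> ` \<eta>" by (auto dest: face_of_imp_subset)
 assume sub: "proj \<tau> ` \<sigma> \<subseteq> proj \<tau> ` \<eta>"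
 have t: "\<tau> \<subseteq> \<sigma>" using assms(4) by (rule face_of_imp_subset)
 have "\<sigma> \<subseteq> \<eta>"
 proof
  fix x assume x: "x \<in> \<sigma>"
  then have "proj \<tau> x \<in> proj \<tau> ` (\<sigma> \<inter> \<eta>)" using sub proj_image_Int[OF assms] by blast
  then obtain y where y: "y \<in> \<sigma> \<inter> \<eta>" "proj \<tau> x = proj \<tau> y" by blast
  then have "x - y \<in> span \<tau>" using proj_diff[of \<tau> x y] by (simp add: proj_eq_0_iff)
  then obtain p q where pq: "p \<in> \<tau>" "q \<in> \<tau>" "x - y = p - q" using span_cone_sum[OF assms(3)] by blast
  have "x + q = y + p" using pq(3) by (simp add: algebra_simps)
  moreover have "y + p \<in> \<eta>" "x + q \<in> \<sigma>"
   using fan_cone(1)[OF assms(1)] fan_cone(1)[OF assms(2)] y pq x t assms(5)[THEN face_of_imp_subset]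
   by (auto intro: convex_cone_add)
  ultimately have "x + q \<in> \<sigma> \<inter> \<eta>" by simp
  \<comment> \<open>The sum x + q lies in the face \<sigma> \<inter> \<eta> of \<sigma>, so its
    summand x does as well.\<close>
  from face_of_cone_hull_sum[OF Int_face[OF assms(1,2)] fan_cone(1)[OF assms(1)] x _ this]
  show "x \<in> \<eta>" using pq t by auto
 qed
 then show "\<sigma> face_of \<eta>" by (rule subset_imp_face[OF assms(1,2)])
qed

lemma proj_image_inj:
 assumes "\<sigma> \<in> \<Sigma>" "\<eta> \<in> \<Sigma>" "\<tau> \<in> \<Sigma>" "\<tau> face_of \<sigma>" "\<tau> face_of \<eta>" "proj \<tau> ` \<sigma> = proj \<tau> ` \<eta>"
 shows "\<sigma> = \<eta>"
 using proj_image_subset_iff[OF assms(1-5)] proj_image_subset_iff[OF assms(2,1,3,5,4)] assms(6)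
 by (auto dest: face_of_imp_subset)

lemma proj_face_of_iff:
 assumes "\<sigma> \<in> \<Sigma>" "\<eta> \<in> \<Sigma>" "\<tau> \<in> \<Sigma>" "\<tau> face_of \<sigma>" "\<tau> face_of \<eta>"
 shows "proj \<tau> ` \<sigma> face_of proj \<tau> ` \<eta> \<longleftrightarrow> \<sigma> face_of \<eta>"
proof
 show "proj \<tau> ` \<sigma> face_of proj \<tau> ` \<eta> \<Longrightarrow> \<sigma> face_of \<eta>"
  using proj_image_subset_iff[OF assms] face_of_imp_subset by blast
 assume "\<sigma> face_of \<eta>"
 then have "gens \<sigma> - gens \<tau> \<subseteq> gens \<eta> - gens \<tau>" using face_of_iff_gens[OF assms(2,1)] by auto
 then show "proj \<tau> ` \<sigma> face_of proj \<tau> ` \<eta>"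
  unfolding proj_cone(1)[OF assms(1,3,4)] proj_cone(1)[OF assms(2,3,5)]
  by (intro face_of_simplicial_cone independent_proj_gens(2) image_mono assms)
qed

text \<open>A face of the quotient cone is spanned by the images it contains; adding the rays of
  \<tau> to their preimages gives the cone \<zeta>.\<close>

lemma face_of_proj_image:
 assumes \<sigma>: "\<sigma> \<in> \<Sigma>" and \<tau>: "\<tau> \<in> \<Sigma>" "\<tau> face_of \<sigma>" and F: "F face_of proj \<tau> ` \<sigma>" "F \<noteq> {}"
 shows "\<exists>\<zeta>\<in>\<Sigma>. \<tau> face_of \<zeta> \<and> \<zeta> face_of \<sigma> \<and> F = proj \<tau> ` \<zeta>"
proof -
 let ?B = "gens \<sigma> - gens \<tau>"
 have sub: "gens \<tau> \<subseteq> gens \<sigma>" using face_of_iff_gens[OF \<sigma> \<tau>(1)] \<tau>(2) by simp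
 define A where "A = {b \<in> ?B. proj \<tau> b \<in> F}"
 have "F = ccone (proj \<tau> ` ?B \<inter> F)"
  using F gens(1)[OF \<sigma>] unfolding proj_cone(1)[OF \<sigma> \<tau>] by (intro face_of_finite_cone) auto
 also have "proj \<tau> ` ?B \<inter> F = proj \<tau> ` A" by (auto simp: A_def)
 finally have F': "F = ccone (proj \<tau> ` A)" .
 define \<zeta> where "\<zeta> = ccone (gens \<tau> \<union> A)"
 have \<zeta>: "\<zeta> \<in> \<Sigma>" "gens \<zeta> = gens \<tau> \<union> A"
  using cone_subset_gens[OF \<sigma>, of "gens \<tau> \<union> A"] sub by (auto simp: \<zeta>_def A_def)
 have f: "\<tau> face_of \<zeta>" "\<zeta> face_of \<sigma>"
  using face_of_iff_gens[OF \<zeta>(1) \<tau>(1)] face_of_iff_gens[OF \<sigma> \<zeta>(1)] \<zeta>(2) sub by (auto simp: A_def)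
 have "gens \<zeta> - gens \<tau> = A" using \<zeta>(2) by (auto simp: A_def)
 then have "proj \<tau> ` \<zeta> = F" using proj_cone(1)[OF \<zeta>(1) \<tau>(1) f(1)] F' by simp
 then show ?thesis using \<zeta>(1) f by blast
qed

lemma dim_face_mono:
 fixes \<sigma> \<tau> :: "'v::euclidean_space set"
 assumes "\<tau> face_of \<sigma>" shows "dim \<tau> \<le> dim \<sigma>"
 using face_of_imp_subset[OF assms] by (rule dim_subset)

lemma face_dim_eq:
 assumes "\<sigma> \<in> \<Sigma>" "\<tau> \<in> \<Sigma>" "\<tau> face_of \<sigma>" "dim \<tau> = dim \<sigma>" shows "\<tau> = \<sigma>"
proof -
 have "gens \<tau> \<subseteq> gens \<sigma>" using face_of_iff_gens assms by blast
 then have "gens \<tau> = gens \<sigma>" using gens(1,6) assms by (metis card_subset_eq)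
 then show ?thesis using gens_inj assms by metis
qed

end

section \<open>Orientations and incidence signs\<close>

lemma wedge_ext_vec_commute: "wedge vs \<^bold>\<and> ext_vec v = (-1) ^ length vs *\<^sub>R (ext_vec v \<^bold>\<and> wedge vs)"
proof (induction vs)
 case (Cons w vs)
 then show ?case
  by (simp add: ext_mult_assoc ext_mult_scale_right ext_vec_anticommute[of w v])
qed simp

lemma wedge_mult_kernel:
 assumes "v \<in> span (set us)" shows "wedge us \<^bold>\<and> (ext_vec v \<^bold>\<and> x) = 0"
proof -
 have "wedge us \<^bold>\<and> (ext_vec v \<^bold>\<and> x) = (wedge us \<^bold>\<and> ext_vec v) \<^bold>\<and> x" by (simp add: ext_mult_assoc)
 also have "\<dots> = 0" by (simp add: wedge_ext_vec_commute wedge_span_zero[OF assms])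
 finally show ?thesis .
qed

text \<open>After multiplication by \<open>wedge us\<close> the other factors matter only modulo
  \<open>span (set us)\<close>. This makes the lifts in the definitions of signs irrelevant.\<close>

lemma wedge_mult_congruent:
 assumes "\<And>v. v \<in> set vs \<Longrightarrow> v - f v \<in> span (set us)"
 shows "wedge us \<^bold>\<and> wedge vs = wedge us \<^bold>\<and> wedge (map f vs)"
 using assms
proof (induction vs)
 case (Cons v vs)
 have swap: "wedge us \<^bold>\<and> (ext_vec w \<^bold>\<and> y) = (-1) ^ length us *\<^sub>R (ext_vec w \<^bold>\<and> (wedge us \<^bold>\<and> y))" for w y
 proof -
  have "wedge us \<^bold>\<and> (ext_vec w \<^bold>\<and> y) = (wedge us \<^bold>\<and> ext_vec w) \<^bold>\<and> y" by (simp add: ext_mult_assoc)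
  then show ?thesis by (simp add: wedge_ext_vec_commute ext_mult_scale_left ext_mult_assoc)
 qed
 have "ext_vec v = ext_vec (v - f v) + ext_vec (f v)" by (simp flip: ext_vec_add)
 then have "wedge us \<^bold>\<and> wedge (v # vs) = wedge us \<^bold>\<and> (ext_vec (f v) \<^bold>\<and> wedge vs)"
  using wedge_mult_kernel[of "v - f v" us "wedge vs"] Cons.prems
  by (simp add: ext_mult_add_left ext_mult_add_right)
 also have "\<dots> = wedge us \<^bold>\<and> wedge (map f (v # vs))"
  using Cons by (simp add: swap)
 finally show ?case .
qed simp

lemma proj_proj_subset:
 assumes "\<tau> \<subseteq> span \<sigma>" shows "proj \<tau> (proj \<sigma> x) = proj \<sigma> x"
 by (rule proj_unique) (use assms in \<open>auto simp: span_0 intro: proj_orth\<close>)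

lemma proj_idem: "proj \<tau> (proj \<tau> x) = proj \<tau> x"
 by (rule proj_proj) simp

text \<open>Since \<tau> lies in span \<sigma>, a vector is in span \<sigma> as soon as its image is
  in the image of span \<sigma>. So N_\<sigma> / N_\<tau> is the saturated sublattice cut out of the
  quotient lattice by the projected cone.\<close>

lemma proj_section:
 assumes "\<tau> \<subseteq> span \<sigma>"
 shows "proj \<tau> ` (N \<inter> span \<sigma>) = proj \<tau> ` N \<inter> span (proj \<tau> ` \<sigma>)"
proof -
 have sp: "span (proj \<tau> ` \<sigma>) = proj \<tau> ` span \<sigma>" by (rule span_linear_image[OF linear_proj])
 have "x \<in> span \<sigma>" if "proj \<tau> x = proj \<tau> y" "y \<in> span \<sigma>" for x y
 proof -
  have "x - y \<in> span \<tau>" using that(1) proj_diff[of \<tau> x y] by (simp add: proj_eq_0_iff)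
  then have "x - y \<in> span \<sigma>" using span_minimal[OF assms subspace_span] by blast
  from span_add[OF this that(2)] show ?thesis by simp
 qed
 then show ?thesis unfolding sp by blast
qed

context simplicial_lattice_fan
begin

abbreviation \<F> :: "'n face set" where
 "\<F> \<equiv> faces \<Sigma>"

lemma faces_iff: "(\<tau>, \<sigma>) \<in> \<F> \<longleftrightarrow> \<tau> \<in> \<Sigma> \<and> \<sigma> \<in> \<Sigma> \<and> \<tau> face_of \<sigma>"
 by (simp add: faces_def)

lemma finite_faces: "finite \<F>"
 by (rule finite_subset[of _ "\<Sigma> \<times> \<Sigma>"]) (auto simp: faces_def finite_fan)

lemma face_subset_span: "\<tau> face_of \<sigma> \<Longrightarrow> \<tau> \<subseteq> span \<sigma>" for \<sigma> \<tau> :: "'n rvec set"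
 by (meson face_of_imp_subset span_superset subset_trans)

lemma face_lattice_basis:
 assumes "(\<tau>, \<sigma>) \<in> \<F>"
 shows "\<exists>ms. length ms = dim \<sigma> - dim \<tau> \<and> face_lattice N (\<tau>, \<sigma>) = kspan \<int> (set ms) \<and>
  span (set ms) = span (proj \<tau> ` \<sigma>)"
proof -
 have f: "\<tau> \<in> \<Sigma>" "\<sigma> \<in> \<Sigma>" "\<tau> face_of \<sigma>" using assms by (auto simp: faces_iff)
 let ?B = "proj \<tau> ` (gens \<sigma> - gens \<tau>)"
 obtain vs where vs: "set vs = ?B" "distinct vs"
  using finite_distinct_list[of ?B] gens(1)[OF f(2)] by auto
 have "length vs = card ?B" using vs distinct_card by metis
 also have "\<dots> = dim (proj \<tau> ` \<sigma>)"
  using dim_eq_card[OF proj_cone(2)[OF f(2,1,3), symmetric] independent_proj_gens(2)[OF f(2,1,3)]] by simp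
 finally have len: "length vs = dim \<sigma> - dim \<tau>" using proj_cone(3)[OF f(2,1,3)] by simp
 have sub: "set vs \<subseteq> proj \<tau> ` N" using vs gens(2)[OF f(2)] by auto
 have "independent (set vs)" using vs independent_proj_gens(2)[OF f(2,1,3)] by simp
 from lattice_section_basis[OF proj_N_module proj_N_coordinatized[OF f(1)] sub vs(2) this]
 obtain ms where ms: "length ms = length vs" "proj \<tau> ` N \<inter> span (set vs) = kspan \<int> (set ms)" by blast
 have sp: "span (set vs) = span (proj \<tau> ` \<sigma>)" using proj_cone(2)[OF f(2,1,3)] vs(1) by simp
 have "face_lattice N (\<tau>, \<sigma>) = kspan \<int> (set ms)"
  using proj_section[OF face_subset_span[OF f(3)], of N] ms(2) sp by (simp add: face_lattice_def)
 moreover have "span (set ms) = span (proj \<tau> ` \<sigma>)"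
 proof
  have "set ms \<subseteq> span (set vs)" using ms(2) kspan_superset[of \<int> "set ms"] by auto
  then show "span (set ms) \<subseteq> span (proj \<tau> ` \<sigma>)" using sp span_minimal[OF _ subspace_span] by metis
  have "set vs \<subseteq> kspan \<int> (set ms)" using ms(2) sub by (auto intro: span_base)
  then have "set vs \<subseteq> span (set ms)" using kspan_subset_span by blast
  then show "span (proj \<tau> ` \<sigma>) \<subseteq> span (set ms)" using sp span_minimal[OF _ subspace_span] by metis
 qed
 ultimately show ?thesis using ms(1) len by (intro exI[of _ ms]) auto
qed

text \<open>Resolves the definite description of the primitive vector in terms of the one extra
  generator u. The positive factor t is all that is known about it, and all that the sign
  computations use.\<close>

lemma primitive_facet:
 assumes "\<tau> \<in> \<Sigma>" "\<sigma> \<in> \<Sigma>" "gens \<sigma> = insert u (gens \<tau>)" "u \<notin> gens \<tau>"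
 shows "\<exists>t>0. primitive N \<tau> \<sigma> = t *\<^sub>R proj \<tau> u"
  "proj \<tau> ` (N \<inter> span \<sigma>) = range (\<lambda>m::int. of_int m *\<^sub>R primitive N \<tau> \<sigma>)"
proof -
 have f: "\<tau> face_of \<sigma>" using face_of_iff_gens[OF assms(2,1)] assms(3) by auto
 have D: "gens \<sigma> - gens \<tau> = {u}" using assms(3,4) by auto
 have u: "u \<in> N" "u \<in> \<sigma>" using gens(2,3)[OF assms(2)] assms(3) by auto
 have ne: "proj \<tau> u \<noteq> 0"
  using independent_proj_gens(2)[OF assms(2,1) f] dependent_zero[of "{proj \<tau> u}"] D by auto
 have "proj \<tau> u \<in> proj \<tau> ` N" using u by simp
 from primitive_multiple[OF proj_N_module proj_N_coordinatized[OF assms(1)] this ne]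
 obtain t where t: "t > 0" "proj \<tau> ` N \<inter> span {proj \<tau> u} = range (\<lambda>m::int. of_int m *\<^sub>R (t *\<^sub>R proj \<tau> u))"
  by blast
 let ?e = "t *\<^sub>R proj \<tau> u"
 have eq: "proj \<tau> ` (N \<inter> span \<sigma>) = range (\<lambda>m::int. of_int m *\<^sub>R ?e)"
  using proj_section[OF face_subset_span[OF f], of N] proj_cone(2)[OF assms(2,1) f] D t(2) by simp
 have P: "?e \<in> proj \<tau> ` \<sigma>"
  using fan_cone(1)[OF assms(2)] u(2) t(1) proj_scale[of \<tau> t u]
  by (metis convex_cone_scaleR image_eqI less_imp_le)
 have "primitive N \<tau> \<sigma> = ?e"
  unfolding primitive_def
 proof (rule the_equality)
  show "?e \<in> proj \<tau> ` \<sigma> \<and> proj \<tau> ` (N \<inter> span \<sigma>) = range (\<lambda>m::int. of_int m *\<^sub>R ?e)" using P eq by simp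
  fix e' assume e': "e' \<in> proj \<tau> ` \<sigma> \<and> proj \<tau> ` (N \<inter> span \<sigma>) = range (\<lambda>m::int. of_int m *\<^sub>R e')"
  have r: "range (\<lambda>m::int. of_int m *\<^sub>R e') = range (\<lambda>m::int. of_int m *\<^sub>R ?e)" using e' eq by simp
  have "of_int 1 *\<^sub>R e' \<in> range (\<lambda>m::int. of_int m *\<^sub>R ?e)" "of_int 1 *\<^sub>R ?e \<in> range (\<lambda>m::int. of_int m *\<^sub>R e')"
   unfolding r[symmetric] by (rule rangeI) (unfold r, rule rangeI)
  then have "\<exists>m::int. e' = of_int m *\<^sub>R ?e" "\<exists>n::int. ?e = of_int n *\<^sub>R e'"
   unfolding of_int_1 scaleR_one by blast+
  then obtain m n :: int where m: "e' = of_int m *\<^sub>R ?e" and n: "?e = of_int n *\<^sub>R e'" by blast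
  have "?e = of_int (n * m) *\<^sub>R ?e" using m n by (metis of_int_mult scaleR_scaleR)
  moreover have "?e \<noteq> 0" using ne t(1) by simp
  ultimately have "of_int (n * m) = (1::real)" by (metis scaleR_cancel_right scaleR_one)
  then have "n * m = 1" by linarith
  then have "m = 1 \<or> m = -1" by (auto simp: zmult_eq_1_iff)
  \<comment> \<open>Generators of an infinite cyclic group are unique up to sign; the opposite one
    does not lie in the projected cone, which is the ray of proj \<tau> u.\<close>
  moreover have "m \<noteq> -1"
  proof
   assume "m = -1"
   then have "- ?e \<in> ccone {proj \<tau> u}" using e' m proj_cone(1)[OF assms(2,1) f] D by simp
   then obtain c where "c (proj \<tau> u) \<ge> 0" "- ?e = c (proj \<tau> u) *\<^sub>R proj \<tau> u"
    by (auto simp: mem_cone_hull_finite)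
   then have "(c (proj \<tau> u) + t) *\<^sub>R proj \<tau> u = 0"
    by (metis add.commute scaleR_left_distrib right_minus)
   then show False using ne t(1) \<open>c (proj \<tau> u) \<ge> 0\<close> by simp
  qed
  ultimately show "e' = ?e" using m by simp
 qed
 then show "\<exists>t>0. primitive N \<tau> \<sigma> = t *\<^sub>R proj \<tau> u"
  "proj \<tau> ` (N \<inter> span \<sigma>) = range (\<lambda>m::int. of_int m *\<^sub>R primitive N \<tau> \<sigma>)" using eq t(1) by auto
qed

lemma codim_one_gens:
 assumes "\<tau> \<in> \<Sigma>" "\<sigma> \<in> \<Sigma>" "\<tau> face_of \<sigma>" "dim \<sigma> = Suc (dim \<tau>)"
 shows "\<exists>u. u \<notin> gens \<tau> \<and> gens \<sigma> = insert u (gens \<tau>)"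
proof -
 have sub: "gens \<tau> \<subseteq> gens \<sigma>" using face_of_iff_gens assms by blast
 have "card (gens \<sigma> - gens \<tau>) = 1"
  using card_Diff_subset[OF gens(1)[OF assms(1)] sub] gens(6) assms by simp
 then obtain u where "gens \<sigma> - gens \<tau> = {u}" by (auto simp: card_1_singleton_iff)
 then show ?thesis using sub by (intro exI[of _ u]) auto
qed

lemma gens_insert_dim:
 assumes "\<tau> \<in> \<Sigma>" "\<sigma> \<in> \<Sigma>" "gens \<sigma> = insert u (gens \<tau>)" "u \<notin> gens \<tau>"
 shows "dim \<sigma> = Suc (dim \<tau>)" "\<tau> face_of \<sigma>" "\<tau> \<noteq> \<sigma>"
proof -
 show "dim \<sigma> = Suc (dim \<tau>)" using gens(1,6)[OF assms(1)] gens(6)[OF assms(2)] assms(3,4) by simp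
 show "\<tau> face_of \<sigma>" using face_of_iff_gens[OF assms(2,1)] assms(3) by auto
 show "\<tau> \<noteq> \<sigma>" using assms(3,4) by auto
qed

end

locale oriented_fan = simplicial_lattice_fan N \<Sigma>
 for N :: "'n::{finite,linorder} rvec set" and \<Sigma> :: "'n rvec set set" +
 fixes \<nu> :: "'n face \<Rightarrow> 'n ext"
 assumes orient: "orientation N \<Sigma> \<nu>"
begin

abbreviation fsign :: "'n face \<Rightarrow> 'n face \<Rightarrow> real" where
 "fsign \<equiv> face_sign N \<nu>"

abbreviation boundary :: "('n face \<Rightarrow> 'n ext) \<Rightarrow> 'n face \<Rightarrow> 'n ext" (\<open>\<partial>\<close>) where
 "\<partial> \<equiv> trop_boundary N \<Sigma> \<nu>"

lemma nu_generator: "(\<tau>, \<sigma>) \<in> \<F> \<Longrightarrow> is_generator (face_lattice N (\<tau>, \<sigma>)) (dim \<sigma> - dim \<tau>) (\<nu> (\<tau>, \<sigma>))"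
 using orient by (auto simp: orientation_def face_dim_def)

lemma nu_dim_one:
 "(\<tau>, \<sigma>) \<in> \<F> \<Longrightarrow> dim \<sigma> = Suc (dim \<tau>) \<Longrightarrow> \<nu> (\<tau>, \<sigma>) = ext_vec (primitive N \<tau> \<sigma>)"
 using orient by (auto simp: orientation_def)

lemma nu_eq_wedge:
 assumes "(\<tau>, \<sigma>) \<in> \<F>" "length ms = dim \<sigma> - dim \<tau>" "face_lattice N (\<tau>, \<sigma>) = kspan \<int> (set ms)"
 shows "\<exists>s\<in>{1, -1}. \<nu> (\<tau>, \<sigma>) = s *\<^sub>R wedge ms"
 using is_generator_unique[OF is_generator_kspan[of ms], of "\<nu> (\<tau>, \<sigma>)"] nu_generator[OF assms(1)] assms(2,3)
 by auto

lemma nu_basis: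
 assumes "(\<tau>, \<sigma>) \<in> \<F>"
 obtains ms s where "length ms = dim \<sigma> - dim \<tau>" "face_lattice N (\<tau>, \<sigma>) = kspan \<int> (set ms)"
  "span (set ms) = span (proj \<tau> ` \<sigma>)" "s \<in> {1, -1}" "\<nu> (\<tau>, \<sigma>) = s *\<^sub>R wedge ms"
 using face_lattice_basis[OF assms] nu_eq_wedge[OF assms] by metis

lemma nu_nonzero: "(\<tau>, \<sigma>) \<in> \<F> \<Longrightarrow> \<nu> (\<tau>, \<sigma>) \<noteq> 0"
proof -
 assume f: "(\<tau>, \<sigma>) \<in> \<F>"
 obtain ms s where ms: "length ms = dim \<sigma> - dim \<tau>" "span (set ms) = span (proj \<tau> ` \<sigma>)"
  "s \<in> {1, -1}" "\<nu> (\<tau>, \<sigma>) = s *\<^sub>R wedge ms" using nu_basis[OF f] by metis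
 have "dim (span (set ms)) = length ms"
  using ms(1,2) proj_cone(3)[of \<sigma> \<tau>] f by (simp add: faces_iff dim_span)
 then have "dim (set ms) = length ms" by (simp add: dim_span)
 moreover have "dim (set ms) \<le> card (set ms)" by (rule dim_le_card') simp
 ultimately have "card (set ms) = length ms" using card_length[of ms] by simp
 then have "distinct ms" "card (set ms) \<le> dim (set ms)" using card_distinct \<open>dim (set ms) = length ms\<close> by auto
 moreover from this(2) have "independent (set ms)"
  by (intro card_le_dim_spanning[OF span_superset[of "set ms"]])
   (auto simp: dim_span)
 ultimately have "wedge ms \<noteq> 0" by (intro wedge_independent_nonzero)
 then show ?thesis using ms(3,4) by auto
qed

lemma nu_kernel:
 assumes "(\<tau>, \<sigma>) \<in> \<F>" "v \<in> span (proj \<tau> ` \<sigma>)"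
 shows "ext_vec v \<^bold>\<and> \<nu> (\<tau>, \<sigma>) = 0"
 using nu_basis[OF assms(1)] assms(2) wedge_span_zero by (metis ext_mult_scale_right scaleR_zero_right)

lemma nu_proj:
 assumes "(\<tau>, \<sigma>) \<in> \<F>" shows "ext_map (proj \<tau>) (\<nu> (\<tau>, \<sigma>)) = \<nu> (\<tau>, \<sigma>)"
proof -
 obtain ms s where ms: "face_lattice N (\<tau>, \<sigma>) = kspan \<int> (set ms)" "\<nu> (\<tau>, \<sigma>) = s *\<^sub>R wedge ms"
  using nu_basis[OF assms] by metis
 have "set ms \<subseteq> face_lattice N (\<tau>, \<sigma>)" using ms(1) kspan_superset[of \<int> "set ms"] by simp
 then have "map (proj \<tau>) ms = ms"
  by (intro map_idI) (auto simp: face_lattice_def proj_idem)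
 then show ?thesis by (simp add: ms(2) ext_map_linear ext_map_wedge[OF linear_proj])
qed

text \<open>\<nu> of (\<tau>, \<sigma>) absorbs everything in the span of \<sigma>, so x may be
  replaced by its class modulo \<sigma>. In the sign conventions every lift of a generator can
  therefore be exchanged for the generator itself.\<close>

lemma nu_mult_proj:
 assumes f: "(\<tau>, \<sigma>) \<in> \<F>" and x: "x \<in> ext_power K {proj \<tau> ` M} k"
 shows "\<nu> (\<tau>, \<sigma>) \<^bold>\<and> x = \<nu> (\<tau>, \<sigma>) \<^bold>\<and> ext_map (proj \<sigma>) x"
proof -
 obtain ms s where ms: "span (set ms) = span (proj \<tau> ` \<sigma>)" "\<nu> (\<tau>, \<sigma>) = s *\<^sub>R wedge ms"
  using nu_basis[OF f] by metis
 have sub: "\<tau> \<subseteq> span \<sigma>" using f face_subset_span by (auto simp: faces_iff)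
 let ?g = "\<lambda>x. \<nu> (\<tau>, \<sigma>) \<^bold>\<and> x - \<nu> (\<tau>, \<sigma>) \<^bold>\<and> ext_map (proj \<sigma>) x"
 have "linear ?g"
  by (rule linearI) (simp_all add: ext_mult_add_right ext_mult_scale_right ext_map_linear algebra_simps)
 then have "ext_power K {proj \<tau> ` M} k \<subseteq> ?g -` {0}"
 proof (intro ext_power_least kmodule_vimage)
  show "kmodule K {0 :: 'n ext}" by (simp add: kmodule_def)
  fix vs L assume vs: "L \<in> {proj \<tau> ` M}" "set vs \<subseteq> L" "length vs = k"
  have "v - proj \<sigma> v \<in> span (set ms)" if v: "v \<in> set vs" for v
  proof -
   obtain y where y: "v = proj \<tau> y" using v vs by auto
   have "proj \<tau> (v - proj \<sigma> v) = v - proj \<sigma> v"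
    by (simp add: proj_diff y proj_idem proj_proj_subset[OF sub])
   moreover have "proj \<tau> (v - proj \<sigma> v) \<in> proj \<tau> ` span \<sigma>" using proj_in by blast
   ultimately show ?thesis using ms(1) span_linear_image[OF linear_proj, of \<tau> \<sigma>] by simp
  qed
  from wedge_mult_congruent[of vs "proj \<sigma>", OF this]
  show "wedge vs \<in> ?g -` {0}" by (simp add: ms(2) ext_mult_scale_left ext_map_wedge[OF linear_proj])
 qed
 then show ?thesis using x by auto
qed

text \<open>N_\<eta> / N_\<tau> is an extension of N_\<eta> / N_\<sigma> by N_\<sigma> / N_\<tau>,
  so a basis of the sublattice followed by lifts of a basis of the quotient is a basis. The wedge of
  these lifts, with its sign, also supplies the witness demanded by the definitions of
  \<open>cup_sign\<close> and \<open>outer_sign\<close>.\<close>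

lemma nu_product:
 assumes f: "(\<tau>, \<sigma>) \<in> \<F>" "(\<sigma>, \<eta>) \<in> \<F>"
 obtains s \<nu>' where "s \<in> {1, -1 :: real}" "\<nu> (\<tau>, \<sigma>) \<^bold>\<and> \<nu> (\<sigma>, \<eta>) = s *\<^sub>R \<nu> (\<tau>, \<eta>)"
  "\<nu>' \<in> ext_power \<int> {face_lattice N (\<tau>, \<eta>)} (dim \<eta> - dim \<sigma>)" "ext_map (proj \<sigma>) \<nu>' = \<nu> (\<sigma>, \<eta>)"
proof -
 have K: "real_subring \<int>" by (rule real_subring_Ints)
 have m: "\<tau> \<in> \<Sigma>" "\<sigma> \<in> \<Sigma>" "\<eta> \<in> \<Sigma>" "\<tau> face_of \<sigma>" "\<sigma> face_of \<eta>" using f by (auto simp: faces_iff)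
 then have te: "(\<tau>, \<eta>) \<in> \<F>" using face_of_trans by (auto simp: faces_iff)
 obtain ms s1 where ms: "length ms = dim \<sigma> - dim \<tau>" "face_lattice N (\<tau>, \<sigma>) = kspan \<int> (set ms)"
  "span (set ms) = span (proj \<tau> ` \<sigma>)" "s1 \<in> {1, -1}" "\<nu> (\<tau>, \<sigma>) = s1 *\<^sub>R wedge ms"
  using nu_basis[OF f(1)] by metis
 obtain ks s2 where ks: "length ks = dim \<eta> - dim \<sigma>" "face_lattice N (\<sigma>, \<eta>) = kspan \<int> (set ks)"
  "s2 \<in> {1, -1}" "\<nu> (\<sigma>, \<eta>) = s2 *\<^sub>R wedge ks"
  using nu_basis[OF f(2)] by metis
 define lift where "lift y = (SOME x. x \<in> N \<inter> span \<eta> \<and> proj \<sigma> x = y)" for y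
 have lift: "lift y \<in> N \<inter> span \<eta>" "proj \<sigma> (lift y) = y" if "y \<in> set ks" for y
 proof -
  have "y \<in> face_lattice N (\<sigma>, \<eta>)" using that ks(2) kspan_superset[of \<int> "set ks"] by auto
  then have "\<exists>x. x \<in> N \<inter> span \<eta> \<and> proj \<sigma> x = y" by (auto simp: face_lattice_def)
  from someI_ex[OF this] show "lift y \<in> N \<inter> span \<eta>" "proj \<sigma> (lift y) = y" by (auto simp: lift_def)
 qed
 define ls where "ls = map (\<lambda>y. proj \<tau> (lift y)) ks"
 have pls: "map (proj \<sigma>) ls = ks"
  using lift(2) proj_proj[OF face_of_imp_subset[OF m(4)]] by (auto simp: ls_def intro!: map_idI)
 have sub: "\<tau> \<subseteq> \<sigma>" "span \<sigma> \<subseteq> span \<eta>" using m(4,5) by (auto dest!: face_of_imp_subset intro: span_mono[THEN subsetD])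
 have km: "kmodule \<int> (face_lattice N (\<tau>, \<eta>))"
  unfolding face_lattice_def by (simp add: kmodule_image[OF linear_proj] kmodule_Int N_module kmodule_span)
 have lsL: "set ls \<subseteq> face_lattice N (\<tau>, \<eta>)" using lift(1) by (auto simp: ls_def face_lattice_def)
 have eq: "face_lattice N (\<tau>, \<eta>) = kspan \<int> (set (ms @ ls))"
 proof
  have "set ms \<subseteq> face_lattice N (\<tau>, \<sigma>)" using ms(2) kspan_superset[of \<int> "set ms"] by auto
  also have "\<dots> \<subseteq> face_lattice N (\<tau>, \<eta>)" using sub(2) by (auto simp: face_lattice_def)
  finally show "kspan \<int> (set (ms @ ls)) \<subseteq> face_lattice N (\<tau>, \<eta>)"
   using lsL by (intro kspan_least[OF km]) auto
  show "face_lattice N (\<tau>, \<eta>) \<subseteq> kspan \<int> (set (ms @ ls))"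
  proof
   fix z assume "z \<in> face_lattice N (\<tau>, \<eta>)"
   then obtain x where x: "z = proj \<tau> x" "x \<in> N" "x \<in> span \<eta>" by (auto simp: face_lattice_def)
   then have "proj \<sigma> x \<in> kspan \<int> (proj \<sigma> ` set (map lift ks))"
   proof -
    have "proj \<sigma> x \<in> kspan \<int> (set ks)" using x ks(2) by (auto simp: face_lattice_def)
    moreover have "proj \<sigma> ` set (map lift ks) = set ks" using lift(2) by (force simp: image_image)
    ultimately show ?thesis by simp
   qed
   then obtain y where y: "y \<in> kspan \<int> (set (map lift ks))" "proj \<sigma> x = proj \<sigma> y"
    using image_kspan[OF K linear_proj[of \<sigma>], of "set (map lift ks)"] by blast
   have "kspan \<int> (set (map lift ks)) \<subseteq> N" using lift(1) by (intro kspan_least N_module) auto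
   \<comment> \<open>After subtracting a lift of its class modulo \<sigma>, x lies in N_\<sigma>,
     where the basis ms applies.\<close>
   then have "x - y \<in> N \<inter> span \<sigma>"
    using x y kmodule_diff[OF N_module K, of x y] proj_diff[of \<sigma> x y] by (auto simp: proj_eq_0_iff[symmetric])
   then have 1: "proj \<tau> (x - y) \<in> kspan \<int> (set ms)" using ms(2) by (auto simp: face_lattice_def)
   have 2: "proj \<tau> y \<in> kspan \<int> (set ls)"
    using y(1) image_kspan[OF K linear_proj[of \<tau>], of "set (map lift ks)"] by (auto simp: ls_def image_image)
   have "kspan \<int> (set ms) \<subseteq> kspan \<int> (set (ms @ ls))" "kspan \<int> (set ls) \<subseteq> kspan \<int> (set (ms @ ls))"
    using kspan_superset[of \<int> "set (ms @ ls)"] by (auto intro!: kspan_mono[OF K])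
   then have "proj \<tau> (x - y) + proj \<tau> y \<in> kspan \<int> (set (ms @ ls))"
    using 1 2 kmoduleD(2)[OF kmodule_kspan[OF K]] by blast
   then show "z \<in> kspan \<int> (set (ms @ ls))" by (simp add: x(1) proj_diff)
  qed
 qed
 have "length (ms @ ls) = dim \<eta> - dim \<tau>"
  using ms(1) ks(1) dim_face_mono[OF m(4)] dim_face_mono[OF m(5)] by (simp add: ls_def)
 from nu_eq_wedge[OF te this eq] obtain s3 where s3: "s3 \<in> {1, -1}" "\<nu> (\<tau>, \<eta>) = s3 *\<^sub>R wedge (ms @ ls)" by blast
 define \<nu>' where "\<nu>' = s2 *\<^sub>R wedge ls"
 have \<nu>': "\<nu>' \<in> ext_power \<int> {face_lattice N (\<tau>, \<eta>)} (dim \<eta> - dim \<sigma>)"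
  using ks(1,3) ext_power_wedge[OF K, of "face_lattice N (\<tau>, \<eta>)" _ ls] lsL
  unfolding \<nu>'_def by (intro kmoduleD(3)[OF kmodule_ext_power[OF K]]) (auto simp: ls_def)
 have map\<nu>': "ext_map (proj \<sigma>) \<nu>' = \<nu> (\<sigma>, \<eta>)"
  by (simp add: \<nu>'_def ext_map_linear ext_map_wedge[OF linear_proj] pls ks(4))
 have "\<nu> (\<tau>, \<sigma>) \<^bold>\<and> \<nu> (\<sigma>, \<eta>) = \<nu> (\<tau>, \<sigma>) \<^bold>\<and> \<nu>'"
  using nu_mult_proj[OF f(1), of \<nu>' \<int> "N \<inter> span \<eta>"] \<nu>' map\<nu>' by (simp add: face_lattice_def)
 also have "\<dots> = (s1 * s2 * s3) *\<^sub>R \<nu> (\<tau>, \<eta>)"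
  using s3 by (auto simp: \<nu>'_def ms(5) ext_mult_scale_left ext_mult_scale_right wedge_append)
 finally have "\<nu> (\<tau>, \<sigma>) \<^bold>\<and> \<nu> (\<sigma>, \<eta>) = (s1 * s2 * s3) *\<^sub>R \<nu> (\<tau>, \<eta>)" .
 moreover have "s1 * s2 * s3 \<in> {1, -1}" using ms(4) ks(3) s3(1) by auto
 ultimately show thesis using that \<nu>' map\<nu>' by blast
qed

lemma nu_scale_cancel: "(\<tau>, \<sigma>) \<in> \<F> \<Longrightarrow> s *\<^sub>R \<nu> (\<tau>, \<sigma>) = s' *\<^sub>R \<nu> (\<tau>, \<sigma>) \<Longrightarrow> s = s'"
 using nu_nonzero by simp

text \<open>The definition multiplies by a lift of \<nu> (\<sigma>, \<eta>). All lifts give the same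
  product as \<nu> (\<sigma>, \<eta>) itself, so the description has one solution, as \<nu> (\<tau>,
  \<eta>) is nonzero.\<close>

lemma cup_sign_eq:
 assumes f: "(\<tau>, \<sigma>) \<in> \<F>" "(\<sigma>, \<eta>) \<in> \<F>"
 shows "cup_sign N \<nu> \<tau> \<sigma> \<eta> \<in> {1, -1}"
  "\<nu> (\<tau>, \<sigma>) \<^bold>\<and> \<nu> (\<sigma>, \<eta>) = cup_sign N \<nu> \<tau> \<sigma> \<eta> *\<^sub>R \<nu> (\<tau>, \<eta>)"
proof -
 obtain s \<nu>' where s: "s \<in> {1, -1 :: real}" "\<nu> (\<tau>, \<sigma>) \<^bold>\<and> \<nu> (\<sigma>, \<eta>) = s *\<^sub>R \<nu> (\<tau>, \<eta>)"
  "\<nu>' \<in> ext_power \<int> {face_lattice N (\<tau>, \<eta>)} (dim \<eta> - dim \<sigma>)" "ext_map (proj \<sigma>) \<nu>' = \<nu> (\<sigma>, \<eta>)"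
  by (rule nu_product[OF f])
 have te: "(\<tau>, \<eta>) \<in> \<F>" using f face_of_trans by (auto simp: faces_iff)
 have *: "\<nu> (\<tau>, \<sigma>) \<^bold>\<and> x = s *\<^sub>R \<nu> (\<tau>, \<eta>)"
  if "x \<in> ext_power \<int> {face_lattice N (\<tau>, \<eta>)} (dim \<eta> - dim \<sigma>)" "ext_map (proj \<sigma>) x = \<nu> (\<sigma>, \<eta>)" for x
  using nu_mult_proj[OF f(1), of x \<int> "N \<inter> span \<eta>"] that s(2) by (simp add: face_lattice_def)
 have "cup_sign N \<nu> \<tau> \<sigma> \<eta> = s"
  unfolding cup_sign_def face_dim_def prod.case
 proof (rule the_equality)
  show "s \<in> {1, -1} \<and> (\<exists>\<nu>'\<in>ext_power \<int> {face_lattice N (\<tau>, \<eta>)} (dim \<eta> - dim \<sigma>).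
    ext_map (proj \<sigma>) \<nu>' = \<nu> (\<sigma>, \<eta>) \<and> \<nu> (\<tau>, \<sigma>) \<^bold>\<and> \<nu>' = s *\<^sub>R \<nu> (\<tau>, \<eta>))"
   using s *[OF s(3,4)] by blast
  show "s' = s" if "s' \<in> {1, -1} \<and> (\<exists>\<nu>'\<in>ext_power \<int> {face_lattice N (\<tau>, \<eta>)} (dim \<eta> - dim \<sigma>).
    ext_map (proj \<sigma>) \<nu>' = \<nu> (\<sigma>, \<eta>) \<and> \<nu> (\<tau>, \<sigma>) \<^bold>\<and> \<nu>' = s' *\<^sub>R \<nu> (\<tau>, \<eta>))" for s'
   using that * nu_scale_cancel[OF te] by metis
 qed
 then show "cup_sign N \<nu> \<tau> \<sigma> \<eta> \<in> {1, -1}"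
  "\<nu> (\<tau>, \<sigma>) \<^bold>\<and> \<nu> (\<sigma>, \<eta>) = cup_sign N \<nu> \<tau> \<sigma> \<eta> *\<^sub>R \<nu> (\<tau>, \<eta>)" using s by auto
qed

text \<open>\<nu> of a one-dimensional face is its primitive vector, so \<open>nu_product\<close>
  already contains the identity defining the sign; the convention adds the minus sign.\<close>

lemma face_sign_outer:
 assumes \<tau>: "\<tau> \<in> \<Sigma>" "\<tau>' \<in> \<Sigma>" "gens \<tau>' = insert u (gens \<tau>)" "u \<notin> gens \<tau>" and \<sigma>: "\<sigma> \<in> \<Sigma>" "\<tau>' face_of \<sigma>"
 shows "fsign (\<tau>', \<sigma>) (\<tau>, \<sigma>) \<in> {1, -1}"
  "ext_vec (primitive N \<tau> \<tau>') \<^bold>\<and> \<nu> (\<tau>', \<sigma>) = - (fsign (\<tau>', \<sigma>) (\<tau>, \<sigma>) *\<^sub>R \<nu> (\<tau>, \<sigma>))"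
proof -
 note d = gens_insert_dim[OF \<tau>]
 have f: "(\<tau>, \<tau>') \<in> \<F>" "(\<tau>', \<sigma>) \<in> \<F>" "(\<tau>, \<sigma>) \<in> \<F>"
  using \<tau> \<sigma> d face_of_trans by (auto simp: faces_iff)
 have e: "\<nu> (\<tau>, \<tau>') = ext_vec (primitive N \<tau> \<tau>')" by (rule nu_dim_one[OF f(1) d(1)])
 obtain s \<nu>' where s: "s \<in> {1, -1 :: real}" "\<nu> (\<tau>, \<tau>') \<^bold>\<and> \<nu> (\<tau>', \<sigma>) = s *\<^sub>R \<nu> (\<tau>, \<sigma>)"
  "\<nu>' \<in> ext_power \<int> {face_lattice N (\<tau>, \<sigma>)} (dim \<sigma> - dim \<tau>')" "ext_map (proj \<tau>') \<nu>' = \<nu> (\<tau>', \<sigma>)"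
  by (rule nu_product[OF f(1,2)])
 have *: "ext_vec (primitive N \<tau> \<tau>') \<^bold>\<and> x = s *\<^sub>R \<nu> (\<tau>, \<sigma>)"
  if "x \<in> ext_power \<int> {face_lattice N (\<tau>, \<sigma>)} (dim \<sigma> - dim \<tau>')" "ext_map (proj \<tau>') x = \<nu> (\<tau>', \<sigma>)" for x
  using nu_mult_proj[OF f(1), of x \<int> "N \<inter> span \<sigma>"] that s(2) e by (simp add: face_lattice_def)
 have "fsign (\<tau>', \<sigma>) (\<tau>, \<sigma>) = - s"
  unfolding face_sign_def outer_sign_def face_dim_def prod.case if_not_P[OF d(3)[symmetric]]
 proof (rule the_equality)
  show "- s \<in> {1, -1} \<and> (\<exists>\<nu>'\<in>ext_power \<int> {face_lattice N (\<tau>, \<sigma>)} (dim \<sigma> - dim \<tau>').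
    ext_map (proj \<tau>') \<nu>' = \<nu> (\<tau>', \<sigma>) \<and> ext_vec (primitive N \<tau> \<tau>') \<^bold>\<and> \<nu>' = - (- s *\<^sub>R \<nu> (\<tau>, \<sigma>)))"
   using s *[OF s(3,4)] by auto
  show "s' = - s" if "s' \<in> {1, -1} \<and> (\<exists>\<nu>'\<in>ext_power \<int> {face_lattice N (\<tau>, \<sigma>)} (dim \<sigma> - dim \<tau>').
    ext_map (proj \<tau>') \<nu>' = \<nu> (\<tau>', \<sigma>) \<and> ext_vec (primitive N \<tau> \<tau>') \<^bold>\<and> \<nu>' = - (s' *\<^sub>R \<nu> (\<tau>, \<sigma>)))" for s'
  proof -
   have "s *\<^sub>R \<nu> (\<tau>, \<sigma>) = (- s') *\<^sub>R \<nu> (\<tau>, \<sigma>)" using that * by (metis scaleR_minus_left)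
   from nu_scale_cancel[OF f(3) this] show ?thesis by simp
  qed
 qed
 then show "fsign (\<tau>', \<sigma>) (\<tau>, \<sigma>) \<in> {1, -1}"
  "ext_vec (primitive N \<tau> \<tau>') \<^bold>\<and> \<nu> (\<tau>', \<sigma>) = - (fsign (\<tau>', \<sigma>) (\<tau>, \<sigma>) *\<^sub>R \<nu> (\<tau>, \<sigma>))"
  using s e by auto
qed

lemma nu_mult_congruent:
 assumes f: "(\<tau>, \<sigma>) \<in> \<F>" and "proj \<sigma> (proj \<tau> x) = proj \<sigma> (proj \<tau> y)"
 shows "ext_vec (proj \<tau> x) \<^bold>\<and> \<nu> (\<tau>, \<sigma>) = ext_vec (proj \<tau> y) \<^bold>\<and> \<nu> (\<tau>, \<sigma>)"
proof -
 have "proj \<tau> x - proj \<tau> y \<in> span \<sigma>" using assms(2) by (simp add: proj_diff flip: proj_eq_0_iff)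
 then have "proj \<tau> (proj \<tau> x - proj \<tau> y) \<in> span (proj \<tau> ` \<sigma>)"
  by (simp add: span_linear_image[OF linear_proj])
 then have "ext_vec (proj \<tau> x - proj \<tau> y) \<^bold>\<and> \<nu> (\<tau>, \<sigma>) = 0"
  by (intro nu_kernel[OF f]) (simp add: proj_diff proj_idem)
 then show ?thesis by (simp add: linear_diff[OF linear_ext_vec] ext_mult_diff)
qed

text \<open>Same principle, with the primitive vector now in the quotient by \<sigma>'. Any lift of
  it in the lattice of the larger face has the same product with \<nu> (\<tau>, \<sigma>').\<close>

lemma face_sign_inner:
 assumes \<sigma>: "\<sigma>' \<in> \<Sigma>" "\<sigma> \<in> \<Sigma>" "gens \<sigma> = insert u (gens \<sigma>')" "u \<notin> gens \<sigma>'" and \<tau>: "\<tau> \<in> \<Sigma>" "\<tau> face_of \<sigma>'"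
 shows "fsign (\<tau>, \<sigma>') (\<tau>, \<sigma>) \<in> {1, -1}"
  "ext_vec (primitive N \<sigma>' \<sigma>) \<^bold>\<and> \<nu> (\<tau>, \<sigma>') = fsign (\<tau>, \<sigma>') (\<tau>, \<sigma>) *\<^sub>R \<nu> (\<tau>, \<sigma>)"
proof -
 note d = gens_insert_dim[OF \<sigma>]
 let ?e = "primitive N \<sigma>' \<sigma>"
 have f: "(\<tau>, \<sigma>') \<in> \<F>" "(\<sigma>', \<sigma>) \<in> \<F>" "(\<tau>, \<sigma>) \<in> \<F>"
  using \<tau> \<sigma> d face_of_trans by (auto simp: faces_iff)
 have sub: "\<tau> \<subseteq> \<sigma>'" "\<tau> \<subseteq> span \<sigma>'" using \<tau>(2) face_of_imp_subset face_subset_span by auto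
 have nu1: "\<nu> (\<sigma>', \<sigma>) = ext_vec ?e" by (rule nu_dim_one[OF f(2) d(1)])
 obtain s0 where s0: "s0 \<in> {1, -1 :: real}" "\<nu> (\<tau>, \<sigma>') \<^bold>\<and> \<nu> (\<sigma>', \<sigma>) = s0 *\<^sub>R \<nu> (\<tau>, \<sigma>)"
  by (rule nu_product[OF f(1,2)])
 define k where "k = dim \<sigma>' - dim \<tau>"
 \<comment> \<open>\<open>nu_product\<close> has the primitive vector on the right, the sign
   convention on the left; moving it across a form of degree k costs (-1)^k, which is absorbed into
   s.\<close>
 have comm: "ext_vec v \<^bold>\<and> \<nu> (\<tau>, \<sigma>') = (-1) ^ k *\<^sub>R (\<nu> (\<tau>, \<sigma>') \<^bold>\<and> ext_vec v)" for v
 proof -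
  obtain ms r where "length ms = dim \<sigma>' - dim \<tau>" "\<nu> (\<tau>, \<sigma>') = r *\<^sub>R wedge ms" using nu_basis[OF f(1)] by metis
  then show ?thesis
   by (simp add: k_def ext_mult_scale_right ext_mult_scale_left wedge_ext_vec_commute flip: power_mult_distrib)
 qed
 define s where "s = (-1) ^ k * s0"
 have s: "s \<in> {1, -1}" using s0(1) by (cases "even k") (auto simp: s_def)
 have e: "ext_vec ?e \<^bold>\<and> \<nu> (\<tau>, \<sigma>') = s *\<^sub>R \<nu> (\<tau>, \<sigma>)"
  using s0(2) comm nu1 by (simp add: s_def)
 have "?e \<in> proj \<sigma>' ` (N \<inter> span \<sigma>)"
  unfolding primitive_facet(2)[OF \<sigma>] by (rule image_eqI[of _ _ 1]) auto
 then obtain n0 where n0: "n0 \<in> N \<inter> span \<sigma>" "?e = proj \<sigma>' n0" by blast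
 have *: "ext_vec n \<^bold>\<and> \<nu> (\<tau>, \<sigma>') = s *\<^sub>R \<nu> (\<tau>, \<sigma>)"
  if n: "n \<in> face_lattice N (\<tau>, \<sigma>)" "proj \<sigma>' n = ?e" for n
 proof -
  obtain x where x: "n = proj \<tau> x" using n(1) by (auto simp: face_lattice_def)
  have "ext_vec (proj \<tau> x) \<^bold>\<and> \<nu> (\<tau>, \<sigma>') = ext_vec (proj \<tau> ?e) \<^bold>\<and> \<nu> (\<tau>, \<sigma>')"
   by (rule nu_mult_congruent[OF f(1)])
    (use n(2) in \<open>simp add: x n0(2) proj_proj[OF sub(1)] proj_proj_subset[OF sub(2)] proj_idem\<close>)
  moreover have "proj \<tau> ?e = ?e" unfolding n0(2) by (rule proj_proj_subset[OF sub(2)])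
  ultimately show ?thesis using e x by simp
 qed
 have n: "proj \<tau> n0 \<in> face_lattice N (\<tau>, \<sigma>)" "proj \<sigma>' (proj \<tau> n0) = ?e"
  using n0 proj_proj[OF sub(1)] by (auto simp: face_lattice_def)
 have "fsign (\<tau>, \<sigma>') (\<tau>, \<sigma>) = s"
  unfolding face_sign_def inner_sign_def prod.case if_P[OF refl]
 proof (rule the_equality)
  show "s \<in> {1, -1} \<and> (\<exists>n\<in>face_lattice N (\<tau>, \<sigma>). proj \<sigma>' n = ?e \<and> ext_vec n \<^bold>\<and> \<nu> (\<tau>, \<sigma>') = s *\<^sub>R \<nu> (\<tau>, \<sigma>))"
   using s n *[OF n] by blast
  show "s' = s" if "s' \<in> {1, -1} \<and>
    (\<exists>n\<in>face_lattice N (\<tau>, \<sigma>). proj \<sigma>' n = ?e \<and> ext_vec n \<^bold>\<and> \<nu> (\<tau>, \<sigma>') = s' *\<^sub>R \<nu> (\<tau>, \<sigma>))" for s'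
   using that * nu_scale_cancel[OF f(3)] by metis
 qed
 then show "fsign (\<tau>, \<sigma>') (\<tau>, \<sigma>) \<in> {1, -1}"
  "ext_vec (primitive N \<sigma>' \<sigma>) \<^bold>\<and> \<nu> (\<tau>, \<sigma>') = fsign (\<tau>, \<sigma>') (\<tau>, \<sigma>) *\<^sub>R \<nu> (\<tau>, \<sigma>)"
  using s e by auto
qed

end

section \<open>The boundary in terms of rays\<close>

context simplicial_lattice_fan
begin

text \<open>The dimensions of the cones in \<tau> \<prec> \<tau>' \<prec> \<sigma>' \<prec> \<sigma>
  can differ in only one place by one, and faces of equal dimension coincide.\<close>

lemma facet_pair_iff:
 "facet_pair \<Sigma> (\<tau>', \<sigma>') (\<tau>, \<sigma>) \<longleftrightarrow> (\<tau>', \<sigma>') \<in> \<F> \<and> (\<tau>, \<sigma>) \<in> \<F> \<and>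
  (\<tau> = \<tau>' \<and> \<sigma>' face_of \<sigma> \<and> dim \<sigma> = Suc (dim \<sigma>') \<or> \<sigma> = \<sigma>' \<and> \<tau> face_of \<tau>' \<and> dim \<tau>' = Suc (dim \<tau>))"
  (is "?L \<longleftrightarrow> ?R")
proof
 assume ?L
 then have f: "\<tau>' \<in> \<Sigma>" "\<sigma>' \<in> \<Sigma>" "\<tau> \<in> \<Sigma>" "\<sigma> \<in> \<Sigma>" "\<tau>' face_of \<sigma>'" "\<tau> face_of \<tau>'" "\<sigma>' face_of \<sigma>"
  and F: "(\<tau>', \<sigma>') \<in> \<F>" "(\<tau>, \<sigma>) \<in> \<F>"
  and d: "dim \<sigma> - dim \<tau> = Suc (dim \<sigma>' - dim \<tau>')"
  by (auto simp: facet_pair_def faces_iff face_le_def face_dim_def)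
 have le: "dim \<tau> \<le> dim \<tau>'" "dim \<tau>' \<le> dim \<sigma>'" "dim \<sigma>' \<le> dim \<sigma>" using f dim_face_mono by blast+
 show ?R
 proof (cases "dim \<tau>' = dim \<tau>")
  case True
  then have "\<tau> = \<tau>'" using face_dim_eq[OF f(1,3,6)] by simp
  moreover have "dim \<sigma> = Suc (dim \<sigma>')" using True le d by linarith
  ultimately show ?thesis using f F by blast
 next
  case False
  then have "dim \<sigma>' = dim \<sigma>" using le d by linarith
  then have "\<sigma>' = \<sigma>" using face_dim_eq[OF f(4,2,7)] by simp
  moreover have "dim \<tau>' = Suc (dim \<tau>)" using \<open>dim \<sigma>' = dim \<sigma>\<close> le d by linarith
  ultimately show ?thesis using f F by blast
 qed
next
 assume R: ?R
 then have f: "\<tau>' \<in> \<Sigma>" "\<sigma>' \<in> \<Sigma>" "\<tau>' face_of \<sigma>'" by (auto simp: faces_iff)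
 have refl: "\<tau>' face_of \<tau>'" "\<sigma>' face_of \<sigma>'" using f by (simp_all add: face_of_iff_gens)
 show ?L using R refl f(3) dim_face_mono[OF f(3)] dim_face_mono[of \<tau> \<tau>']
  unfolding facet_pair_def by (elim conjE disjE) (simp_all add: face_le_def face_dim_def)
qed

lemma sum_cofaces:
 assumes f: "(\<tau>, \<sigma>) \<in> \<F>"
 shows "(\<Sum>\<delta> | facet_pair \<Sigma> (\<tau>, \<sigma>) \<delta>. h \<delta>) =
  (\<Sum>\<eta> | \<eta> \<in> \<Sigma> \<and> \<sigma> face_of \<eta> \<and> dim \<eta> = Suc (dim \<sigma>). h (\<tau>, \<eta>)) +
  (\<Sum>\<rho> | \<rho> \<in> \<Sigma> \<and> \<rho> face_of \<tau> \<and> dim \<tau> = Suc (dim \<rho>). h (\<rho>, \<sigma>))" (is "_ = sum _ ?A + sum _ ?B")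
proof -
 have eq: "{\<delta>. facet_pair \<Sigma> (\<tau>, \<sigma>) \<delta>} = Pair \<tau> ` ?A \<union> (\<lambda>\<rho>. (\<rho>, \<sigma>)) ` ?B"
  using f face_of_trans by (auto simp: facet_pair_iff faces_iff)
 have fin: "finite ?A" "finite ?B" using finite_fan by simp_all
 have "sum h (Pair \<tau> ` ?A \<union> (\<lambda>\<rho>. (\<rho>, \<sigma>)) ` ?B) = sum h (Pair \<tau> ` ?A) + sum h ((\<lambda>\<rho>. (\<rho>, \<sigma>)) ` ?B)"
  using fin by (intro sum.union_disjoint) auto
 then show ?thesis unfolding eq by (simp add: sum.reindex inj_on_def)
qed

end

context oriented_fan
begin

text \<open>A coface of (\<tau>, \<sigma>) arises by adding a ray to \<sigma> (flag True) or by
  deleting a ray from \<tau> (flag False). Recording both kinds by a ray lets the two terms of a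
  double boundary be exchanged uniformly.\<close>

definition moves :: "'n face \<Rightarrow> ('n rvec \<times> bool) set" where
 "moves = (\<lambda>(\<tau>, \<sigma>). {(u, b). if b then u \<notin> gens \<sigma> \<and> (\<exists>\<eta>\<in>\<Sigma>. gens \<eta> = insert u (gens \<sigma>)) else u \<in> gens \<tau>})"

definition move :: "'n rvec \<times> bool \<Rightarrow> 'n face \<Rightarrow> 'n face" where
 "move = (\<lambda>(u, b) (\<tau>, \<sigma>). if b then (\<tau>, ccone (insert u (gens \<sigma>)))
  else (ccone (gens \<tau> - {u}), \<sigma>))"

lemma move_True:
 assumes f: "(\<tau>, \<sigma>) \<in> \<F>" and m: "(u, True) \<in> moves (\<tau>, \<sigma>)"
 obtains \<eta> where "move (u, True) (\<tau>, \<sigma>) = (\<tau>, \<eta>)" "(\<tau>, \<eta>) \<in> \<F>" "\<eta> \<in> \<Sigma>"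
  "gens \<eta> = insert u (gens \<sigma>)" "u \<notin> gens \<sigma>"
proof -
 obtain \<eta> where \<eta>: "\<eta> \<in> \<Sigma>" "gens \<eta> = insert u (gens \<sigma>)" "u \<notin> gens \<sigma>" using m by (auto simp: moves_def)
 have "ccone (insert u (gens \<sigma>)) = \<eta>" using gens(5)[OF \<eta>(1)] \<eta>(2) by simp
 moreover have "\<tau> face_of \<eta>"
  using f gens_insert_dim(2)[OF _ \<eta>] face_of_trans by (auto simp: faces_iff)
 ultimately show thesis using that \<eta> f by (auto simp: move_def faces_iff)
qed

lemma move_False:
 assumes f: "(\<tau>, \<sigma>) \<in> \<F>" and m: "(u, False) \<in> moves (\<tau>, \<sigma>)"
 obtains \<rho> where "move (u, False) (\<tau>, \<sigma>) = (\<rho>, \<sigma>)" "(\<rho>, \<sigma>) \<in> \<F>" "\<rho> \<in> \<Sigma>"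
  "gens \<tau> = insert u (gens \<rho>)" "u \<notin> gens \<rho>" "gens \<rho> = gens \<tau> - {u}"
proof -
 have u: "u \<in> gens \<tau>" using m by (auto simp: moves_def)
 have \<tau>: "\<tau> \<in> \<Sigma>" using f by (simp add: faces_iff)
 define \<rho> where "\<rho> = ccone (gens \<tau> - {u})"
 have \<rho>: "\<rho> \<in> \<Sigma>" "gens \<rho> = gens \<tau> - {u}"
  using cone_subset_gens[OF \<tau>, of "gens \<tau> - {u}"] by (auto simp: \<rho>_def)
 have g: "gens \<tau> = insert u (gens \<rho>)" "u \<notin> gens \<rho>" unfolding \<rho>(2) using u by auto
 have "\<rho> face_of \<sigma>"
  using gens_insert_dim(2)[OF \<rho>(1) \<tau> g] f face_of_trans by (auto simp: faces_iff)
 then have "(\<rho>, \<sigma>) \<in> \<F>" using f \<rho>(1) by (simp add: faces_iff)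
 then show thesis by (rule that[rotated]) (rule \<rho>(1) g \<rho>(2) | simp add: move_def \<rho>_def)+
qed

text \<open>Faces are compared through their ray sets, where the effect of moves is plain set
  algebra.\<close>

definition rays_of :: "'n face \<Rightarrow> 'n rvec set \<times> 'n rvec set" where
 "rays_of = (\<lambda>(\<tau>, \<sigma>). (gens \<tau>, gens \<sigma>))"

lemma rays_of_inj: "\<gamma> \<in> \<F> \<Longrightarrow> \<delta> \<in> \<F> \<Longrightarrow> rays_of \<gamma> = rays_of \<delta> \<Longrightarrow> \<gamma> = \<delta>"
 using gens_inj by (cases \<gamma>; cases \<delta>) (auto simp: rays_of_def faces_iff)

lemma rays_of_move:
 assumes "\<gamma> \<in> \<F>" "m \<in> moves \<gamma>"
 shows "move m \<gamma> \<in> \<F>"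
  "rays_of (move m \<gamma>) = (if snd m then (fst (rays_of \<gamma>), insert (fst m) (snd (rays_of \<gamma>)))
   else (fst (rays_of \<gamma>) - {fst m}, snd (rays_of \<gamma>)))"
proof -
 obtain \<tau> \<sigma> u b where eq: "\<gamma> = (\<tau>, \<sigma>)" "m = (u, b)" by (metis surj_pair)
 have "move m \<gamma> \<in> \<F> \<and> rays_of (move m \<gamma>) = (if b then (gens \<tau>, insert u (gens \<sigma>))
   else (gens \<tau> - {u}, gens \<sigma>))"
 proof (cases b)
  case True
  then obtain \<eta> where "move (u, True) (\<tau>, \<sigma>) = (\<tau>, \<eta>)" "(\<tau>, \<eta>) \<in> \<F>" "gens \<eta> = insert u (gens \<sigma>)"
   using move_True[of \<tau> \<sigma> u] assms unfolding eq by metis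
  with True show ?thesis by (simp add: eq rays_of_def)
 next
  case False
  then obtain \<rho> where "move (u, False) (\<tau>, \<sigma>) = (\<rho>, \<sigma>)" "(\<rho>, \<sigma>) \<in> \<F>" "gens \<rho> = gens \<tau> - {u}"
   using move_False[of \<tau> \<sigma> u] assms unfolding eq by metis
  with False show ?thesis by (simp add: eq rays_of_def)
 qed
 then show "move m \<gamma> \<in> \<F>"
  "rays_of (move m \<gamma>) = (if snd m then (fst (rays_of \<gamma>), insert (fst m) (snd (rays_of \<gamma>)))
   else (fst (rays_of \<gamma>) - {fst m}, snd (rays_of \<gamma>)))"
  by (simp_all add: eq rays_of_def)
qed

lemma cofaces_eq:
 assumes "\<gamma> \<in> \<F>"
 shows "{\<delta>. facet_pair \<Sigma> \<gamma> \<delta>} = (\<lambda>m. move m \<gamma>) ` moves \<gamma>" "inj_on (\<lambda>m. move m \<gamma>) (moves \<gamma>)"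
proof -
 obtain \<tau> \<sigma> where \<gamma>: "\<gamma> = (\<tau>, \<sigma>)" by (metis surj_pair)
 have f: "\<tau> \<in> \<Sigma>" "\<sigma> \<in> \<Sigma>" "\<tau> face_of \<sigma>" using assms by (auto simp: \<gamma> faces_iff)
 show "{\<delta>. facet_pair \<Sigma> \<gamma> \<delta>} = (\<lambda>m. move m \<gamma>) ` moves \<gamma>"
 proof (intro subset_antisym subsetI)
  fix \<delta> assume \<delta>0: "\<delta> \<in> {\<delta>. facet_pair \<Sigma> \<gamma> \<delta>}"
  obtain \<tau>0 \<sigma>0 where \<delta>: "\<delta> = (\<tau>0, \<sigma>0)" by (metis surj_pair)
  have m: "\<tau>0 \<in> \<Sigma>" "\<sigma>0 \<in> \<Sigma>" using \<delta>0 by (auto simp: \<delta> \<gamma> facet_pair_iff faces_iff)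
  from \<delta>0 consider "\<tau>0 = \<tau>" "\<sigma> face_of \<sigma>0" "dim \<sigma>0 = Suc (dim \<sigma>)" | "\<sigma>0 = \<sigma>" "\<tau>0 face_of \<tau>" "dim \<tau> = Suc (dim \<tau>0)"
   by (auto simp: \<delta> \<gamma> facet_pair_iff)
  then show "\<delta> \<in> (\<lambda>m. move m \<gamma>) ` moves \<gamma>"
  proof cases
   case 1
   obtain u where u: "u \<notin> gens \<sigma>" "gens \<sigma>0 = insert u (gens \<sigma>)"
    using codim_one_gens[OF f(2) m(2) 1(2,3)] by blast
   have "\<delta> = move (u, True) \<gamma>" using gens(5)[OF m(2)] u 1(1) by (simp add: \<gamma> \<delta> move_def)
   moreover have "(u, True) \<in> moves \<gamma>" using u m(2) by (auto simp: moves_def \<gamma>)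
   ultimately show ?thesis by blast
  next
   case 2
   obtain u where u: "u \<notin> gens \<tau>0" "gens \<tau> = insert u (gens \<tau>0)"
    using codim_one_gens[OF m(1) f(1) 2(2,3)] by blast
   have "gens \<tau> - {u} = gens \<tau>0" using u by auto
   then have "\<delta> = move (u, False) \<gamma>" using gens(5)[OF m(1)] 2(1) by (simp add: \<gamma> \<delta> move_def)
   moreover have "(u, False) \<in> moves \<gamma>" using u by (auto simp: moves_def \<gamma>)
   ultimately show ?thesis by blast
  qed
 next
  fix \<delta> assume "\<delta> \<in> (\<lambda>m. move m \<gamma>) ` moves \<gamma>"
  then obtain u b where m: "(u, b) \<in> moves \<gamma>" and \<delta>: "\<delta> = move (u, b) \<gamma>" by auto
  show "\<delta> \<in> {\<delta>. facet_pair \<Sigma> \<gamma> \<delta>}"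
  proof (cases b)
   case True
   then obtain \<eta> where \<eta>: "move (u, True) (\<tau>, \<sigma>) = (\<tau>, \<eta>)" "(\<tau>, \<eta>) \<in> \<F>" "\<eta> \<in> \<Sigma>"
    "gens \<eta> = insert u (gens \<sigma>)" "u \<notin> gens \<sigma>"
    using move_True[of \<tau> \<sigma> u] assms m unfolding \<gamma> by metis
   from gens_insert_dim[OF f(2) \<eta>(3-5)] show ?thesis
    using True assms by (simp add: \<gamma> \<delta> \<eta>(1,2) facet_pair_iff)
  next
   case False
   then obtain \<rho> where \<rho>: "move (u, False) (\<tau>, \<sigma>) = (\<rho>, \<sigma>)" "(\<rho>, \<sigma>) \<in> \<F>" "\<rho> \<in> \<Sigma>"
    "gens \<tau> = insert u (gens \<rho>)" "u \<notin> gens \<rho>"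
    using move_False[of \<tau> \<sigma> u] assms m unfolding \<gamma> by metis
   from gens_insert_dim[OF \<rho>(3) f(1) \<rho>(4,5)] show ?thesis
    using False assms by (simp add: \<gamma> \<delta> \<rho>(1,2) facet_pair_iff)
  qed
 qed
 show "inj_on (\<lambda>m. move m \<gamma>) (moves \<gamma>)"
 proof (rule inj_onI)
  fix m m' assume mm: "m \<in> moves \<gamma>" "m' \<in> moves \<gamma>" "move m \<gamma> = move m' \<gamma>"
  from arg_cong[OF mm(3), of rays_of] rays_of_move(2)[OF assms mm(1)] rays_of_move(2)[OF assms mm(2)]
  show "m = m'" using mm(1,2) by (cases m; cases m') (auto simp: \<gamma> rays_of_def moves_def split: if_splits)
 qed
qed

lemma finite_moves: "\<gamma> \<in> \<F> \<Longrightarrow> finite (moves \<gamma>)"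
proof -
 assume \<gamma>: "\<gamma> \<in> \<F>"
 have "finite {\<delta>. facet_pair \<Sigma> \<gamma> \<delta>}"
  by (rule finite_subset[OF _ finite_faces]) (auto simp: facet_pair_def)
 then show ?thesis unfolding cofaces_eq(1)[OF \<gamma>] using cofaces_eq(2)[OF \<gamma>] finite_imageD by blast
qed

lemma trop_boundary_moves:
 assumes "\<gamma> \<in> \<F>"
 shows "\<partial> c \<gamma> =
  (\<Sum>m\<in>moves \<gamma>. fsign \<gamma> (move m \<gamma>) *\<^sub>R ext_map (proj (fst \<gamma>)) (c (move m \<gamma>)))"
 unfolding trop_boundary_def cofaces_eq(1)[OF assms] by (simp add: sum.reindex[OF cofaces_eq(2)[OF assms]])

lemma trop_boundary_outside: "\<gamma> \<notin> \<F> \<Longrightarrow> \<partial> c \<gamma> = 0"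
 by (simp add: trop_boundary_def facet_pair_def)

text \<open>Two successive moves change different rays or different ends of the face, so their order
  is immaterial; existence of the intermediate cones comes from simpliciality.\<close>

lemma moves_swap:
 assumes \<gamma>: "\<gamma> \<in> \<F>" and m: "m \<in> moves \<gamma>" "m' \<in> moves (move m \<gamma>)"
 shows "m' \<in> moves \<gamma>" "m \<in> moves (move m' \<gamma>)" "move m' (move m \<gamma>) = move m (move m' \<gamma>)"
proof -
 obtain \<tau> \<sigma> where \<gamma>eq: "\<gamma> = (\<tau>, \<sigma>)" by (metis surj_pair)
 have f: "\<tau> \<in> \<Sigma>" "\<sigma> \<in> \<Sigma>" "\<tau> face_of \<sigma>" using \<gamma> by (auto simp: \<gamma>eq faces_iff)
 then have sub: "gens \<tau> \<subseteq> gens \<sigma>" using face_of_iff_gens by blast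
 have moves_iff: "(u, b) \<in> moves \<delta> \<longleftrightarrow> (if b then u \<notin> snd (rays_of \<delta>) \<and>
   (\<exists>\<eta>\<in>\<Sigma>. gens \<eta> = insert u (snd (rays_of \<delta>))) else u \<in> fst (rays_of \<delta>))" for u b \<delta>
  by (cases \<delta>) (simp add: moves_def rays_of_def)
 obtain u b u' b' where eq: "m = (u, b)" "m' = (u', b')" by (metis surj_pair)
 note r = rays_of_move(2)[OF \<gamma> m(1)]
 show m': "m' \<in> moves \<gamma>"
 proof (cases "b' \<and> b")
  case True
  then have u': "u' \<notin> insert u (gens \<sigma>)" "\<exists>\<eta>\<in>\<Sigma>. gens \<eta> = insert u' (insert u (gens \<sigma>))"
   using m(2) r by (auto simp: eq moves_iff \<gamma>eq rays_of_def)
  then obtain \<eta> where \<eta>: "\<eta> \<in> \<Sigma>" "gens \<eta> = insert u' (insert u (gens \<sigma>))" by blast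
  \<comment> \<open>Two additions: the cone with only the second ray added exists, being spanned by
    a subset of the rays of \<eta>.\<close>
  have "insert u' (gens \<sigma>) \<subseteq> gens \<eta>" using \<eta> by auto
  from cone_subset_gens[OF \<eta>(1) this] show ?thesis
   using True u'(1) by (auto simp: eq moves_iff \<gamma>eq rays_of_def)
 next
  case False
  then show ?thesis using m(2) r by (auto simp: eq moves_iff \<gamma>eq rays_of_def split: if_splits)
 qed
 note r' = rays_of_move(2)[OF \<gamma> m']
 show m2: "m \<in> moves (move m' \<gamma>)"
  using m r r' sub by (cases b; cases b') (auto simp: eq moves_iff \<gamma>eq rays_of_def insert_commute)
 show "move m' (move m \<gamma>) = move m (move m' \<gamma>)"
 proof (rule rays_of_inj)
  show "move m' (move m \<gamma>) \<in> \<F>" "move m (move m' \<gamma>) \<in> \<F>"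
   using rays_of_move(1) \<gamma> m m' m2 by blast+
  show "rays_of (move m' (move m \<gamma>)) = rays_of (move m (move m' \<gamma>))"
   unfolding rays_of_move(2)[OF rays_of_move(1)[OF \<gamma> m(1)] m(2)]
    rays_of_move(2)[OF rays_of_move(1)[OF \<gamma> m'] m2] r r'
   by (auto simp: eq)
 qed
qed

text \<open>Common form of the inner and outer sign rules. Primitive vectors are replaced by the
  chosen ray vectors, at the cost of the positive factor t, and the kind of move contributes the
  sign in front.\<close>

lemma nu_move:
 assumes \<gamma>: "\<gamma> \<in> \<F>" and m: "(u, b) \<in> moves \<gamma>"
 shows "fsign \<gamma> (move (u, b) \<gamma>) \<in> {1, -1}"
  "\<exists>t>0. ext_vec (proj (fst (move (u, b) \<gamma>)) u) \<^bold>\<and> \<nu> \<gamma> =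
   ((if b then 1 else -1) * t * fsign \<gamma> (move (u, b) \<gamma>)) *\<^sub>R \<nu> (move (u, b) \<gamma>)"
proof -
 obtain \<tau> \<sigma> where \<gamma>eq: "\<gamma> = (\<tau>, \<sigma>)" by (metis surj_pair)
 have f: "\<tau> \<in> \<Sigma>" "\<sigma> \<in> \<Sigma>" "\<tau> face_of \<sigma>" using \<gamma> by (auto simp: \<gamma>eq faces_iff)
 have "fsign \<gamma> (move (u, b) \<gamma>) \<in> {1, -1} \<and>
  (\<exists>t>0. ext_vec (proj (fst (move (u, b) \<gamma>)) u) \<^bold>\<and> \<nu> \<gamma> =
   ((if b then 1 else -1) * t * fsign \<gamma> (move (u, b) \<gamma>)) *\<^sub>R \<nu> (move (u, b) \<gamma>))"
 proof (cases b)
  case True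
  obtain \<eta> where \<eta>: "move (u, True) (\<tau>, \<sigma>) = (\<tau>, \<eta>)" "(\<tau>, \<eta>) \<in> \<F>" "\<eta> \<in> \<Sigma>"
   "gens \<eta> = insert u (gens \<sigma>)" "u \<notin> gens \<sigma>"
   using move_True[of \<tau> \<sigma> u] \<gamma> m True unfolding \<gamma>eq by metis
  obtain t where t: "t > 0" "primitive N \<sigma> \<eta> = t *\<^sub>R proj \<sigma> u" using primitive_facet(1)[OF f(2) \<eta>(3-5)] by blast
  note s = face_sign_inner[OF f(2) \<eta>(3-5) f(1,3)]
  have "ext_vec (proj \<tau> u) \<^bold>\<and> \<nu> (\<tau>, \<sigma>) = ext_vec (proj \<tau> (proj \<sigma> u)) \<^bold>\<and> \<nu> (\<tau>, \<sigma>)"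
   using f(3) face_subset_span proj_proj[OF face_of_imp_subset[OF f(3)]]
   by (intro nu_mult_congruent) (use \<gamma> in \<open>auto simp: \<gamma>eq proj_idem\<close>)
  also have "proj \<tau> (proj \<sigma> u) = (1 / t) *\<^sub>R primitive N \<sigma> \<eta>"
   using t by (simp add: proj_proj_subset[OF face_subset_span[OF f(3)]])
  also have "ext_vec ((1 / t) *\<^sub>R primitive N \<sigma> \<eta>) \<^bold>\<and> \<nu> (\<tau>, \<sigma>) = (1 / t * fsign (\<tau>, \<sigma>) (\<tau>, \<eta>)) *\<^sub>R \<nu> (\<tau>, \<eta>)"
   by (simp add: ext_vec_scale ext_mult_scale_left s(2))
  finally show ?thesis using s(1) t(1) True by (auto simp: \<gamma>eq \<eta>(1) intro!: exI[of _ "1 / t"])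
 next
  case False
  obtain \<rho> where \<rho>: "move (u, False) (\<tau>, \<sigma>) = (\<rho>, \<sigma>)" "(\<rho>, \<sigma>) \<in> \<F>" "\<rho> \<in> \<Sigma>"
   "gens \<tau> = insert u (gens \<rho>)" "u \<notin> gens \<rho>"
   using move_False[of \<tau> \<sigma> u] \<gamma> m False unfolding \<gamma>eq by metis
  obtain t where t: "t > 0" "primitive N \<rho> \<tau> = t *\<^sub>R proj \<rho> u" using primitive_facet(1)[OF \<rho>(3) f(1) \<rho>(4,5)] by blast
  note s = face_sign_outer[OF \<rho>(3) f(1) \<rho>(4,5) f(2,3)]
  have "proj \<rho> u = (1 / t) *\<^sub>R primitive N \<rho> \<tau>" using t by simp
  then have "ext_vec (proj \<rho> u) \<^bold>\<and> \<nu> (\<tau>, \<sigma>) = (- (1 / t * fsign (\<tau>, \<sigma>) (\<rho>, \<sigma>))) *\<^sub>R \<nu> (\<rho>, \<sigma>)"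
   by (simp add: ext_vec_scale ext_mult_scale_left s(2))
  then show ?thesis using s(1) t(1) False by (auto simp: \<gamma>eq \<rho>(1) intro!: exI[of _ "1 / t"])
 qed
 then show "fsign \<gamma> (move (u, b) \<gamma>) \<in> {1, -1}"
  "\<exists>t>0. ext_vec (proj (fst (move (u, b) \<gamma>)) u) \<^bold>\<and> \<nu> \<gamma> =
   ((if b then 1 else -1) * t * fsign \<gamma> (move (u, b) \<gamma>)) *\<^sub>R \<nu> (move (u, b) \<gamma>)" by auto
qed

text \<open>Two commuting moves along rays \<open>u\<close>, \<open>u'\<close> multiply \<open>\<nu> \<gamma>\<close> by \<open>u' \<and> u\<close> or \<open>u \<and> u'\<close> up to a positive factor
 and a sign depending only on the kinds of the two moves; so their incidence signs differ.\<close>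

lemma face_sign_swap:
 assumes \<gamma>: "\<gamma> \<in> \<F>" and m: "m \<in> moves \<gamma>" "m' \<in> moves (move m \<gamma>)"
 shows "fsign \<gamma> (move m \<gamma>) * fsign (move m \<gamma>) (move m' (move m \<gamma>)) =
  - (fsign \<gamma> (move m' \<gamma>) * fsign (move m' \<gamma>) (move m' (move m \<gamma>)))"
proof -
 define \<kappa> :: "'n rvec \<times> bool \<Rightarrow> real" where "\<kappa> m = (if snd m then 1 else -1)" for m
 have key: "\<exists>t>0. ext_vec (proj (fst (move m' (move m \<gamma>))) (fst m')) \<^bold>\<and>
   (ext_vec (proj (fst (move m' (move m \<gamma>))) (fst m)) \<^bold>\<and> \<nu> \<gamma>) =
   (t * (\<kappa> m * \<kappa> m') * (fsign \<gamma> (move m \<gamma>) * fsign (move m \<gamma>) (move m' (move m \<gamma>))))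
    *\<^sub>R \<nu> (move m' (move m \<gamma>))"
  if m: "m \<in> moves \<gamma>" "m' \<in> moves (move m \<gamma>)" for m m'
 proof -
  obtain u b u' b' where eq: "m = (u, b)" "m' = (u', b')" by (metis surj_pair)
  let ?\<delta> = "move m \<gamma>" and ?\<epsilon> = "move m' (move m \<gamma>)"
  have \<delta>: "?\<delta> \<in> \<F>" using rays_of_move(1)[OF \<gamma> m(1)] .
  obtain t where t: "t > 0" "ext_vec (proj (fst ?\<delta>) u) \<^bold>\<and> \<nu> \<gamma> = (\<kappa> m * t * fsign \<gamma> ?\<delta>) *\<^sub>R \<nu> ?\<delta>"
   using nu_move(2)[OF \<gamma>, of u b] m(1) unfolding eq \<kappa>_def by auto
  obtain t' where t': "t' > 0" "ext_vec (proj (fst ?\<epsilon>) u') \<^bold>\<and> \<nu> ?\<delta> = (\<kappa> m' * t' * fsign ?\<delta> ?\<epsilon>) *\<^sub>R \<nu> ?\<epsilon>"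
   using nu_move(2)[OF \<delta>, of u' b'] m(2) unfolding eq \<kappa>_def by auto
  \<comment> \<open>The ray u is projected to the intermediate stratum in one formula and to the
    final stratum in the other. The two images differ by a multiple of the image of u', which
    disappears on multiplication by u'.\<close>
  have "\<exists>k. proj (fst ?\<epsilon>) u - proj (fst ?\<delta>) u = k *\<^sub>R proj (fst ?\<epsilon>) u'"
  proof (cases b')
   case True
   obtain \<tau> \<sigma> where \<delta>eq: "?\<delta> = (\<tau>, \<sigma>)" by (metis surj_pair)
   have "move m' (\<tau>, \<sigma>) = (\<tau>, ccone (insert u' (gens \<sigma>)))" using True by (simp add: eq(2) move_def)
   then have "fst ?\<epsilon> = fst ?\<delta>" unfolding \<delta>eq by simp
   then show ?thesis by (intro exI[of _ 0]) simp
  next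
   case False
   obtain \<tau> \<sigma> where \<delta>eq: "?\<delta> = (\<tau>, \<sigma>)" by (metis surj_pair)
   have m': "(u', False) \<in> moves (\<tau>, \<sigma>)" using m(2) False unfolding \<delta>eq eq(2) by simp
   have \<tau>: "\<tau> \<in> \<Sigma>" using \<delta> by (simp add: \<delta>eq faces_iff)
   obtain \<rho> where \<rho>: "move (u', False) (\<tau>, \<sigma>) = (\<rho>, \<sigma>)" "\<rho> \<in> \<Sigma>" "gens \<tau> = insert u' (gens \<rho>)"
    using move_False[OF \<delta>[unfolded \<delta>eq] m'] by metis
   have "proj \<tau> u = proj {proj \<rho> u'} (proj \<rho> u)"
    using proj_insert[of "gens \<rho>" u' u] \<rho>(2,3) \<tau> proj_gens by metis
   moreover have "proj \<rho> u - proj {proj \<rho> u'} (proj \<rho> u) \<in> span {proj \<rho> u'}" by (rule proj_in)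
   ultimately show ?thesis using \<rho>(1) False by (auto simp: \<delta>eq eq(2) span_singleton)
  qed
  then obtain k where k: "proj (fst ?\<epsilon>) u = proj (fst ?\<delta>) u + k *\<^sub>R proj (fst ?\<epsilon>) u'"
   by (metis add.commute diff_add_cancel)
  have "ext_vec (proj (fst ?\<epsilon>) u') \<^bold>\<and> (ext_vec (proj (fst ?\<epsilon>) u) \<^bold>\<and> \<nu> \<gamma>) =
    ext_vec (proj (fst ?\<epsilon>) u') \<^bold>\<and> (ext_vec (proj (fst ?\<delta>) u) \<^bold>\<and> \<nu> \<gamma>)"
   by (simp add: k ext_vec_add ext_vec_scale ext_mult_add_left ext_mult_add_right ext_mult_scale_left ext_mult_scale_right)
  also have "\<dots> = ((t * t') * (\<kappa> m * \<kappa> m') * (fsign \<gamma> ?\<delta> * fsign ?\<delta> ?\<epsilon>)) *\<^sub>R \<nu> ?\<epsilon>"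
   by (simp add: t(2) ext_mult_scale_right t'(2) mult_ac)
  finally show ?thesis using t(1) t'(1) by (intro exI[of _ "t * t'"]) (simp add: eq)
 qed
 note sw = moves_swap[OF \<gamma> m]
 let ?\<epsilon> = "move m' (move m \<gamma>)"
 have \<epsilon>: "?\<epsilon> \<in> \<F>" using rays_of_move(1)[OF rays_of_move(1)[OF \<gamma> m(1)] m(2)] .
 let ?s = "fsign \<gamma> (move m \<gamma>) * fsign (move m \<gamma>) ?\<epsilon>"
 let ?s' = "fsign \<gamma> (move m' \<gamma>) * fsign (move m' \<gamma>) ?\<epsilon>"
 let ?X = "ext_vec (proj (fst ?\<epsilon>) (fst m')) \<^bold>\<and> (ext_vec (proj (fst ?\<epsilon>) (fst m)) \<^bold>\<and> \<nu> \<gamma>)"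
 obtain t where t: "t > 0" "?X = (t * (\<kappa> m * \<kappa> m') * ?s) *\<^sub>R \<nu> ?\<epsilon>" using key[OF m] by blast
 from key[OF sw(1,2)] obtain t' where t'0: "t' > 0"
  "ext_vec (proj (fst ?\<epsilon>) (fst m)) \<^bold>\<and> (ext_vec (proj (fst ?\<epsilon>) (fst m')) \<^bold>\<and> \<nu> \<gamma>) =
   (t' * (\<kappa> m' * \<kappa> m) * ?s') *\<^sub>R \<nu> ?\<epsilon>"
  unfolding sw(3)[symmetric] by blast
 have t': "t' > 0" "- ?X = (t' * (\<kappa> m * \<kappa> m') * ?s') *\<^sub>R \<nu> ?\<epsilon>"
  using t'0(1) t'0(2)[unfolded ext_vec_anticommute[of "proj (fst ?\<epsilon>) (fst m)"] mult.commute[of "\<kappa> m'"]]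
  by auto
 have "(t * (\<kappa> m * \<kappa> m') * ?s + t' * (\<kappa> m * \<kappa> m') * ?s') *\<^sub>R \<nu> ?\<epsilon> = ?X + - ?X"
  unfolding scaleR_add_left t(2)[symmetric] t'(2)[symmetric] ..
 then have "(t * (\<kappa> m * \<kappa> m') * ?s + t' * (\<kappa> m * \<kappa> m') * ?s') *\<^sub>R \<nu> ?\<epsilon> = 0"
  by (simp only: add.right_inverse)
 moreover have "\<nu> ?\<epsilon> \<noteq> 0" using nu_nonzero \<epsilon> by (metis surj_pair)
 ultimately have "t * (\<kappa> m * \<kappa> m') * ?s + t' * (\<kappa> m * \<kappa> m') * ?s' = 0"
  using scaleR_eq_0_iff by blast
 moreover have "(\<kappa> m * \<kappa> m') * (t * ?s + t' * ?s') =
   t * (\<kappa> m * \<kappa> m') * ?s + t' * (\<kappa> m * \<kappa> m') * ?s'" by (simp only: distrib_left mult_ac)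
 ultimately have "(\<kappa> m * \<kappa> m') * (t * ?s + t' * ?s') = 0" by (rule trans[rotated])
 then have eq: "t * ?s + t' * ?s' = 0" by (simp add: \<kappa>_def split: if_splits)
 have s: "a * b = 1 \<or> a * b = - 1" if "a \<in> {1, -1 :: real}" "b \<in> {1, -1}" for a b using that by auto
 have "?s = 1 \<or> ?s = -1"
  by (rule s) (use nu_move(1) \<gamma> m rays_of_move(1)[OF \<gamma> m(1)] in \<open>metis surj_pair\<close>)+
 moreover have "?s' = 1 \<or> ?s' = -1"
  unfolding sw(3)
  by (rule s) (use nu_move(1) \<gamma> sw rays_of_move(1)[OF \<gamma> sw(1)] in \<open>metis surj_pair\<close>)+
 \<comment> \<open>Both products of signs are 1 or -1, and a combination of them with positive
   coefficients vanishes; so they are opposite.\<close>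
 ultimately show ?thesis using eq t(1) t'(1) by auto
qed

lemma fst_move_subset:
 assumes "\<gamma> \<in> \<F>" "m \<in> moves \<gamma>" shows "fst (move m \<gamma>) \<subseteq> fst \<gamma>"
proof -
 obtain \<tau> \<sigma> u b where eq: "\<gamma> = (\<tau>, \<sigma>)" "m = (u, b)" by (metis surj_pair)
 show ?thesis
 proof (cases b)
  case False
  then obtain \<rho> where \<rho>: "move (u, False) (\<tau>, \<sigma>) = (\<rho>, \<sigma>)" "\<rho> \<in> \<Sigma>" "gens \<tau> = insert u (gens \<rho>)" "u \<notin> gens \<rho>"
   using move_False[of \<tau> \<sigma> u] assms unfolding eq by metis
  have "\<tau> \<in> \<Sigma>" using assms(1) by (simp add: eq faces_iff)
  from face_of_imp_subset[OF gens_insert_dim(2)[OF \<rho>(2) this \<rho>(3,4)]] show ?thesis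
   using False by (simp add: eq \<rho>(1))
 qed (simp add: eq move_def)
qed

text \<open>The terms are indexed by ordered pairs of moves. Both orders lead to the same coface
  with the same projected coefficient, and \<open>face_sign_swap\<close> makes the terms
  cancel.\<close>

lemma trop_boundary_twice: "\<partial> (\<partial> c) = 0"
proof
 fix \<gamma>
 show "\<partial> (\<partial> c) \<gamma> = 0 \<gamma>"
 proof (cases "\<gamma> \<in> \<F>")
  case False
  then show ?thesis by (simp add: trop_boundary_outside)
 next
  case \<gamma>: True
  let ?S = "\<lambda>\<gamma> \<delta>. fsign \<gamma> \<delta>"
  let ?f = "\<lambda>(m, m'). (?S \<gamma> (move m \<gamma>) * ?S (move m \<gamma>) (move m' (move m \<gamma>))) *\<^sub>R
    ext_map (proj (fst \<gamma>)) (c (move m' (move m \<gamma>)))"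
  let ?P = "Sigma (moves \<gamma>) (\<lambda>m. moves (move m \<gamma>))"
  have fin: "finite (moves \<gamma>)" "\<And>m. m \<in> moves \<gamma> \<Longrightarrow> finite (moves (move m \<gamma>))"
   using finite_moves \<gamma> rays_of_move(1) by auto
  have "\<partial> (\<partial> c) \<gamma> =
    (\<Sum>m\<in>moves \<gamma>. \<Sum>m'\<in>moves (move m \<gamma>). ?f (m, m'))"
   unfolding trop_boundary_moves[OF \<gamma>]
  proof (rule sum.cong[OF refl])
   fix m assume m: "m \<in> moves \<gamma>"
   have "ext_map (proj (fst \<gamma>)) (ext_map (proj (fst (move m \<gamma>))) x) = ext_map (proj (fst \<gamma>)) x" for x
    using proj_proj[OF fst_move_subset[OF \<gamma> m]]
    by (simp add: ext_map_comp[OF linear_proj linear_proj])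
   then show "?S \<gamma> (move m \<gamma>) *\<^sub>R ext_map (proj (fst \<gamma>)) (\<partial> c (move m \<gamma>)) =
     (\<Sum>m'\<in>moves (move m \<gamma>). ?f (m, m'))"
    by (simp add: trop_boundary_moves[OF rays_of_move(1)[OF \<gamma> m]] ext_map_linear scaleR_sum_right)
  qed
  also have "\<dots> = sum ?f ?P" using fin by (subst sum.Sigma) auto
  also have "\<dots> = 0"
  proof (rule sum_swap_antisymmetric)
   fix m m' assume "(m, m') \<in> ?P"
   then have m: "m \<in> moves \<gamma>" "m' \<in> moves (move m \<gamma>)" by auto
   note sw = moves_swap[OF \<gamma> m]
   show "(m', m) \<in> ?P \<and> ?f (m', m) = - ?f (m, m')"
    using sw face_sign_swap[OF \<gamma> m] by (simp flip: scaleR_minus_left)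
  qed
  finally show ?thesis by simp
 qed
qed

lemma linear_trop_boundary:
 "\<partial> (c + c') = \<partial> c + \<partial> c'"
 "\<partial> (c - c') = \<partial> c - \<partial> c'"
 "\<partial> 0 = 0"
 by (auto simp: trop_boundary_def fun_eq_iff ext_map_linear scaleR_add_right scaleR_diff_right sum.distrib sum_subtractf)

end

section \<open>Exactness and trivial homology\<close>

lemma carrier_homology:
 "carrier (homology C D q) = (\<lambda>z. (\<lambda>h. h + z) ` (D ` C (Suc q))) ` cycles C D q"
 by (auto simp: homology_def FactGroup_def RCOSETS_def r_coset_def add_group_def)

lemma homology_class_eq: "homology_class C D q c = (\<lambda>h. h + c) ` (D ` C (Suc q))"
 by (auto simp: homology_class_def r_coset_def add_group_def)

text \<open>When every cycle is a boundary, each coset is the group of boundaries itself; the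
  quotient then has one element, and its group laws are read off from it.\<close>

lemma trivial_homologyI:
 assumes C: "\<And>q. 0 \<in> C q" "\<And>q x y. x \<in> C q \<Longrightarrow> y \<in> C q \<Longrightarrow> x + y \<in> C q" "\<And>q x. x \<in> C q \<Longrightarrow> - x \<in> C q"
  and D: "\<And>x y. D (x + y) = D x + D y"
  and exact: "cycles C D q \<subseteq> D ` C (Suc q)"
 shows "trivial_group (homology C D q)"
proof -
 let ?B = "D ` C (Suc q)"
 have D0: "D 0 = 0" using D[of 0 0] by simp
 have Dm: "D (- x) = - D x" for x
  using D[of x "- x"] D0 by (simp add: eq_neg_iff_add_eq_0 add.commute)
 have B: "0 \<in> ?B" "\<And>x y. x \<in> ?B \<Longrightarrow> y \<in> ?B \<Longrightarrow> x + y \<in> ?B" "\<And>x. x \<in> ?B \<Longrightarrow> - x \<in> ?B"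
 proof -
  show "0 \<in> ?B" using imageI[OF C(1), of D "Suc q"] D0 by simp
  show "x + y \<in> ?B" if xy: "x \<in> ?B" "y \<in> ?B" for x y
  proof -
   obtain a where a: "x = D a" "a \<in> C (Suc q)" using xy(1) by (rule imageE)
   obtain b where b: "y = D b" "b \<in> C (Suc q)" using xy(2) by (rule imageE)
   show ?thesis using imageI[OF C(2)[OF a(2) b(2)], of D] by (simp add: D a b)
  qed
  show "- x \<in> ?B" if x: "x \<in> ?B" for x
  proof -
   obtain a where "x = D a" "a \<in> C (Suc q)" using x by (rule imageE)
   then show ?thesis using imageI[OF C(3), of a "Suc q" D] Dm by simp
  qed
 qed
 have coset: "(\<lambda>h. h + z) ` ?B = ?B" if "z \<in> ?B" for z
 proof
  show "?B \<subseteq> (\<lambda>h. h + z) ` ?B"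
  proof
   fix x assume "x \<in> ?B"
   then have "x + - z \<in> ?B" using B(2,3) that by blast
   then show "x \<in> (\<lambda>h. h + z) ` ?B" by (rule rev_image_eqI) simp
  qed
 qed (use B(2) that in blast)
 have "0 \<in> cycles C D q" using C(1) D0 by (simp add: cycles_def)
 moreover have "(\<lambda>h. h + z) ` ?B = ?B" if "z \<in> cycles C D q" for z
  using coset exact that by blast
 ultimately have car: "carrier (homology C D q) = {?B}"
  unfolding carrier_homology by (metis (no_types, lifting) empty_iff image_constant image_cong)
 have one: "\<one>\<^bsub>homology C D q\<^esub> = ?B" by (simp add: homology_def FactGroup_def)
 have mult: "?B \<otimes>\<^bsub>homology C D q\<^esub> ?B = ?B"
 proof -
  have "?B \<otimes>\<^bsub>homology C D q\<^esub> ?B = (\<Union>h\<in>?B. \<Union>k\<in>?B. {h + k})"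
   by (simp add: homology_def FactGroup_def set_mult_def add_group_def)
  also have "\<dots> = ?B"
  proof
   show "?B \<subseteq> (\<Union>h\<in>?B. \<Union>k\<in>?B. {h + k})"
   proof
    fix x assume "x \<in> ?B"
    then show "x \<in> (\<Union>h\<in>?B. \<Union>k\<in>?B. {h + k})" using B(1) by (intro UN_I[of x] UN_I[of 0]) auto
   qed
  qed (use B(2) in blast)
  finally show ?thesis .
 qed
 have "group (homology C D q)"
  by (rule groupI) (use car one mult in auto)
 then show ?thesis unfolding trivial_group_def car one by simp
qed

lemma trivial_homologyD:
 assumes "trivial_group (homology C D q)" "0 \<in> C (Suc q)" "D 0 = 0"
 shows "cycles C D q \<subseteq> D ` C (Suc q)"
proof
 fix z assume z: "z \<in> cycles C D q"
 have B: "0 \<in> D ` C (Suc q)" using imageI[OF assms(2), of D] assms(3) by simp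
 have "(\<lambda>h. h + z) ` (D ` C (Suc q)) \<in> carrier (homology C D q)"
  unfolding carrier_homology using z by (rule imageI)
 moreover have "carrier (homology C D q) = {\<one>\<^bsub>homology C D q\<^esub>}"
  using assms(1) by (simp add: trivial_group_def)
 moreover have "\<one>\<^bsub>homology C D q\<^esub> = D ` C (Suc q)" by (simp add: homology_def FactGroup_def)
 ultimately have "(\<lambda>h. h + z) ` (D ` C (Suc q)) = D ` C (Suc q)" by simp
 moreover have "0 + z \<in> (\<lambda>h. h + z) ` (D ` C (Suc q))" using B by (rule imageI)
 ultimately show "z \<in> D ` C (Suc q)" by simp
qed

text \<open>Replaces the spectral sequence of a bounded filtration. At stage m the chain y has the
  right boundary on all levels below m; \<open>step\<close> applied to the remaining cycle corrects
  level m, and its boundary vanishes below, so earlier levels are not disturbed.\<close>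

lemma filtered_exact:
 fixes gr :: "'f \<Rightarrow> nat" and D :: "('f \<Rightarrow> 'v::ab_group_add) \<Rightarrow> 'f \<Rightarrow> 'v"
 assumes C: "0 \<in> C (Suc q)" "\<And>x y. x \<in> C (Suc q) \<Longrightarrow> y \<in> C (Suc q) \<Longrightarrow> x + y \<in> C (Suc q)"
  "\<And>x y. x \<in> C q \<Longrightarrow> y \<in> C q \<Longrightarrow> x - y \<in> C q"
  and D: "\<And>x y. D (x + y) = D x + D y" "\<And>x y. D (x - y) = D x - D y" "\<And>x. x \<in> C (Suc q) \<Longrightarrow> D x \<in> C q"
  "\<And>x. x \<in> C (Suc q) \<Longrightarrow> D (D x) = 0"
  and bound: "\<And>c \<gamma>. c \<in> C q \<Longrightarrow> n \<le> gr \<gamma> \<Longrightarrow> c \<gamma> = 0"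
  and step: "\<And>m z. z \<in> C q \<Longrightarrow> D z = 0 \<Longrightarrow> (\<And>\<gamma>. gr \<gamma> < m \<Longrightarrow> z \<gamma> = 0) \<Longrightarrow>
   \<exists>y\<in>C (Suc q). \<forall>\<gamma>. gr \<gamma> \<le> m \<longrightarrow> D y \<gamma> = z \<gamma>"
 shows "cycles C D q \<subseteq> D ` C (Suc q)"
proof
 fix z assume "z \<in> cycles C D q"
 then have z: "z \<in> C q" "D z = 0" by (auto simp: cycles_def)
 have D0: "D 0 = 0" using D(1)[of 0 0] by simp
 have "\<exists>y\<in>C (Suc q). \<forall>\<gamma>. gr \<gamma> < m \<longrightarrow> D y \<gamma> = z \<gamma>" for m
 proof (induction m)
  case 0
  show ?case using C(1) by (intro bexI[of _ 0]) auto
 next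
  case (Suc m)
  then obtain y where y: "y \<in> C (Suc q)" "\<And>\<gamma>. gr \<gamma> < m \<Longrightarrow> D y \<gamma> = z \<gamma>" by blast
  have "\<exists>y'\<in>C (Suc q). \<forall>\<gamma>. gr \<gamma> \<le> m \<longrightarrow> D y' \<gamma> = (z - D y) \<gamma>"
  proof (rule step)
   show "z - D y \<in> C q" using z(1) D(3)[OF y(1)] by (rule C(3))
   show "D (z - D y) = 0" by (simp add: D(2,4) z(2) y(1))
   show "(z - D y) \<gamma> = 0" if "gr \<gamma> < m" for \<gamma> using y(2)[OF that] by simp
  qed
  then obtain y' where y': "y' \<in> C (Suc q)" "\<And>\<gamma>. gr \<gamma> \<le> m \<Longrightarrow> D y' \<gamma> = (z - D y) \<gamma>" by blast
  have "D (y + y') \<gamma> = z \<gamma>" if "gr \<gamma> < Suc m" for \<gamma> using y'(2)[of \<gamma>] that by (simp add: D(1))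
  then show ?case using C(2)[OF y(1) y'(1)] by blast
 qed
 from this[of n] obtain y where y: "y \<in> C (Suc q)" "\<And>\<gamma>. gr \<gamma> < n \<Longrightarrow> D y \<gamma> = z \<gamma>" by blast
 have "D y = z"
 proof
  fix \<gamma> show "D y \<gamma> = z \<gamma>"
   using y(2)[of \<gamma>] bound[OF z(1), of \<gamma>] bound[OF D(3)[OF y(1)], of \<gamma>] by (cases "gr \<gamma> < n") auto
 qed
 then show "z \<in> D ` C (Suc q)" using y(1) by blast
qed

section \<open>Koszul exactness\<close>

text \<open>The map v \<mapsto> v - x(v) \<rho> kills \<rho> and fixes the kernel of
  \<open>x \<rho>\<close>, so what it annihilates is divisible by \<rho>. An element annihilated for
  each \<rho> in S is divisible by all of S, which is more factors than its degree.\<close>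

lemma wedge_coordinates_zero:
 fixes S :: "'n::{finite,linorder} rvec set" and x :: "'n rvec \<Rightarrow> 'n rvec \<Rightarrow> real"
 assumes S: "finite S" and x: "\<And>\<rho>. \<rho> \<in> S \<Longrightarrow> linear (x \<rho>)"
  "\<And>\<rho> \<rho>'. \<rho> \<in> S \<Longrightarrow> \<rho>' \<in> S \<Longrightarrow> x \<rho> \<rho>' = (if \<rho>' = \<rho> then 1 else 0)"
  and w: "w \<in> grade p" "p < card S"
  and zero: "\<And>\<rho>. \<rho> \<in> S \<Longrightarrow> ext_map (\<lambda>v. v - x \<rho> v *\<^sub>R \<rho>) w = 0"
 shows "w = 0"
proof -
 let ?V = "{v. \<forall>\<rho>\<in>S. x \<rho> v = 0}"
 \<comment> \<open>Wedges are written in factors from S and from the common kernel of the forms; R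
   is the set of rays already shown to occur in every term.\<close>
 define W where "W R = span {wedge ws | ws. length ws = p \<and> set ws \<subseteq> S \<union> ?V \<and> R \<subseteq> set ws}" for R
 have lin: "linear (\<lambda>v. v - x \<rho> v *\<^sub>R \<rho>)" if "\<rho> \<in> S" for \<rho>
  by (rule linearI) (simp_all add: linear_add[OF x(1)[OF that]] linear_scale[OF x(1)[OF that]] algebra_simps)
 have "v \<in> kspan UNIV (S \<union> ?V)" for v
 proof -
  let ?u = "\<Sum>\<rho>\<in>S. x \<rho> v *\<^sub>R \<rho>"
  note km = kmodule_kspan[OF real_subring_UNIV, of "S \<union> ?V"]
  note sup = kspan_superset[of UNIV "S \<union> ?V"]
  have "x \<rho> ?u = x \<rho> v" if "\<rho> \<in> S" for \<rho>
  proof -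
   have "x \<rho> ?u = (\<Sum>\<rho>'\<in>S. x \<rho>' v * x \<rho> \<rho>')" by (simp add: linear_sum[OF x(1)[OF that]] linear_scale[OF x(1)[OF that]])
   also have "\<dots> = (\<Sum>\<rho>'\<in>S. if \<rho>' = \<rho> then x \<rho> v else 0)" using x(2)[OF that] by (intro sum.cong) auto
   finally show ?thesis using S that by simp
  qed
  then have "v - ?u \<in> ?V" using x(1) by (simp add: linear_diff)
  then have "v - ?u \<in> kspan UNIV (S \<union> ?V)" using sup by auto
  moreover have "?u \<in> kspan UNIV (S \<union> ?V)"
   using sup by (intro kmodule_sum[OF km] kmoduleD(3)[OF km]) auto
  ultimately have "(v - ?u) + ?u \<in> kspan UNIV (S \<union> ?V)" by (rule kmoduleD(2)[OF km])
  then show ?thesis by simp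
 qed
 then have "wedge vs \<in> W {}" if "length vs = p" for vs
  using wedge_kspan[OF real_subring_UNIV, of vs "S \<union> ?V"] kspan_subset_span that
  unfolding W_def by (fastforce simp: conj_commute)
 then have "grade p \<subseteq> W {}" unfolding grade_def W_def by (intro span_minimal subspace_span) auto
 then have W0: "w \<in> W {}" using w(1) by auto
 have "w \<in> W R" if "finite R" "R \<subseteq> S" for R
  using that
 proof (induction R rule: finite_induct)
  case empty
  show ?case by (rule W0)
 next
  case (insert \<rho> R)
  then have \<rho>: "\<rho> \<in> S" and wR: "w \<in> W R" by auto
  let ?e = "\<lambda>v. v - x \<rho> v *\<^sub>R \<rho>"
  have "y - ext_map ?e y \<in> W (insert \<rho> R)" if "y \<in> W R" for y
   using that unfolding W_def
  proof (induction rule: span_induct)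
   case base
   have "linear (\<lambda>y. y - ext_map ?e y)"
    by (intro linear_compose_sub linear_ident linear_ext_map)
   then show ?case by (rule subspace_linear_vimage[OF _ subspace_span])
  next
   case (step y)
   then obtain ws where ws: "y = wedge ws" "length ws = p" "set ws \<subseteq> S \<union> ?V" "R \<subseteq> set ws" by blast
   show ?case
   proof (cases "\<rho> \<in> set ws")
    case True
    have "0 = ?e \<rho>" using x(2)[OF \<rho> \<rho>] by simp
    then have 0: "0 \<in> set (map ?e ws)" unfolding set_map using True by (rule image_eqI)
    have "wedge (map ?e ws) = 0"
    proof (rule ccontr)
     assume "wedge (map ?e ws) \<noteq> 0"
     then have "independent (set (map ?e ws))" using wedge_nonzero_imp by blast
     with dependent_zero[OF 0] show False by simp
    qed
    then have "y - ext_map ?e y = wedge ws" by (simp add: ws(1) ext_map_wedge[OF lin[OF \<rho>]])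
    then show ?thesis using True ws by (auto intro!: span_base)
   next
    case False
    have "x \<rho> v = 0" if "v \<in> set ws" for v
     using ws(3) that False x(2)[OF \<rho>, of v] \<rho> by auto
    then have "map ?e ws = ws" by (intro map_idI) auto
    then show ?thesis by (simp add: ws(1) ext_map_wedge[OF lin[OF \<rho>]] span_0)
   qed
  qed
  from this[OF wR] show ?case using zero[OF \<rho>] by simp
 qed
 from this[OF S order_refl] have "w \<in> W S" .
 moreover have "\<not> S \<subseteq> set ws" if "length ws = p" for ws
  using card_mono[of "set ws" S] card_length[of ws] w(2) that by auto
 then have "{wedge ws | ws. length ws = p \<and> set ws \<subseteq> S \<union> ?V \<and> S \<subseteq> set ws} = {}" by auto
 ultimately show ?thesis unfolding W_def by simp
qed

text \<open>Abstracts the faces with a fixed second cone \<sigma>: S is its ray set and A that of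
  the first cone. The differential enlarges A and so lowers the face dimension
  \<open>card S - card A\<close>; \<open>F_quotient\<close> is its structure map,
  \<open>F_section\<close> the partial inverse from which homotopies are made.\<close>

locale koszul =
 fixes S :: "'n::{finite,linorder} rvec set" and x :: "'n rvec \<Rightarrow> 'n rvec \<Rightarrow> real"
  and F :: "'n rvec set \<Rightarrow> 'n ext set" and sgn :: "'n rvec set \<Rightarrow> 'n rvec \<Rightarrow> real"
 assumes finS: "finite S" and x_lin: "\<And>\<rho>. \<rho> \<in> S \<Longrightarrow> linear (x \<rho>)"
  and x_dual: "\<And>\<rho> \<rho>'. \<rho> \<in> S \<Longrightarrow> \<rho>' \<in> S \<Longrightarrow> x \<rho> \<rho>' = (if \<rho>' = \<rho> then 1 else 0)"
  and F_zero: "\<And>A. 0 \<in> F A" and F_add: "\<And>A a b. a \<in> F A \<Longrightarrow> b \<in> F A \<Longrightarrow> a + b \<in> F A"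
  and F_neg: "\<And>A a. a \<in> F A \<Longrightarrow> - a \<in> F A"
  and F_proj: "\<And>A w. A \<subseteq> S \<Longrightarrow> w \<in> F A \<Longrightarrow> ext_map (proj A) w = w"
  and F_section: "\<And>A \<rho> w. A \<subseteq> S \<Longrightarrow> \<rho> \<in> S - A \<Longrightarrow> w \<in> F (insert \<rho> A) \<Longrightarrow>
   ext_map (\<lambda>v. proj A (v - x \<rho> v *\<^sub>R \<rho>)) w \<in> F A"
  and F_quotient: "\<And>A u w. A \<subseteq> S \<Longrightarrow> u \<in> A \<Longrightarrow> w \<in> F (A - {u}) \<Longrightarrow> ext_map (proj A) w \<in> F A"
  and sgn_unit: "\<And>A \<rho>. A \<subseteq> S \<Longrightarrow> \<rho> \<in> S - A \<Longrightarrow> sgn A \<rho> \<in> {1, -1}"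
  and sgn_swap: "\<And>A \<rho> \<rho>'. A \<subseteq> S \<Longrightarrow> \<rho> \<in> S - A \<Longrightarrow> \<rho>' \<in> S - A \<Longrightarrow> \<rho> \<noteq> \<rho>' \<Longrightarrow>
   sgn A \<rho> * sgn (insert \<rho> A) \<rho>' = - (sgn A \<rho>' * sgn (insert \<rho>' A) \<rho>)"
begin

definition d :: "('n rvec set \<Rightarrow> 'n ext) \<Rightarrow> 'n rvec set \<Rightarrow> 'n ext" where
 "d z A = (\<Sum>u\<in>A. sgn (A - {u}) u *\<^sub>R ext_map (proj A) (z (A - {u})))"

text \<open>For \<rho> outside A, a section of the quotient map from level A to level
  \<open>insert \<rho> A\<close>: moving v along \<rho> into the kernel of \<open>x \<rho>\<close>
  makes the result depend only on its class modulo \<rho>.\<close>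

definition sec :: "'n rvec set \<Rightarrow> 'n rvec \<Rightarrow> 'n rvec \<Rightarrow> 'n rvec" where
 "sec A \<rho> v = proj A (v - x \<rho> v *\<^sub>R \<rho>)"

lemma d_add: "d (\<lambda>A. y A + y' A) A = d y A + d y' A"
 and d_diff: "d (\<lambda>A. y A - y' A) A = d y A - d y' A"
 by (simp_all add: d_def ext_map_linear scaleR_add_right
   scaleR_diff_right sum.distrib sum_subtractf)

lemma d_twice:
 assumes A: "A \<subseteq> S" shows "d (d y) A = 0"
proof -
 have fin: "finite A" using A finS finite_subset by blast
 let ?f = "\<lambda>(u, v). (sgn (A - {u}) u * sgn (A - {u} - {v}) v) *\<^sub>R ext_map (proj A) (y (A - {u} - {v}))"
 let ?P = "Sigma A (\<lambda>u. A - {u})"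
 have "d (d y) A = (\<Sum>u\<in>A. \<Sum>v\<in>A - {u}. ?f (u, v))"
  unfolding d_def[of "d y"]
 proof (rule sum.cong[OF refl])
  fix u assume "u \<in> A"
  have "ext_map (proj A) (ext_map (proj (A - {u})) w) = ext_map (proj A) w" for w
   using proj_proj[of "A - {u}" A] by (simp add: ext_map_comp[OF linear_proj linear_proj])
  then show "sgn (A - {u}) u *\<^sub>R ext_map (proj A) (d y (A - {u})) = (\<Sum>v\<in>A - {u}. ?f (u, v))"
   by (simp add: d_def ext_map_linear scaleR_sum_right)
 qed
 also have "\<dots> = sum ?f ?P" using fin by (subst sum.Sigma) auto
 also have "\<dots> = 0"
 proof (rule sum_swap_antisymmetric)
  fix u v assume uv: "(u, v) \<in> ?P"
  have "insert v (A - {u} - {v}) = A - {u}" "insert u (A - {u} - {v}) = A - {v}"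
   "A - {v} - {u} = A - {u} - {v}" using uv by auto
  then show "(v, u) \<in> ?P \<and> ?f (v, u) = - ?f (u, v)"
   using uv sgn_swap[of "A - {u} - {v}" u v] A by (auto simp: mult.commute simp flip: scaleR_minus_left)
 qed
 finally show ?thesis .
qed

lemma linear_sec: "\<rho> \<in> S \<Longrightarrow> linear (sec A \<rho>)"
 unfolding sec_def
 by (rule linearI) (simp_all add: linear_add[OF x_lin] linear_scale[OF x_lin] proj_add proj_diff proj_scale algebra_simps)

lemma F_sum: "(\<And>u. u \<in> B \<Longrightarrow> g u \<in> F A) \<Longrightarrow> sum g B \<in> F A"
 by (induction B rule: infinite_finite_induct) (auto simp: F_zero F_add)

lemma d_mem:
 assumes "A \<subseteq> S" "\<And>B. B \<subseteq> S \<Longrightarrow> y B \<in> F B" shows "d y A \<in> F A"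
proof -
 have "sgn (A - {u}) u *\<^sub>R ext_map (proj A) (y (A - {u})) \<in> F A" if u: "u \<in> A" for u
 proof -
  have "ext_map (proj A) (y (A - {u})) \<in> F A" by (rule F_quotient[OF assms(1) u assms(2)]) (use assms(1) in auto)
  moreover have "sgn (A - {u}) u \<in> {1, -1}" by (rule sgn_unit) (use assms(1) u in auto)
  ultimately show ?thesis using F_neg by auto
 qed
 then show ?thesis unfolding d_def by (rule F_sum)
qed

text \<open>h runs against the differential by means of the section for \<rho>. It recovers z where
  A contains \<rho>; elsewhere it yields the image of z A under the section, so that the difference
  is the part divisible by \<rho>.\<close>

lemma homotopy:
 assumes A: "A \<subseteq> S" and \<rho>: "\<rho> \<in> S" and z: "\<And>B. B \<subseteq> S \<Longrightarrow> z B \<in> F B" and dz: "\<And>B. B \<subseteq> S \<Longrightarrow> d z B = 0"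
  and h: "\<And>B. h B = (if \<rho> \<in> B then 0 else sgn B \<rho> *\<^sub>R ext_map (sec B \<rho>) (z (insert \<rho> B)))"
 shows "d h A = (if \<rho> \<in> A then z A else ext_map (sec A \<rho>) (z A))"
proof -
 have fin: "finite A" using A finS finite_subset by blast
 have pp: "proj A (proj (A - {u}) v) = proj A v" for u v by (rule proj_proj) auto
 have proj_sec: "ext_map (proj A) (ext_map (sec (A - {u}) \<rho>) w) = ext_map (sec A \<rho>) w" for u w
 proof -
  have "(\<lambda>v. proj A (sec (A - {u}) \<rho> v)) = sec A \<rho>" by (simp add: sec_def pp fun_eq_iff)
  then show ?thesis by (simp add: ext_map_comp[OF linear_proj linear_sec[OF \<rho>]])
 qed
 have sq: "sgn B r * sgn B r = 1" if "B \<subseteq> S" "r \<in> S - B" for B r using sgn_unit[OF that] by auto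
 show ?thesis
 proof (cases "\<rho> \<in> A")
  case True
  \<comment> \<open>h vanishes at sets containing \<rho>, so only u = \<rho> contributes; the two
    signs of this term multiply to 1.\<close>
  have "d h A = (\<Sum>u\<in>A. if u = \<rho> then (sgn (A - {\<rho>}) \<rho> * sgn (A - {\<rho>}) \<rho>) *\<^sub>R ext_map (sec A \<rho>) (z A) else 0)"
   unfolding d_def
  proof (rule sum.cong[OF refl])
   fix u assume u: "u \<in> A"
   have "insert \<rho> (A - {\<rho>}) = A" using True by auto
   then show "sgn (A - {u}) u *\<^sub>R ext_map (proj A) (h (A - {u})) =
     (if u = \<rho> then (sgn (A - {\<rho>}) \<rho> * sgn (A - {\<rho>}) \<rho>) *\<^sub>R ext_map (sec A \<rho>) (z A) else 0)"
    using u True by (auto simp: h ext_map_linear proj_sec)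
  qed
  also have "\<dots> = ext_map (sec A \<rho>) (z A)"
  proof -
   have "sgn (A - {\<rho>}) \<rho> * sgn (A - {\<rho>}) \<rho> = 1" by (rule sq) (use A \<rho> in auto)
   then show ?thesis using True fin by simp
  qed
  also have "sec A \<rho> v = proj A v" for v
   unfolding sec_def using True by (intro proj_eqI) (simp add: span_base span_scale span_neg)
  then have "sec A \<rho> = proj A" by (rule ext)
  finally show ?thesis using True F_proj[OF A z[OF A]] by simp
 next
  case False
  \<comment> \<open>The section factors through the quotient by \<open>insert \<rho> A\<close>,
    since it vanishes on \<rho> and on A.\<close>
  have kill: "sec A \<rho> (proj (insert \<rho> A) v) = sec A \<rho> v" for v
  proof -
   have "sec A \<rho> a = 0" if "a \<in> insert \<rho> A" for a
   proof (cases "a = \<rho>")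
    case True
    then show ?thesis using x_dual[OF \<rho> \<rho>] by (simp add: sec_def proj_0)
   next
    case F: False
    then have a: "a \<in> A" using that by simp
    then have "x \<rho> a = 0" using x_dual[OF \<rho>, of a] A F by auto
    then show ?thesis using a by (simp add: sec_def proj_eq_0_iff span_base)
   qed
   then have "span (insert \<rho> A) \<subseteq> {v. sec A \<rho> v = 0}"
    using subspace_linear_vimage[OF linear_sec[OF \<rho>], of "{0}" A] by (intro span_minimal) (auto simp: subspace_def)
   then have "sec A \<rho> (v - proj (insert \<rho> A) v) = 0" using proj_in by blast
   then show ?thesis by (simp add: linear_diff[OF linear_sec[OF \<rho>]])
  qed
  let ?B = "insert \<rho> A"
  have B: "?B \<subseteq> S" using A \<rho> by auto
  let ?g = "\<lambda>u. sgn (?B - {u}) u *\<^sub>R ext_map (sec A \<rho>) (z (?B - {u}))"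
  \<comment> \<open>The cycle equation at \<open>insert \<rho> A\<close>, pushed through the
    section: its term u = \<rho> is the wanted image of z A, and the other terms are those of d h A
    up to sign.\<close>
  have "0 = ext_map (sec A \<rho>) (d z ?B)" by (simp add: dz[OF B] ext_map_linear)
  also have "\<dots> = sum ?g ?B"
   by (simp add: d_def ext_map_linear
     ext_map_comp[OF linear_sec[OF \<rho>] linear_proj] kill eta_contract_eq)
  also have "\<dots> = sgn A \<rho> *\<^sub>R ext_map (sec A \<rho>) (z A) + sum ?g A"
   using fin False by simp
  finally have "sum ?g A + sgn A \<rho> *\<^sub>R ext_map (sec A \<rho>) (z A) = 0"
   by (simp only: add.commute)
  then have eq: "sum ?g A = - (sgn A \<rho> *\<^sub>R ext_map (sec A \<rho>) (z A))"
   by (rule eq_neg_iff_add_eq_0[THEN iffD2])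
  have "d h A = (\<Sum>u\<in>A. - (sgn A \<rho> *\<^sub>R ?g u))"
   unfolding d_def
  proof (rule sum.cong[OF refl])
   fix u assume u: "u \<in> A"
   let ?C = "A - {u}"
   have C: "?C \<subseteq> S" "\<rho> \<in> S - ?C" "u \<in> S - ?C" "u \<noteq> \<rho>" "\<rho> \<notin> ?C" using u A \<rho> False by auto
   have e: "insert u ?C = A" "insert \<rho> ?C = ?B - {u}" using u C(4) by auto
   have "sgn ?C u * sgn A \<rho> = - (sgn ?C \<rho> * sgn (?B - {u}) u)"
    using sgn_swap[OF C(1,3,2,4)] unfolding e .
   moreover have "sgn ?C \<rho> * sgn ?C \<rho> = 1" "sgn A \<rho> * sgn A \<rho> = 1"
    using sq[OF C(1,2)] sq[OF A] \<rho> False by auto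
   ultimately have s: "sgn ?C u * sgn ?C \<rho> = - (sgn A \<rho> * sgn (?B - {u}) u)" by algebra
   have "sgn ?C u *\<^sub>R ext_map (proj A) (h ?C) = (sgn ?C u * sgn ?C \<rho>) *\<^sub>R ext_map (sec A \<rho>) (z (?B - {u}))"
    unfolding h[of ?C] if_not_P[OF C(5)] e(2) ext_map_linear proj_sec scaleR_scaleR ..
   then show "sgn ?C u *\<^sub>R ext_map (proj A) (h ?C) = - (sgn A \<rho> *\<^sub>R ?g u)"
    by (simp add: s)
  qed
  also have "\<dots> = - (sgn A \<rho> *\<^sub>R sum ?g A)" by (simp add: sum_negf scaleR_sum_right)
  also have "\<dots> = ext_map (sec A \<rho>) (z A)"
   using sq[of A \<rho>] A \<rho> False by (simp add: eq)
  finally show ?thesis using False by simp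
 qed
qed

text \<open>Rays are treated one at a time, with the invariant that d y agrees with z at all sets
  meeting R. The empty set is never reached; d y vanishes there, so z {} = 0 has to be proved, and
  this is where p < q enters.\<close>

lemma exact:
 assumes deg: "F {} \<subseteq> grade p" "p < q"
  and z: "\<And>A. A \<subseteq> S \<Longrightarrow> z A \<in> F A" "\<And>A. A \<subseteq> S \<Longrightarrow> card S - card A \<noteq> q \<Longrightarrow> z A = 0"
  and dz: "\<And>A. A \<subseteq> S \<Longrightarrow> d z A = 0"
 shows "\<exists>y. (\<forall>A\<subseteq>S. y A \<in> F A \<and> (card S - card A \<noteq> Suc q \<longrightarrow> y A = 0)) \<and> (\<forall>A\<subseteq>S. d y A = z A)"
proof -
 have "\<exists>y. (\<forall>A\<subseteq>S. y A \<in> F A \<and> (card S - card A \<noteq> Suc q \<longrightarrow> y A = 0)) \<and>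
   (\<forall>A\<subseteq>S. A \<inter> R \<noteq> {} \<longrightarrow> d y A = z A)" if "finite R" "R \<subseteq> S" for R
  using that
 proof (induction R rule: finite_induct)
  case empty
  show ?case by (intro exI[of _ "\<lambda>_. 0"]) (simp add: F_zero)
 next
  case (insert \<rho> R)
  have "R \<subseteq> S" using insert.prems by simp
  from insert.IH[OF this] obtain y where
   y0: "\<forall>A\<subseteq>S. y A \<in> F A \<and> (card S - card A \<noteq> Suc q \<longrightarrow> y A = 0)"
   "\<forall>A\<subseteq>S. A \<inter> R \<noteq> {} \<longrightarrow> d y A = z A" by (elim exE conjE)
  have y: "\<And>A. A \<subseteq> S \<Longrightarrow> y A \<in> F A" "\<And>A. A \<subseteq> S \<Longrightarrow> card S - card A \<noteq> Suc q \<Longrightarrow> y A = 0"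
   "\<And>A. A \<subseteq> S \<Longrightarrow> A \<inter> R \<noteq> {} \<Longrightarrow> d y A = z A" using y0 by simp_all
  have \<rho>: "\<rho> \<in> S" using insert.prems by simp
  define z' where "z' A = z A - d y A" for A
  define h where "h B = (if \<rho> \<in> B then 0 else sgn B \<rho> *\<^sub>R ext_map (sec B \<rho>) (z' (insert \<rho> B)))" for B
  have z'F: "z' A \<in> F A" if "A \<subseteq> S" for A
   using F_add[OF z(1)[OF that] F_neg[OF d_mem[OF that y(1)]]] by (simp add: z'_def)
  have dz': "d z' A = 0" if "A \<subseteq> S" for A
   unfolding z'_def d_diff using dz[OF that] d_twice[OF that] by simp
  have dy0: "d y A = 0" if A: "A \<subseteq> S" "card S - card A \<noteq> q" for A
  proof -
   have fin: "finite A" using A(1) finS finite_subset by blast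
   have "y (A - {u}) = 0" if u: "u \<in> A" for u
   proof (rule y(2))
    have "card A = Suc (card (A - {u}))" using card.remove[OF fin u] .
    moreover have "card A \<le> card S" by (rule card_mono[OF finS A(1)])
    ultimately show "card S - card (A - {u}) \<noteq> Suc q" using A(2) by linarith
   qed (use A in auto)
   then show ?thesis by (simp add: d_def ext_map_linear)
  qed
  have hF: "h A \<in> F A \<and> (card S - card A \<noteq> Suc q \<longrightarrow> h A = 0)" if A: "A \<subseteq> S" for A
  proof (cases "\<rho> \<in> A")
   case True
   then show ?thesis by (simp add: h_def F_zero)
  next
   case False
   have iA: "insert \<rho> A \<subseteq> S" using A \<rho> by auto
   have fin: "finite A" using A finS finite_subset by blast
   have "ext_map (sec A \<rho>) (z' (insert \<rho> A)) \<in> F A"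
    using F_section[OF A _ z'F[OF iA]] \<rho> False unfolding sec_def[abs_def] by simp
   moreover have "sgn A \<rho> \<in> {1, -1}" by (rule sgn_unit) (use A \<rho> False in auto)
   moreover have "z' (insert \<rho> A) = 0" if "card S - card A \<noteq> Suc q"
   proof -
    have "card (insert \<rho> A) = Suc (card A)" "card (insert \<rho> A) \<le> card S"
     using fin False card_mono[OF finS iA] by auto
    then have "card S - card (insert \<rho> A) \<noteq> q" using that by linarith
    then show ?thesis using z(2)[OF iA] dy0[OF iA] by (simp add: z'_def)
   qed
   ultimately show ?thesis using F_neg False by (auto simp: h_def ext_map_linear)
  qed
  have "d (\<lambda>A. y A + h A) A = z A" if A: "A \<subseteq> S" "A \<inter> insert \<rho> R \<noteq> {}" for A
  proof -
   have dh: "d h A = (if \<rho> \<in> A then z' A else ext_map (sec A \<rho>) (z' A))"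
    by (rule homotopy[OF A(1) \<rho> z'F dz' h_def])
   show ?thesis
   proof (cases "\<rho> \<in> A")
    case True
    then show ?thesis by (simp add: d_add dh z'_def)
   next
    case False
    \<comment> \<open>A meets the rays treated before, so z' is zero there and its image under the
      section changes nothing.\<close>
    then have "d y A = z A" using y(3) A by auto
    then show ?thesis using False by (simp add: d_add dh z'_def ext_map_linear)
   qed
  qed
  then show ?case using y(1,2) hF F_add by (intro exI[of _ "\<lambda>A. y A + h A"]) auto
 qed
 from this[OF finS order_refl] obtain y where
  y: "\<forall>A\<subseteq>S. y A \<in> F A \<and> (card S - card A \<noteq> Suc q \<longrightarrow> y A = 0)" "\<forall>A\<subseteq>S. A \<inter> S \<noteq> {} \<longrightarrow> d y A = z A" by (elim exE conjE)
 \<comment> \<open>If S does not have q elements, the degree condition applies. Otherwise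
   \<open>homotopy\<close> at the empty set shows that every section annihilates z {}, whose degree
   p is below the number of rays.\<close>
 have "z {} = 0"
 proof (cases "card S = q")
  case False
  then show ?thesis using z(2)[of "{}"] by simp
 next
  case True
  show ?thesis
  proof (rule wedge_coordinates_zero[OF finS x_lin x_dual])
   show "z {} \<in> grade p" "p < card S" using z(1)[of "{}"] deg True by auto
   show "ext_map (\<lambda>v. v - x \<rho> v *\<^sub>R \<rho>) (z {}) = 0" if \<rho>: "\<rho> \<in> S" for \<rho>
   proof -
    have p0: "proj {} v = v" for v :: "'n rvec" by (rule proj_unique) (auto simp: span_0)
    have "d (\<lambda>B. if \<rho> \<in> B then 0 else sgn B \<rho> *\<^sub>R ext_map (sec B \<rho>) (z (insert \<rho> B))) {} =
      ext_map (sec {} \<rho>) (z {})"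
     using homotopy[OF empty_subsetI \<rho> z(1) dz refl] by simp
    then show ?thesis by (simp add: d_def sec_def[abs_def] p0)
   qed
  qed
 qed
 then have "d y {} = z {}" by (simp add: d_def)
 then have "\<forall>A\<subseteq>S. d y A = z A" using y(2) by (metis Int_absorb2)
 then show ?thesis using y(1) by blast
qed

end

section \<open>Vanishing of the homology off the diagonal\<close>

context simplicial_lattice_fan
begin

text \<open>What the hypotheses on the fan supply to the Koszul argument. The last clause does not
  ask for x to be K-valued on N: as \<open>gen\<close> need not be primitive, x \<rho> n may have a
  denominator, but its multiple of \<rho> must be a K-combination of lattice points of the
  ray.\<close>

definition dual_coords :: "real set \<Rightarrow> bool" where
 "dual_coords K \<longleftrightarrow> (\<forall>\<sigma>\<in>\<Sigma>. \<exists>x. \<forall>\<rho>\<in>gens \<sigma>. linear (x \<rho> :: _ \<Rightarrow> real) \<and>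
   (\<forall>\<rho>'\<in>gens \<sigma>. x \<rho> \<rho>' = (if \<rho>' = \<rho> then 1 else 0)) \<and>
   (\<forall>n\<in>N. x \<rho> n *\<^sub>R \<rho> \<in> kspan K (N \<inter> span {\<rho>})))"

lemma trop_F_eq: "trop_F K N \<Sigma> p (\<tau>, \<sigma>) = ext_power K {proj \<tau> ` (N \<inter> span \<eta>) | \<eta>. \<eta> \<in> \<Sigma> \<and> \<sigma> face_of \<eta>} p"
 by (simp add: trop_F_def star_lattices_def)

lemma trop_F_proj:
 assumes "x \<in> trop_F K N \<Sigma> p (\<tau>, \<sigma>)" shows "ext_map (proj \<tau>) x = x"
proof -
 have lin: "linear (\<lambda>x. ext_map (proj \<tau>) x - x)"
  by (intro linear_compose_sub linear_ident linear_ext_map)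
 have "trop_F K N \<Sigma> p (\<tau>, \<sigma>) \<subseteq> (\<lambda>x. ext_map (proj \<tau>) x - x) -` {0}"
  unfolding trop_F_eq
 proof (rule ext_power_least)
  show "kmodule K ((\<lambda>x. ext_map (proj \<tau>) x - x) -` {0})"
   by (rule kmodule_vimage[OF lin]) (simp add: kmodule_def)
  fix vs L assume L: "L \<in> {proj \<tau> ` (N \<inter> span \<eta>) | \<eta>. \<eta> \<in> \<Sigma> \<and> \<sigma> face_of \<eta>}" "set vs \<subseteq> L" "length vs = p"
  then have "set vs \<subseteq> range (proj \<tau>)" by auto
  then have "map (proj \<tau>) vs = vs" by (intro map_idI) (auto simp: proj_idem)
  then show "wedge vs \<in> (\<lambda>x. ext_map (proj \<tau>) x - x) -` {0}" by (simp add: ext_map_wedge[OF linear_proj])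
 qed
 with assms show ?thesis by auto
qed

lemma trop_F_quotient:
 assumes K: "real_subring K" and le: "\<tau>0 \<subseteq> \<tau>" "\<sigma> face_of \<sigma>0" and x: "x \<in> trop_F K N \<Sigma> p (\<tau>0, \<sigma>0)"
 shows "ext_map (proj \<tau>) x \<in> trop_F K N \<Sigma> p (\<tau>, \<sigma>)"
 unfolding trop_F_eq
proof (rule ext_map_ext_power[OF K linear_proj _ x[unfolded trop_F_eq]])
 fix L assume "L \<in> {proj \<tau>0 ` (N \<inter> span \<eta>) | \<eta>. \<eta> \<in> \<Sigma> \<and> \<sigma>0 face_of \<eta>}"
 then obtain \<eta> where \<eta>: "L = proj \<tau>0 ` (N \<inter> span \<eta>)" "\<eta> \<in> \<Sigma>" "\<sigma>0 face_of \<eta>" by blast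
 have "proj \<tau> ` L = proj \<tau> ` (N \<inter> span \<eta>)" by (simp add: \<eta>(1) image_image proj_proj[OF le(1)])
 then have "proj \<tau> ` L \<subseteq> kspan K (proj \<tau> ` (N \<inter> span \<eta>))"
  using kspan_superset[OF real_subringD(1)[OF K]] by metis
 moreover have "\<sigma> face_of \<eta>" using le(2) \<eta>(3) face_of_trans by blast
 ultimately show "\<exists>L'\<in>{proj \<tau> ` (N \<inter> span \<eta>) | \<eta>. \<eta> \<in> \<Sigma> \<and> \<sigma> face_of \<eta>}. proj \<tau> ` L \<subseteq> kspan K L'"
  using \<eta>(2) by blast
qed

lemma kmodule_trop_F: "real_subring K \<Longrightarrow> kmodule K (trop_F K N \<Sigma> p \<delta>)"
 unfolding trop_F_def by (rule kmodule_ext_power)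

lemma trop_chains_mem:
 assumes "c \<in> trop_chains K N \<Sigma> p q"
 shows "\<delta> \<in> \<F> \<Longrightarrow> face_dim \<delta> = q \<Longrightarrow> c \<delta> \<in> trop_F K N \<Sigma> p \<delta>"
  "\<not> (\<delta> \<in> \<F> \<and> face_dim \<delta> = q) \<Longrightarrow> c \<delta> = 0"
 using assms unfolding trop_chains_def by (smt (verit) mem_Collect_eq)+

lemma trop_chainsI:
 assumes "\<And>\<delta>. \<delta> \<in> \<F> \<Longrightarrow> face_dim \<delta> = q \<Longrightarrow> c \<delta> \<in> trop_F K N \<Sigma> p \<delta>"
  "\<And>\<delta>. \<not> (\<delta> \<in> \<F> \<and> face_dim \<delta> = q) \<Longrightarrow> c \<delta> = 0"
 shows "c \<in> trop_chains K N \<Sigma> p q"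
 using assms unfolding trop_chains_def by simp

lemma trop_chains_proj:
 assumes "c \<in> trop_chains K N \<Sigma> p q" shows "ext_map (proj \<tau>) (c (\<tau>, \<sigma>)) = c (\<tau>, \<sigma>)"
 using trop_chains_mem[OF assms] trop_F_proj ext_map_linear(1) by metis

lemma trop_chains_group:
 assumes K: "real_subring K"
 shows "0 \<in> trop_chains K N \<Sigma> p q"
  "c \<in> trop_chains K N \<Sigma> p q \<Longrightarrow> c' \<in> trop_chains K N \<Sigma> p q \<Longrightarrow> c + c' \<in> trop_chains K N \<Sigma> p q"
  "c \<in> trop_chains K N \<Sigma> p q \<Longrightarrow> c' \<in> trop_chains K N \<Sigma> p q \<Longrightarrow> c - c' \<in> trop_chains K N \<Sigma> p q"
  "c \<in> trop_chains K N \<Sigma> p q \<Longrightarrow> - c \<in> trop_chains K N \<Sigma> p q"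
proof -
 note km = kmodule_trop_F[OF K]
 show "0 \<in> trop_chains K N \<Sigma> p q" by (rule trop_chainsI) (simp_all add: kmoduleD(1)[OF km])
 show "c + c' \<in> trop_chains K N \<Sigma> p q" if "c \<in> trop_chains K N \<Sigma> p q" "c' \<in> trop_chains K N \<Sigma> p q"
  using trop_chains_mem[OF that(1)] trop_chains_mem[OF that(2)]
  by (intro trop_chainsI) (simp_all add: kmoduleD(2)[OF km])
 show "c - c' \<in> trop_chains K N \<Sigma> p q" if "c \<in> trop_chains K N \<Sigma> p q" "c' \<in> trop_chains K N \<Sigma> p q"
  using trop_chains_mem[OF that(1)] trop_chains_mem[OF that(2)]
  by (intro trop_chainsI) (simp_all add: kmodule_diff[OF km K])
 show "- c \<in> trop_chains K N \<Sigma> p q" if "c \<in> trop_chains K N \<Sigma> p q"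
  using trop_chains_mem[OF that] by (intro trop_chainsI) (simp_all add: kmodule_neg[OF km K])
qed

end

context oriented_fan
begin

lemma face_sign_unit:
 assumes "facet_pair \<Sigma> \<gamma> \<delta>" shows "fsign \<gamma> \<delta> \<in> {1, -1}"
proof -
 have \<gamma>: "\<gamma> \<in> \<F>" using assms by (simp add: facet_pair_def)
 have "\<delta> \<in> (\<lambda>m. move m \<gamma>) ` moves \<gamma>" using assms cofaces_eq(1)[OF \<gamma>] by blast
 then obtain u b where "(u, b) \<in> moves \<gamma>" "\<delta> = move (u, b) \<gamma>" by auto
 then show ?thesis using nu_move(1)[OF \<gamma>] by simp
qed

lemma trop_boundary_chains:
 assumes K: "real_subring K" and c: "c \<in> trop_chains K N \<Sigma> p (Suc q)"
 shows "\<partial> c \<in> trop_chains K N \<Sigma> p q"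
proof (rule trop_chainsI)
 note km = kmodule_trop_F[OF K]
 fix \<gamma> assume \<gamma>: "\<gamma> \<in> \<F>" "face_dim \<gamma> = q"
 show "\<partial> c \<gamma> \<in> trop_F K N \<Sigma> p \<gamma>"
  unfolding trop_boundary_def
 proof (rule kmodule_sum[OF km])
  fix \<delta> assume \<delta>: "\<delta> \<in> {\<delta>. facet_pair \<Sigma> \<gamma> \<delta>}"
  obtain \<tau> \<sigma> \<tau>0 \<sigma>0 where eq: "\<gamma> = (\<tau>, \<sigma>)" "\<delta> = (\<tau>0, \<sigma>0)" by (metis surj_pair)
  have "\<tau>0 \<subseteq> \<tau>" "\<sigma> face_of \<sigma>0" "\<delta> \<in> \<F>" "face_dim \<delta> = Suc q"
   using \<delta> \<gamma>(2) face_of_imp_subset by (auto simp: facet_pair_def face_le_def eq)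
  then have "ext_map (proj (fst \<gamma>)) (c \<delta>) \<in> trop_F K N \<Sigma> p \<gamma>"
   using trop_F_quotient[OF K, of \<tau>0 \<tau> \<sigma> \<sigma>0] trop_chains_mem(1)[OF c, of \<delta>] by (simp add: eq)
  moreover from kmodule_neg[OF km K this] have "- ext_map (proj (fst \<gamma>)) (c \<delta>) \<in> trop_F K N \<Sigma> p \<gamma>" .
  moreover have "fsign \<gamma> \<delta> = 1 \<or> fsign \<gamma> \<delta> = -1" using face_sign_unit[of \<gamma> \<delta>] \<delta> by simp
  ultimately show "fsign \<gamma> \<delta> *\<^sub>R ext_map (proj (fst \<gamma>)) (c \<delta>) \<in> trop_F K N \<Sigma> p \<gamma>" by auto
 qed
next
 fix \<gamma> assume \<gamma>: "\<not> (\<gamma> \<in> \<F> \<and> face_dim \<gamma> = q)"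
 have "c \<delta> = 0" if "facet_pair \<Sigma> \<gamma> \<delta>" for \<delta>
  using trop_chains_mem(2)[OF c, of \<delta>] \<gamma> that by (auto simp: facet_pair_def)
 then show "\<partial> c \<gamma> = 0" by (simp add: trop_boundary_def ext_map_linear)
qed

lemma trivial_trop_homology:
 assumes K: "real_subring K"
  and exact: "cycles (trop_chains K N \<Sigma> p) (\<partial>) q \<subseteq>
   \<partial> ` trop_chains K N \<Sigma> p (Suc q)"
 shows "trivial_group (trop_homology K N \<Sigma> \<nu> p q)"
 unfolding trop_homology_def
 using exact by (intro trivial_homologyI) (auto intro: trop_chains_group[OF K] simp: linear_trop_boundary)

lemma trop_homology_filtered:
 fixes gr :: "'n face \<Rightarrow> nat"
 assumes K: "real_subring K" and bound: "\<And>\<gamma>. gr \<gamma> < n"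
  and step: "\<And>m z. z \<in> trop_chains K N \<Sigma> p q \<Longrightarrow> \<partial> z = 0 \<Longrightarrow> (\<And>\<gamma>. gr \<gamma> < m \<Longrightarrow> z \<gamma> = 0) \<Longrightarrow>
   \<exists>y\<in>trop_chains K N \<Sigma> p (Suc q). \<forall>\<gamma>. gr \<gamma> \<le> m \<longrightarrow> \<partial> y \<gamma> = z \<gamma>"
 shows "trivial_group (trop_homology K N \<Sigma> \<nu> p q)"
 using bound[unfolded not_le[symmetric]]
 by (intro trivial_trop_homology[OF K] filtered_exact[where gr = gr and n = n] trop_chains_group[OF K]
   linear_trop_boundary trop_boundary_chains[OF K] trop_boundary_twice step) auto

text \<open>The use of the filtration by dim \<sigma>: cofaces with a larger second cone carry zero,
  so only deletions of a ray of A remain, which is the differential of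
  \<open>koszul\<close>.\<close>

lemma trop_boundary_outer:
 assumes \<sigma>: "\<sigma> \<in> \<Sigma>" and A: "A \<subseteq> gens \<sigma>"
  and z: "\<And>\<eta>. \<eta> \<in> \<Sigma> \<Longrightarrow> \<sigma> face_of \<eta> \<Longrightarrow> \<sigma> \<noteq> \<eta> \<Longrightarrow> z (ccone A, \<eta>) = 0"
 shows "\<partial> z (ccone A, \<sigma>) =
  (\<Sum>u\<in>A. fsign (ccone A, \<sigma>) (ccone (A - {u}), \<sigma>) *\<^sub>R
   ext_map (proj A) (z (ccone (A - {u}), \<sigma>)))"
proof -
 let ?\<tau> = "ccone A"
 have \<tau>: "?\<tau> \<in> \<Sigma>" "gens ?\<tau> = A" using cone_subset_gens[OF \<sigma> A] by auto
 have f: "(?\<tau>, \<sigma>) \<in> \<F>" using \<tau> \<sigma> A face_of_iff_gens[OF \<sigma> \<tau>(1)] by (simp add: faces_iff)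
 have pA: "proj ?\<tau> = proj A" using proj_gens[OF \<tau>(1)] \<tau>(2) by simp
 let ?f = "\<lambda>m. fsign (?\<tau>, \<sigma>) (move m (?\<tau>, \<sigma>)) *\<^sub>R ext_map (proj A) (z (move m (?\<tau>, \<sigma>)))"
 have "\<partial> z (?\<tau>, \<sigma>) = sum ?f (moves (?\<tau>, \<sigma>))"
  unfolding trop_boundary_moves[OF f] by (simp add: pA)
 also have "\<dots> = sum ?f ((\<lambda>u. (u, False)) ` A)"
 proof (rule sum.mono_neutral_right[OF finite_moves[OF f]])
  show "(\<lambda>u. (u, False)) ` A \<subseteq> moves (?\<tau>, \<sigma>)" by (auto simp: moves_def \<tau>(2))
  show "\<forall>m\<in>moves (?\<tau>, \<sigma>) - (\<lambda>u. (u, False)) ` A. ?f m = 0"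
  proof
   fix m assume m: "m \<in> moves (?\<tau>, \<sigma>) - (\<lambda>u. (u, False)) ` A"
   obtain u b where eq: "m = (u, b)" by (metis surj_pair)
   have b: "b" using m by (auto simp: eq moves_def \<tau>(2) split: if_splits)
   then have "(u, True) \<in> moves (?\<tau>, \<sigma>)" using m eq by simp
   from move_True[OF f this] obtain \<eta> where \<eta>: "move (u, True) (?\<tau>, \<sigma>) = (?\<tau>, \<eta>)" "\<eta> \<in> \<Sigma>"
    "gens \<eta> = insert u (gens \<sigma>)" "u \<notin> gens \<sigma>" by metis
   from z[OF \<eta>(2)] gens_insert_dim[OF \<sigma> \<eta>(2-4)] show "?f m = 0"
    using b by (simp add: eq \<eta>(1) ext_map_linear)
  qed
 qed
 also have "\<dots> = (\<Sum>u\<in>A. ?f (u, False))" by (subst sum.reindex) (auto simp: inj_on_def)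
 finally show ?thesis by (simp add: move_def \<tau>(2))
qed

text \<open>The sign axioms are \<open>nu_move\<close> and \<open>face_sign_swap\<close> for
  deletions of rays. The substantial point is \<open>F_section\<close>: the section must respect the
  coefficient lattice of every cone \<eta> above \<sigma>.\<close>

lemma koszul_face:
 assumes K: "real_subring K" and \<sigma>: "\<sigma> \<in> \<Sigma>"
  and x: "\<And>\<rho>. \<rho> \<in> gens \<sigma> \<Longrightarrow> linear (x \<rho> :: _ \<Rightarrow> real)"
   "\<And>\<rho> \<rho>'. \<rho> \<in> gens \<sigma> \<Longrightarrow> \<rho>' \<in> gens \<sigma> \<Longrightarrow> x \<rho> \<rho>' = (if \<rho>' = \<rho> then 1 else 0)"
   "\<And>\<rho> n. \<rho> \<in> gens \<sigma> \<Longrightarrow> n \<in> N \<Longrightarrow> x \<rho> n *\<^sub>R \<rho> \<in> kspan K (N \<inter> span {\<rho>})"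
 shows "koszul (gens \<sigma>) x (\<lambda>A. trop_F K N \<Sigma> p (ccone A, \<sigma>))
  (\<lambda>A \<rho>. fsign (ccone (insert \<rho> A), \<sigma>) (ccone A, \<sigma>))"
proof (rule koszul.intro)
 note km = kmodule_trop_F[OF K]
 let ?F = "\<lambda>A. trop_F K N \<Sigma> p (ccone A, \<sigma>)"
 have cone: "ccone A \<in> \<Sigma>" "gens (ccone A) = A" "proj (ccone A) = proj A"
  "(ccone A, \<sigma>) \<in> \<F>" if "A \<subseteq> gens \<sigma>" for A
 proof -
  show 1: "ccone A \<in> \<Sigma>" "gens (ccone A) = A" using cone_subset_gens[OF \<sigma> that] by auto
  show "proj (ccone A) = proj A" using proj_gens[OF 1(1)] 1(2) by simp
  show "(ccone A, \<sigma>) \<in> \<F>" using 1 \<sigma> face_of_iff_gens[OF \<sigma> 1(1)] that by (simp add: faces_iff)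
 qed
 have del: "(u, False) \<in> moves (ccone (insert u A), \<sigma>)"
  "move (u, False) (ccone (insert u A), \<sigma>) = (ccone A, \<sigma>)"
  if "insert u A \<subseteq> gens \<sigma>" "u \<notin> A" for u A
  using cone(2)[OF that(1)] that(2) by (simp_all add: moves_def move_def)
 show "finite (gens \<sigma>)" by (rule gens(1)[OF \<sigma>])
 show "linear (x \<rho>)" if "\<rho> \<in> gens \<sigma>" for \<rho> using x(1)[OF that] .
 show "x \<rho> \<rho>' = (if \<rho>' = \<rho> then 1 else 0)" if "\<rho> \<in> gens \<sigma>" "\<rho>' \<in> gens \<sigma>" for \<rho> \<rho>'
  using x(2)[OF that] .
 show "0 \<in> ?F A" for A using kmoduleD(1)[OF km] .
 show "a + b \<in> ?F A" if "a \<in> ?F A" "b \<in> ?F A" for a b A using kmoduleD(2)[OF km that] .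
 show "- a \<in> ?F A" if "a \<in> ?F A" for a A using kmodule_neg[OF km K that] .
 show "ext_map (proj A) w = w" if "A \<subseteq> gens \<sigma>" "w \<in> ?F A" for A w
  using trop_F_proj[OF that(2)] cone(3)[OF that(1)] by simp
 show "ext_map (proj A) w \<in> ?F A" if "A \<subseteq> gens \<sigma>" "u \<in> A" "w \<in> ?F (A - {u})" for A u w
 proof -
  have "ccone (A - {u}) \<subseteq> ccone A" by (rule hull_mono) auto
  moreover have "\<sigma> face_of \<sigma>" using face_of_iff_gens[OF \<sigma> \<sigma>] by simp
  ultimately have "ext_map (proj (ccone A)) w \<in> ?F A" by (rule trop_F_quotient[OF K _ _ that(3)])
  then show ?thesis unfolding cone(3)[OF that(1)] .
 qed
 show "fsign (ccone (insert \<rho> A), \<sigma>) (ccone A, \<sigma>) \<in> {1, -1}"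
  if "A \<subseteq> gens \<sigma>" "\<rho> \<in> gens \<sigma> - A" for A \<rho>
 proof -
  have i: "insert \<rho> A \<subseteq> gens \<sigma>" "\<rho> \<notin> A" using that by auto
  show ?thesis using nu_move(1)[OF cone(4)[OF i(1)] del(1)[OF i]] unfolding del(2)[OF i] .
 qed
 show "fsign (ccone (insert \<rho> A), \<sigma>) (ccone A, \<sigma>) *
   fsign (ccone (insert \<rho>' (insert \<rho> A)), \<sigma>) (ccone (insert \<rho> A), \<sigma>) =
  - (fsign (ccone (insert \<rho>' A), \<sigma>) (ccone A, \<sigma>) *
   fsign (ccone (insert \<rho> (insert \<rho>' A)), \<sigma>) (ccone (insert \<rho>' A), \<sigma>))"
  if "A \<subseteq> gens \<sigma>" "\<rho> \<in> gens \<sigma> - A" "\<rho>' \<in> gens \<sigma> - A" "\<rho> \<noteq> \<rho>'" for A \<rho> \<rho>'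
 proof -
  let ?\<gamma> = "(ccone (insert \<rho>' (insert \<rho> A)), \<sigma>)"
  have i: "insert \<rho>' (insert \<rho> A) \<subseteq> gens \<sigma>" "\<rho>' \<notin> insert \<rho> A" using that by auto
  have j: "insert \<rho> A \<subseteq> gens \<sigma>" "\<rho> \<notin> A" using that by auto
  have i': "insert \<rho> (insert \<rho>' A) \<subseteq> gens \<sigma>" "\<rho> \<notin> insert \<rho>' A" using that by auto
  note g = cone(4)[OF i(1)]
  have e: "move (\<rho>', False) ?\<gamma> = (ccone (insert \<rho> A), \<sigma>)" "move (\<rho>, False) (ccone (insert \<rho> A), \<sigma>) = (ccone A, \<sigma>)"
   "move (\<rho>, False) ?\<gamma> = (ccone (insert \<rho>' A), \<sigma>)"
   using del(2)[OF i] del(2)[OF j] del(2)[OF i'] by (simp_all add: insert_commute)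
  have "(\<rho>, False) \<in> moves (move (\<rho>', False) ?\<gamma>)" unfolding e(1) by (rule del(1)[OF j])
  from face_sign_swap[OF g del(1)[OF i] this] show ?thesis
   unfolding e by (simp add: mult.commute insert_commute)
 qed
 show "ext_map (\<lambda>v. proj A (v - x \<rho> v *\<^sub>R \<rho>)) w \<in> ?F A"
  if A: "A \<subseteq> gens \<sigma>" and \<rho>: "\<rho> \<in> gens \<sigma> - A" and w: "w \<in> ?F (insert \<rho> A)" for A \<rho> w
  unfolding trop_F_eq cone(3)[OF A]
 proof (rule ext_map_ext_power[OF K])
  have \<rho>g: "\<rho> \<in> gens \<sigma>" using \<rho> by simp
  show lin: "linear (\<lambda>v. proj A (v - x \<rho> v *\<^sub>R \<rho>))"
   by (rule linearI) (simp_all add: linear_add[OF x(1)[OF \<rho>g]] linear_scale[OF x(1)[OF \<rho>g]]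
     proj_add proj_diff proj_scale algebra_simps)
  have iA: "insert \<rho> A \<subseteq> gens \<sigma>" using A \<rho> by auto
  show "w \<in> ext_power K {proj (insert \<rho> A) ` (N \<inter> span \<eta>) | \<eta>. \<eta> \<in> \<Sigma> \<and> \<sigma> face_of \<eta>} p"
   using w unfolding trop_F_eq cone(3)[OF iA] .
  fix L assume "L \<in> {proj (insert \<rho> A) ` (N \<inter> span \<eta>) | \<eta>. \<eta> \<in> \<Sigma> \<and> \<sigma> face_of \<eta>}"
  then obtain \<eta> where \<eta>: "L = proj (insert \<rho> A) ` (N \<inter> span \<eta>)" "\<eta> \<in> \<Sigma>" "\<sigma> face_of \<eta>" by blast
  have \<rho>\<eta>: "\<rho> \<in> N \<inter> span \<eta>"
   using \<rho> gens(2,3)[OF \<sigma>] face_subset_span[OF \<eta>(3)] by auto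
  let ?g = "\<lambda>v. proj A (v - x \<rho> v *\<^sub>R \<rho>)"
  have zero: "?g a = 0" if a: "a \<in> insert \<rho> A" for a
  proof (cases "a = \<rho>")
   case True
   then show ?thesis using x(2)[OF \<rho>g \<rho>g] by (simp add: proj_0)
  next
   case F: False
   then have a: "a \<in> A" using a by simp
   then have "x \<rho> a = 0" using x(2)[OF \<rho>g, of a] A F by auto
   then show ?thesis using a by (simp add: proj_eq_0_iff span_base)
  qed
  then have "span (insert \<rho> A) \<subseteq> {v. ?g v = 0}"
   using subspace_linear_vimage[OF lin, of "{0}"] by (intro span_minimal) (auto simp: subspace_def)
  then have "?g (v - proj (insert \<rho> A) v) = 0" for v using proj_in by blast
  \<comment> \<open>The projection modulo \<open>insert \<rho> A\<close> may be dropped in front of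
    ?g, so lattice vectors can be inserted in place of their classes.\<close>
  then have g: "?g (proj (insert \<rho> A) v) = ?g v" for v
   using linear_diff[OF lin, of v "proj (insert \<rho> A) v"] by simp
  let ?M = "kspan K (proj A ` (N \<inter> span \<eta>))"
  have kM: "kmodule K ?M" by (rule kmodule_kspan[OF K])
  have "?g n \<in> ?M" if n: "n \<in> N \<inter> span \<eta>" for n
  proof -
   have "proj A n \<in> ?M"
    by (rule subsetD[OF kspan_superset[OF real_subringD(1)[OF K]]]) (use n in simp)
   moreover have "proj A (x \<rho> n *\<^sub>R \<rho>) \<in> ?M"
   proof -
    \<comment> \<open>Here integrality enters: the correction along \<rho> is a K-combination of
      lattice points of the ray, and the ray lies in span \<eta>, so the same \<eta> serves before
      and after.\<close>
    have "x \<rho> n *\<^sub>R \<rho> \<in> kspan K (N \<inter> span {\<rho>})" using x(3)[OF \<rho>g] n by simp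
    also have "\<dots> \<subseteq> kspan K (N \<inter> span \<eta>)"
    proof (rule kspan_mono[OF K])
     have "span {\<rho>} \<subseteq> span \<eta>" using \<rho>\<eta> by (intro span_minimal) auto
     then show "N \<inter> span {\<rho>} \<subseteq> kspan K (N \<inter> span \<eta>)"
      using kspan_superset[OF real_subringD(1)[OF K], of "N \<inter> span \<eta>"] by auto
    qed
    finally show ?thesis unfolding image_kspan[OF K linear_proj[of A], symmetric] by (rule imageI)
   qed
   ultimately show ?thesis using kmodule_diff[OF kM K] by (simp add: proj_diff)
  qed
  then have "?g ` L \<subseteq> ?M" using g by (auto simp: \<eta>(1))
  then show "\<exists>L'\<in>{proj A ` (N \<inter> span \<eta>) | \<eta>. \<eta> \<in> \<Sigma> \<and> \<sigma> face_of \<eta>}. ?g ` L \<subseteq> kspan K L'"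
   using \<eta>(2,3) by blast
 qed
qed

text \<open>The level is \<open>CARD('n) - dim \<sigma>\<close>, so larger \<sigma> are settled
  first. On the lowest level that occurs the boundary stays at a fixed \<sigma>, and the solutions
  for the different \<sigma> are chosen independently and combined into one chain.\<close>

lemma homology_vanish_above:
 assumes K: "real_subring K" and dual: "dual_coords K" and pq: "p < q"
 shows "trivial_group (trop_homology K N \<Sigma> \<nu> p q)"
proof (rule trop_homology_filtered[OF K])
 let ?D = "\<partial>" and ?C = "trop_chains K N \<Sigma> p"
 let ?gr = "\<lambda>\<gamma> :: 'n face. CARD('n) - dim (snd \<gamma>)"
 show "?gr \<gamma> < Suc CARD('n)" for \<gamma> using dim_subset_UNIV[of "fst \<gamma>"] by simp
 fix m z assume z: "z \<in> ?C q" "?D z = 0" "\<And>\<gamma>. ?gr \<gamma> < m \<Longrightarrow> z \<gamma> = 0"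
 have big: "?gr (\<tau>, \<eta>) < ?gr (\<tau>', \<sigma>)" if "\<sigma> \<in> \<Sigma>" "\<eta> \<in> \<Sigma>" "\<sigma> face_of \<eta>" "\<sigma> \<noteq> \<eta>" for \<sigma> \<eta> \<tau> \<tau>'
 proof -
  have "dim \<sigma> < dim \<eta>" using dim_face_mono[OF that(3)] face_dim_eq[OF that(2,1,3)] that(4) by (metis le_neq_trans)
  moreover have "dim \<eta> \<le> CARD('n)" using dim_subset_UNIV[of \<eta>] by simp
  ultimately show ?thesis by simp
 qed
 \<comment> \<open>The boundary sum is the unfolded differential of \<open>koszul\<close>, restated
   here because the interpretation exists only for one \<sigma> inside the next block.\<close>
 define Q where "Q \<sigma> y \<longleftrightarrow> (\<forall>A\<subseteq>gens \<sigma>. y A \<in> trop_F K N \<Sigma> p (ccone A, \<sigma>) \<and>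
    (card (gens \<sigma>) - card A \<noteq> Suc q \<longrightarrow> y A = 0)) \<and>
   (\<forall>A\<subseteq>gens \<sigma>. (\<Sum>u\<in>A. fsign (ccone (insert u (A - {u})), \<sigma>) (ccone (A - {u}), \<sigma>) *\<^sub>R
    ext_map (proj A) (y (A - {u}))) = z (ccone A, \<sigma>))" for \<sigma> y
 have ex: "\<exists>y. Q \<sigma> y" if \<sigma>: "\<sigma> \<in> \<Sigma>" "CARD('n) - dim \<sigma> = m" for \<sigma>
 proof -
  have "\<exists>x. \<forall>\<rho>\<in>gens \<sigma>. linear (x \<rho> :: _ \<Rightarrow> real) \<and>
    (\<forall>\<rho>'\<in>gens \<sigma>. x \<rho> \<rho>' = (if \<rho>' = \<rho> then 1 else 0)) \<and>
    (\<forall>n\<in>N. x \<rho> n *\<^sub>R \<rho> \<in> kspan K (N \<inter> span {\<rho>}))"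
   using dual \<sigma>(1) unfolding dual_coords_def by (rule bspec)
  then obtain x where x: "\<forall>\<rho>\<in>gens \<sigma>. linear (x \<rho> :: _ \<Rightarrow> real) \<and>
    (\<forall>\<rho>'\<in>gens \<sigma>. x \<rho> \<rho>' = (if \<rho>' = \<rho> then 1 else 0)) \<and>
    (\<forall>n\<in>N. x \<rho> n *\<^sub>R \<rho> \<in> kspan K (N \<inter> span {\<rho>}))" by (elim exE)
  interpret kz: koszul "gens \<sigma>" x "\<lambda>A. trop_F K N \<Sigma> p (ccone A, \<sigma>)"
   "\<lambda>A \<rho>. fsign (ccone (insert \<rho> A), \<sigma>) (ccone A, \<sigma>)"
   by (rule koszul_face[OF K \<sigma>(1)]) (use x in simp_all)
  have cone: "ccone A \<in> \<Sigma>" "(ccone A, \<sigma>) \<in> \<F>"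
   "face_dim (ccone A, \<sigma>) = card (gens \<sigma>) - card A" if A: "A \<subseteq> gens \<sigma>" for A
  proof -
   have 1: "ccone A \<in> \<Sigma>" "gens (ccone A) = A" using cone_subset_gens[OF \<sigma>(1) A] by auto
   show "ccone A \<in> \<Sigma>" by (rule 1(1))
   show "(ccone A, \<sigma>) \<in> \<F>" using 1 \<sigma> face_of_iff_gens[OF \<sigma>(1) 1(1)] A by (simp add: faces_iff)
   show "face_dim (ccone A, \<sigma>) = card (gens \<sigma>) - card A"
    using gens(6)[OF \<sigma>(1)] gens(6)[OF 1(1)] 1(2) by (simp add: face_dim_def)
  qed
  have "\<exists>y. (\<forall>A\<subseteq>gens \<sigma>. y A \<in> trop_F K N \<Sigma> p (ccone A, \<sigma>) \<and>
    (card (gens \<sigma>) - card A \<noteq> Suc q \<longrightarrow> y A = 0)) \<and>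
   (\<forall>A\<subseteq>gens \<sigma>. kz.d y A = z (ccone A, \<sigma>))"
  proof (rule kz.exact[OF _ pq])
   show "trop_F K N \<Sigma> p (ccone {}, \<sigma>) \<subseteq> grade p" unfolding trop_F_def by (rule ext_power_subset_grade)
   fix A assume A: "A \<subseteq> gens \<sigma>"
   show "z (ccone A, \<sigma>) = 0" if "card (gens \<sigma>) - card A \<noteq> q"
    using trop_chains_mem(2)[OF z(1)] cone(3)[OF A] that by metis
   then show "z (ccone A, \<sigma>) \<in> trop_F K N \<Sigma> p (ccone A, \<sigma>)"
    using trop_chains_mem(1)[OF z(1) cone(2)[OF A]] cone(3)[OF A] kmoduleD(1)[OF kmodule_trop_F[OF K]] by metis
   have "\<partial> z (ccone A, \<sigma>) = kz.d (\<lambda>A. z (ccone A, \<sigma>)) A"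
    unfolding kz.d_def
    by (subst trop_boundary_outer[OF \<sigma>(1) A])
     (use z(3) big[OF \<sigma>(1)] \<sigma>(2) in \<open>auto simp: insert_absorb intro!: sum.cong\<close>)
   then show "kz.d (\<lambda>A. z (ccone A, \<sigma>)) A = 0" using z(2) by simp
  qed
  then show ?thesis unfolding kz.d_def Q_def .
 qed
 define Y where "Y \<sigma> = (SOME y. Q \<sigma> y)" for \<sigma>
 have YQ: "Q \<sigma> (Y \<sigma>)" if "\<sigma> \<in> \<Sigma>" "CARD('n) - dim \<sigma> = m" for \<sigma>
  unfolding Y_def by (rule someI_ex[OF ex[OF that]])
 have Y: "\<And>\<sigma> A. \<sigma> \<in> \<Sigma> \<Longrightarrow> CARD('n) - dim \<sigma> = m \<Longrightarrow> A \<subseteq> gens \<sigma> \<Longrightarrow>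
   Y \<sigma> A \<in> trop_F K N \<Sigma> p (ccone A, \<sigma>) \<and> (card (gens \<sigma>) - card A \<noteq> Suc q \<longrightarrow> Y \<sigma> A = 0)"
  "\<And>\<sigma> A. \<sigma> \<in> \<Sigma> \<Longrightarrow> CARD('n) - dim \<sigma> = m \<Longrightarrow> A \<subseteq> gens \<sigma> \<Longrightarrow>
   (\<Sum>u\<in>A. fsign (ccone (insert u (A - {u})), \<sigma>) (ccone (A - {u}), \<sigma>) *\<^sub>R
    ext_map (proj A) (Y \<sigma> (A - {u}))) = z (ccone A, \<sigma>)"
  using YQ unfolding Q_def by simp_all
 define y where "y = (\<lambda>(\<tau>, \<sigma>). if (\<tau>, \<sigma>) \<in> \<F> \<and> CARD('n) - dim \<sigma> = m then Y \<sigma> (gens \<tau>) else 0)"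
 have yC: "y \<in> ?C (Suc q)"
 proof (rule trop_chainsI)
  fix \<delta> :: "'n face"
  obtain \<tau> \<sigma> where eq: "\<delta> = (\<tau>, \<sigma>)" by (metis surj_pair)
  have *: "y \<delta> \<in> trop_F K N \<Sigma> p \<delta> \<and> (face_dim \<delta> \<noteq> Suc q \<longrightarrow> y \<delta> = 0)" if f: "\<delta> \<in> \<F>"
  proof (cases "CARD('n) - dim \<sigma> = m")
   case True
   have m: "\<tau> \<in> \<Sigma>" "\<sigma> \<in> \<Sigma>" "gens \<tau> \<subseteq> gens \<sigma>" using f face_of_iff_gens by (auto simp: eq faces_iff)
   then show ?thesis
    using Y(1)[OF m(2) True m(3)] gens(5)[OF m(1)] gens(6)[OF m(1)] gens(6)[OF m(2)] f True
    by (simp add: eq y_def face_dim_def)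
  next
   case False
   then show ?thesis by (simp add: y_def eq kmoduleD(1)[OF kmodule_trop_F[OF K]])
  qed
  show "\<delta> \<in> \<F> \<Longrightarrow> y \<delta> \<in> trop_F K N \<Sigma> p \<delta>" using * by simp
  show "\<not> (\<delta> \<in> \<F> \<and> face_dim \<delta> = Suc q) \<Longrightarrow> y \<delta> = 0"
   using * by (cases "\<delta> \<in> \<F>") (auto simp: y_def eq)
 qed
 moreover have "?D y \<gamma> = z \<gamma>" if gr: "?gr \<gamma> \<le> m" for \<gamma>
 proof (cases "\<gamma> \<in> \<F>")
  case False
  then show ?thesis using trop_chains_mem(2)[OF z(1)] by (simp add: trop_boundary_outside)
 next
  case True
  obtain \<tau> \<sigma> where eq: "\<gamma> = (\<tau>, \<sigma>)" by (metis surj_pair)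
  have t: "\<tau> \<in> \<Sigma>" "\<sigma> \<in> \<Sigma>" "gens \<tau> \<subseteq> gens \<sigma>" using True face_of_iff_gens by (auto simp: eq faces_iff)
  have \<tau>: "\<tau> = ccone (gens \<tau>)" by (rule gens(5)[OF t(1)])
  have y0: "y (\<rho>, \<eta>) = 0" if "?gr (\<rho>, \<eta>) < m" for \<rho> \<eta> using that by (simp add: y_def)
  have "?D y \<gamma> = (\<Sum>u\<in>gens \<tau>. fsign (\<tau>, \<sigma>) (ccone (gens \<tau> - {u}), \<sigma>) *\<^sub>R
    ext_map (proj (gens \<tau>)) (y (ccone (gens \<tau> - {u}), \<sigma>)))"
  proof -
   have "y (ccone (gens \<tau>), \<eta>) = 0" if "\<eta> \<in> \<Sigma>" "\<sigma> face_of \<eta>" "\<sigma> \<noteq> \<eta>" for \<eta>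
    using y0 big[OF t(2) that, of "ccone (gens \<tau>)" \<tau>] gr by (simp add: eq)
   from trop_boundary_outer[OF t(2,3), of y, OF this] show ?thesis unfolding eq \<tau>[symmetric] .
  qed
  also have "\<dots> = z \<gamma>"
  proof (cases "?gr \<gamma> = m")
   case False
   then have "y (\<rho>, \<sigma>) = 0" for \<rho> using y0[of \<rho> \<sigma>] gr by (simp add: eq)
   moreover have "z \<gamma> = 0" using z(3) False gr by simp
   ultimately show ?thesis by (simp add: ext_map_linear)
  next
   case m: True
   then have m': "CARD('n) - dim \<sigma> = m" by (simp add: eq)
   have "y (ccone (gens \<tau> - {u}), \<sigma>) = Y \<sigma> (gens \<tau> - {u})" for u
   proof -
    have s: "gens \<tau> - {u} \<subseteq> gens \<sigma>" using t(3) by auto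
    note c = cone_subset_gens[OF t(2) s]
    have "ccone (gens \<tau> - {u}) face_of \<sigma>" using face_of_iff_gens[OF t(2) c(1)] c(2) s by simp
    then show ?thesis using c t(2) m' by (simp add: y_def faces_iff)
   qed
   then have "(\<Sum>u\<in>gens \<tau>. fsign (\<tau>, \<sigma>) (ccone (gens \<tau> - {u}), \<sigma>) *\<^sub>R
     ext_map (proj (gens \<tau>)) (y (ccone (gens \<tau> - {u}), \<sigma>))) =
    (\<Sum>u\<in>gens \<tau>. fsign (ccone (insert u (gens \<tau> - {u})), \<sigma>) (ccone (gens \<tau> - {u}), \<sigma>) *\<^sub>R
     ext_map (proj (gens \<tau>)) (Y \<sigma> (gens \<tau> - {u})))"
    by (intro sum.cong refl) (simp add: insert_absorb flip: \<tau>)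
   also have "\<dots> = z (ccone (gens \<tau>), \<sigma>)" by (rule Y(2)[OF t(2) m' t(3)])
   finally show ?thesis unfolding eq \<tau>[symmetric] .
  qed
  finally show ?thesis .
 qed
 ultimately show "\<exists>y\<in>?C (Suc q). \<forall>\<gamma>. ?gr \<gamma> \<le> m \<longrightarrow> ?D y \<gamma> = z \<gamma>" by blast
qed

end

section \<open>Below the diagonal: Borel--Moore complexes of star fans\<close>

lemma proj_proj_image:
 fixes \<tau> \<sigma> :: "'v::euclidean_space set"
 assumes "\<tau> \<subseteq> span \<sigma>" shows "proj (proj \<tau> ` \<sigma>) (proj \<tau> x) = proj \<sigma> x"
proof (rule proj_unique)
 have "proj \<tau> (x - proj \<sigma> x) \<in> proj \<tau> ` span \<sigma>" using proj_in by blast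
 then show "proj \<tau> x - proj \<sigma> x \<in> span (proj \<tau> ` \<sigma>)"
  by (simp add: span_linear_image[OF linear_proj] proj_diff proj_proj_subset[OF assms])
 fix y assume "y \<in> proj \<tau> ` \<sigma>"
 then obtain w where w: "y = proj \<tau> w" "w \<in> \<sigma>" by blast
 have "y \<in> span \<sigma>" using proj_mem_span[OF assms, of w] w by (simp add: span_base)
 then show "orthogonal (proj \<sigma> x) y" by (rule proj_orth)
qed

context simplicial_lattice_fan
begin

lemma primitive_star:
 assumes "\<tau> \<subseteq> span \<sigma>'" "\<tau> \<subseteq> span \<sigma>"
 shows "primitive (proj \<tau> ` N) (proj \<tau> ` \<sigma>') (proj \<tau> ` \<sigma>) = primitive N \<sigma>' \<sigma>"
proof -
 have "proj (proj \<tau> ` \<sigma>') ` (proj \<tau> ` \<sigma>) = proj \<sigma>' ` \<sigma>"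
  by (simp add: image_image proj_proj_image[OF assms(1)])
 moreover have "proj (proj \<tau> ` \<sigma>') ` (proj \<tau> ` N \<inter> span (proj \<tau> ` \<sigma>)) = proj \<sigma>' ` (N \<inter> span \<sigma>)"
  by (simp add: image_image proj_proj_image[OF assms(1)] flip: proj_section[OF assms(2)])
 ultimately show ?thesis by (simp add: primitive_def)
qed

lemma star_fan_mem: "\<sigma> \<in> \<Sigma> \<Longrightarrow> \<tau> face_of \<sigma> \<Longrightarrow> proj \<tau> ` \<sigma> \<in> star_fan \<Sigma> \<tau>"
 by (auto simp: star_fan_def)

lemma star_cone_unique:
 assumes "\<tau> \<in> \<Sigma>" "\<sigma> \<in> \<Sigma>" "\<tau> face_of \<sigma>"
 shows "(THE \<eta>. \<eta> \<in> \<Sigma> \<and> \<tau> face_of \<eta> \<and> proj \<tau> ` \<eta> = proj \<tau> ` \<sigma>) = \<sigma>"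
 by (rule the_equality) (use assms proj_image_inj in blast)+

text \<open>Cones of the star fan above the image of \<sigma> are the images of the cones \<eta>
  above \<sigma>, and their spans cut N_\<eta> / N_\<tau> out of the quotient lattice by
  \<open>proj_section\<close>.\<close>

lemma fan_F_star:
 assumes "\<tau> \<in> \<Sigma>" "\<sigma> \<in> \<Sigma>" "\<tau> face_of \<sigma>"
 shows "fan_F K (proj \<tau> ` N) (star_fan \<Sigma> \<tau>) p (proj \<tau> ` \<sigma>) = trop_F K N \<Sigma> p (\<tau>, \<sigma>)"
proof -
 have sec: "proj \<tau> ` N \<inter> span (proj \<tau> ` \<eta>) = proj \<tau> ` (N \<inter> span \<eta>)" if "\<tau> face_of \<eta>" for \<eta>
  using proj_section[OF face_subset_span[OF that]] by simp
 have "{proj \<tau> ` N \<inter> span \<eta> |\<eta>. \<eta> \<in> star_fan \<Sigma> \<tau> \<and> proj \<tau> ` \<sigma> face_of \<eta>} =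
   {proj \<tau> ` (N \<inter> span \<eta>) | \<eta>. \<eta> \<in> \<Sigma> \<and> \<sigma> face_of \<eta>}" (is "?A = ?B")
 proof
  show "?A \<subseteq> ?B"
  proof
   fix L assume "L \<in> ?A"
   then obtain \<eta> where \<eta>: "L = proj \<tau> ` N \<inter> span (proj \<tau> ` \<eta>)" "\<eta> \<in> \<Sigma>" "\<tau> face_of \<eta>"
    "proj \<tau> ` \<sigma> face_of proj \<tau> ` \<eta>" unfolding star_fan_def by blast
   then have "\<sigma> face_of \<eta>" using proj_face_of_iff[OF assms(2) \<eta>(2) assms(1,3) \<eta>(3)] by simp
   then show "L \<in> ?B" using \<eta> sec[OF \<eta>(3)] by blast
  qed
  show "?B \<subseteq> ?A"
  proof
   fix L assume "L \<in> ?B"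
   then obtain \<eta> where \<eta>: "L = proj \<tau> ` (N \<inter> span \<eta>)" "\<eta> \<in> \<Sigma>" "\<sigma> face_of \<eta>" by blast
   have f: "\<tau> face_of \<eta>" using face_of_trans[OF assms(3) \<eta>(3)] .
   have "proj \<tau> ` \<sigma> face_of proj \<tau> ` \<eta>" using proj_face_of_iff[OF assms(2) \<eta>(2) assms(1,3) f] \<eta>(3) by simp
   then show "L \<in> ?A" using \<eta>(1) sec[OF f] star_fan_mem[OF \<eta>(2) f] by blast
  qed
 qed
 then show ?thesis by (simp add: fan_F_def trop_F_eq)
qed

end

context oriented_fan
begin

definition star_nu :: "'n rvec set \<Rightarrow> 'n rvec set \<Rightarrow> 'n ext" where
 "star_nu \<tau> \<zeta> = \<nu> (\<tau>, THE \<sigma>. \<sigma> \<in> \<Sigma> \<and> \<tau> face_of \<sigma> \<and> proj \<tau> ` \<sigma> = \<zeta>)"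

lemma star_nu_eq: "\<tau> \<in> \<Sigma> \<Longrightarrow> \<sigma> \<in> \<Sigma> \<Longrightarrow> \<tau> face_of \<sigma> \<Longrightarrow> star_nu \<tau> (proj \<tau> ` \<sigma>) = \<nu> (\<tau>, \<sigma>)"
 unfolding star_nu_def by (simp add: star_cone_unique)

lemma star_orientation:
 assumes "\<tau> \<in> \<Sigma>" shows "fan_orientation (proj \<tau> ` N) (star_fan \<Sigma> \<tau>) (star_nu \<tau>)"
 unfolding fan_orientation_def
proof
 fix \<zeta> assume "\<zeta> \<in> star_fan \<Sigma> \<tau>"
 then obtain \<sigma> where \<sigma>: "\<zeta> = proj \<tau> ` \<sigma>" "\<sigma> \<in> \<Sigma>" "\<tau> face_of \<sigma>" by (auto simp: star_fan_def)
 have f: "(\<tau>, \<sigma>) \<in> \<F>" using assms \<sigma> by (simp add: faces_iff)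
 show "is_generator (proj \<tau> ` N \<inter> span \<zeta>) (dim \<zeta>) (star_nu \<tau> \<zeta>)"
  using nu_generator[OF f] proj_section[OF face_subset_span[OF \<sigma>(3)], of N] proj_cone(3)[OF \<sigma>(2) assms \<sigma>(3)]
   star_nu_eq[OF assms \<sigma>(2,3)] by (simp add: \<sigma>(1) face_lattice_def)
qed

lemma sum_star_cofaces:
 assumes \<tau>: "\<tau> \<in> \<Sigma>" and \<sigma>: "\<sigma> \<in> \<Sigma>" "\<tau> face_of \<sigma>"
 shows "(\<Sum>\<zeta> | \<zeta> \<in> star_fan \<Sigma> \<tau> \<and> proj \<tau> ` \<sigma> face_of \<zeta> \<and> R \<zeta>. h \<zeta>) =
  (\<Sum>\<eta> | \<eta> \<in> \<Sigma> \<and> \<sigma> face_of \<eta> \<and> R (proj \<tau> ` \<eta>). h (proj \<tau> ` \<eta>))" (is "sum _ ?A = sum _ ?S")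
proof -
 have f: "\<tau> face_of \<eta>" if "\<eta> \<in> ?S" for \<eta> using that \<sigma>(2) face_of_trans by blast
 have "?A = (`) (proj \<tau>) ` ?S"
 proof
  show "?A \<subseteq> (`) (proj \<tau>) ` ?S"
  proof
   fix \<zeta> assume \<zeta>: "\<zeta> \<in> ?A"
   then obtain \<eta> where \<eta>: "\<zeta> = proj \<tau> ` \<eta>" "\<eta> \<in> \<Sigma>" "\<tau> face_of \<eta>" by (auto simp: star_fan_def)
   then show "\<zeta> \<in> (`) (proj \<tau>) ` ?S" using \<zeta> proj_face_of_iff[OF \<sigma>(1) \<eta>(2) \<tau> \<sigma>(2) \<eta>(3)] by simp
  qed
  show "(`) (proj \<tau>) ` ?S \<subseteq> ?A"
  proof
   fix \<zeta> assume "\<zeta> \<in> (`) (proj \<tau>) ` ?S"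
   then obtain \<eta> where \<eta>: "\<zeta> = proj \<tau> ` \<eta>" "\<eta> \<in> ?S" by blast
   then show "\<zeta> \<in> ?A" using f[OF \<eta>(2)] proj_face_of_iff[OF \<sigma>(1) _ \<tau> \<sigma>(2), of \<eta>] star_fan_mem[of \<eta> \<tau>] by simp
  qed
 qed
 moreover have "inj_on ((`) (proj \<tau>)) ?S" by (rule inj_onI) (use proj_image_inj \<tau> f in blast)
 ultimately show ?thesis by (simp add: sum.reindex)
qed

text \<open>The signs agree because the star fan produces the same lattices, the same primitive
  vectors (\<open>primitive_star\<close>), and a quotient map that coincides with proj \<sigma>' on
  the lattice concerned.\<close>

lemma star_bm_boundary:
 assumes \<tau>: "\<tau> \<in> \<Sigma>" and \<sigma>': "\<sigma>' \<in> \<Sigma>" "\<tau> face_of \<sigma>'"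
 shows "bm_boundary (proj \<tau> ` N) (star_fan \<Sigma> \<tau>) (star_nu \<tau>) b (proj \<tau> ` \<sigma>') =
  (\<Sum>\<sigma> | \<sigma> \<in> \<Sigma> \<and> \<sigma>' face_of \<sigma> \<and> dim \<sigma> = Suc (dim \<sigma>'). fsign (\<tau>, \<sigma>') (\<tau>, \<sigma>) *\<^sub>R b (proj \<tau> ` \<sigma>))"
proof -
 let ?S = "{\<sigma>. \<sigma> \<in> \<Sigma> \<and> \<sigma>' face_of \<sigma> \<and> dim \<sigma> = Suc (dim \<sigma>')}"
 have \<tau>\<sigma>: "\<tau> face_of \<sigma>" if "\<sigma>' face_of \<sigma>" for \<sigma> using that \<sigma>'(2) face_of_trans by blast
 have "dim (proj \<tau> ` \<sigma>) = Suc (dim (proj \<tau> ` \<sigma>')) \<longleftrightarrow> dim \<sigma> = Suc (dim \<sigma>')" if "\<sigma> \<in> \<Sigma>" "\<sigma>' face_of \<sigma>" for \<sigma>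
  using proj_cone(3)[OF that(1) \<tau> \<tau>\<sigma>[OF that(2)]] proj_cone(3)[OF \<sigma>'(1) \<tau> \<sigma>'(2)]
   dim_face_mono[OF \<sigma>'(2)] dim_face_mono[OF that(2)] by linarith
 then have S: "{\<sigma>. \<sigma> \<in> \<Sigma> \<and> \<sigma>' face_of \<sigma> \<and> dim (proj \<tau> ` \<sigma>) = Suc (dim (proj \<tau> ` \<sigma>'))} = ?S" by blast
 show ?thesis
  unfolding bm_boundary_def using star_fan_mem[OF \<sigma>']
  apply (simp only: simp_thms)
  unfolding sum_star_cofaces[OF \<tau> \<sigma>'] S
 proof (rule sum.cong[OF refl])
  fix \<sigma> assume "\<sigma> \<in> ?S"
  then have \<sigma>: "\<sigma> \<in> \<Sigma>" "\<sigma>' face_of \<sigma>" "dim \<sigma> = Suc (dim \<sigma>')" "\<tau> face_of \<sigma>" using \<tau>\<sigma> by auto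
  have sub: "\<tau> \<subseteq> span \<sigma>'" "\<tau> \<subseteq> \<sigma>'" "\<tau> \<subseteq> span \<sigma>"
   using face_subset_span[OF \<sigma>'(2)] face_of_imp_subset[OF \<sigma>'(2)] face_subset_span[OF \<sigma>(4)] by auto
  have "proj (proj \<tau> ` \<sigma>') n = proj \<sigma>' n" if "n \<in> proj \<tau> ` (N \<inter> span \<sigma>)" for n
   using that proj_proj_image[OF sub(1)] proj_proj[OF sub(2)] by auto
  then have "inner_sign (proj \<tau> ` (N \<inter> span \<sigma>)) e (proj (proj \<tau> ` \<sigma>')) a b =
    inner_sign (proj \<tau> ` (N \<inter> span \<sigma>)) e (proj \<sigma>') a b" for e a b
   unfolding inner_sign_def by (metis (no_types, lifting))
  then have "inner_sign (proj \<tau> ` N \<inter> span (proj \<tau> ` \<sigma>)) (primitive (proj \<tau> ` N) (proj \<tau> ` \<sigma>') (proj \<tau> ` \<sigma>))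
    (proj (proj \<tau> ` \<sigma>')) (star_nu \<tau> (proj \<tau> ` \<sigma>')) (star_nu \<tau> (proj \<tau> ` \<sigma>)) = fsign (\<tau>, \<sigma>') (\<tau>, \<sigma>)"
   using primitive_star[OF sub(1,3)] star_nu_eq[OF \<tau> \<sigma>'] star_nu_eq[OF \<tau> \<sigma>(1,4)]
   by (simp add: face_sign_def face_lattice_def flip: proj_section[OF sub(3)])
  then show "inner_sign (proj \<tau> ` N \<inter> span (proj \<tau> ` \<sigma>)) (primitive (proj \<tau> ` N) (proj \<tau> ` \<sigma>') (proj \<tau> ` \<sigma>))
    (proj (proj \<tau> ` \<sigma>')) (star_nu \<tau> (proj \<tau> ` \<sigma>')) (star_nu \<tau> (proj \<tau> ` \<sigma>)) *\<^sub>R b (proj \<tau> ` \<sigma>) =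
   fsign (\<tau>, \<sigma>') (\<tau>, \<sigma>) *\<^sub>R b (proj \<tau> ` \<sigma>)" by simp
 qed
qed

lemma trop_boundary_inner:
 assumes f: "(\<tau>, \<sigma>') \<in> \<F>"
  and c: "\<And>\<rho>. \<rho> \<in> \<Sigma> \<Longrightarrow> dim \<rho> < dim \<tau> \<Longrightarrow> c (\<rho>, \<sigma>') = 0" "\<And>\<sigma>. ext_map (proj \<tau>) (c (\<tau>, \<sigma>)) = c (\<tau>, \<sigma>)"
 shows "\<partial> c (\<tau>, \<sigma>') =
  (\<Sum>\<sigma> | \<sigma> \<in> \<Sigma> \<and> \<sigma>' face_of \<sigma> \<and> dim \<sigma> = Suc (dim \<sigma>'). fsign (\<tau>, \<sigma>') (\<tau>, \<sigma>) *\<^sub>R c (\<tau>, \<sigma>))"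
proof -
 have "(\<Sum>\<rho> | \<rho> \<in> \<Sigma> \<and> \<rho> face_of \<tau> \<and> dim \<tau> = Suc (dim \<rho>).
   fsign (\<tau>, \<sigma>') (\<rho>, \<sigma>') *\<^sub>R ext_map (proj \<tau>) (c (\<rho>, \<sigma>'))) = 0"
  by (rule sum.neutral) (use c(1) in \<open>simp add: ext_map_linear\<close>)
 then show ?thesis
  using sum_cofaces[OF f, of "\<lambda>\<delta>. fsign (\<tau>, \<sigma>') \<delta> *\<^sub>R ext_map (proj \<tau>) (c \<delta>)"]
  by (simp add: trop_boundary_def c(2))
qed

text \<open>On the lowest level m that occurs the boundary stays inside the stars of the cones of
  dimension m. Duality for these stars makes every degree except d - m exact, and that degree is
  handled by the coefficients.\<close>

lemma homology_vanish_below: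
 assumes K: "real_subring K" and pure: "pure_dim \<Sigma> d"
  and man: "tropical_homology_manifold K N \<Sigma> d \<omega>" and pq: "q < p"
 shows "trivial_group (trop_homology K N \<Sigma> \<nu> p q)"
proof (rule trop_homology_filtered[OF K])
 let ?D = "\<partial>" and ?C = "trop_chains K N \<Sigma> p"
 let ?gr = "\<lambda>\<gamma> :: 'n face. dim (fst \<gamma>)"
 note cc = trop_chains_group[OF K]
 note km = kmodule_trop_F[OF K]
 show "?gr \<gamma> < Suc CARD('n)" for \<gamma> using dim_subset_UNIV[of "fst \<gamma>"] by simp
 fix m z assume z: "z \<in> ?C q" "?D z = 0" "\<And>\<gamma>. ?gr \<gamma> < m \<Longrightarrow> z \<gamma> = 0"
 show "\<exists>y\<in>?C (Suc q). \<forall>\<gamma>. ?gr \<gamma> \<le> m \<longrightarrow> ?D y \<gamma> = z \<gamma>"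
 proof (cases "q = d - m")
  case True
  \<comment> \<open>The degree left open by duality. The lattices N_\<eta> / N_\<tau> have rank at
    most d - m = q < p, so the coefficients on this level are zero.\<close>
  have "z \<gamma> = 0" if gr: "?gr \<gamma> \<le> m" for \<gamma>
  proof (cases "?gr \<gamma> = m \<and> \<gamma> \<in> \<F> \<and> face_dim \<gamma> = q")
   case False
   then show ?thesis using z(3)[of \<gamma>] trop_chains_mem(2)[OF z(1), of \<gamma>] gr by (cases "?gr \<gamma> = m") auto
  next
   case c: True
   obtain \<tau> \<sigma> where eq: "\<gamma> = (\<tau>, \<sigma>)" by (metis surj_pair)
   have t: "\<tau> \<in> \<Sigma>" "\<sigma> \<in> \<Sigma>" "\<tau> face_of \<sigma>" "dim \<tau> = m" using c by (auto simp: eq faces_iff)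
   have "z \<gamma> \<in> trop_F K N \<Sigma> p (\<tau>, \<sigma>)" using trop_chains_mem(1)[OF z(1)] c eq by blast
   moreover have "dim (proj \<tau> ` (N \<inter> span \<eta>)) < p" if \<eta>: "\<eta> \<in> \<Sigma>" "\<sigma> face_of \<eta>" for \<eta>
   proof -
    have f: "\<tau> face_of \<eta>" using t(3) \<eta>(2) face_of_trans by blast
    obtain \<eta>' where "\<eta>' \<in> \<Sigma>" "dim \<eta>' = d" "\<eta> face_of \<eta>'" using pure \<eta>(1) by (auto simp: pure_dim_def)
    then have "dim \<eta> \<le> d" using dim_face_mono by metis
    have "proj \<tau> ` (N \<inter> span \<eta>) \<subseteq> span (proj \<tau> ` \<eta>)"
     by (auto simp: span_linear_image[OF linear_proj])
    then have "dim (proj \<tau> ` (N \<inter> span \<eta>)) \<le> dim (proj \<tau> ` \<eta>)"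
     using dim_subset dim_span by metis
    also have "\<dots> \<le> d - m" using proj_cone(3)[OF \<eta>(1) t(1) f] t(4) \<open>dim \<eta> \<le> d\<close> by simp
    finally show ?thesis using True pq by simp
   qed
   ultimately show ?thesis
    unfolding trop_F_eq by (intro ext_power_zero[of "{proj \<tau> ` (N \<inter> span \<eta>) | \<eta>. \<eta> \<in> \<Sigma> \<and> \<sigma> face_of \<eta>}" p]) auto
  qed
  then show ?thesis using cc(1) by (intro bexI[of _ 0]) (auto simp: linear_trop_boundary(3))
 next
  case False
  let ?B = "\<lambda>\<tau>. bm_chains K (proj \<tau> ` N) (star_fan \<Sigma> \<tau>) p"
  let ?d = "\<lambda>\<tau>. bm_boundary (proj \<tau> ` N) (star_fan \<Sigma> \<tau>) (star_nu \<tau>)"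
  have ex: "\<exists>y\<in>?B \<tau> (Suc q). \<forall>\<sigma>. \<sigma> \<in> \<Sigma> \<and> \<tau> face_of \<sigma> \<longrightarrow> ?d \<tau> y (proj \<tau> ` \<sigma>) = z (\<tau>, \<sigma>)"
   if \<tau>: "\<tau> \<in> \<Sigma>" "dim \<tau> = m" for \<tau>
  proof -
   \<comment> \<open>The chain at the fixed stratum \<tau>, transported to the star fan through the
     unique cone lying over each of its cones.\<close>
   define z' where "z' \<zeta> = (if \<zeta> \<in> star_fan \<Sigma> \<tau> then
    z (\<tau>, THE \<sigma>. \<sigma> \<in> \<Sigma> \<and> \<tau> face_of \<sigma> \<and> proj \<tau> ` \<sigma> = \<zeta>) else 0)" for \<zeta>
   have z': "z' (proj \<tau> ` \<sigma>) = z (\<tau>, \<sigma>)" if "\<sigma> \<in> \<Sigma>" "\<tau> face_of \<sigma>" for \<sigma>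
    using star_cone_unique[OF \<tau>(1) that] star_fan_mem[OF that] by (simp add: z'_def)
   have mem: "z' \<in> ?B \<tau> q"
    unfolding bm_chains_def
   proof (intro CollectI allI)
    fix \<zeta>
    have "z' \<zeta> \<in> fan_F K (proj \<tau> ` N) (star_fan \<Sigma> \<tau>) p \<zeta> \<and> (dim \<zeta> \<noteq> q \<longrightarrow> z' \<zeta> = 0)" if \<zeta>: "\<zeta> \<in> star_fan \<Sigma> \<tau>"
    proof -
     obtain \<sigma> where \<sigma>: "\<zeta> = proj \<tau> ` \<sigma>" "\<sigma> \<in> \<Sigma>" "\<tau> face_of \<sigma>" using \<zeta> by (auto simp: star_fan_def)
     have f: "(\<tau>, \<sigma>) \<in> \<F>" using \<tau> \<sigma> by (simp add: faces_iff)
     have "dim \<zeta> = face_dim (\<tau>, \<sigma>)" using proj_cone(3)[OF \<sigma>(2) \<tau>(1) \<sigma>(3)] \<sigma>(1) by (simp add: face_dim_def)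
     then show ?thesis
      unfolding \<sigma>(1) fan_F_star[OF \<tau>(1) \<sigma>(2,3)] z'[OF \<sigma>(2,3)]
      using trop_chains_mem[OF z(1), of "(\<tau>, \<sigma>)"] f kmoduleD(1)[OF km, of p "(\<tau>, \<sigma>)"] \<sigma>(1) by metis
    qed
    then show "if \<zeta> \<in> star_fan \<Sigma> \<tau> \<and> dim \<zeta> = q then z' \<zeta> \<in> fan_F K (proj \<tau> ` N) (star_fan \<Sigma> \<tau>) p \<zeta> else z' \<zeta> = 0"
     by (auto simp: z'_def)
   qed
   have dz': "?d \<tau> z' = 0"
   proof
    fix \<zeta>
    show "?d \<tau> z' \<zeta> = 0 \<zeta>"
    proof (cases "\<zeta> \<in> star_fan \<Sigma> \<tau>")
     case False
     then show ?thesis by (simp add: bm_boundary_def)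
    next
     case True
     then obtain \<sigma> where \<sigma>: "\<zeta> = proj \<tau> ` \<sigma>" "\<sigma> \<in> \<Sigma>" "\<tau> face_of \<sigma>" by (auto simp: star_fan_def)
     have f: "(\<tau>, \<sigma>) \<in> \<F>" using \<tau> \<sigma> by (simp add: faces_iff)
     have "?d \<tau> z' \<zeta> = (\<Sum>\<eta> | \<eta> \<in> \<Sigma> \<and> \<sigma> face_of \<eta> \<and> dim \<eta> = Suc (dim \<sigma>). fsign (\<tau>, \<sigma>) (\<tau>, \<eta>) *\<^sub>R z (\<tau>, \<eta>))"
      unfolding \<sigma>(1) star_bm_boundary[OF \<tau>(1) \<sigma>(2,3)]
      by (rule sum.cong[OF refl]) (use z' face_of_trans[OF \<sigma>(3)] in simp)
     also have "\<dots> = ?D z (\<tau>, \<sigma>)"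
      by (rule trop_boundary_inner[OF f, symmetric]) (use z(3) \<tau>(2) trop_chains_proj[OF z(1)] in auto)
     finally show ?thesis using z(2) by simp
    qed
   qed
   have "tropical_poincare_duality K (proj \<tau> ` N) (star_fan \<Sigma> \<tau>) (d - dim \<tau>) (star_weight \<Sigma> \<omega> \<tau>)"
    using man \<tau>(1) by (simp add: tropical_homology_manifold_def)
   then have "trivial_group (bm_homology K (proj \<tau> ` N) (star_fan \<Sigma> \<tau>) (star_nu \<tau>) p q)"
    using star_orientation[OF \<tau>(1)] False \<tau>(2) unfolding tropical_poincare_duality_def by simp
   then have "cycles (?B \<tau>) (?d \<tau>) q \<subseteq> ?d \<tau> ` ?B \<tau> (Suc q)"
    unfolding bm_homology_def
   proof (rule trivial_homologyD)
    show "0 \<in> ?B \<tau> (Suc q)"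
     unfolding bm_chains_def fan_F_def by (auto intro: kmoduleD(1)[OF kmodule_ext_power[OF K]])
    show "?d \<tau> 0 = 0" by (simp add: bm_boundary_def fun_eq_iff)
   qed
   moreover have "z' \<in> cycles (?B \<tau>) (?d \<tau>) q" using mem dz' by (simp add: cycles_def)
   ultimately obtain y where "y \<in> ?B \<tau> (Suc q)" "z' = ?d \<tau> y" by blast
   then show ?thesis using z' by (intro bexI[of _ y]) auto
  qed
  define Q where "Q \<tau> y \<longleftrightarrow> y \<in> ?B \<tau> (Suc q) \<and>
   (\<forall>\<sigma>. \<sigma> \<in> \<Sigma> \<and> \<tau> face_of \<sigma> \<longrightarrow> ?d \<tau> y (proj \<tau> ` \<sigma>) = z (\<tau>, \<sigma>))" for \<tau> y
  define Y where "Y \<tau> = (SOME y. Q \<tau> y)" for \<tau>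
  have "Q \<tau> (Y \<tau>)" if "\<tau> \<in> \<Sigma>" "dim \<tau> = m" for \<tau>
   unfolding Y_def by (rule someI_ex[of "Q \<tau>"]) (use ex[OF that] in \<open>unfold Q_def, blast\<close>)
  then have Y0: "Y \<tau> \<in> ?B \<tau> (Suc q) \<and> (\<forall>\<sigma>. \<sigma> \<in> \<Sigma> \<and> \<tau> face_of \<sigma> \<longrightarrow> ?d \<tau> (Y \<tau>) (proj \<tau> ` \<sigma>) = z (\<tau>, \<sigma>))"
   if "\<tau> \<in> \<Sigma>" "dim \<tau> = m" for \<tau>
   using that unfolding Q_def by blast
  have Y: "Y \<tau> \<in> ?B \<tau> (Suc q)" "\<sigma> \<in> \<Sigma> \<Longrightarrow> \<tau> face_of \<sigma> \<Longrightarrow> ?d \<tau> (Y \<tau>) (proj \<tau> ` \<sigma>) = z (\<tau>, \<sigma>)"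
   if "\<tau> \<in> \<Sigma>" "dim \<tau> = m" for \<tau> \<sigma> using Y0[OF that] by simp_all
  define y where "y = (\<lambda>(\<tau>, \<sigma>). if (\<tau>, \<sigma>) \<in> \<F> \<and> dim \<tau> = m then Y \<tau> (proj \<tau> ` \<sigma>) else 0)"
  have yC: "y \<in> ?C (Suc q)"
  proof (rule trop_chainsI)
   fix \<delta> :: "'n face"
   obtain \<tau> \<sigma> where eq: "\<delta> = (\<tau>, \<sigma>)" by (metis surj_pair)
   have *: "y \<delta> \<in> trop_F K N \<Sigma> p \<delta> \<and> (face_dim \<delta> \<noteq> Suc q \<longrightarrow> y \<delta> = 0)" if f: "\<delta> \<in> \<F>"
   proof (cases "dim \<tau> = m")
    case True
    have t: "\<tau> \<in> \<Sigma>" "\<sigma> \<in> \<Sigma>" "\<tau> face_of \<sigma>" using f by (auto simp: eq faces_iff)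
    have dm: "dim (proj \<tau> ` \<sigma>) = face_dim \<delta>" using proj_cone(3)[OF t(2,1,3)] by (simp add: eq face_dim_def)
    have "if proj \<tau> ` \<sigma> \<in> star_fan \<Sigma> \<tau> \<and> dim (proj \<tau> ` \<sigma>) = Suc q
     then Y \<tau> (proj \<tau> ` \<sigma>) \<in> fan_F K (proj \<tau> ` N) (star_fan \<Sigma> \<tau>) p (proj \<tau> ` \<sigma>) else Y \<tau> (proj \<tau> ` \<sigma>) = 0"
     using Y(1)[OF t(1) True] unfolding bm_chains_def by blast
    then have "if face_dim \<delta> = Suc q then Y \<tau> (proj \<tau> ` \<sigma>) \<in> trop_F K N \<Sigma> p \<delta> else Y \<tau> (proj \<tau> ` \<sigma>) = 0"
     using star_fan_mem[OF t(2,3)] fan_F_star[OF t] dm by (auto simp: eq split: if_splits)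
    moreover have "y \<delta> = Y \<tau> (proj \<tau> ` \<sigma>)" using f True by (simp add: eq y_def)
    ultimately show ?thesis using kmoduleD(1)[OF km] by (auto split: if_splits)
   next
    case False
    then show ?thesis by (simp add: y_def eq kmoduleD(1)[OF km])
   qed
   show "\<delta> \<in> \<F> \<Longrightarrow> y \<delta> \<in> trop_F K N \<Sigma> p \<delta>" using * by simp
   show "\<not> (\<delta> \<in> \<F> \<and> face_dim \<delta> = Suc q) \<Longrightarrow> y \<delta> = 0"
    using * by (cases "\<delta> \<in> \<F>") (auto simp: y_def eq)
  qed
  moreover have "?D y \<gamma> = z \<gamma>" if gr: "?gr \<gamma> \<le> m" for \<gamma>
  proof (cases "\<gamma> \<in> \<F>")
   case False
   then show ?thesis using trop_chains_mem(2)[OF z(1)] by (simp add: trop_boundary_outside)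
  next
   case True
   obtain \<tau> \<sigma> where eq: "\<gamma> = (\<tau>, \<sigma>)" by (metis surj_pair)
   have t: "\<tau> \<in> \<Sigma>" "\<sigma> \<in> \<Sigma>" "\<tau> face_of \<sigma>" using True by (auto simp: eq faces_iff)
   have f: "(\<tau>, \<sigma>) \<in> \<F>" using True eq by simp
   have "?D y \<gamma> = (\<Sum>\<eta> | \<eta> \<in> \<Sigma> \<and> \<sigma> face_of \<eta> \<and> dim \<eta> = Suc (dim \<sigma>). fsign (\<tau>, \<sigma>) (\<tau>, \<eta>) *\<^sub>R y (\<tau>, \<eta>))"
    unfolding eq by (rule trop_boundary_inner[OF f]) (use gr trop_chains_proj[OF yC] in \<open>auto simp: y_def eq\<close>)
   also have "\<dots> = z \<gamma>"
   proof (cases "dim \<tau> = m")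
    case False
    then show ?thesis using z(3)[of \<gamma>] gr by (simp add: y_def eq)
   next
    case m: True
    have "(\<Sum>\<eta> | \<eta> \<in> \<Sigma> \<and> \<sigma> face_of \<eta> \<and> dim \<eta> = Suc (dim \<sigma>). fsign (\<tau>, \<sigma>) (\<tau>, \<eta>) *\<^sub>R y (\<tau>, \<eta>)) =
      ?d \<tau> (Y \<tau>) (proj \<tau> ` \<sigma>)"
     unfolding star_bm_boundary[OF t]
     by (rule sum.cong[OF refl]) (use m t face_of_trans[OF t(3)] in \<open>simp add: y_def faces_iff\<close>)
    then show ?thesis using Y(2)[OF t(1) m t(2,3)] by (simp add: eq)
   qed
   finally show ?thesis .
  qed
  ultimately show ?thesis by blast
 qed
qed

end

section \<open>Poincare duals as combinations of strata at infinity\<close>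

lemma kdualD:
 assumes "\<phi> \<in> kdual K S"
 shows "x \<in> S \<Longrightarrow> y \<in> S \<Longrightarrow> \<phi> (x + y) = \<phi> x + \<phi> y" "c \<in> K \<Longrightarrow> x \<in> S \<Longrightarrow> \<phi> (c *\<^sub>R x) = c * \<phi> x"
  "x \<in> S \<Longrightarrow> \<phi> x \<in> K" "x \<notin> S \<Longrightarrow> \<phi> x = 0"
 using assms unfolding kdual_def by auto

lemma kdual_zero:
 assumes "\<phi> \<in> kdual K S" "kmodule K S" shows "\<phi> 0 = 0"
 using kdualD(1)[OF assms(1), of 0 0] kmoduleD(1)[OF assms(2)] by simp

lemma kdual_add:
 assumes "real_subring K" "\<phi> \<in> kdual K S" "\<psi> \<in> kdual K S" shows "(\<lambda>x. \<phi> x + \<psi> x) \<in> kdual K S"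
 unfolding kdual_def using kdualD[OF assms(2)] kdualD[OF assms(3)] real_subringD[OF assms(1)]
 by (auto simp: algebra_simps)

lemma kdual_scale:
 assumes "real_subring K" "\<phi> \<in> kdual K S" "c \<in> K" shows "(\<lambda>x. c * \<phi> x) \<in> kdual K S"
 unfolding kdual_def using kdualD[OF assms(2)] real_subringD(6)[OF assms(1)] assms(3)
 by (auto simp: algebra_simps)

lemma kdual_eqI:
 assumes K: "real_subring K" and \<phi>: "\<phi> \<in> kdual K (ext_power K \<L> p)" and \<psi>: "\<psi> \<in> kdual K (ext_power K \<L> p)"
  and eq: "\<And>vs L. L \<in> \<L> \<Longrightarrow> set vs \<subseteq> L \<Longrightarrow> length vs = p \<Longrightarrow> \<phi> (wedge vs) = \<psi> (wedge vs)"
 shows "\<phi> = \<psi>"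
proof -
 let ?S = "ext_power K \<L> p"
 note km = kmodule_ext_power[OF K, of \<L> p]
 have "?S \<subseteq> {x \<in> ?S. \<phi> x = \<psi> x}"
 proof (rule ext_power_least)
  show "kmodule K {x \<in> ?S. \<phi> x = \<psi> x}"
   unfolding kmodule_def using kmoduleD[OF km] kdual_zero[OF \<phi> km] kdual_zero[OF \<psi> km]
    kdualD(1,2)[OF \<phi>] kdualD(1,2)[OF \<psi>] by auto
  fix vs L assume "L \<in> \<L>" "set vs \<subseteq> L" "length vs = p"
  then show "wedge vs \<in> {x \<in> ?S. \<phi> x = \<psi> x}" using eq ext_power_wedge[OF K] by auto
 qed
 then have "\<phi> x = \<psi> x" for x using kdualD(4)[OF \<phi>, of x] kdualD(4)[OF \<psi>, of x] by (cases "x \<in> ?S") auto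
 then show ?thesis by blast
qed

lemma ext_vec_mult_ext_power:
 assumes K: "real_subring K" and v: "v \<in> L" and x: "x \<in> ext_power K {L} k"
 shows "ext_vec v \<^bold>\<and> x \<in> ext_power K {L} (Suc k)"
proof -
 have "ext_power K {L} k \<subseteq> (\<lambda>x. ext_vec v \<^bold>\<and> x) -` ext_power K {L} (Suc k)"
 proof (rule ext_power_least[OF kmodule_vimage[OF linear_ext_mult_right kmodule_ext_power[OF K]]])
  fix vs L' assume "L' \<in> {L}" "set vs \<subseteq> L'" "length vs = k"
  then show "wedge vs \<in> (\<lambda>x. ext_vec v \<^bold>\<and> x) -` ext_power K {L} (Suc k)"
   using ext_power_wedge[OF K, of L "{L}" "v # vs"] v by simp
 qed
 with x show ?thesis by blast
qed

text \<open>Only the values of g on L have to lie in K. For k = 0 the truncated degree is harmless,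
  because constants are contracted to 0.\<close>

lemma ext_cut_ext_power:
 assumes K: "real_subring K" and g: "\<And>v. v \<in> L \<Longrightarrow> g \<bullet> v \<in> K" and x: "x \<in> ext_power K {L} k"
 shows "ext_cut g x \<in> ext_power K {L} (k - 1)"
proof -
 have w: "ext_cut g (wedge vs) \<in> ext_power K {L} (length vs - 1)" if "set vs \<subseteq> L" for vs
  using that
 proof (induction vs)
  case Nil
  then show ?case by (simp add: kmoduleD(1)[OF kmodule_ext_power[OF K]])
 next
  case (Cons v vs)
  note km = kmodule_ext_power[OF K, of "{L}" "length vs"]
  have 1: "(g \<bullet> v) *\<^sub>R wedge vs \<in> ext_power K {L} (length vs)"
   using Cons.prems g by (intro kmoduleD(3)[OF km] ext_power_wedge[OF K]) auto
  have 2: "ext_vec v \<^bold>\<and> ext_cut g (wedge vs) \<in> ext_power K {L} (length vs)"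
  proof (cases vs)
   case Nil
   then show ?thesis by (simp add: kmoduleD(1)[OF kmodule_ext_power[OF K]])
  next
   case vs: (Cons u us)
   have "ext_cut g (wedge vs) \<in> ext_power K {L} (length vs - 1)" using Cons by simp
   from ext_vec_mult_ext_power[OF K _ this, of v] Cons.prems show ?thesis by (simp add: vs)
  qed
  show ?case using kmodule_diff[OF km K 1 2] by (simp add: cut_ext_vec_mult)
 qed
 have "ext_power K {L} k \<subseteq> ext_cut g -` ext_power K {L} (k - 1)"
  by (rule ext_power_least[OF kmodule_vimage[OF linear_cut kmodule_ext_power[OF K]]]) (use w in auto)
 with x show ?thesis by blast
qed

locale tropical_setting = oriented_fan N \<Sigma> \<nu>
 for N :: "'n::{finite,linorder} rvec set" and \<Sigma> :: "'n rvec set set" and \<nu> :: "'n face \<Rightarrow> 'n ext" +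
 fixes K :: "real set" and d :: nat and \<omega> :: "'n rvec set \<Rightarrow> int"
 assumes K: "K = \<int> \<or> K = \<rat>" and tropical: "tropical_fan N \<Sigma> d \<omega>"
begin

lemma subK: "real_subring K"
 using K real_subring_Ints real_subring_Rats by auto

lemma Ints_K: "\<int> \<subseteq> K"
 by (rule real_subring_Ints_subset[OF subK])

lemma pure: "pure_dim \<Sigma> d"
 using tropical by (simp add: tropical_fan_def)

lemma balanced:
 "\<tau> \<in> \<Sigma> \<Longrightarrow> Suc (dim \<tau>) = d \<Longrightarrow>
  (\<Sum>\<sigma> | \<sigma> \<in> \<Sigma> \<and> dim \<sigma> = d \<and> \<tau> face_of \<sigma>. of_int (\<omega> \<sigma>) *\<^sub>R primitive N \<tau> \<sigma>) = 0"
 using tropical by (simp add: tropical_fan_def)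

lemma dim_le: "\<sigma> \<in> \<Sigma> \<Longrightarrow> dim \<sigma> \<le> d"
 using pure dim_face_mono unfolding pure_dim_def by metis

lemma top_maximal: "\<eta> \<in> \<Sigma> \<Longrightarrow> dim \<eta> = d \<Longrightarrow> \<eta>' \<in> \<Sigma> \<Longrightarrow> \<eta> face_of \<eta>' \<Longrightarrow> \<eta>' = \<eta>"
 using face_dim_eq[of \<eta>' \<eta>] dim_le[of \<eta>'] dim_face_mono[of \<eta> \<eta>'] by fastforce

lemma face_refl: "\<sigma> \<in> \<Sigma> \<Longrightarrow> \<sigma> face_of \<sigma>"
 using face_of_iff_gens by blast

lemma star_lattices_top:
 assumes "\<eta> \<in> \<Sigma>" "dim \<eta> = d" shows "star_lattices N \<Sigma> (\<tau>, \<eta>) = {proj \<tau> ` (N \<inter> span \<eta>)}"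
 using top_maximal[OF assms] assms(1) face_refl by (auto simp: star_lattices_def)

lemma trop_F_top:
 assumes "\<eta> \<in> \<Sigma>" "dim \<eta> = d" shows "trop_F K N \<Sigma> p (\<tau>, \<eta>) = ext_power K {face_lattice N (\<tau>, \<eta>)} p"
 by (simp add: trop_F_def star_lattices_top[OF assms] face_lattice_def)

lemma nu_mem:
 assumes "(\<tau>, \<sigma>) \<in> \<F>"
 shows "\<nu> (\<tau>, \<sigma>) \<in> ext_power K {face_lattice N (\<tau>, \<sigma>)} (dim \<sigma> - dim \<tau>)"
 using is_generator_mem[OF nu_generator[OF assms]] ext_power_ring_mono[OF Ints_K] by blast

lemma nu_mem_trop_F:
 assumes "(\<tau>, \<sigma>) \<in> \<F>" "\<sigma>' face_of \<sigma>" "k = dim \<sigma> - dim \<tau>"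
 shows "\<nu> (\<tau>, \<sigma>) \<in> trop_F K N \<Sigma> k (\<tau>, \<sigma>')"
proof -
 have "ext_power K {face_lattice N (\<tau>, \<sigma>)} k \<subseteq> trop_F K N \<Sigma> k (\<tau>, \<sigma>')"
  unfolding trop_F_eq face_lattice_def prod.case
  by (rule ext_power_mono[OF subK]) (use assms in \<open>auto simp: faces_iff\<close>)
 then show ?thesis using nu_mem[OF assms(1)] assms(3) by auto
qed

lemma proj_lattice_coordinatized: "\<tau> \<in> \<Sigma> \<Longrightarrow> coordinatized K (proj \<tau> ` N)"
 using coordinatized_ring_mono[OF proj_N_coordinatized Ints_K] .

lemma star_lattices_subset: "star_lattices N \<Sigma> (\<tau>, \<sigma>) \<subseteq> Pow (proj \<tau> ` N)"
 by (auto simp: star_lattices_def)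

lemma trop_kdual_extension:
 assumes "\<tau> \<in> \<Sigma>" "\<phi> \<in> kdual K (trop_F K N \<Sigma> p (\<tau>, \<sigma>))"
 shows "\<exists>g. linear g \<and> (\<forall>x\<in>trop_F K N \<Sigma> p (\<tau>, \<sigma>). g x = \<phi> x)"
 using kdual_real_extension[OF K proj_lattice_coordinatized[OF assms(1)] star_lattices_subset]
  assms(2) unfolding trop_F_def by blast

lemma trop_cochains_mem:
 assumes "a \<in> trop_cochains K N \<Sigma> p q"
 shows "\<delta> \<in> \<F> \<Longrightarrow> face_dim \<delta> = q \<Longrightarrow> a \<delta> \<in> kdual K (trop_F K N \<Sigma> p \<delta>)"
  "\<not> (\<delta> \<in> \<F> \<and> face_dim \<delta> = q) \<Longrightarrow> a \<delta> = 0"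
 using assms unfolding trop_cochains_def by (smt (verit) mem_Collect_eq)+

definition stratum_combination :: "nat \<Rightarrow> ('n rvec set \<Rightarrow> real) \<Rightarrow> 'n face \<Rightarrow> 'n ext" where
 "stratum_combination p k = (\<lambda>(\<sigma>, \<eta>). if (\<sigma>, \<eta>) \<in> \<F> \<and> dim \<sigma> = p \<and> dim \<eta> = d
   then (of_int (\<omega> \<eta>) * k \<sigma>) *\<^sub>R \<nu> (\<sigma>, \<eta>) else 0)"

lemma stratum_combination_chain:
 assumes "\<And>\<sigma>. \<sigma> \<in> \<Sigma> \<Longrightarrow> dim \<sigma> = p \<Longrightarrow> k \<sigma> \<in> K"
 shows "stratum_combination p k \<in> trop_chains K N \<Sigma> (d - p) (d - p)"
proof (rule trop_chainsI)
 fix \<delta> :: "'n face"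
 obtain \<sigma> \<eta> where eq: "\<delta> = (\<sigma>, \<eta>)" by (metis surj_pair)
 note km = kmodule_trop_F[OF subK]
 show "stratum_combination p k \<delta> \<in> trop_F K N \<Sigma> (d - p) \<delta>"
 proof (cases "(\<sigma>, \<eta>) \<in> \<F> \<and> dim \<sigma> = p \<and> dim \<eta> = d")
  case True
  have m: "\<sigma> \<in> \<Sigma>" "\<eta> \<in> \<Sigma>" using True by (auto simp: faces_iff)
  have "of_int (\<omega> \<eta>) * k \<sigma> \<in> K"
   by (rule real_subringD(6)[OF subK]) (use Ints_K assms[OF m(1)] True in auto)
  moreover have "\<nu> (\<sigma>, \<eta>) \<in> trop_F K N \<Sigma> (d - p) (\<sigma>, \<eta>)"
   using True face_refl[OF m(2)] by (intro nu_mem_trop_F) auto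
  ultimately show ?thesis using True by (simp add: eq stratum_combination_def kmoduleD(3)[OF km])
 next
  case False
  then show ?thesis using kmoduleD(1)[OF km] by (auto simp: eq stratum_combination_def)
 qed
 show "stratum_combination p k \<delta> = 0" if "\<not> (\<delta> \<in> \<F> \<and> face_dim \<delta> = d - p)"
  using that by (auto simp: eq stratum_combination_def face_dim_def)
qed

lemma ext_map_proj_zero [simp]: "ext_map (proj {0}) x = (x :: 'n ext)"
proof -
 have "proj {0} = (\<lambda>v :: 'n rvec. v)" by (simp add: fun_eq_iff)
 then show ?thesis by (simp add: ext_map_id)
qed

lemma pull_wedge:
 assumes "\<eta> \<in> \<Sigma>" "dim \<eta> = d" "set us \<subseteq> N \<inter> span \<eta>" "length us = k"
 shows "pull K N \<Sigma> k (\<sigma>, \<sigma>') ({0}, \<eta>) \<phi> (wedge us) = \<phi> (wedge (map (proj \<sigma>) us))"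
proof -
 have "wedge us \<in> trop_F K N \<Sigma> k ({0}, \<eta>)"
  using ext_power_wedge[OF subK, of "N \<inter> span \<eta>" "{N \<inter> span \<eta>}" us] assms
  by (simp add: trop_F_top face_lattice_def)
 then show ?thesis by (simp add: pull_def restrict0_def ext_map_wedge[OF linear_proj])
qed

text \<open>The form pulled back from the stratum of \<open>\<sigma>\<close> vanishes on \<open>span \<sigma>\<close>, so a single shuffle contributes.\<close>

lemma form_wedge_top:
 assumes \<eta>: "\<eta> \<in> \<Sigma>" "dim \<eta> = d" and \<sigma>: "\<sigma> \<in> \<Sigma>" "\<sigma> face_of \<eta>" "dim \<sigma> = p"
  and a: "a \<in> kdual K (trop_F K N \<Sigma> p ({0}, \<sigma>))" and b: "b \<in> kdual K (trop_F K N \<Sigma> (d - p) (\<sigma>, \<eta>))"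
 shows "form_wedge K (star_lattices N \<Sigma> ({0}, \<eta>)) p (d - p)
   (pull K N \<Sigma> p ({0}, \<sigma>) ({0}, \<eta>) a) (pull K N \<Sigma> (d - p) (\<sigma>, \<eta>) ({0}, \<eta>) b) (of_int (\<omega> \<eta>) *\<^sub>R \<nu> ({0}, \<eta>)) =
  of_int (\<omega> \<eta>) * (cup_sign N \<nu> {0} \<sigma> \<eta> * (a (\<nu> ({0}, \<sigma>)) * b (\<nu> (\<sigma>, \<eta>))))"
proof -
 let ?L = "N \<inter> span \<eta>" and ?q = "d - p"
 let ?\<alpha> = "pull K N \<Sigma> p ({0}, \<sigma>) ({0}, \<eta>) a" and ?\<beta> = "pull K N \<Sigma> (d - p) (\<sigma>, \<eta>) ({0}, \<eta>) b"
 have pd: "p \<le> d" "p + ?q = d" using dim_le[OF \<sigma>(1)] \<sigma>(3) by auto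
 have f: "({0}, \<sigma>) \<in> \<F>" "(\<sigma>, \<eta>) \<in> \<F>" "({0}, \<eta>) \<in> \<F>"
  using \<eta> \<sigma> zero_cone by (auto simp: faces_iff)
 have SL: "star_lattices N \<Sigma> ({0}, \<eta>) = {?L}" using star_lattices_top[OF \<eta>, of "{0}"] by simp
 \<comment> \<open>Real extensions of the two forms, to which \<open>shuffle_product_exists\<close>
   applies; below, B' is the second one pulled back along the quotient by \<sigma>.\<close>
 obtain A where A: "linear A" "\<And>x. x \<in> trop_F K N \<Sigma> p ({0}, \<sigma>) \<Longrightarrow> A x = a x"
  using trop_kdual_extension[OF zero_cone(1) a] by blast
 obtain B where B: "linear B" "\<And>x. x \<in> trop_F K N \<Sigma> ?q (\<sigma>, \<eta>) \<Longrightarrow> B x = b x"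
  using trop_kdual_extension[OF \<sigma>(1) b] by blast
 define B' where "B' x = B (ext_map (proj \<sigma>) x)" for x
 have B': "linear B'" unfolding B'_def using linear_compose[OF linear_ext_map B(1)] by (simp add: o_def)
 let ?f = "\<lambda>vs. \<Sum>I | I \<subseteq> {..<p + ?q} \<and> card I = p. shuffle_sign I ({..<p + ?q} - I)
    * A (wedge (nths vs I)) * B' (wedge (nths vs ({..<p + ?q} - I)))"
 have "\<exists>\<gamma>. linear \<gamma> \<and> (\<forall>vs. length vs = p + ?q \<longrightarrow> \<gamma> (wedge vs) = ?f vs)"
  by (rule shuffle_product_exists[OF A(1) B'])
 then obtain \<gamma> where \<gamma>0: "linear \<gamma> \<and> (\<forall>vs. length vs = p + ?q \<longrightarrow> \<gamma> (wedge vs) = ?f vs)" by (rule exE)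
 have \<gamma>: "linear \<gamma>" "length vs = p + ?q \<Longrightarrow> \<gamma> (wedge vs) = ?f vs" for vs
  using \<gamma>0 by simp_all
 have cardc: "card ({..<p + ?q} - I) = ?q" if "I \<subseteq> {..<p + ?q}" "card I = p" for I
  using card_Diff_subset[of I "{..<p + ?q}"] that finite_subset[OF that(1)] by simp
 have Aw: "A (wedge us) = ?\<alpha> (wedge us)" "?\<alpha> (wedge us) \<in> K" if us: "set us \<subseteq> ?L" "length us = p" for us
 proof -
  have "wedge us \<in> trop_F K N \<Sigma> p ({0}, \<sigma>)"
   using ext_power_wedge[OF subK, of ?L "star_lattices N \<Sigma> ({0}, \<sigma>)" us] us \<eta>(1) \<sigma>(2)
   unfolding trop_F_def by (auto simp: star_lattices_def)
  moreover have "?\<alpha> (wedge us) = a (wedge us)" using pull_wedge[OF \<eta> us] map_idI[of us "proj {0}"] by simp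
  ultimately show "A (wedge us) = ?\<alpha> (wedge us)" "?\<alpha> (wedge us) \<in> K" using A(2) kdualD(3)[OF a] by auto
 qed
 have Bw: "B' (wedge us) = ?\<beta> (wedge us)" "?\<beta> (wedge us) \<in> K" if us: "set us \<subseteq> ?L" "length us = ?q" for us
 proof -
  have "wedge (map (proj \<sigma>) us) \<in> trop_F K N \<Sigma> ?q (\<sigma>, \<eta>)"
   using ext_power_wedge[OF subK, of "proj \<sigma> ` ?L" "{proj \<sigma> ` ?L}" "map (proj \<sigma>) us"] us
   by (auto simp: trop_F_top[OF \<eta>] face_lattice_def)
  moreover have "?\<beta> (wedge us) = b (wedge (map (proj \<sigma>) us))" using pull_wedge[OF \<eta> us] by simp
  ultimately show "B' (wedge us) = ?\<beta> (wedge us)" "?\<beta> (wedge us) \<in> K"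
   using B(2) kdualD(3)[OF b] by (auto simp: B'_def ext_map_wedge[OF linear_proj])
 qed
 have nthsL: "set (nths vs I) \<subseteq> ?L" if "set vs \<subseteq> ?L" for vs I using that set_nths_subset[of vs I] by blast
 have lenI: "length (nths vs I) = p" "length (nths vs ({..<p + ?q} - I)) = ?q"
  if "length vs = p + ?q" "I \<subseteq> {..<p + ?q}" "card I = p" for vs :: "'n rvec list" and I
  using length_nths_subset[of I vs] length_nths_subset[of "{..<p + ?q} - I" vs] cardc[OF that(2,3)] that by auto
 have \<gamma>L: "\<gamma> (wedge vs) = (\<Sum>I | I \<subseteq> {..<p + ?q} \<and> card I = p. shuffle_sign I ({..<p + ?q} - I)
    * ?\<alpha> (wedge (nths vs I)) * ?\<beta> (wedge (nths vs ({..<p + ?q} - I))))"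
  if vs: "set vs \<subseteq> ?L" "length vs = p + ?q" for vs
  unfolding \<gamma>(2)[OF vs(2)] using Aw(1)[OF nthsL[OF vs(1)]] Bw(1)[OF nthsL[OF vs(1)]] lenI[OF vs(2)]
  by (intro sum.cong refl) auto
 have \<gamma>K: "\<gamma> (wedge vs) \<in> K" if vs: "set vs \<subseteq> ?L" "length vs = p + ?q" for vs
 proof -
  have "kmodule K K" using real_subringD[OF subK] by (auto simp: kmodule_def)
  moreover have "shuffle_sign I J \<in> K" for I J :: "nat set"
   using real_subringD[OF subK] minus_one_power_iff[of "card {(i, j). i \<in> I \<and> j \<in> J \<and> j < i}", where 'a = real]
   by (auto simp: shuffle_sign_def)
  ultimately show ?thesis
   unfolding \<gamma>L[OF vs]
   using Aw(2)[OF nthsL[OF vs(1)]] Bw(2)[OF nthsL[OF vs(1)]] lenI[OF vs(2)] real_subringD(6)[OF subK]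
   by (intro kmodule_sum[of K K]) auto
 qed
 let ?S = "ext_power K {?L} (p + ?q)"
 have "?S \<subseteq> \<gamma> -` K"
  by (rule ext_power_least[OF kmodule_vimage[OF \<gamma>(1)]])
   (use \<gamma>K real_subringD[OF subK] in \<open>auto simp: kmodule_def\<close>)
 then have \<gamma>d: "restrict0 ?S \<gamma> \<in> kdual K ?S"
  by (intro kdual_restrict0[OF \<gamma>(1) _ kmodule_ext_power[OF subK]]) auto
 have res: "restrict0 ?S \<gamma> (wedge vs) = \<gamma> (wedge vs)" if "set vs \<subseteq> ?L" "length vs = p + ?q" for vs
  using ext_power_wedge[OF subK, of ?L "{?L}" vs] that by (simp add: restrict0_def)
 \<comment> \<open>Resolves the definite description of \<open>form_wedge\<close>: \<gamma>
   restricted to the lattice has the shuffle values, and a form on a lattice is determined by its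
   values on wedges.\<close>
 have fw: "form_wedge K {?L} p ?q ?\<alpha> ?\<beta> = restrict0 ?S \<gamma>"
  unfolding form_wedge_def
 proof (rule the_equality, intro conjI ballI allI impI)
  show "restrict0 ?S \<gamma> \<in> kdual K ?S" by (rule \<gamma>d)
  fix L vs assume "L \<in> {?L}" "set vs \<subseteq> L \<and> length vs = p + ?q"
  then show "restrict0 ?S \<gamma> (wedge vs) = (\<Sum>I | I \<subseteq> {..<p + ?q} \<and> card I = p. shuffle_sign I ({..<p + ?q} - I)
    * ?\<alpha> (wedge (nths vs I)) * ?\<beta> (wedge (nths vs ({..<p + ?q} - I))))"
   using res[of vs] \<gamma>L[of vs] by simp
 next
  fix \<gamma>' assume \<gamma>': "\<gamma>' \<in> kdual K ?S \<and> (\<forall>L\<in>{?L}. \<forall>vs. set vs \<subseteq> L \<and> length vs = p + ?q \<longrightarrow>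
    \<gamma>' (wedge vs) = (\<Sum>I | I \<subseteq> {..<p + ?q} \<and> card I = p. shuffle_sign I ({..<p + ?q} - I)
    * ?\<alpha> (wedge (nths vs I)) * ?\<beta> (wedge (nths vs ({..<p + ?q} - I)))))"
  show "\<gamma>' = restrict0 ?S \<gamma>"
   by (rule kdual_eqI[OF subK _ \<gamma>d]) (use \<gamma>' res \<gamma>L in auto)
 qed
 let ?s = "cup_sign N \<nu> {0} \<sigma> \<eta>"
 note s = cup_sign_eq[OF f(1,2)]
 obtain ms s1 where ms: "length ms = dim \<sigma> - dim {0 :: 'n rvec}" "span (set ms) = span (proj {0} ` \<sigma>)"
  "\<nu> ({0}, \<sigma>) = s1 *\<^sub>R wedge ms" using nu_basis[OF f(1)] by metis
 obtain ks s2 where ks: "length ks = dim \<eta> - dim \<sigma>" "face_lattice N (\<sigma>, \<eta>) = kspan \<int> (set ks)"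
  "\<nu> (\<sigma>, \<eta>) = s2 *\<^sub>R wedge ks" using nu_basis[OF f(2)] by metis
 have lenm: "length ms = p" and lenk: "length ks = ?q" using ms(1) ks(1) \<sigma>(3) \<eta>(2) by (simp_all add: dim_eq_0)
 have pm: "proj \<sigma> m = 0" if "m \<in> set ms" for m
  using span_base[OF that] ms(2) by (simp add: proj_eq_0_iff)
 have pk: "map (proj \<sigma>) ks = ks"
 proof -
  have "set ks \<subseteq> face_lattice N (\<sigma>, \<eta>)" using ks(2) kspan_superset[of \<int> "set ks"] by simp
  then show ?thesis by (intro map_idI) (auto simp: face_lattice_def proj_idem)
 qed
 have Bk: "B' (wedge ks) = B (wedge ks)" by (simp add: B'_def ext_map_wedge[OF linear_proj] pk)
 \<comment> \<open>Evaluation on a family adapted to \<sigma>: ms spans \<sigma>, while ks generates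
   the quotient lattice of \<eta> by \<sigma>.\<close>
 have "\<gamma> (wedge (ms @ ks)) = A (wedge ms) * B (wedge ks)"
 proof -
  let ?g = "\<lambda>I. shuffle_sign I ({..<p + ?q} - I) * A (wedge (nths (ms @ ks) I))
   * B' (wedge (nths (ms @ ks) ({..<p + ?q} - I)))"
  have "\<gamma> (wedge (ms @ ks)) = sum ?g {I. I \<subseteq> {..<p + ?q} \<and> card I = p}"
   by (rule \<gamma>(2)) (simp add: lenm lenk)
  also have "\<dots> = sum ?g {{..<p}}"
  proof (rule sum.mono_neutral_right)
   show "finite {I. I \<subseteq> {..<p + ?q} \<and> card I = p}" by (rule finite_subset[of _ "Pow {..<p + ?q}"]) auto
   show "{{..<p}} \<subseteq> {I. I \<subseteq> {..<p + ?q} \<and> card I = p}" by auto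
   show "\<forall>I\<in>{I. I \<subseteq> {..<p + ?q} \<and> card I = p} - {{..<p}}. ?g I = 0"
   proof
    fix I assume I: "I \<in> {I. I \<subseteq> {..<p + ?q} \<and> card I = p} - {{..<p}}"
    \<comment> \<open>A set of p positions other than the first p misses some i < p. Then ms ! i
      lands in the second factor, where the projection modulo \<sigma> kills it.\<close>
    have "\<not> {..<p} \<subseteq> I"
    proof
     assume sub: "{..<p} \<subseteq> I"
     have "finite I" using I finite_subset[of I "{..<p + ?q}"] by auto
     then have "{..<p} = I" using card_subset_eq[OF _ sub] I by simp
     then show False using I by auto
    qed
    then obtain i where i: "i < p" "i \<notin> I" by auto
    have "ms ! i \<in> set (nths (ms @ ks) ({..<p + ?q} - I))"
     unfolding set_nths using i lenm lenk by (auto simp: nth_append intro!: exI[of _ i])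
    then have "proj \<sigma> (ms ! i) \<in> set (map (proj \<sigma>) (nths (ms @ ks) ({..<p + ?q} - I)))" by simp
    moreover have "proj \<sigma> (ms ! i) = 0" using pm i lenm by simp
    ultimately have 0: "0 \<in> set (map (proj \<sigma>) (nths (ms @ ks) ({..<p + ?q} - I)))" by metis
    have "wedge (map (proj \<sigma>) (nths (ms @ ks) ({..<p + ?q} - I))) = 0"
     using wedge_nonzero_imp[of "map (proj \<sigma>) (nths (ms @ ks) ({..<p + ?q} - I))"] dependent_zero[OF 0] by blast
    then have "B' (wedge (nths (ms @ ks) ({..<p + ?q} - I))) = 0"
     by (simp add: B'_def ext_map_wedge[OF linear_proj] linear_0[OF B(1)])
    then show "?g I = 0" by simp
   qed
  qed
  also have "\<dots> = ?g {..<p}" by simp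
  also have "\<dots> = A (wedge ms) * B (wedge ks)"
  proof -
   have "nths (ms @ ks) {..<p} = ms" using lenm by (simp add: nths_append)
   moreover have "{j. j + length ms \<in> {..<p + ?q} - {..<p}} = {..<?q}" using lenm by auto
   moreover have "set (nths ms ({..<p + ?q} - {..<p})) = {}" using lenm by (auto simp: set_nths)
   ultimately have "nths (ms @ ks) ({..<p + ?q} - {..<p}) = ks" "nths (ms @ ks) {..<p} = ms"
    using lenk by (simp_all add: nths_append)
   moreover have "{(i, j). i \<in> {..<p} \<and> j \<in> {..<p + ?q} - {..<p} \<and> j < i} = {}" by auto
   then have "shuffle_sign {..<p} ({..<p + ?q} - {..<p}) = 1" unfolding shuffle_sign_def by (simp only: card.empty power_0)
   ultimately show ?thesis using Bk by simp
  qed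
  finally show ?thesis .
 qed
 then have prod: "\<gamma> (\<nu> ({0}, \<sigma>) \<^bold>\<and> \<nu> (\<sigma>, \<eta>)) = A (\<nu> ({0}, \<sigma>)) * B (\<nu> (\<sigma>, \<eta>))"
  by (simp add: ms(3) ks(3) ext_mult_scale_left ext_mult_scale_right linear_scale[OF \<gamma>(1)]
    linear_scale[OF A(1)] linear_scale[OF B(1)] flip: wedge_append)
 have "A (\<nu> ({0}, \<sigma>)) = a (\<nu> ({0}, \<sigma>))"
  using \<sigma>(3) face_refl[OF \<sigma>(1)] by (intro A(2) nu_mem_trop_F[OF f(1)]) (auto simp: dim_eq_0)
 moreover have "B (\<nu> (\<sigma>, \<eta>)) = b (\<nu> (\<sigma>, \<eta>))"
  using \<sigma>(3) \<eta>(2) face_refl[OF \<eta>(1)] by (intro B(2) nu_mem_trop_F[OF f(2)]) auto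
 moreover have "\<gamma> (\<nu> ({0}, \<sigma>) \<^bold>\<and> \<nu> (\<sigma>, \<eta>)) = ?s * \<gamma> (\<nu> ({0}, \<eta>))"
  by (simp add: s(2) linear_scale[OF \<gamma>(1)])
 ultimately have "?s * \<gamma> (\<nu> ({0}, \<eta>)) = a (\<nu> ({0}, \<sigma>)) * b (\<nu> (\<sigma>, \<eta>))" using prod by simp
 then have val: "\<gamma> (\<nu> ({0}, \<eta>)) = ?s * (a (\<nu> ({0}, \<sigma>)) * b (\<nu> (\<sigma>, \<eta>)))" using s(1) by auto
 have "\<nu> ({0}, \<eta>) \<in> ?S"
  using nu_mem[OF f(3)] \<eta>(2) pd by (simp add: face_lattice_def dim_eq_0)
 then have "of_int (\<omega> \<eta>) *\<^sub>R \<nu> ({0}, \<eta>) \<in> ?S"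
  using Ints_K by (intro kmoduleD(3)[OF kmodule_ext_power[OF subK]]) auto
 then show ?thesis unfolding SL fw by (simp add: restrict0_def linear_scale[OF \<gamma>(1)] val)
qed

end

section \<open>Boundaries of stratum combinations and the cap product\<close>

context simplicial_lattice_fan
begin

lemma sum_facets:
 assumes f: "(\<tau>, \<sigma>) \<in> \<F>"
 shows "(\<Sum>\<gamma> | facet_pair \<Sigma> \<gamma> (\<tau>, \<sigma>). h \<gamma>) =
  (\<Sum>\<eta> | \<eta> \<in> \<Sigma> \<and> \<tau> face_of \<eta> \<and> \<eta> face_of \<sigma> \<and> dim \<sigma> = Suc (dim \<eta>). h (\<tau>, \<eta>)) +
  (\<Sum>\<rho> | \<rho> \<in> \<Sigma> \<and> \<tau> face_of \<rho> \<and> \<rho> face_of \<sigma> \<and> dim \<rho> = Suc (dim \<tau>). h (\<rho>, \<sigma>))" (is "_ = sum _ ?A + sum _ ?B")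
proof -
 have eq: "{\<gamma>. facet_pair \<Sigma> \<gamma> (\<tau>, \<sigma>)} = Pair \<tau> ` ?A \<union> (\<lambda>\<rho>. (\<rho>, \<sigma>)) ` ?B"
  using f by (auto simp: facet_pair_iff faces_iff)
 have fin: "finite ?A" "finite ?B" using finite_fan by simp_all
 have "sum h (Pair \<tau> ` ?A \<union> (\<lambda>\<rho>. (\<rho>, \<sigma>)) ` ?B) = sum h (Pair \<tau> ` ?A) + sum h ((\<lambda>\<rho>. (\<rho>, \<sigma>)) ` ?B)"
  using fin by (intro sum.union_disjoint) auto
 then show ?thesis unfolding eq by (simp add: sum.reindex inj_on_def)
qed

end

context oriented_fan
begin

lemma inner_sign_facet:
 assumes "\<sigma>' \<in> \<Sigma>" "\<sigma> \<in> \<Sigma>" "\<sigma>' face_of \<sigma>" "dim \<sigma> = Suc (dim \<sigma>')" "\<tau> \<in> \<Sigma>" "\<tau> face_of \<sigma>'"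
 shows "fsign (\<tau>, \<sigma>') (\<tau>, \<sigma>) *\<^sub>R \<nu> (\<tau>, \<sigma>) = ext_vec (primitive N \<sigma>' \<sigma>) \<^bold>\<and> \<nu> (\<tau>, \<sigma>')"
proof -
 obtain u where "u \<notin> gens \<sigma>'" "gens \<sigma> = insert u (gens \<sigma>')" using codim_one_gens[OF assms(1-4)] by blast
 then show ?thesis using face_sign_inner(2)[OF assms(1,2) _ _ assms(5,6)] by simp
qed

lemma outer_sign_facet:
 assumes "\<tau> \<in> \<Sigma>" "\<tau>' \<in> \<Sigma>" "\<tau> face_of \<tau>'" "dim \<tau>' = Suc (dim \<tau>)" "\<sigma> \<in> \<Sigma>" "\<tau>' face_of \<sigma>"
 shows "fsign (\<tau>', \<sigma>) (\<tau>, \<sigma>) *\<^sub>R \<nu> (\<tau>, \<sigma>) = - (ext_vec (primitive N \<tau> \<tau>') \<^bold>\<and> \<nu> (\<tau>', \<sigma>))"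
proof -
 obtain u where "u \<notin> gens \<tau>" "gens \<tau>' = insert u (gens \<tau>)" using codim_one_gens[OF assms(1-4)] by blast
 then show ?thesis using face_sign_outer(2)[OF assms(1,2) _ _ assms(5,6)] by simp
qed

lemma primitive_in_span:
 assumes "\<tau> \<in> \<Sigma>" "\<sigma> \<in> \<Sigma>" "\<tau> face_of \<sigma>" "dim \<sigma> = Suc (dim \<tau>)"
 shows "\<exists>v\<in>N \<inter> span \<sigma>. primitive N \<tau> \<sigma> = proj \<tau> v" "primitive N \<tau> \<sigma> \<in> span \<sigma>"
proof -
 obtain u where u: "u \<notin> gens \<tau>" "gens \<sigma> = insert u (gens \<tau>)" using codim_one_gens[OF assms] by blast
 have "1 *\<^sub>R primitive N \<tau> \<sigma> \<in> proj \<tau> ` (N \<inter> span \<sigma>)"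
  unfolding primitive_facet(2)[OF assms(1,2) u(2,1)] by (rule range_eqI[of _ _ 1]) simp
 then show "\<exists>v\<in>N \<inter> span \<sigma>. primitive N \<tau> \<sigma> = proj \<tau> v" by auto
 then obtain v where v: "v \<in> span \<sigma>" "primitive N \<tau> \<sigma> = proj \<tau> v" by blast
 have "v - proj \<tau> v \<in> span \<sigma>" using proj_in[of v \<tau>] span_mono[OF face_of_imp_subset[OF assms(3)]] by blast
 from span_diff[OF v(1) this] v(2) show "primitive N \<tau> \<sigma> \<in> span \<sigma>" by simp
qed

text \<open>\<nu> (\<tau>, \<sigma>) is divisible by the primitive vector towards \<tau>', and this
  direction is lost in the stratum of \<tau>'. So chains with multiples of \<nu> as components have
  no boundary at infinity.\<close>

lemma nu_outer_zero:
 assumes "\<tau> \<in> \<Sigma>" "\<tau>' \<in> \<Sigma>" "\<tau> face_of \<tau>'" "dim \<tau>' = Suc (dim \<tau>)" "\<sigma> \<in> \<Sigma>" "\<tau>' face_of \<sigma>"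
 shows "ext_map (proj \<tau>') (\<nu> (\<tau>, \<sigma>)) = 0"
proof -
 have f: "(\<tau>, \<sigma>) \<in> \<F>" "(\<tau>', \<sigma>) \<in> \<F>" using assms face_of_trans by (auto simp: faces_iff)
 have "proj \<tau>' (primitive N \<tau> \<tau>') = 0" using primitive_in_span(2)[OF assms(1-4)] by (simp add: proj_eq_0_iff)
 then have "ext_map (proj \<tau>') (fsign (\<tau>', \<sigma>) (\<tau>, \<sigma>) *\<^sub>R \<nu> (\<tau>, \<sigma>)) = 0"
  unfolding outer_sign_facet[OF assms]
  by (simp add: ext_map_linear ext_map_mult[OF linear_proj])
 moreover have "fsign (\<tau>', \<sigma>) (\<tau>, \<sigma>) \<noteq> 0"
  using face_sign_unit[of "(\<tau>', \<sigma>)" "(\<tau>, \<sigma>)"] f assms by (auto simp: facet_pair_iff)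
 ultimately show ?thesis by (simp add: ext_map_linear)
qed

end

context tropical_setting
begin

lemma stratum_combination_apply:
 "(\<sigma>, \<eta>) \<in> \<F> \<Longrightarrow> dim \<sigma> = p \<Longrightarrow> dim \<eta> = d \<Longrightarrow>
  stratum_combination p k (\<sigma>, \<eta>) = (of_int (\<omega> \<eta>) * k \<sigma>) *\<^sub>R \<nu> (\<sigma>, \<eta>)"
 "\<not> (dim \<sigma> = p \<and> dim \<eta> = d) \<Longrightarrow> stratum_combination p k (\<sigma>, \<eta>) = 0"
 by (auto simp: stratum_combination_def)

text \<open>The incidence sign times \<nu> (\<sigma>, \<eta>) is the primitive vector of \<eta>
  modulo \<zeta> times \<nu> (\<sigma>, \<zeta>). Factoring out the latter leaves the balancing
  condition at \<zeta>.\<close>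

lemma balanced_product:
 assumes "\<sigma> \<in> \<Sigma>" "\<zeta> \<in> \<Sigma>" "\<sigma> face_of \<zeta>" "Suc (dim \<zeta>) = d"
 shows "(\<Sum>\<eta> | \<eta> \<in> \<Sigma> \<and> \<zeta> face_of \<eta> \<and> dim \<eta> = Suc (dim \<zeta>).
  (of_int (\<omega> \<eta>) * fsign (\<sigma>, \<zeta>) (\<sigma>, \<eta>)) *\<^sub>R \<nu> (\<sigma>, \<eta>)) = 0" (is "sum ?f ?A = 0")
proof -
 have eq: "?A = {\<eta> \<in> \<Sigma>. dim \<eta> = d \<and> \<zeta> face_of \<eta>}" using assms(4) by auto
 have lin: "linear (\<lambda>v. ext_vec v \<^bold>\<and> \<nu> (\<sigma>, \<zeta>))" by (rule linear_ext_vec_mult)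
 have "sum ?f ?A = (\<Sum>\<eta>\<in>?A. ext_vec (of_int (\<omega> \<eta>) *\<^sub>R primitive N \<zeta> \<eta>) \<^bold>\<and> \<nu> (\<sigma>, \<zeta>))"
 proof (rule sum.cong[OF refl])
  fix \<eta> assume "\<eta> \<in> ?A"
  then have "fsign (\<sigma>, \<zeta>) (\<sigma>, \<eta>) *\<^sub>R \<nu> (\<sigma>, \<eta>) = ext_vec (primitive N \<zeta> \<eta>) \<^bold>\<and> \<nu> (\<sigma>, \<zeta>)"
   using assms by (intro inner_sign_facet) auto
  then show "?f \<eta> = ext_vec (of_int (\<omega> \<eta>) *\<^sub>R primitive N \<zeta> \<eta>) \<^bold>\<and> \<nu> (\<sigma>, \<zeta>)"
   by (simp add: linear_scale[OF lin] flip: scaleR_scaleR)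
 qed
 also have "\<dots> = ext_vec (\<Sum>\<eta>\<in>?A. of_int (\<omega> \<eta>) *\<^sub>R primitive N \<zeta> \<eta>) \<^bold>\<and> \<nu> (\<sigma>, \<zeta>)"
  by (simp add: linear_sum[OF lin])
 also have "\<dots> = 0" using balanced[OF assms(2,4)] by (simp add: eq linear_0[OF lin])
 finally show ?thesis .
qed

text \<open>Inside a stratum the boundary is \<open>balanced_product\<close> scaled by the
  coefficient of the stratum; towards infinity each term vanishes by
  \<open>nu_outer_zero\<close>.\<close>

lemma stratum_combination_cycle:
 "\<partial> (stratum_combination p k) = 0"
proof
 fix \<gamma> :: "'n face"
 obtain \<rho> \<zeta> where eq: "\<gamma> = (\<rho>, \<zeta>)" by (metis surj_pair)
 let ?c = "stratum_combination p k"
 show "\<partial> ?c \<gamma> = 0 \<gamma>"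
 proof (cases "\<gamma> \<in> \<F>")
  case False
  then show ?thesis by (simp add: trop_boundary_outside)
 next
  case True
  then have f: "(\<rho>, \<zeta>) \<in> \<F>" and m: "\<rho> \<in> \<Sigma>" "\<zeta> \<in> \<Sigma>" "\<rho> face_of \<zeta>" by (auto simp: eq faces_iff)
  let ?A = "{\<eta> \<in> \<Sigma>. \<zeta> face_of \<eta> \<and> dim \<eta> = Suc (dim \<zeta>)}" and ?B = "{\<rho>' \<in> \<Sigma>. \<rho>' face_of \<rho> \<and> dim \<rho> = Suc (dim \<rho>')}"
  let ?h = "\<lambda>\<delta>. fsign (\<rho>, \<zeta>) \<delta> *\<^sub>R ext_map (proj \<rho>) (?c \<delta>)"
  have "\<partial> ?c \<gamma> = (\<Sum>\<eta>\<in>?A. ?h (\<rho>, \<eta>)) + (\<Sum>\<rho>'\<in>?B. ?h (\<rho>', \<zeta>))"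
   using sum_cofaces[OF f, of ?h] by (simp add: trop_boundary_def eq)
  also have "(\<Sum>\<rho>'\<in>?B. ?h (\<rho>', \<zeta>)) = 0"
  proof (rule sum.neutral, rule ballI)
   fix \<rho>' assume "\<rho>' \<in> ?B"
   then have "ext_map (proj \<rho>) (\<nu> (\<rho>', \<zeta>)) = 0" using m by (intro nu_outer_zero) auto
   then show "?h (\<rho>', \<zeta>) = 0"
    by (simp add: stratum_combination_def ext_map_linear)
  qed
  also have "(\<Sum>\<eta>\<in>?A. ?h (\<rho>, \<eta>)) = 0"
  proof (cases "dim \<rho> = p \<and> Suc (dim \<zeta>) = d")
   case True
   have "(\<Sum>\<eta>\<in>?A. ?h (\<rho>, \<eta>)) =
    k \<rho> *\<^sub>R (\<Sum>\<eta>\<in>?A. (of_int (\<omega> \<eta>) * fsign (\<rho>, \<zeta>) (\<rho>, \<eta>)) *\<^sub>R \<nu> (\<rho>, \<eta>))"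
    unfolding scaleR_sum_right
   proof (rule sum.cong[OF refl])
    fix \<eta> assume "\<eta> \<in> ?A"
    then have "(\<rho>, \<eta>) \<in> \<F>" "dim \<eta> = d" using m True face_of_trans by (auto simp: faces_iff)
    then show "?h (\<rho>, \<eta>) = k \<rho> *\<^sub>R (of_int (\<omega> \<eta>) * fsign (\<rho>, \<zeta>) (\<rho>, \<eta>)) *\<^sub>R \<nu> (\<rho>, \<eta>)"
     using True by (simp add: stratum_combination_apply ext_map_linear nu_proj mult_ac)
   qed
   then show ?thesis using balanced_product[OF m] True by simp
  next
   case False
   then show ?thesis
    by (intro sum.neutral ballI) (auto simp: stratum_combination_apply ext_map_linear)
  qed
  finally show ?thesis by simp
 qed
qed

text \<open>\<open>cap\<close> is a definite description. Existence: both pairings expand into a sum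
  over cones \<sigma> \<prec> \<eta> of dimensions p and d, where the sign from the cup product and
  the one from \<open>form_wedge_top\<close> cancel. Uniqueness: forms separate the points of the
  coefficient modules.\<close>

lemma cap_eq:
 assumes a: "\<And>\<sigma>. \<sigma> \<in> \<Sigma> \<Longrightarrow> dim \<sigma> = p \<Longrightarrow> a ({0}, \<sigma>) \<in> kdual K (trop_F K N \<Sigma> p ({0}, \<sigma>))" and p: "p \<le> d"
 shows "cap K N \<Sigma> \<nu> p p (d - p) (d - p) a (fundamental_cycle \<Sigma> d \<omega> \<nu>) =
  stratum_combination p (\<lambda>\<sigma>. a ({0}, \<sigma>) (\<nu> ({0}, \<sigma>)))"
proof -
 let ?q = "d - p" and ?k = "\<lambda>\<sigma>. a ({0}, \<sigma>) (\<nu> ({0}, \<sigma>))"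
 let ?c = "stratum_combination p ?k" and ?z = "fundamental_cycle \<Sigma> d \<omega> \<nu>"
 let ?S = "{(\<sigma>, \<eta>) \<in> \<F>. dim \<sigma> = p \<and> dim \<eta> = d}"
 have kK: "?k \<sigma> \<in> K" if \<sigma>: "\<sigma> \<in> \<Sigma>" "dim \<sigma> = p" for \<sigma>
  by (rule kdualD(3)[OF a[OF \<sigma>]], rule nu_mem_trop_F)
   (use \<sigma> zero_cone face_refl in \<open>auto simp: faces_iff dim_eq_0\<close>)
 have c: "?c \<in> trop_chains K N \<Sigma> ?q ?q" by (rule stratum_combination_chain[OF kK])
 have pair: "pairing \<Sigma> b ?c = pairing \<Sigma> (cup K N \<Sigma> \<nu> p p ?q ?q a b) ?z"
  if b: "b \<in> trop_cochains K N \<Sigma> ?q ?q" for b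
 proof -
  have bm: "b (\<sigma>, \<eta>) \<in> kdual K (trop_F K N \<Sigma> ?q (\<sigma>, \<eta>))" if "(\<sigma>, \<eta>) \<in> ?S" for \<sigma> \<eta>
   using trop_cochains_mem(1)[OF b] that by (auto simp: face_dim_def)
  have b0: "b \<delta> 0 = 0" for \<delta>
   using trop_cochains_mem[OF b, of \<delta>] kdual_zero[OF _ kmodule_trop_F[OF subK]]
   by (cases "\<delta> \<in> \<F> \<and> face_dim \<delta> = ?q") auto
  let ?t = "\<lambda>\<sigma> \<eta>. of_int (\<omega> \<eta>) * (?k \<sigma> * b (\<sigma>, \<eta>) (\<nu> (\<sigma>, \<eta>)))"
  have "pairing \<Sigma> b ?c = (\<Sum>\<delta>\<in>?S. b \<delta> (?c \<delta>))"
   unfolding pairing_def by (rule sum.mono_neutral_right[OF finite_faces]) (auto simp: stratum_combination_def b0 split: if_splits)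
  also have "\<dots> = (\<Sum>(\<sigma>, \<eta>)\<in>?S. ?t \<sigma> \<eta>)"
  proof (rule sum.cong[OF refl])
   fix \<delta> assume "\<delta> \<in> ?S"
   then obtain \<sigma> \<eta> where S: "(\<sigma>, \<eta>) \<in> \<F>" "dim \<sigma> = p" "dim \<eta> = d" "\<delta> = (\<sigma>, \<eta>)" by blast
   have m: "\<sigma> \<in> \<Sigma>" "\<eta> \<in> \<Sigma>" using S by (auto simp: faces_iff)
   have "of_int (\<omega> \<eta>) * ?k \<sigma> \<in> K"
    by (rule real_subringD(6)[OF subK]) (use Ints_K kK[OF m(1)] S in auto)
   moreover have "\<nu> (\<sigma>, \<eta>) \<in> trop_F K N \<Sigma> ?q (\<sigma>, \<eta>)"
    using S face_refl[OF m(2)] by (intro nu_mem_trop_F) auto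
   ultimately have "b (\<sigma>, \<eta>) ((of_int (\<omega> \<eta>) * ?k \<sigma>) *\<^sub>R \<nu> (\<sigma>, \<eta>)) = of_int (\<omega> \<eta>) * ?k \<sigma> * b (\<sigma>, \<eta>) (\<nu> (\<sigma>, \<eta>))"
    using S by (intro kdualD(2)[OF bm]) auto
   then show "b \<delta> (?c \<delta>) = (case \<delta> of (\<sigma>, \<eta>) \<Rightarrow> ?t \<sigma> \<eta>)"
    using S by (simp add: stratum_combination_apply)
  qed
  also have "\<dots> = (\<Sum>(\<eta>, \<sigma>)\<in>(SIGMA \<eta>:{\<eta> \<in> \<Sigma>. dim \<eta> = d}. {\<sigma> \<in> \<Sigma>. \<sigma> face_of \<eta> \<and> dim \<sigma> = p}). ?t \<sigma> \<eta>)"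
   by (rule sum.reindex_bij_witness[where i = prod.swap and j = prod.swap]) (auto simp: faces_iff)
  also have "\<dots> = (\<Sum>\<eta> | \<eta> \<in> \<Sigma> \<and> dim \<eta> = d. \<Sum>\<sigma> | \<sigma> \<in> \<Sigma> \<and> \<sigma> face_of \<eta> \<and> dim \<sigma> = p. ?t \<sigma> \<eta>)"
   using finite_fan by (intro sum.Sigma[symmetric]) auto
  also have "\<dots> = (\<Sum>\<eta> | \<eta> \<in> \<Sigma> \<and> dim \<eta> = d. cup K N \<Sigma> \<nu> p p ?q ?q a b ({0}, \<eta>) (?z ({0}, \<eta>)))"
  proof (rule sum.cong[OF refl])
   fix \<eta> assume "\<eta> \<in> {\<eta> \<in> \<Sigma>. dim \<eta> = d}"
   then have \<eta>: "\<eta> \<in> \<Sigma>" "dim \<eta> = d" by auto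
   have f: "({0}, \<eta>) \<in> \<F>" "face_dim ({0 :: 'n rvec}, \<eta>) = p + ?q" using \<eta> zero_cone p by (auto simp: faces_iff face_dim_def dim_eq_0)
   have A: "{\<sigma> \<in> \<Sigma>. {0} face_of \<sigma> \<and> \<sigma> face_of \<eta> \<and> face_dim ({0}, \<sigma>) = p} = {\<sigma> \<in> \<Sigma>. \<sigma> face_of \<eta> \<and> dim \<sigma> = p}"
    using zero_cone by (auto simp: face_dim_def dim_eq_0)
   have z: "?z ({0}, \<eta>) = of_int (\<omega> \<eta>) *\<^sub>R \<nu> ({0}, \<eta>)" using \<eta> by (simp add: fundamental_cycle_def)
   show "(\<Sum>\<sigma> | \<sigma> \<in> \<Sigma> \<and> \<sigma> face_of \<eta> \<and> dim \<sigma> = p. ?t \<sigma> \<eta>) = cup K N \<Sigma> \<nu> p p ?q ?q a b ({0}, \<eta>) (?z ({0}, \<eta>))"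
    unfolding cup_def prod.case z if_P[OF conjI[OF f]] A
   proof (rule sum.cong[OF refl])
    fix \<sigma> assume "\<sigma> \<in> {\<sigma> \<in> \<Sigma>. \<sigma> face_of \<eta> \<and> dim \<sigma> = p}"
    then have \<sigma>: "\<sigma> \<in> \<Sigma>" "\<sigma> face_of \<eta>" "dim \<sigma> = p" by auto
    have fs: "({0}, \<sigma>) \<in> \<F>" "(\<sigma>, \<eta>) \<in> \<F>" using \<sigma> \<eta> zero_cone by (auto simp: faces_iff)
    have "(\<sigma>, \<eta>) \<in> ?S" using fs \<sigma> \<eta> by simp
    from form_wedge_top[OF \<eta> \<sigma> a[OF \<sigma>(1,3)] bm[OF this]] cup_sign_eq(1)[OF fs]
    show "?t \<sigma> \<eta> = cup_sign N \<nu> {0} \<sigma> \<eta> * form_wedge K (star_lattices N \<Sigma> ({0}, \<eta>)) p ?q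
      (pull K N \<Sigma> p ({0}, \<sigma>) ({0}, \<eta>) (a ({0}, \<sigma>))) (pull K N \<Sigma> ?q (\<sigma>, \<eta>) ({0}, \<eta>) (b (\<sigma>, \<eta>)))
      (of_int (\<omega> \<eta>) *\<^sub>R \<nu> ({0}, \<eta>))" by auto
   qed
  qed
  also have "\<dots> = (\<Sum>\<delta>\<in>Pair {0} ` {\<eta> \<in> \<Sigma>. dim \<eta> = d}. cup K N \<Sigma> \<nu> p p ?q ?q a b \<delta> (?z \<delta>))"
   by (simp add: sum.reindex inj_on_def)
  also have "\<dots> = pairing \<Sigma> (cup K N \<Sigma> \<nu> p p ?q ?q a b) ?z"
   unfolding pairing_def
  proof (rule sum.mono_neutral_left[OF finite_faces])
   show "Pair {0} ` {\<eta> \<in> \<Sigma>. dim \<eta> = d} \<subseteq> \<F>" using zero_cone by (auto simp: faces_iff)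
   show "\<forall>\<delta>\<in>\<F> - Pair {0} ` {\<eta> \<in> \<Sigma>. dim \<eta> = d}. cup K N \<Sigma> \<nu> p p ?q ?q a b \<delta> (?z \<delta>) = 0"
   proof
    fix \<delta> assume \<delta>: "\<delta> \<in> \<F> - Pair {0} ` {\<eta> \<in> \<Sigma>. dim \<eta> = d}"
    obtain \<tau> \<eta> where eq: "\<delta> = (\<tau>, \<eta>)" by (metis surj_pair)
    have t: "\<tau> \<in> \<Sigma>" "\<eta> \<in> \<Sigma>" using \<delta> by (auto simp: eq faces_iff)
    \<comment> \<open>A face of dimension d must be ({0}, \<eta>) with \<eta> of dimension d; on all
      other faces the cup product is zero by definition.\<close>
    have "face_dim \<delta> \<noteq> p + ?q"
    proof
     assume "face_dim \<delta> = p + ?q"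
     then have "dim \<eta> - dim \<tau> = d" using p by (simp add: eq face_dim_def)
     moreover have "dim \<tau> \<le> dim \<eta>" using \<delta> dim_face_mono[of \<tau> \<eta>] by (simp add: eq faces_iff)
     ultimately have "dim \<eta> = d" "dim \<tau> = 0" using dim_le[OF t(2)] by linarith+
     moreover from this have "\<tau> = {0}" using zero_cone(2)[OF t(1)] face_dim_eq[OF t(1) zero_cone(1)] by (simp add: dim_eq_0)
     ultimately show False using \<delta> t by (auto simp: eq)
    qed
    then show "cup K N \<Sigma> \<nu> p p ?q ?q a b \<delta> (?z \<delta>) = 0" by (simp add: eq cup_def)
   qed
  qed
  finally show ?thesis .
 qed
 show ?thesis
  unfolding cap_def
 proof (rule the_equality, intro conjI ballI)
  show "?c \<in> trop_chains K N \<Sigma> ?q ?q" by (rule c)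
  show "pairing \<Sigma> b ?c = pairing \<Sigma> (cup K N \<Sigma> \<nu> p p ?q ?q a b) ?z" if "b \<in> trop_cochains K N \<Sigma> ?q ?q" for b
   by (rule pair[OF that])
 next
  fix c' assume c': "c' \<in> trop_chains K N \<Sigma> ?q ?q \<and>
   (\<forall>b\<in>trop_cochains K N \<Sigma> ?q ?q. pairing \<Sigma> b c' = pairing \<Sigma> (cup K N \<Sigma> \<nu> p p ?q ?q a b) ?z)"
  show "c' = ?c"
  proof
   fix \<delta> :: "'n face"
   show "c' \<delta> = ?c \<delta>"
   proof (cases "\<delta> \<in> \<F> \<and> face_dim \<delta> = ?q")
    case False
    then show ?thesis using trop_chains_mem(2)[OF c False] trop_chains_mem(2)[OF conjunct1[OF c'] False] by simp
   next
    case True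
    obtain \<tau> \<sigma> where eq: "\<delta> = (\<tau>, \<sigma>)" by (metis surj_pair)
    have \<tau>: "\<tau> \<in> \<Sigma>" using True by (auto simp: eq faces_iff)
    have mem: "c' \<delta> \<in> trop_F K N \<Sigma> ?q \<delta>" "?c \<delta> \<in> trop_F K N \<Sigma> ?q \<delta>"
     using trop_chains_mem(1)[OF c] trop_chains_mem(1)[OF conjunct1[OF c']] True by blast+
    have val: "\<phi> (c' \<delta>) = \<phi> (?c \<delta>)" if \<phi>: "\<phi> \<in> kdual K (trop_F K N \<Sigma> ?q \<delta>)" for \<phi>
    proof -
     \<comment> \<open>A test cochain supported on the single face \<delta>, turning equality of
       pairings into equality of values of \<phi>.\<close>
     define b where "b \<delta>' = (if \<delta>' = \<delta> then \<phi> else 0)" for \<delta>'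
     have b: "b \<in> trop_cochains K N \<Sigma> ?q ?q"
      using True \<phi> real_subringD(1,2)[OF subK] by (auto simp: trop_cochains_def b_def kdual_def)
     have "pairing \<Sigma> b x = \<phi> (x \<delta>)" for x
     proof -
      have "pairing \<Sigma> b x = (\<Sum>\<delta>'\<in>\<F>. if \<delta>' = \<delta> then \<phi> (x \<delta>) else 0)"
       unfolding pairing_def b_def by (intro sum.cong) auto
      then show ?thesis using True finite_faces by simp
     qed
     moreover have "pairing \<Sigma> b c' = pairing \<Sigma> b ?c" using bspec[OF conjunct2[OF c'] b] pair[OF b] by (rule trans[OF _ sym])
     ultimately show ?thesis by simp
    qed
    show ?thesis
    proof (rule ccontr)
     assume "c' \<delta> \<noteq> ?c \<delta>"
     moreover have "c' \<delta> - ?c \<delta> \<in> trop_F K N \<Sigma> ?q \<delta>"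
      by (rule kmodule_diff[OF kmodule_trop_F[OF subK] subK mem])
     ultimately obtain \<phi> where \<phi>: "\<phi> \<in> kdual K (trop_F K N \<Sigma> ?q \<delta>)" "\<phi> (c' \<delta> - ?c \<delta>) \<noteq> 0"
      using kdual_separates[OF subK proj_lattice_coordinatized[OF \<tau>] star_lattices_subset, of "c' \<delta> - ?c \<delta>" \<sigma> ?q]
      unfolding trop_F_def eq by auto
     have "\<phi> (c' \<delta>) = \<phi> (c' \<delta> - ?c \<delta>) + \<phi> (?c \<delta>)"
      using kdualD(1)[OF \<phi>(1) \<open>c' \<delta> - ?c \<delta> \<in> _\<close> mem(2)] by simp
     then show False using val[OF \<phi>(1)] \<phi>(2) by simp
    qed
   qed
  qed
 qed
qed

end

section \<open>Caps of coboundaries are boundaries\<close>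

context tropical_setting
begin

lemma zero_face: "\<sigma> \<in> \<Sigma> \<Longrightarrow> ({0}, \<sigma>) \<in> \<F>" "face_dim ({0}, \<sigma>) = dim \<sigma>"
 using zero_cone by (auto simp: faces_iff face_dim_def dim_eq_0)

lemma coboundary_kdual:
 assumes b: "b \<in> trop_cochains K N \<Sigma> p q" and \<delta>: "\<delta> \<in> \<F>" "face_dim \<delta> = Suc q"
 shows "trop_coboundary K N \<Sigma> \<nu> p b \<delta> \<in> kdual K (trop_F K N \<Sigma> p \<delta>)"
proof -
 let ?S = "trop_F K N \<Sigma> p \<delta>"
 have summand: "(\<lambda>x. fsign \<gamma> \<delta> * pull K N \<Sigma> p \<gamma> \<delta> (b \<gamma>) x) \<in> kdual K ?S" if \<gamma>: "facet_pair \<Sigma> \<gamma> \<delta>" for \<gamma>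
 proof (rule kdual_scale[OF subK])
  obtain \<tau> \<sigma> \<tau>0 \<sigma>0 where eq: "\<gamma> = (\<tau>, \<sigma>)" "\<delta> = (\<tau>0, \<sigma>0)" by (metis surj_pair)
  have sub: "\<tau>0 \<subseteq> \<tau>" "\<sigma> face_of \<sigma>0" "\<gamma> \<in> \<F>" "face_dim \<gamma> = q"
   using \<gamma> \<delta>(2) face_of_imp_subset by (auto simp: facet_pair_def face_le_def eq)
  have im: "ext_map (proj (fst \<gamma>)) x \<in> trop_F K N \<Sigma> p \<gamma>" if "x \<in> ?S" for x
   using trop_F_quotient[OF subK sub(1,2)] that by (simp add: eq)
  note D = kdualD[OF trop_cochains_mem(1)[OF b sub(3,4)]]
  show "pull K N \<Sigma> p \<gamma> \<delta> (b \<gamma>) \<in> kdual K ?S"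
   unfolding kdual_def pull_def restrict0_def
   using im D kmoduleD[OF kmodule_trop_F[OF subK, of p \<delta>]]
   by (auto simp: ext_map_linear)
  show "fsign \<gamma> \<delta> \<in> K"
   using face_sign_unit[OF \<gamma>] real_subringD[OF subK] by auto
 qed
 have "(\<lambda>x. \<Sum>\<gamma>\<in>A. fsign \<gamma> \<delta> * pull K N \<Sigma> p \<gamma> \<delta> (b \<gamma>) x) \<in> kdual K ?S"
  if "finite A" "A \<subseteq> {\<gamma>. facet_pair \<Sigma> \<gamma> \<delta>}" for A
  using that
 proof (induction A rule: finite_induct)
  case empty
  then show ?case using real_subringD(2)[OF subK] by (auto simp: kdual_def)
 next
  case (insert \<gamma> A)
  then show ?case using kdual_add[OF subK summand[of \<gamma>]] by simp
 qed
 moreover have "finite {\<gamma>. facet_pair \<Sigma> \<gamma> \<delta>}"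
  by (rule finite_subset[OF _ finite_faces]) (auto simp: facet_pair_def)
 ultimately show ?thesis unfolding trop_coboundary_def by blast
qed

text \<open>The bounding chain contracts \<open>\<nu> (\<sigma>, \<eta>)\<close> by the linear form \<open>v \<mapsto> b\<^sub>\<sigma>(v \<and> \<nu>\<^sub>\<sigma>)\<close>, which vanishes on \<open>\<sigma>\<close>.\<close>

lemma cap_coboundary:
 assumes b: "b \<in> trop_cochains K N \<Sigma> (Suc r) r" and r: "Suc r \<le> d"
 shows "\<exists>y\<in>trop_chains K N \<Sigma> (d - Suc r) (Suc (d - Suc r)). \<partial> y =
  stratum_combination (Suc r) (\<lambda>\<sigma>. trop_coboundary K N \<Sigma> \<nu> (Suc r) b ({0}, \<sigma>) (\<nu> ({0}, \<sigma>)))"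
proof -
 let ?p = "Suc r" and ?k = "\<lambda>\<sigma>. trop_coboundary K N \<Sigma> \<nu> (Suc r) b ({0}, \<sigma>) (\<nu> ({0}, \<sigma>))"
 let ?F = "\<lambda>\<sigma>. trop_F K N \<Sigma> ?p ({0}, \<sigma>)"
 define Q where "Q \<sigma> g \<longleftrightarrow> linear g \<and> (\<forall>x\<in>?F \<sigma>. g x = b ({0}, \<sigma>) x)" for \<sigma> and g :: "'n ext \<Rightarrow> real"
 define G where "G \<sigma> = (SOME g. Q \<sigma> g)" for \<sigma>
 have "Q \<sigma> (G \<sigma>)" if \<sigma>: "\<sigma> \<in> \<Sigma>" "dim \<sigma> = r" for \<sigma>
  unfolding G_def
 proof (rule someI_ex[of "Q \<sigma>"])
  show "\<exists>g. Q \<sigma> g"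
   using trop_kdual_extension[OF zero_cone(1) trop_cochains_mem(1)[OF b zero_face(1)[OF \<sigma>(1)]]] zero_face(2) \<sigma>(2)
   unfolding Q_def by simp
 qed
 then have G: "linear (G \<sigma>)" "x \<in> ?F \<sigma> \<Longrightarrow> G \<sigma> x = b ({0}, \<sigma>) x" if "\<sigma> \<in> \<Sigma>" "dim \<sigma> = r" for \<sigma> x
  using that unfolding Q_def by simp_all
 \<comment> \<open>The adjoint of a real functional, evaluated at 1, is the vector representing it;
   contraction by the form then becomes \<open>ext_cut\<close>.\<close>
 define w where "w \<sigma> = adjoint (\<lambda>v. G \<sigma> (ext_vec v \<^bold>\<and> \<nu> ({0}, \<sigma>))) 1" for \<sigma>
 have w: "w \<sigma> \<bullet> v = G \<sigma> (ext_vec v \<^bold>\<and> \<nu> ({0}, \<sigma>))" if "\<sigma> \<in> \<Sigma>" "dim \<sigma> = r" for \<sigma> v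
 proof -
  have "linear (\<lambda>v. G \<sigma> (ext_vec v \<^bold>\<and> \<nu> ({0}, \<sigma>)))"
   using linear_compose[OF linear_ext_vec_mult G(1)[OF that]] by (simp add: o_def)
  from adjoint_works[OF this, of v 1] show ?thesis by (simp add: w_def inner_commute[of _ v])
 qed
 have w0: "w \<sigma> \<bullet> v = 0" if "\<sigma> \<in> \<Sigma>" "dim \<sigma> = r" "v \<in> span \<sigma>" for \<sigma> v
 proof -
  have "proj {0} ` \<sigma> = \<sigma>" by simp
  then show ?thesis using nu_kernel[OF zero_face(1)[OF that(1)], of v] that by (simp add: w linear_0[OF G(1)])
 qed
 have Fmono: "?F \<sigma> \<subseteq> ?F \<sigma>'" if "\<sigma>' face_of \<sigma>" for \<sigma> \<sigma>'
  using trop_F_quotient[OF subK order_refl that, of _ ?p "{0}"] by auto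
 have wK: "w \<sigma> \<bullet> v \<in> K"
  if \<sigma>: "\<sigma> \<in> \<Sigma>" "dim \<sigma> = r" and \<eta>: "\<eta> \<in> \<Sigma>" "\<sigma> face_of \<eta>" and v: "v \<in> proj \<sigma> ` (N \<inter> span \<eta>)" for \<sigma> \<eta> v
 proof -
  obtain n where n: "n \<in> N \<inter> span \<eta>" "v = proj \<sigma> n" using v by blast
  \<comment> \<open>The form vanishes on span \<sigma>, so its value on a class can be computed on a
    lattice lift n, where b is available.\<close>
  have "w \<sigma> \<bullet> (n - v) = 0" using proj_in[of n \<sigma>] by (intro w0[OF \<sigma>]) (simp add: n(2))
  then have "w \<sigma> \<bullet> v = G \<sigma> (ext_vec n \<^bold>\<and> \<nu> ({0}, \<sigma>))" using w[OF \<sigma>, of n] by (simp add: inner_diff_right)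
  moreover have "ext_vec n \<^bold>\<and> \<nu> ({0}, \<sigma>) \<in> ?F \<sigma>"
  proof -
   have "\<nu> ({0}, \<sigma>) \<in> ext_power K {face_lattice N ({0}, \<sigma>)} r"
    using nu_mem[OF zero_face(1)[OF \<sigma>(1)]] \<sigma>(2) by (simp add: dim_eq_0)
   also have "face_lattice N ({0}, \<sigma>) = N \<inter> span \<sigma>" by (simp add: face_lattice_def)
   also have "ext_power K {N \<inter> span \<sigma>} r \<subseteq> ext_power K {N \<inter> span \<eta>} r"
    using span_mono[OF face_of_imp_subset[OF \<eta>(2)]]
     by (intro ext_power_least[OF kmodule_ext_power[OF subK]]) (auto intro!: ext_power_wedge[OF subK, of "N \<inter> span \<eta>"])
   finally have "ext_vec n \<^bold>\<and> \<nu> ({0}, \<sigma>) \<in> ext_power K {N \<inter> span \<eta>} ?p"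
    by (rule ext_vec_mult_ext_power[OF subK n(1)])
   also have "\<dots> \<subseteq> ?F \<sigma>"
    unfolding trop_F_eq using \<eta> by (intro ext_power_mono[OF subK]) auto
   finally show ?thesis .
  qed
  ultimately show ?thesis
   using G(2)[OF \<sigma>] kdualD(3)[OF trop_cochains_mem(1)[OF b zero_face(1)[OF \<sigma>(1)]]] zero_face(2) \<sigma>(2) by simp
 qed
 \<comment> \<open>The minus sign compensates the one in the sign convention for faces at
   infinity.\<close>
 define y where "y = (\<lambda>(\<sigma>, \<eta>). if (\<sigma>, \<eta>) \<in> \<F> \<and> dim \<sigma> = r \<and> dim \<eta> = d
  then - (of_int (\<omega> \<eta>) *\<^sub>R ext_cut (w \<sigma>) (\<nu> (\<sigma>, \<eta>))) else 0)"
 have yC: "y \<in> trop_chains K N \<Sigma> (d - ?p) (Suc (d - ?p))"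
 proof (rule trop_chainsI)
  fix \<delta> :: "'n face"
  obtain \<sigma> \<eta> where eq: "\<delta> = (\<sigma>, \<eta>)" by (metis surj_pair)
  note km = kmodule_trop_F[OF subK]
  show "y \<delta> \<in> trop_F K N \<Sigma> (d - ?p) \<delta>"
  proof (cases "(\<sigma>, \<eta>) \<in> \<F> \<and> dim \<sigma> = r \<and> dim \<eta> = d")
   case True
   then have m: "\<sigma> \<in> \<Sigma>" "dim \<sigma> = r" "\<eta> \<in> \<Sigma>" "\<sigma> face_of \<eta>" "dim \<eta> = d" by (auto simp: faces_iff)
   have "ext_cut (w \<sigma>) (\<nu> (\<sigma>, \<eta>)) \<in> ext_power K {face_lattice N (\<sigma>, \<eta>)} (dim \<eta> - dim \<sigma> - 1)"
    using True wK[OF m(1-4)] by (intro ext_cut_ext_power[OF subK] nu_mem) (auto simp: face_lattice_def)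
   then have "ext_cut (w \<sigma>) (\<nu> (\<sigma>, \<eta>)) \<in> trop_F K N \<Sigma> (d - ?p) \<delta>" using m(2,5) by (simp add: eq trop_F_top[OF m(3,5)])
   moreover have "of_int (\<omega> \<eta>) \<in> K" using Ints_K by auto
   ultimately show ?thesis using True by (simp add: eq y_def kmoduleD(3)[OF km] kmodule_neg[OF km subK])
  next
   case False
   then show ?thesis using kmoduleD(1)[OF km] by (auto simp: eq y_def)
  qed
  show "y \<delta> = 0" if "\<not> (\<delta> \<in> \<F> \<and> face_dim \<delta> = Suc (d - ?p))"
   using that r by (auto simp: eq y_def face_dim_def)
 qed
 have k: "?k \<rho> = (\<Sum>\<rho>' | \<rho>' \<in> \<Sigma> \<and> \<rho>' face_of \<rho> \<and> dim \<rho> = Suc (dim \<rho>'). w \<rho>' \<bullet> primitive N \<rho>' \<rho>)"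
  if \<rho>: "\<rho> \<in> \<Sigma>" "dim \<rho> = ?p" for \<rho>
 proof -
  let ?x = "\<nu> ({0}, \<rho>)"
  let ?h = "\<lambda>\<gamma>. fsign \<gamma> ({0}, \<rho>) * pull K N \<Sigma> ?p \<gamma> ({0}, \<rho>) (b \<gamma>) ?x"
  let ?A = "{\<eta>. \<eta> \<in> \<Sigma> \<and> {0} face_of \<eta> \<and> \<eta> face_of \<rho> \<and> dim \<rho> = Suc (dim \<eta>)}"
  have x: "?x \<in> ?F \<rho>" using \<rho> by (intro nu_mem_trop_F zero_face face_refl) (auto simp: dim_eq_0)
  have "?k \<rho> = sum ?h {\<gamma>. facet_pair \<Sigma> \<gamma> ({0}, \<rho>)}" by (simp add: trop_coboundary_def)
  also have "\<dots> = (\<Sum>\<eta>\<in>?A. ?h ({0}, \<eta>)) +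
    (\<Sum>\<eta> | \<eta> \<in> \<Sigma> \<and> {0} face_of \<eta> \<and> \<eta> face_of \<rho> \<and> dim \<eta> = Suc (dim {0 :: 'n rvec}). ?h (\<eta>, \<rho>))"
   by (rule sum_facets[OF zero_face(1)[OF \<rho>(1)]])
  \<comment> \<open>Facets of ({0}, \<rho>) at infinity see \<nu> through a projection that
    annihilates it, so only facets in the open stratum contribute to the coboundary.\<close>
  also have "(\<Sum>\<eta> | \<eta> \<in> \<Sigma> \<and> {0} face_of \<eta> \<and> \<eta> face_of \<rho> \<and> dim \<eta> = Suc (dim {0 :: 'n rvec}). ?h (\<eta>, \<rho>)) = 0"
  proof (rule sum.neutral, rule ballI)
   fix \<eta> assume "\<eta> \<in> {\<eta>. \<eta> \<in> \<Sigma> \<and> {0} face_of \<eta> \<and> \<eta> face_of \<rho> \<and> dim \<eta> = Suc (dim {0 :: 'n rvec})}"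
   then have \<eta>: "\<eta> \<in> \<Sigma>" "{0} face_of \<eta>" "\<eta> face_of \<rho>" "dim \<eta> = Suc (dim {0 :: 'n rvec})" by auto
   have "ext_map (proj \<eta>) ?x = 0" by (rule nu_outer_zero[OF zero_cone(1) \<eta>(1,2,4) \<rho>(1) \<eta>(3)])
   moreover have "b (\<eta>, \<rho>) 0 = 0"
    using kdual_zero[OF trop_cochains_mem(1)[OF b] kmodule_trop_F[OF subK], of "(\<eta>, \<rho>)"] \<eta> \<rho>
    by (auto simp: faces_iff face_dim_def dim_eq_0)
   ultimately show "?h (\<eta>, \<rho>) = 0" by (simp add: pull_def restrict0_def)
  qed
  also have "(\<Sum>\<eta>\<in>?A. ?h ({0}, \<eta>)) + 0 = (\<Sum>\<eta>\<in>?A. w \<eta> \<bullet> primitive N \<eta> \<rho>)"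
   unfolding add_0_right
  proof (rule sum.cong[OF refl])
   fix \<eta> assume "\<eta> \<in> ?A"
   then have \<eta>: "\<eta> \<in> \<Sigma>" "\<eta> face_of \<rho>" "dim \<rho> = Suc (dim \<eta>)" "{0} face_of \<eta>" and d: "dim \<eta> = r" using \<rho>(2) by auto
   have "?h ({0}, \<eta>) = fsign ({0}, \<eta>) ({0}, \<rho>) * G \<eta> ?x"
    using x Fmono[OF \<eta>(2)] G(2)[OF \<eta>(1) d] by (auto simp: pull_def restrict0_def)
   also have "\<dots> = G \<eta> (fsign ({0}, \<eta>) ({0}, \<rho>) *\<^sub>R ?x)" by (simp add: linear_scale[OF G(1)[OF \<eta>(1) d]])
   also have "\<dots> = w \<eta> \<bullet> primitive N \<eta> \<rho>"
    using inner_sign_facet[OF \<eta>(1) \<rho>(1) \<eta>(2,3) zero_cone(1) \<eta>(4)] by (simp add: w[OF \<eta>(1) d])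
   finally show "?h ({0}, \<eta>) = w \<eta> \<bullet> primitive N \<eta> \<rho>" .
  qed
  also have "?A = {\<rho>'. \<rho>' \<in> \<Sigma> \<and> \<rho>' face_of \<rho> \<and> dim \<rho> = Suc (dim \<rho>')}" using zero_cone by auto
  finally show ?thesis .
 qed
 have "\<partial> y \<gamma> = stratum_combination ?p ?k \<gamma>" for \<gamma> :: "'n face"
 proof (cases "\<gamma> \<in> \<F>")
  case False
  then show ?thesis by (cases \<gamma>) (auto simp: trop_boundary_outside stratum_combination_def)
 next
  case True
  obtain \<rho> \<zeta> where eq: "\<gamma> = (\<rho>, \<zeta>)" by (metis surj_pair)
  have f: "(\<rho>, \<zeta>) \<in> \<F>" and m: "\<rho> \<in> \<Sigma>" "\<zeta> \<in> \<Sigma>" "\<rho> face_of \<zeta>" using True by (auto simp: eq faces_iff)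
  let ?A = "{\<eta> \<in> \<Sigma>. \<zeta> face_of \<eta> \<and> dim \<eta> = Suc (dim \<zeta>)}" and ?B = "{\<rho>' \<in> \<Sigma>. \<rho>' face_of \<rho> \<and> dim \<rho> = Suc (dim \<rho>')}"
  let ?h = "\<lambda>\<delta>. fsign (\<rho>, \<zeta>) \<delta> *\<^sub>R ext_map (proj \<rho>) (y \<delta>)"
  have "\<partial> y \<gamma> = (\<Sum>\<eta>\<in>?A. ?h (\<rho>, \<eta>)) + (\<Sum>\<rho>'\<in>?B. ?h (\<rho>', \<zeta>))"
   using sum_cofaces[OF f, of ?h] by (simp add: trop_boundary_def eq)
  also have "(\<Sum>\<eta>\<in>?A. ?h (\<rho>, \<eta>)) = 0"
  proof (cases "dim \<rho> = r \<and> Suc (dim \<zeta>) = d")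
   case True
   have "(\<Sum>\<eta>\<in>?A. ?h (\<rho>, \<eta>)) =
    (\<Sum>\<eta>\<in>?A. - ext_cut (w \<rho>) ((of_int (\<omega> \<eta>) * fsign (\<rho>, \<zeta>) (\<rho>, \<eta>)) *\<^sub>R \<nu> (\<rho>, \<eta>)))"
   proof (rule sum.cong[OF refl])
    fix \<eta> assume "\<eta> \<in> ?A"
    then have "(\<rho>, \<eta>) \<in> \<F>" "dim \<eta> = d" using m True face_of_trans by (auto simp: faces_iff)
    then show "?h (\<rho>, \<eta>) = - ext_cut (w \<rho>) ((of_int (\<omega> \<eta>) * fsign (\<rho>, \<zeta>) (\<rho>, \<eta>)) *\<^sub>R \<nu> (\<rho>, \<eta>))"
     using True by (simp add: trop_chains_proj[OF yC]) (simp add: y_def linear_scale[OF linear_cut] mult_ac)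
   qed
   \<comment> \<open>The contraction depends on \<rho> only and comes out of the sum, leaving the
     balancing relation.\<close>
   also have "\<dots> = - ext_cut (w \<rho>) (\<Sum>\<eta>\<in>?A. (of_int (\<omega> \<eta>) * fsign (\<rho>, \<zeta>) (\<rho>, \<eta>)) *\<^sub>R \<nu> (\<rho>, \<eta>))"
    by (simp add: linear_sum[OF linear_cut] sum_negf)
   finally show ?thesis using balanced_product[OF m] True by (simp add: linear_0[OF linear_cut])
  next
   case False
   then show ?thesis by (intro sum.neutral ballI) (auto simp: y_def ext_map_linear)
  qed
  also have "(\<Sum>\<rho>'\<in>?B. ?h (\<rho>', \<zeta>)) = stratum_combination ?p ?k \<gamma>"
  proof (cases "dim \<rho> = ?p \<and> dim \<zeta> = d")
   case True
   have "(\<Sum>\<rho>'\<in>?B. ?h (\<rho>', \<zeta>)) = (\<Sum>\<rho>'\<in>?B. (of_int (\<omega> \<zeta>) * (w \<rho>' \<bullet> primitive N \<rho>' \<rho>)) *\<^sub>R \<nu> (\<rho>, \<zeta>))"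
   proof (rule sum.cong[OF refl])
    fix \<rho>' assume "\<rho>' \<in> ?B"
    then have \<rho>': "\<rho>' \<in> \<Sigma>" "\<rho>' face_of \<rho>" "dim \<rho> = Suc (dim \<rho>')" by auto
    have f': "(\<rho>', \<zeta>) \<in> \<F>" using \<rho>' m face_of_trans by (auto simp: faces_iff)
    let ?e = "primitive N \<rho>' \<rho>"
    have pe: "proj \<rho> ?e = 0" using primitive_in_span(2)[OF \<rho>'(1) m(1) \<rho>'(2,3)] by (simp add: proj_eq_0_iff)
    have "?h (\<rho>', \<zeta>) = - (of_int (\<omega> \<zeta>) *\<^sub>R ext_map (proj \<rho>) (ext_cut (w \<rho>') (fsign (\<rho>, \<zeta>) (\<rho>', \<zeta>) *\<^sub>R \<nu> (\<rho>', \<zeta>))))"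
     using f' \<rho>'(3) True
     by (simp add: y_def linear_scale[OF linear_cut] ext_map_linear mult_ac)
    also have "\<dots> = of_int (\<omega> \<zeta>) *\<^sub>R ext_map (proj \<rho>) (ext_cut (w \<rho>') (ext_vec ?e \<^bold>\<and> \<nu> (\<rho>, \<zeta>)))"
     unfolding outer_sign_facet[OF \<rho>'(1) m(1) \<rho>'(2,3) m(2,3)]
     by (simp add: linear_neg[OF linear_cut] ext_map_linear)
    \<comment> \<open>Contracting the product of e and \<nu> gives (w \<bullet> e) \<nu> minus a
      term still divisible by e, which dies in the stratum of \<rho>.\<close>
    also have "\<dots> = (of_int (\<omega> \<zeta>) * (w \<rho>' \<bullet> ?e)) *\<^sub>R \<nu> (\<rho>, \<zeta>)"
     by (simp add: cut_ext_vec_mult ext_map_linear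
      nu_proj[OF f] ext_map_mult[OF linear_proj] pe)
    finally show "?h (\<rho>', \<zeta>) = (of_int (\<omega> \<zeta>) * (w \<rho>' \<bullet> ?e)) *\<^sub>R \<nu> (\<rho>, \<zeta>)" .
   qed
   also have "\<dots> = (of_int (\<omega> \<zeta>) * (\<Sum>\<rho>'\<in>?B. w \<rho>' \<bullet> primitive N \<rho>' \<rho>)) *\<^sub>R \<nu> (\<rho>, \<zeta>)"
    by (simp add: sum_distrib_left scaleR_sum_left)
   also have "\<dots> = stratum_combination ?p ?k \<gamma>"
    using True f k[OF m(1)] by (simp add: eq stratum_combination_apply)
   finally show ?thesis .
  next
   case False
   then have "stratum_combination ?p ?k \<gamma> = 0" by (auto simp: eq stratum_combination_def)
   moreover have "(\<Sum>\<rho>'\<in>?B. ?h (\<rho>', \<zeta>)) = 0"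
    using False by (intro sum.neutral ballI) (auto simp: y_def ext_map_linear)
   ultimately show ?thesis by simp
  qed
  finally show ?thesis by simp
 qed
 then show ?thesis using yC by (intro bexI[of _ y] ext)
qed

lemma stratum_combination_add:
 "stratum_combination p k + stratum_combination p k' = stratum_combination p (\<lambda>\<sigma>. k \<sigma> + k' \<sigma>)"
 by (auto simp: fun_eq_iff stratum_combination_def algebra_simps scaleR_add_left)

text \<open>Two representatives of \<alpha> differ by a coboundary, whose cap is a boundary by
  \<open>cap_coboundary\<close>; for p = 0 there is only one representative. Hence the union in
  \<open>poincare_dual\<close> consists of equal cosets and is a homology class.\<close>

lemma poincare_dual_combination:
 assumes p: "p \<le> d" and \<alpha>: "\<alpha> \<in> carrier (trop_cohomology K N \<Sigma> \<nu> p p)"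
 shows "\<exists>k. (\<forall>\<sigma>\<in>\<Sigma>. dim \<sigma> = p \<longrightarrow> k \<sigma> \<in> K) \<and> stratum_combination p k \<in> poincare_dual K N \<Sigma> d \<omega> \<nu> p \<alpha> \<and>
  poincare_dual K N \<Sigma> d \<omega> \<nu> p \<alpha> \<in> carrier (trop_homology K N \<Sigma> \<nu> (d - p) (d - p))"
proof -
 let ?q = "d - p" and ?D = "\<partial>"
 let ?C = "trop_chains K N \<Sigma> ?q" and ?\<delta> = "trop_coboundary K N \<Sigma> \<nu> p"
 let ?B = "case p of 0 \<Rightarrow> {0} | Suc r \<Rightarrow> ?\<delta> ` trop_cochains K N \<Sigma> p r"
 obtain a where a: "a \<in> trop_cochains K N \<Sigma> p p" "\<alpha> = (\<lambda>h. h + a) ` ?B"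
  using \<alpha> by (auto simp: trop_cohomology_def cohomology_def FactGroup_def RCOSETS_def r_coset_def add_group_def cycles_def)
 define k where "k \<sigma> = a ({0}, \<sigma>) (\<nu> ({0}, \<sigma>))" for \<sigma>
 have ak: "a ({0}, \<sigma>) \<in> kdual K (trop_F K N \<Sigma> p ({0}, \<sigma>))" if "\<sigma> \<in> \<Sigma>" "dim \<sigma> = p" for \<sigma>
  using trop_cochains_mem(1)[OF a(1) zero_face(1)] zero_face(2) that by simp
 have kK: "k \<sigma> \<in> K" if "\<sigma> \<in> \<Sigma>" "dim \<sigma> = p" for \<sigma>
  unfolding k_def using that by (intro kdualD(3)[OF ak] nu_mem_trop_F zero_face face_refl) (auto simp: dim_eq_0)
 have cl: "homology_class ?C ?D ?q (cap K N \<Sigma> \<nu> p p ?q ?q a' (fundamental_cycle \<Sigma> d \<omega> \<nu>)) =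
   (\<lambda>h. h + stratum_combination p k) ` (?D ` ?C (Suc ?q))" if a': "a' \<in> \<alpha>" for a'
 proof -
  obtain h where h: "h \<in> ?B" "a' = h + a" using a' a(2) by blast
  have "\<exists>y\<in>?C (Suc ?q). cap K N \<Sigma> \<nu> p p ?q ?q a' (fundamental_cycle \<Sigma> d \<omega> \<nu>) = ?D y + stratum_combination p k"
  proof (cases p)
   case 0
   then have "a' = a" using h by simp
   then have "cap K N \<Sigma> \<nu> p p ?q ?q a' (fundamental_cycle \<Sigma> d \<omega> \<nu>) = stratum_combination p k"
    using cap_eq[OF ak p] by (simp add: k_def[abs_def])
   then show ?thesis using trop_chains_group(1)[OF subK] by (intro bexI[of _ 0]) (simp_all add: linear_trop_boundary(3))
  next
   case (Suc r)
   then obtain b where b: "b \<in> trop_cochains K N \<Sigma> (Suc r) r" "h = ?\<delta> b" using h(1) by auto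
   obtain y where y: "y \<in> ?C (Suc ?q)" "?D y = stratum_combination p (\<lambda>\<sigma>. ?\<delta> b ({0}, \<sigma>) (\<nu> ({0}, \<sigma>)))"
    using cap_coboundary[OF b(1)] p Suc by auto
   have "cap K N \<Sigma> \<nu> p p ?q ?q a' (fundamental_cycle \<Sigma> d \<omega> \<nu>) =
     stratum_combination p (\<lambda>\<sigma>. a' ({0}, \<sigma>) (\<nu> ({0}, \<sigma>)))"
   proof (rule cap_eq[OF _ p])
    fix \<sigma> assume \<sigma>: "\<sigma> \<in> \<Sigma>" "dim \<sigma> = p"
    have "?\<delta> b ({0}, \<sigma>) \<in> kdual K (trop_F K N \<Sigma> p ({0}, \<sigma>))"
     using coboundary_kdual[OF b(1) zero_face(1)] zero_face(2) \<sigma> Suc by simp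
    from kdual_add[OF subK this ak[OF \<sigma>]]
    show "a' ({0}, \<sigma>) \<in> kdual K (trop_F K N \<Sigma> p ({0}, \<sigma>))" by (simp add: h(2) b(2) plus_fun_def)
   qed
   also have "\<dots> = ?D y + stratum_combination p k"
    by (simp add: y(2) stratum_combination_add h(2) b(2) k_def)
   finally show ?thesis using y(1) by blast
  qed
  then obtain y where y: "y \<in> ?C (Suc ?q)"
   "cap K N \<Sigma> \<nu> p p ?q ?q a' (fundamental_cycle \<Sigma> d \<omega> \<nu>) = ?D y + stratum_combination p k" by blast
  let ?c = "stratum_combination p k"
  have "(\<lambda>h. h + (?D y + ?c)) ` (?D ` ?C (Suc ?q)) = (\<lambda>h. h + ?c) ` (?D ` ?C (Suc ?q))" (is "?L = ?R")
  proof
   show "?L \<subseteq> ?R"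
   proof
    fix u assume "u \<in> ?L"
    then obtain x where x: "x \<in> ?C (Suc ?q)" "u = ?D x + (?D y + ?c)" by blast
    then have "u = ?D (x + y) + ?c" by (simp add: linear_trop_boundary(1) add.assoc)
    then show "u \<in> ?R" using trop_chains_group(2)[OF subK x(1) y(1)] by blast
   qed
   show "?R \<subseteq> ?L"
   proof
    fix u assume "u \<in> ?R"
    then obtain x where x: "x \<in> ?C (Suc ?q)" "u = ?D x + ?c" by blast
    then have "u = ?D (x - y) + (?D y + ?c)" by (simp add: linear_trop_boundary(2) add.assoc)
    then show "u \<in> ?L" using trop_chains_group(3)[OF subK x(1) y(1)] by blast
   qed
  qed
  then show ?thesis by (simp add: homology_class_eq y(2))
 qed
 have "0 \<in> trop_cochains K N \<Sigma> p r" for r using real_subringD(2)[OF subK] by (auto simp: trop_cochains_def kdual_def)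
 \<comment> \<open>Without a representative the union would be empty instead of the common
   coset.\<close>
 then have "\<alpha> \<noteq> {}" using a(2) by (cases p) auto
 then have pd: "poincare_dual K N \<Sigma> d \<omega> \<nu> p \<alpha> = (\<lambda>h. h + stratum_combination p k) ` (?D ` ?C (Suc ?q))"
  using cl by (auto simp: poincare_dual_def)
 have "stratum_combination p k \<in> cycles ?C ?D ?q"
  using stratum_combination_chain[OF kK] by (simp add: cycles_def stratum_combination_cycle)
 then have "poincare_dual K N \<Sigma> d \<omega> \<nu> p \<alpha> \<in> carrier (trop_homology K N \<Sigma> \<nu> ?q ?q)"
  unfolding trop_homology_def carrier_homology pd by blast
 moreover have "stratum_combination p k \<in> poincare_dual K N \<Sigma> d \<omega> \<nu> p \<alpha>"
 proof -
  have "?D 0 = 0" "0 \<in> ?C (Suc ?q)" using trop_chains_group(1)[OF subK] by (simp_all add: linear_trop_boundary(3))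
  then have "0 \<in> ?D ` ?C (Suc ?q)" by (metis imageI)
  then show ?thesis unfolding pd by (rule rev_image_eqI) simp
 qed
 ultimately show ?thesis using kK by blast
qed

end

section \<open>Tropical cycles on the subdivision into cones\<close>

context simplicial_lattice_fan
begin

lemma point_hom_apply:
 "m \<in> dual_cone N \<sigma> \<Longrightarrow> point_hom N \<sigma> (\<tau>, v) m = (if \<forall>x\<in>\<tau>. m \<bullet> x = 0 then ereal (m \<bullet> v) else \<infinity>)"
 by (simp add: point_hom_def)

lemma dual_cone_support:
 assumes "\<sigma> \<in> \<Sigma>" "\<tau> \<in> \<Sigma>" "\<tau> face_of \<sigma>"
 shows "\<exists>m\<in>dual_cone N \<sigma>. \<forall>x\<in>\<sigma>. m \<bullet> x = 0 \<longleftrightarrow> x \<in> \<tau>"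
proof -
 obtain V where V: "finite V" "V \<subseteq> N" "\<sigma> = ccone V" using fan_cone(4)[OF assms(1)] by blast
 have "V \<subseteq> span N" "\<tau> \<noteq> {}" using V(2) span_superset fan_cone(3)[OF assms(2)] by blast+
 then obtain m where "m \<in> dual_cone N \<sigma>" "\<And>x. x \<in> \<sigma> \<Longrightarrow> m \<bullet> x = 0 \<longleftrightarrow> x \<in> \<tau>"
  using cone_face_support[OF V(1,3) _ assms(3)] by metis
 then show ?thesis by blast
qed

lemma closedin_point_hom:
 assumes m: "m \<in> dual_cone N \<sigma>" and C: "closed C"
 shows "closedin (cone_topology N \<Sigma> \<sigma>) {x \<in> cone_points \<Sigma> \<sigma>. point_hom N \<sigma> x m \<in> C}"
proof -
 have "continuous_map (cone_topology N \<Sigma> \<sigma>) euclidean ((\<lambda>f. f m) \<circ> point_hom N \<sigma>)"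
  unfolding cone_topology_def by (intro continuous_map_pullback continuous_map_product_projection m)
 from closedin_continuous_map_preimage[OF this, of C] C show ?thesis
  by (simp add: topspace_cone_topology)
qed

text \<open>The points of the closed face usually written as a box with upper index \<tau> and lower
  index \<zeta>, stratum by stratum.\<close>

definition face_points :: "'n rvec set \<Rightarrow> 'n rvec set \<Rightarrow> ('n rvec set \<times> 'n rvec) set" where
 "face_points \<tau> \<zeta> = {(\<rho>, v). \<rho> \<in> \<Sigma> \<and> \<tau> face_of \<rho> \<and> \<rho> face_of \<zeta> \<and> v \<in> proj \<rho> ` \<zeta>}"

text \<open>The topology is glued from the cones, so closedness is tested in each \<sigma>. There
  the trace is cut out by closed conditions on homomorphisms: value 0 at a functional supporting
  \<zeta> \<inter> \<sigma>, and value \<infinity> at every m not vanishing on \<tau>.\<close>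

lemma closedin_face_points:
 assumes \<zeta>: "\<zeta> \<in> \<Sigma>" and \<tau>: "\<tau> \<in> \<Sigma>" "\<tau> face_of \<zeta>"
 shows "closedin (compactification N \<Sigma>) (face_points \<tau> \<zeta>)"
proof -
 let ?X = "compactification N \<Sigma>" and ?P = "\<lambda>\<sigma>. cone_points \<Sigma> \<sigma>" and ?E = "face_points \<tau> \<zeta>"
 have closed: "closedin (cone_topology N \<Sigma> \<sigma>) (?E \<inter> ?P \<sigma>)" if \<sigma>: "\<sigma> \<in> \<Sigma>" for \<sigma>
 proof (cases "\<tau> face_of \<sigma>")
  case False
  have "?E \<inter> ?P \<sigma> = {}" using False face_of_trans by (auto simp: face_points_def cone_points_def)
  then show ?thesis by simp
 next
  case True
  let ?D = "dual_cone N \<sigma>" and ?\<zeta> = "\<zeta> \<inter> \<sigma>"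
  have ne: "?\<zeta> \<noteq> {}" using fan_cone(3)[OF \<zeta>] fan_cone(3)[OF \<sigma>] by blast
  have f: "?\<zeta> face_of \<sigma>" "?\<zeta> face_of \<zeta>" "?\<zeta> \<in> \<Sigma>"
   using Int_face[OF \<zeta> \<sigma>] Int_face'[OF \<zeta> \<sigma>] face_mem[OF \<zeta> _ ne] by simp_all
  obtain m0 where m0: "m0 \<in> ?D" "\<forall>x\<in>\<sigma>. m0 \<bullet> x = 0 \<longleftrightarrow> x \<in> ?\<zeta>" using dual_cone_support[OF \<sigma> f(3,1)] by blast
  let ?S = "\<lambda>m C. {x \<in> ?P \<sigma>. point_hom N \<sigma> x m \<in> C}"
  let ?M = "{m \<in> ?D. \<exists>x\<in>\<tau>. m \<bullet> x \<noteq> 0}"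
  have "?E \<inter> ?P \<sigma> = \<Inter> (insert (?S m0 {0}) ((\<lambda>m. ?S m {\<infinity>}) ` ?M))" (is "_ = ?I")
  proof
   show "?E \<inter> ?P \<sigma> \<subseteq> ?I"
   proof
    fix z assume "z \<in> ?E \<inter> ?P \<sigma>"
    then obtain \<rho> v where z: "z = (\<rho>, v)" "z \<in> ?P \<sigma>" "\<rho> \<in> \<Sigma>" "\<tau> face_of \<rho>" "\<rho> face_of \<zeta>" "v \<in> proj \<rho> ` \<zeta>"
     "\<rho> face_of \<sigma>" "v \<in> proj \<rho> ` \<sigma>" by (auto simp: face_points_def cone_points_def)
    have "v \<in> proj \<rho> ` ?\<zeta>" using z(6,8) proj_image_Int[OF \<zeta> \<sigma> z(3,5,7)] by blast
    then obtain x where x: "x \<in> ?\<zeta>" "v = proj \<rho> x" by blast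
    have 0: "m0 \<bullet> y = 0" if "y \<in> \<rho>" for y
     using that m0(2) face_of_imp_subset[OF z(5)] face_of_imp_subset[OF z(7)] by blast
    have "point_hom N \<sigma> z m0 = 0"
     using 0 x m0(2) by (simp add: z(1) point_hom_apply[OF m0(1)] inner_proj)
    moreover have "point_hom N \<sigma> z m = \<infinity>" if "m \<in> ?M" for m
    proof -
     have "\<exists>x\<in>\<rho>. m \<bullet> x \<noteq> 0" using that face_of_imp_subset[OF z(4)] by blast
     then show ?thesis using that by (auto simp: z(1) point_hom_apply)
    qed
    ultimately show "z \<in> ?I" using z(2) by simp
   qed
   show "?I \<subseteq> ?E \<inter> ?P \<sigma>"
   proof
    fix z assume z: "z \<in> ?I"
    then obtain \<rho> v where eq: "z = (\<rho>, v)" "\<rho> \<in> \<Sigma>" "\<rho> face_of \<sigma>" "v \<in> proj \<rho> ` \<sigma>" and zP: "z \<in> ?P \<sigma>"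
     by (auto simp: cone_points_def)
    have z0: "point_hom N \<sigma> z m0 = 0" and zi: "\<And>m. m \<in> ?M \<Longrightarrow> point_hom N \<sigma> z m = \<infinity>" using z by auto
    have "\<forall>x\<in>\<rho>. m0 \<bullet> x = 0" "m0 \<bullet> v = 0" using z0 by (auto simp: eq(1) point_hom_apply[OF m0(1)] split: if_splits)
    then have "\<rho> \<subseteq> ?\<zeta>" using m0(2) face_of_imp_subset[OF eq(3)] by blast
    then have \<rho>\<zeta>: "\<rho> face_of \<zeta>" using subset_imp_face[OF eq(2) \<zeta>] by blast
    obtain x where x: "x \<in> \<sigma>" "v = proj \<rho> x" using eq(4) by blast
    have "m0 \<bullet> x = 0" using \<open>\<forall>x\<in>\<rho>. m0 \<bullet> x = 0\<close> \<open>m0 \<bullet> v = 0\<close> by (simp add: x(2) inner_proj)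
    then have v: "v \<in> proj \<rho> ` \<zeta>" using x m0(2) by blast
    \<comment> \<open>A functional vanishing exactly on \<rho> has a finite value at z. It therefore
      cannot be among those forced to be infinite, so it vanishes on \<tau>, which gives \<tau>
      \<subseteq> \<rho>.\<close>
    obtain m1 where m1: "m1 \<in> ?D" "\<forall>x\<in>\<sigma>. m1 \<bullet> x = 0 \<longleftrightarrow> x \<in> \<rho>" using dual_cone_support[OF \<sigma> eq(2,3)] by blast
    have "point_hom N \<sigma> z m1 \<noteq> \<infinity>"
     using m1(2) face_of_imp_subset[OF eq(3)] by (auto simp: eq(1) point_hom_apply[OF m1(1)])
    then have "m1 \<notin> ?M" using zi by blast
    then have "\<tau> \<subseteq> \<rho>" using m1 face_of_imp_subset[OF True] by blast
    then have "\<tau> face_of \<rho>" by (rule subset_imp_face[OF \<tau>(1) eq(2)])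
    then show "z \<in> ?E \<inter> ?P \<sigma>" using eq \<rho>\<zeta> v zP by (simp add: face_points_def)
   qed
  qed
  moreover have "closedin (cone_topology N \<Sigma> \<sigma>) ?I"
   using closedin_point_hom[OF m0(1), of "{0}"] closedin_point_hom[of _ \<sigma> "{\<infinity>}"] by (intro closedin_Inter) auto
  ultimately show ?thesis by simp
 qed
 have top: "topspace ?X = (\<Union>\<sigma>\<in>\<Sigma>. ?P \<sigma>)" by (rule topspace_compactification[OF fan])
 have "?E \<subseteq> topspace ?X" using \<zeta> unfolding top by (auto simp: face_points_def cone_points_def)
 moreover have "openin (cone_topology N \<Sigma> \<sigma>) ((topspace ?X - ?E) \<inter> ?P \<sigma>)" if "\<sigma> \<in> \<Sigma>" for \<sigma>
 proof -
  have "(topspace ?X - ?E) \<inter> ?P \<sigma> = topspace (cone_topology N \<Sigma> \<sigma>) - ?E \<inter> ?P \<sigma>"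
   using that by (auto simp: top topspace_cone_topology)
  then show ?thesis using closed[OF that] by (simp add: closedin_def)
 qed
 ultimately show ?thesis unfolding closedin_def openin_compactification using top by auto
qed

text \<open>A point of the stratum \<open>\<rho>\<close> is reached from the stratum \<open>\<tau>\<close> by moving to infinity along an interior
 direction of \<open>\<rho>\<close>.\<close>

lemma face_points_dense:
 assumes \<zeta>: "\<zeta> \<in> \<Sigma>" and \<tau>: "\<tau> \<in> \<Sigma>" "\<tau> face_of \<zeta>" and z: "z \<in> face_points \<tau> \<zeta>"
 shows "z \<in> compactification N \<Sigma> closure_of ({\<tau>} \<times> proj \<tau> ` \<zeta>)"
proof -
 let ?X = "compactification N \<Sigma>" and ?D = "dual_cone N \<zeta>"
 obtain \<rho> x where z: "z = (\<rho>, proj \<rho> x)" "x \<in> \<zeta>" and \<rho>: "\<rho> \<in> \<Sigma>" "\<tau> face_of \<rho>" "\<rho> face_of \<zeta>"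
  using z by (auto simp: face_points_def)
 have zP: "z \<in> cone_points \<Sigma> \<zeta>" using z \<rho> by (auto simp: cone_points_def)
 have cc: "convex_cone \<zeta>" "convex_cone \<rho>" using fan_cone(1) \<zeta> \<rho>(1) by blast+
 \<comment> \<open>A direction in the relative interior of \<rho>: all generators enter with
   positive coefficient.\<close>
 define y where "y = (\<Sum>g\<in>gens \<rho>. g)"
 have g\<rho>: "g \<in> \<rho>" if "g \<in> gens \<rho>" for g using gens(3)[OF \<rho>(1)] that by blast
 have "y \<in> ccone (gens \<rho>)"
  unfolding mem_cone_hull_finite[OF gens(1)[OF \<rho>(1)]] by (rule exI[of _ "\<lambda>_. 1"]) (simp add: y_def)
 then have y\<rho>: "y \<in> \<rho>" using gens(5)[OF \<rho>(1)] by simp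
 have y\<zeta>: "y \<in> \<zeta>" using y\<rho> face_of_imp_subset[OF \<rho>(3)] by blast
 define s where "s n = (\<tau>, proj \<tau> (x + real n *\<^sub>R y))" for n :: nat
 have xy: "x + real n *\<^sub>R y \<in> \<zeta>" for n
  using cc(1) z(2) y\<zeta> by (simp add: convex_cone_add convex_cone_scaleR)
 have sS: "s n \<in> {\<tau>} \<times> proj \<tau> ` \<zeta>" for n using xy by (simp add: s_def)
 have sP: "s n \<in> cone_points \<Sigma> \<zeta>" for n using xy \<tau> by (auto simp: s_def cone_points_def)
 have lim: "limitin (product_topology (\<lambda>_. euclidean) ?D) (\<lambda>n. point_hom N \<zeta> (s n)) (point_hom N \<zeta> z) sequentially"
  unfolding limitin_componentwise
 proof (intro conjI ballI)
  show "point_hom N \<zeta> z \<in> extensional ?D" by (simp add: z(1) point_hom_def)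
  show "\<forall>\<^sub>F n in sequentially. point_hom N \<zeta> (s n) \<in> topspace (product_topology (\<lambda>_. euclidean) ?D)"
   by (simp add: s_def point_hom_def)
  fix m assume m: "m \<in> ?D"
  have "(\<lambda>n. point_hom N \<zeta> (s n) m) \<longlonglongrightarrow> point_hom N \<zeta> z m"
  proof (cases "\<forall>g\<in>\<tau>. m \<bullet> g = 0")
   case False
   then have "\<not> (\<forall>g\<in>\<rho>. m \<bullet> g = 0)" using face_of_imp_subset[OF \<rho>(2)] by blast
   then have "point_hom N \<zeta> z m = \<infinity>" "point_hom N \<zeta> (s n) m = \<infinity>" for n
    unfolding z(1) s_def point_hom_apply[OF m] using False by (simp_all only: if_False)
   then show ?thesis by simp
  next
   case \<tau>0: True
   then have s: "point_hom N \<zeta> (s n) m = ereal (m \<bullet> x + real n * (m \<bullet> y))" for n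
    by (simp add: s_def point_hom_apply[OF m] inner_proj inner_add_right)
   show ?thesis
   proof (cases "\<forall>g\<in>\<rho>. m \<bullet> g = 0")
    case True
    then have "point_hom N \<zeta> z m = ereal (m \<bullet> x)" by (simp add: z(1) point_hom_apply[OF m] inner_proj)
    moreover have "m \<bullet> y = 0" using True y\<rho> by blast
    ultimately show ?thesis by (simp add: s)
   next
    case False
    have ge: "0 \<le> m \<bullet> g" if "g \<in> gens \<rho>" for g
     using m g\<rho>[OF that] face_of_imp_subset[OF \<rho>(3)] by (auto simp: dual_cone_def)
    \<comment> \<open>m is nonnegative on the generators, so vanishing on their sum would make it
      vanish on all of \<rho>.\<close>
    have "m \<bullet> y \<noteq> 0"
    proof
     assume "m \<bullet> y = 0"
     then have "\<forall>g\<in>gens \<rho>. m \<bullet> g = 0"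
      using sum_nonneg_eq_0_iff[OF gens(1)[OF \<rho>(1)], of "\<lambda>g. m \<bullet> g"] ge by (simp add: y_def inner_sum_right)
     moreover have "\<exists>c. g = (\<Sum>b\<in>gens \<rho>. c b *\<^sub>R b)" if "g \<in> \<rho>" for g
      using that mem_cone_hull_finite[OF gens(1)[OF \<rho>(1)], of g] gens(5)[OF \<rho>(1)] by blast
     ultimately have "m \<bullet> g = 0" if "g \<in> \<rho>" for g
      using that by (metis (no_types, lifting) inner_scaleR_right inner_sum_right mult_zero_right sum.neutral)
     with False show False by blast
    qed
    moreover have "0 \<le> m \<bullet> y" using m y\<zeta> by (auto simp: dual_cone_def)
    ultimately have "0 < m \<bullet> y" by simp
    then have "filterlim (\<lambda>n. m \<bullet> x + real n * (m \<bullet> y)) at_top sequentially"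
     by (intro filterlim_tendsto_add_at_top[OF tendsto_const]
       filterlim_at_top_mult_tendsto_pos[OF tendsto_const] filterlim_real_sequentially)
    then have "(\<lambda>n. ereal (m \<bullet> x + real n * (m \<bullet> y))) \<longlonglongrightarrow> \<infinity>"
     by (simp add: tendsto_PInfty_eq_at_top)
    moreover have "point_hom N \<zeta> z m = \<infinity>"
     unfolding z(1) point_hom_apply[OF m] using False by (simp only: if_False)
    ultimately show ?thesis by (simp only: s)
   qed
  qed
  then show "limitin euclidean (\<lambda>n. point_hom N \<zeta> (s n) m) (point_hom N \<zeta> z m) sequentially" by simp
 qed
 show ?thesis
  unfolding in_closure_of
 proof (intro conjI allI impI)
  show "z \<in> topspace ?X" unfolding topspace_compactification[OF fan] using zP \<zeta> by blast
  fix U assume U: "z \<in> U \<and> openin ?X U"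
  then have "openin (cone_topology N \<Sigma> \<zeta>) (U \<inter> cone_points \<Sigma> \<zeta>)" using \<zeta> by (simp add: openin_compactification)
  then obtain W where W: "openin (product_topology (\<lambda>_. euclidean) ?D) W"
   "U \<inter> cone_points \<Sigma> \<zeta> = point_hom N \<zeta> -` W \<inter> cone_points \<Sigma> \<zeta>"
   unfolding cone_topology_def openin_pullback_topology by blast
  have "point_hom N \<zeta> z \<in> W" using U zP W(2) by blast
  then have "\<forall>\<^sub>F n in sequentially. point_hom N \<zeta> (s n) \<in> W" using lim W(1) by (simp add: limitin_def)
  then obtain n where "point_hom N \<zeta> (s n) \<in> W" by (auto simp: eventually_sequentially)
  then have "s n \<in> U" using W(2) sP by blast
  then show "\<exists>u. u \<in> {\<tau>} \<times> proj \<tau> ` \<zeta> \<and> u \<in> U" using sS by blast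
 qed
qed

lemma cell_closure_eq:
 assumes "\<zeta> \<in> \<Sigma>" "\<tau> \<in> \<Sigma>" "\<tau> face_of \<zeta>"
 shows "cell_closure N \<Sigma> (\<tau>, proj \<tau> ` \<zeta>) = face_points \<tau> \<zeta>"
proof
 have "\<tau> face_of \<tau>" using assms(2) by (simp add: face_of_iff_gens)
 then have "{\<tau>} \<times> proj \<tau> ` \<zeta> \<subseteq> face_points \<tau> \<zeta>" using assms by (auto simp: face_points_def)
 then show "cell_closure N \<Sigma> (\<tau>, proj \<tau> ` \<zeta>) \<subseteq> face_points \<tau> \<zeta>"
  using closedin_face_points[OF assms] by (simp add: cell_closure_def closure_of_minimal)
 show "face_points \<tau> \<zeta> \<subseteq> cell_closure N \<Sigma> (\<tau>, proj \<tau> ` \<zeta>)"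
  using face_points_dense[OF assms] by (auto simp: cell_closure_def)
qed

end

text \<open>V is completed to a basis of the real span by vectors of M. In terms of integral dual
  forms, the cone is given by nonnegativity of all coordinates together with nonpositivity of those
  outside V.\<close>

lemma rational_polyhedron_cone:
 fixes M :: "'n::finite rvec set"
 assumes M: "coordinatized \<int> M" and V: "V \<subseteq> M" "independent V"
 shows "rational_polyhedron M (ccone V)"
proof -
 obtain B where B: "V \<subseteq> B" "B \<subseteq> M" "independent B" "M \<subseteq> span B"
  using maximal_independent_subset_extend[OF V] by blast
 have fin: "finite B" "finite V" using independent_imp_finite[OF B(3)] B(1) finite_subset by auto
 obtain bs where bs: "set bs = B" "distinct bs" using finite_distinct_list[OF fin(1)] by blast
 have "\<exists>c x. c > 0 \<and> c \<in> \<int> \<and> (\<forall>v\<in>set bs. linear (x v :: _ \<Rightarrow> real) \<and> x v ` M \<subseteq> \<int> \<and>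
  (\<forall>w\<in>set bs. x v w = (if w = v then c else 0)))"
  by (rule integral_dual_family[OF M]) (use bs B in auto)
 then obtain c x where c: "c > 0" and x: "\<forall>v\<in>B. linear (x v :: _ \<Rightarrow> real) \<and> x v ` M \<subseteq> \<int> \<and>
  (\<forall>w\<in>B. x v w = (if w = v then c else 0))" unfolding bs(1) by (elim exE conjE)
 have lin: "linear (x v)" and xM: "n \<in> M \<Longrightarrow> x v n \<in> \<int>" and xB: "w \<in> B \<Longrightarrow> x v w = (if w = v then c else 0)"
  if "v \<in> B" for v w n using x that by auto
 define m where "m v = adjoint (x v) 1" for v
 have m: "m v \<bullet> z = x v z" if "v \<in> B" for v z
  using adjoint_works[OF lin[OF that], of z 1] by (simp add: m_def inner_commute[of _ z])
 have spanM: "span M = span B" using B(2,4) by (simp add: span_eq span_superset[THEN subset_trans] subset_trans[OF B(2) span_superset])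
 have coord: "x w (\<Sum>v\<in>A. a v *\<^sub>R v) = (if w \<in> A then a w * c else 0)" if "w \<in> B" "A \<subseteq> B" for w A a
 proof -
  have "x w (\<Sum>v\<in>A. a v *\<^sub>R v) = (\<Sum>v\<in>A. if v = w then a w * c else 0)"
   unfolding linear_sum[OF lin[OF that(1)]] linear_scale[OF lin[OF that(1)]]
   by (rule sum.cong) (use xB[OF that(1)] that(2) in auto)
  then show ?thesis using finite_subset[OF that(2) fin(1)] by simp
 qed
 let ?H = "(\<lambda>v. (m v, 0 :: real)) ` B \<union> (\<lambda>v. (- m v, 0)) ` (B - V)"
 have "ccone V = {z \<in> span M. \<forall>(l, t)\<in>?H. l \<bullet> z \<ge> t}" (is "_ = ?R")
 proof
  show "ccone V \<subseteq> ?R"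
  proof
   fix z assume "z \<in> ccone V"
   then obtain a where a: "\<forall>b\<in>V. 0 \<le> a b" "z = (\<Sum>b\<in>V. a b *\<^sub>R b)" using mem_cone_hull_finite[OF fin(2)] by blast
   have "z \<in> span M" unfolding a(2) using V(1) by (intro span_sum span_scale span_base) auto
   moreover have "m v \<bullet> z = (if v \<in> V then a v * c else 0)" if "v \<in> B" for v
    using m[OF that] coord[OF that B(1)] a(2) by simp
   ultimately show "z \<in> ?R" using a(1) c by auto
  qed
  show "?R \<subseteq> ccone V"
  proof
   fix z assume z: "z \<in> ?R"
   then have "z \<in> span B" using spanM by blast
   then obtain a where a: "z = (\<Sum>v\<in>B. a v *\<^sub>R v)" unfolding span_finite[OF fin(1)] by blast
   have ac: "m v \<bullet> z = a v * c" if "v \<in> B" for v using m[OF that] coord[OF that order_refl] a that by simp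
   have nn: "0 \<le> a v" if "v \<in> B" for v
   proof -
    have "0 \<le> m v \<bullet> z" using z that by blast
    then show ?thesis using ac[OF that] c by (simp add: zero_le_mult_iff)
   qed
   have "a v = 0" if "v \<in> B - V" for v
   proof -
    have "0 \<le> - m v \<bullet> z" using z that by blast
    then have "a v * c \<le> 0" using ac that by simp
    then show ?thesis using nn[of v] that c by (simp add: mult_le_0_iff)
   qed
   then have "z = (\<Sum>v\<in>V. a v *\<^sub>R v)" unfolding a by (intro sum.mono_neutral_right fin B(1)) auto
   then show "z \<in> ccone V" using nn B(1) mem_cone_hull_finite[OF fin(2)] by blast
  qed
 qed
 moreover have "\<forall>(l, t)\<in>?H. \<forall>n\<in>M. l \<bullet> n \<in> \<int>" using m xM by auto
 ultimately show ?thesis unfolding rational_polyhedron_def using fin by (intro exI[of _ ?H]) auto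
qed

lemma span_dirs: "0 \<in> P \<Longrightarrow> span (dirs P) = span P"
proof
 assume "0 \<in> P"
 then have "P \<subseteq> dirs P" unfolding dirs_def by force
 then show "span P \<subseteq> span (dirs P)" by (rule span_mono)
 have "dirs P \<subseteq> span P" by (auto simp: dirs_def intro: span_diff span_base)
 then show "span (dirs P) \<subseteq> span P" by (simp add: span_minimal)
qed

text \<open>Because Q contains 0, \<open>dirs Q\<close> has the same span as Q; and modulo that span
  the directions from Q into the cone P are the points of P.\<close>

lemma facet_normal_cone:
 assumes P: "convex_cone P" "0 \<in> Q" "Q \<subseteq> P"
 shows "facet_normal M Q P = primitive M Q P"
proof -
 let ?C = "{t *\<^sub>R (x - y) | t x y. 0 \<le> t \<and> x \<in> P \<and> y \<in> Q}"
 have pr: "proj (dirs Q) = proj Q" by (rule proj_cong_span[OF span_dirs[OF P(2)]])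
 have PC: "P \<subseteq> ?C"
 proof
  fix x assume "x \<in> P"
  then show "x \<in> ?C" using P(2) by (intro CollectI exI[of _ 1] exI[of _ x] exI[of _ 0]) auto
 qed
 have "?C \<subseteq> span P" using P(3) by (auto intro!: span_scale span_diff intro: span_base)
 then have sp: "span ?C = span P" using span_mono[OF PC] by (intro antisym) (simp_all add: span_minimal)
 have "proj Q ` ?C = proj Q ` P"
 proof
  show "proj Q ` P \<subseteq> proj Q ` ?C" using PC by blast
  show "proj Q ` ?C \<subseteq> proj Q ` P"
  proof
   fix z assume "z \<in> proj Q ` ?C"
   then obtain t x y where t: "0 \<le> t" "x \<in> P" "y \<in> Q" "z = proj Q (t *\<^sub>R (x - y))" by blast
   have "proj Q y = 0" using t(3) by (simp add: proj_eq_0_iff span_base)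
   then have "z = proj Q (t *\<^sub>R x)" by (simp add: t(4) proj_scale proj_diff)
   moreover have "t *\<^sub>R x \<in> P" using P(1) t(1,2) by (simp add: convex_cone_scaleR)
   ultimately show "z \<in> proj Q ` P" by blast
  qed
 qed
 then show ?thesis unfolding facet_normal_def primitive_def pr sp by simp
qed

section \<open>The subdivision of the compactification into its faces\<close>

context simplicial_lattice_fan
begin

lemma star_cone:
 assumes "(\<tau>, \<sigma>) \<in> \<F>"
 shows "rational_polyhedron (proj \<tau> ` N) (proj \<tau> ` \<sigma>)" "polyhedron (proj \<tau> ` \<sigma>)" "convex_cone (proj \<tau> ` \<sigma>)"
  "0 \<in> proj \<tau> ` \<sigma>" "aff_dim (proj \<tau> ` \<sigma>) = int (dim \<sigma> - dim \<tau>)" "cell_dim (\<tau>, proj \<tau> ` \<sigma>) = dim \<sigma> - dim \<tau>"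
proof -
 have m: "\<tau> \<in> \<Sigma>" "\<sigma> \<in> \<Sigma>" "\<tau> face_of \<sigma>" using assms by (auto simp: faces_iff)
 have "proj \<tau> ` (gens \<sigma> - gens \<tau>) \<subseteq> proj \<tau> ` N" using gens(2)[OF m(2)] by blast
 then show "rational_polyhedron (proj \<tau> ` N) (proj \<tau> ` \<sigma>)"
  unfolding proj_cone(1)[OF m(2,1,3)]
  by (rule rational_polyhedron_cone[OF proj_N_coordinatized[OF m(1)] _ independent_proj_gens(2)[OF m(2,1,3)]])
 show "polyhedron (proj \<tau> ` \<sigma>)" "convex_cone (proj \<tau> ` \<sigma>)"
  unfolding proj_cone(1)[OF m(2,1,3)] using gens(1)[OF m(2)]
  by (simp_all add: polyhedron_convex_cone_hull convex_cone_convex_cone_hull)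
 show 0: "0 \<in> proj \<tau> ` \<sigma>" using fan_cone(3)[OF m(2)] linear_0[OF linear_proj, of \<tau>] by (metis imageI)
 then show "aff_dim (proj \<tau> ` \<sigma>) = int (dim \<sigma> - dim \<tau>)"
  using aff_dim_zero[OF hull_inc[OF 0]] proj_cone(3)[OF m(2,1,3)] by simp
 then show "cell_dim (\<tau>, proj \<tau> ` \<sigma>) = dim \<sigma> - dim \<tau>" by (simp add: cell_dim_def)
qed

lemma facet_normal_star:
 assumes "(\<tau>, \<zeta>) \<in> \<F>" "(\<tau>, \<eta>) \<in> \<F>" "\<zeta> face_of \<eta>"
 shows "facet_normal (proj \<tau> ` N) (proj \<tau> ` \<zeta>) (proj \<tau> ` \<eta>) = primitive N \<zeta> \<eta>"
proof -
 have sub: "\<tau> \<subseteq> span \<zeta>" "\<tau> \<subseteq> span \<eta>" using assms face_subset_span by (auto simp: faces_iff)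
 have "facet_normal (proj \<tau> ` N) (proj \<tau> ` \<zeta>) (proj \<tau> ` \<eta>) = primitive (proj \<tau> ` N) (proj \<tau> ` \<zeta>) (proj \<tau> ` \<eta>)"
  using star_cone(3,4)[OF assms(2)] star_cone(4)[OF assms(1)] face_of_imp_subset[OF assms(3)]
  by (intro facet_normal_cone) auto
 then show ?thesis using primitive_star[OF sub] by simp
qed

lemma star_Int:
 assumes "(\<tau>, \<sigma>) \<in> \<F>" "(\<tau>, \<eta>) \<in> \<F>"
 shows "proj \<tau> ` \<sigma> \<inter> proj \<tau> ` \<eta> face_of proj \<tau> ` \<sigma>"
proof -
 have m: "\<tau> \<in> \<Sigma>" "\<sigma> \<in> \<Sigma>" "\<tau> face_of \<sigma>" "\<eta> \<in> \<Sigma>" "\<tau> face_of \<eta>" using assms by (auto simp: faces_iff)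
 have ne: "\<sigma> \<inter> \<eta> \<noteq> {}" using fan_cone(3)[OF m(2)] fan_cone(3)[OF m(4)] by blast
 have f: "\<sigma> \<inter> \<eta> face_of \<sigma>" "\<sigma> \<inter> \<eta> \<in> \<Sigma>" using Int_face[OF m(2,4)] face_mem[OF m(2) _ ne] by simp_all
 have "\<tau> face_of \<sigma> \<inter> \<eta>" using face_of_imp_subset[OF m(3)] face_of_imp_subset[OF m(5)] by (intro subset_imp_face[OF m(1) f(2)]) auto
 then show ?thesis
  unfolding proj_image_Int[OF m(2,4,1,3,5)] using proj_face_of_iff[OF f(2) m(2,1) _ m(3)] f(1) by simp
qed

text \<open>A face meeting the relative interior is everything; applied to the intersection of the
  two projected cones as a face of the first.\<close>

lemma rel_interior_meets:
 assumes "(\<tau>, \<sigma>) \<in> \<F>" "(\<tau>, \<eta>) \<in> \<F>" "rel_interior (proj \<tau> ` \<sigma>) \<inter> proj \<tau> ` \<eta> \<noteq> {}"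
 shows "\<sigma> face_of \<eta>"
proof -
 have m: "\<tau> \<in> \<Sigma>" "\<sigma> \<in> \<Sigma>" "\<tau> face_of \<sigma>" "\<eta> \<in> \<Sigma>" "\<tau> face_of \<eta>" using assms by (auto simp: faces_iff)
 have "proj \<tau> ` \<sigma> \<inter> proj \<tau> ` \<eta> \<inter> rel_interior (proj \<tau> ` \<sigma>) \<noteq> {}"
  using assms(3) rel_interior_subset[of "proj \<tau> ` \<sigma>"] by blast
 then have "proj \<tau> ` \<sigma> \<subseteq> proj \<tau> ` \<eta>" using face_of_disjoint_rel_interior[OF star_Int[OF assms(1,2)]] by blast
 then show ?thesis using proj_image_subset_iff[OF m(2,4,1,3,5)] by simp
qed

text \<open>A point outside the relative interior lies on a facet, which is the projection of a cone
  of smaller dimension; descent ends at a cone containing the point in its relative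
  interior.\<close>

lemma rel_interior_cell:
 assumes \<sigma>: "(\<tau>, \<sigma>) \<in> \<F>" "v \<in> proj \<tau> ` \<sigma>"
 shows "\<exists>\<eta>. (\<tau>, \<eta>) \<in> \<F> \<and> v \<in> rel_interior (proj \<tau> ` \<eta>)"
 using assms
proof (induction "dim \<sigma>" arbitrary: \<sigma> rule: less_induct)
 case less
 have m: "\<tau> \<in> \<Sigma>" "\<sigma> \<in> \<Sigma>" "\<tau> face_of \<sigma>" using less.prems by (auto simp: faces_iff)
 show ?case
 proof (cases "v \<in> rel_interior (proj \<tau> ` \<sigma>)")
  case False
  then obtain F where F: "F facet_of proj \<tau> ` \<sigma>" "v \<in> F"
   using rel_boundary_of_polyhedron[OF star_cone(2)[OF less.prems(1)]] less.prems(2) by blast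
  have "F face_of proj \<tau> ` \<sigma>" "F \<noteq> {}" using F by (auto simp: facet_of_def)
  from face_of_proj_image[OF m(2,1,3) this]
  obtain \<zeta> where \<zeta>: "\<zeta> \<in> \<Sigma>" "\<tau> face_of \<zeta>" "\<zeta> face_of \<sigma>" "F = proj \<tau> ` \<zeta>" by blast
  have "\<zeta> \<noteq> \<sigma>" using F(1) \<zeta>(4) by (auto simp: facet_of_irrefl)
  then have "dim \<zeta> < dim \<sigma>" using face_dim_eq[OF m(2) \<zeta>(1,3)] dim_face_mono[OF \<zeta>(3)] by fastforce
  then show ?thesis using less.hyps[of \<zeta>] F(2) \<zeta> m(1) by (simp add: faces_iff)
 qed (use less.prems in blast)
qed

text \<open>The decomposition into the closed faces themselves, each represented by the polyhedron
  in a stratum whose closure it is.\<close>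

definition cells :: "'n face set" where
 "cells = (\<lambda>(\<tau>, \<sigma>). (\<tau>, proj \<tau> ` \<sigma>)) ` \<F>"

lemma mem_cells: "(\<tau>, P) \<in> cells \<longleftrightarrow> (\<exists>\<sigma>. (\<tau>, \<sigma>) \<in> \<F> \<and> P = proj \<tau> ` \<sigma>)"
 by (auto simp: cells_def)

lemma subdivision_cells: "subdivision N \<Sigma> cells"
 unfolding subdivision_def
proof (intro conjI)
 have "finite \<F>" by (rule finite_subset[of _ "\<Sigma> \<times> \<Sigma>"]) (auto simp: faces_iff finite_fan)
 then show "finite cells" by (simp add: cells_def)
 show "\<forall>(\<tau>, P)\<in>cells. \<tau> \<in> \<Sigma> \<and> P \<noteq> {} \<and> rational_polyhedron (proj \<tau> ` N) P \<and>
  (\<exists>\<sigma>\<in>\<Sigma>. \<tau> face_of \<sigma> \<and> rel_interior P \<subseteq> rel_interior (proj \<tau> ` \<sigma>))"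
  using star_cone(1,4) by (fastforce simp: mem_cells faces_iff)
 show "\<forall>(\<tau>, P)\<in>cells. \<forall>F. F face_of P \<and> F \<noteq> {} \<longrightarrow> (\<forall>\<rho>\<in>\<Sigma>. cell_closure N \<Sigma> (\<tau>, F) `` {\<rho>} = {} \<or>
   (\<rho>, cell_closure N \<Sigma> (\<tau>, F) `` {\<rho>}) \<in> cells)"
 proof (clarify)
  fix \<tau> P F \<rho> assume P: "(\<tau>, P) \<in> cells" and F: "F face_of P" "F \<noteq> {}" and \<rho>: "\<rho> \<in> \<Sigma>"
   and new: "(\<rho>, cell_closure N \<Sigma> (\<tau>, F) `` {\<rho>}) \<notin> cells"
  obtain \<sigma> where \<sigma>: "\<tau> \<in> \<Sigma>" "\<sigma> \<in> \<Sigma>" "\<tau> face_of \<sigma>" "P = proj \<tau> ` \<sigma>" using P by (auto simp: mem_cells faces_iff)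
  obtain \<zeta> where \<zeta>: "\<zeta> \<in> \<Sigma>" "\<tau> face_of \<zeta>" "F = proj \<tau> ` \<zeta>"
   using face_of_proj_image[OF \<sigma>(2,1,3) F(1)[unfolded \<sigma>(4)] F(2)] by blast
  \<comment> \<open>By \<open>cell_closure_eq\<close>, a closed face meets the stratum of \<rho> in
    a projected cone or not at all, so no new cells arise.\<close>
  have eq: "cell_closure N \<Sigma> (\<tau>, F) `` {\<rho>} = (if \<tau> face_of \<rho> \<and> \<rho> face_of \<zeta> then proj \<rho> ` \<zeta> else {})"
   unfolding \<zeta>(3) cell_closure_eq[OF \<zeta>(1) \<sigma>(1) \<zeta>(2)] using \<rho> by (auto simp: face_points_def)
  show "cell_closure N \<Sigma> (\<tau>, F) `` {\<rho>} = {}"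
   using new \<rho> \<zeta>(1) unfolding eq by (auto simp: mem_cells faces_iff split: if_splits)
 qed
 show "\<forall>(\<tau>, v)\<in>topspace (compactification N \<Sigma>). \<exists>!P. (\<tau>, P) \<in> cells \<and> v \<in> rel_interior P"
 proof clarify
  fix \<tau> v assume "(\<tau>, v) \<in> topspace (compactification N \<Sigma>)"
  then obtain \<sigma> where "(\<tau>, \<sigma>) \<in> \<F>" "v \<in> proj \<tau> ` \<sigma>"
   unfolding topspace_compactification[OF fan] by (auto simp: cone_points_def faces_iff)
  from rel_interior_cell[OF this] obtain \<eta> where \<eta>: "(\<tau>, \<eta>) \<in> \<F>" "v \<in> rel_interior (proj \<tau> ` \<eta>)" by blast
  show "\<exists>!P. (\<tau>, P) \<in> cells \<and> v \<in> rel_interior P"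
  proof (rule ex1I[of _ "proj \<tau> ` \<eta>"])
   show "(\<tau>, proj \<tau> ` \<eta>) \<in> cells \<and> v \<in> rel_interior (proj \<tau> ` \<eta>)" using \<eta> by (auto simp: mem_cells)
   fix P assume P: "(\<tau>, P) \<in> cells \<and> v \<in> rel_interior P"
   then obtain \<eta>' where \<eta>': "(\<tau>, \<eta>') \<in> \<F>" "P = proj \<tau> ` \<eta>'" by (auto simp: mem_cells)
   have "v \<in> proj \<tau> ` \<eta>" "v \<in> proj \<tau> ` \<eta>'" using P \<eta> \<eta>'(2) rel_interior_subset by blast+
   then have "\<eta> face_of \<eta>'" "\<eta>' face_of \<eta>"
    using rel_interior_meets[OF \<eta>(1) \<eta>'(1)] rel_interior_meets[OF \<eta>'(1) \<eta>(1)] P \<eta>(2) \<eta>'(2) by blast+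
   then show "P = proj \<tau> ` \<eta>" using face_of_imp_subset \<eta>'(2) by blast
  qed
 qed
qed

end

context tropical_setting
begin

definition cell_nu :: "'n face \<Rightarrow> 'n ext" where
 "cell_nu = (\<lambda>(\<tau>, P). star_nu \<tau> P)"

lemma cell_nu_eq: "(\<tau>, \<sigma>) \<in> \<F> \<Longrightarrow> cell_nu (\<tau>, proj \<tau> ` \<sigma>) = \<nu> (\<tau>, \<sigma>)"
 by (simp add: cell_nu_def star_nu_eq faces_iff)

lemma cell_orientation_cells: "cell_orientation N cells cell_nu"
 unfolding cell_orientation_def
proof
 fix \<delta> assume "\<delta> \<in> cells"
 then obtain \<tau> \<sigma> where eq: "\<delta> = (\<tau>, proj \<tau> ` \<sigma>)" and f: "(\<tau>, \<sigma>) \<in> \<F>" by (auto simp: cells_def)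
 have \<tau>: "\<tau> \<subseteq> span \<sigma>" using f face_subset_span by (simp add: faces_iff)
 have "cell_lattice N \<delta> = face_lattice N (\<tau>, \<sigma>)"
  by (simp add: eq cell_lattice_def face_lattice_def span_dirs[OF star_cone(4)[OF f]] proj_section[OF \<tau>])
 moreover have "\<nu> (\<tau>, \<sigma>) = ext_one" if "dim \<sigma> - dim \<tau> = 0"
 proof -
  have "dim \<sigma> = dim \<tau>" using that dim_face_mono[of \<tau> \<sigma>] f by (simp add: faces_iff)
  then show ?thesis using orient f unfolding orientation_def by blast
 qed
 ultimately show "is_generator (cell_lattice N \<delta>) (cell_dim \<delta>) (cell_nu \<delta>) \<and> (cell_dim \<delta> = 0 \<longrightarrow> cell_nu \<delta> = ext_one)"
  using nu_generator[OF f] star_cone(6)[OF f] cell_nu_eq[OF f] by (simp add: eq)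
qed

definition stratum_weight :: "('n rvec set \<Rightarrow> real) \<Rightarrow> 'n rvec set \<Rightarrow> 'n rvec set \<Rightarrow> real" where
 "stratum_weight k \<tau> Q = of_int (star_weight \<Sigma> \<omega> \<tau> Q) * k \<tau>"

lemma stratum_weight_eq: "(\<tau>, \<eta>) \<in> \<F> \<Longrightarrow> stratum_weight k \<tau> (proj \<tau> ` \<eta>) = of_int (\<omega> \<eta>) * k \<tau>"
 by (simp add: stratum_weight_def star_weight_def star_cone_unique faces_iff)

lemma mem_star_fan: "\<tau> \<in> \<Sigma> \<Longrightarrow> Q \<in> star_fan \<Sigma> \<tau> \<longleftrightarrow> (\<exists>\<eta>. (\<tau>, \<eta>) \<in> \<F> \<and> Q = proj \<tau> ` \<eta>)"
 by (auto simp: star_fan_def faces_iff)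

text \<open>Facet normals in the quotient by \<tau> are the primitive vectors of the original fan,
  so balancing at the image of \<sigma> is balancing of the fan at \<sigma>, scaled by k
  \<tau>.\<close>

lemma balanced_star:
 assumes \<tau>: "\<tau> \<in> \<Sigma>" "dim \<tau> = p" and k: "k \<tau> \<in> K"
 shows "balanced_complex K (proj \<tau> ` N) (d - p) (star_fan \<Sigma> \<tau>) (stratum_weight k \<tau>)"
 unfolding balanced_complex_def
proof (intro conjI ballI allI impI)
 note mem = mem_star_fan[OF \<tau>(1)]
 show "finite (star_fan \<Sigma> \<tau>)" using finite_fan by (simp add: star_fan_def)
 fix P assume "P \<in> star_fan \<Sigma> \<tau>"
 then obtain \<sigma> where \<sigma>: "(\<tau>, \<sigma>) \<in> \<F>" "P = proj \<tau> ` \<sigma>" using mem by blast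
 have m: "\<tau> face_of \<sigma>" "\<sigma> \<in> \<Sigma>" using \<sigma>(1) by (auto simp: faces_iff)
 show "P \<noteq> {}" "rational_polyhedron (proj \<tau> ` N) P" using star_cone(1,4)[OF \<sigma>(1)] \<sigma>(2) by auto
 show "F \<in> star_fan \<Sigma> \<tau>" if "F face_of P \<and> F \<noteq> {}" for F
  using face_of_proj_image[OF m(2) \<tau>(1) m(1), of F] that \<sigma>(2) mem \<tau>(1) by (auto simp: faces_iff)
 show "P \<inter> Q face_of P" "P \<inter> Q face_of Q" if Q: "Q \<in> star_fan \<Sigma> \<tau>" for Q
 proof -
  obtain \<eta> where \<eta>: "(\<tau>, \<eta>) \<in> \<F>" "Q = proj \<tau> ` \<eta>" using Q unfolding mem by (elim exE conjE)
  show "P \<inter> Q face_of P" using star_Int[OF \<sigma>(1) \<eta>(1)] \<sigma>(2) \<eta>(2) by simp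
  show "P \<inter> Q face_of Q" using star_Int[OF \<eta>(1) \<sigma>(1)] \<sigma>(2) \<eta>(2) by (simp add: Int_commute)
 qed
 show "\<exists>Q\<in>star_fan \<Sigma> \<tau>. aff_dim Q = int (d - p) \<and> P face_of Q"
 proof -
  obtain \<eta> where \<eta>: "\<eta> \<in> \<Sigma>" "dim \<eta> = d" "\<sigma> face_of \<eta>" using pure m(2) by (auto simp: pure_dim_def)
  have \<tau>\<eta>: "\<tau> face_of \<eta>" using m(1) \<eta>(3) by (rule face_of_trans)
  then have f: "(\<tau>, \<eta>) \<in> \<F>" using \<tau> \<eta> by (simp add: faces_iff)
  show ?thesis using mem f star_cone(5)[OF f] \<tau>(2) \<eta> proj_face_of_iff[OF m(2) \<eta>(1) \<tau>(1) m(1) \<tau>\<eta>] \<sigma>(2)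
   by (intro bexI[of _ "proj \<tau> ` \<eta>"]) auto
 qed
 show "stratum_weight k \<tau> P \<in> K"
 proof -
  have "of_int (\<omega> \<sigma>) \<in> K" using Ints_K by auto
  from real_subringD(6)[OF subK this k] show ?thesis using stratum_weight_eq[OF \<sigma>(1)] \<sigma>(2) by simp
 qed
 assume "aff_dim P = int (d - p) - 1"
 then have ds: "Suc (dim \<sigma>) = d" using star_cone(5)[OF \<sigma>(1)] \<sigma>(2) dim_le[OF \<tau>(1)] \<tau>(2) dim_face_mono[OF m(1)] by simp
 let ?A = "{Q. Q \<in> star_fan \<Sigma> \<tau> \<and> aff_dim Q = int (d - p) \<and> P face_of Q}"
  and ?B = "{\<eta>. \<eta> \<in> \<Sigma> \<and> dim \<eta> = d \<and> \<sigma> face_of \<eta>}"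
 have B: "(\<tau>, \<eta>) \<in> \<F>" if "\<eta> \<in> \<Sigma>" "\<sigma> face_of \<eta>" for \<eta> using that \<tau>(1) face_of_trans[OF m(1)] by (auto simp: faces_iff)
 have "aff_dim (proj \<tau> ` \<eta>) = int (d - p) \<longleftrightarrow> dim \<eta> = d" if "\<eta> \<in> \<Sigma>" "\<sigma> face_of \<eta>" for \<eta>
  using star_cone(5)[OF B[OF that]] dim_le[OF \<tau>(1)] dim_le[OF that(1)] dim_face_mono[OF m(1)] dim_face_mono[OF that(2)] \<tau>(2) by auto
 then have eq: "{\<eta>. \<eta> \<in> \<Sigma> \<and> \<sigma> face_of \<eta> \<and> aff_dim (proj \<tau> ` \<eta>) = int (d - p)} = ?B" by blast
 have "(\<Sum>Q\<in>?A. stratum_weight k \<tau> Q *\<^sub>R facet_normal (proj \<tau> ` N) P Q) =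
   (\<Sum>\<eta>\<in>?B. stratum_weight k \<tau> (proj \<tau> ` \<eta>) *\<^sub>R facet_normal (proj \<tau> ` N) P (proj \<tau> ` \<eta>))"
  using sum_star_cofaces[OF \<tau>(1) m(2,1), where R = "\<lambda>Q. aff_dim Q = int (d - p)"] unfolding eq \<sigma>(2)
  by (simp add: conj_commute)
 also have "\<dots> = (\<Sum>\<eta>\<in>?B. k \<tau> *\<^sub>R of_int (\<omega> \<eta>) *\<^sub>R primitive N \<sigma> \<eta>)"
  by (rule sum.cong[OF refl]) (use B facet_normal_star[OF \<sigma>(1)] stratum_weight_eq \<sigma>(2) in auto)
 also have "\<dots> = k \<tau> *\<^sub>R (\<Sum>\<eta>\<in>?B. of_int (\<omega> \<eta>) *\<^sub>R primitive N \<sigma> \<eta>)" by (simp only: scaleR_sum_right)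
 also have "\<dots> = 0" using balanced[OF m(2) ds] by simp
 finally show "(\<Sum>Q\<in>?A. stratum_weight k \<tau> Q *\<^sub>R facet_normal (proj \<tau> ` N) P Q) = 0" .
qed

text \<open>On \<open>cells\<close> with the orientations inherited from \<nu>, subdividing changes
  nothing, and the chain of the weighted star fans coincides with the combination. So the bounding
  term in \<open>is_cycle_class\<close> can be taken to be 0.\<close>

lemma combination_tropical_cycle:
 assumes p: "p \<le> d" and k: "\<And>\<sigma>. \<sigma> \<in> \<Sigma> \<Longrightarrow> dim \<sigma> = p \<Longrightarrow> k \<sigma> \<in> K"
  and h: "h \<in> carrier (trop_homology K N \<Sigma> \<nu> (d - p) (d - p))" "stratum_combination p k \<in> h"
 shows "\<exists>Z. tropical_cycle K N \<Sigma> (d - p) Z \<and> is_cycle_class K N \<Sigma> \<nu> (d - p) Z h"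
proof -
 let ?T = "{\<tau> \<in> \<Sigma>. dim \<tau> = p}"
 have "finite ?T" using finite_fan by simp
 then obtain ts where ts: "set ts = ?T" "distinct ts" using finite_distinct_list by blast
 define Z where "Z = map (\<lambda>\<tau>. (\<tau>, star_fan \<Sigma> \<tau>, stratum_weight k \<tau>)) ts"
 have "tropical_cycle K N \<Sigma> (d - p) Z"
  using ts(1) balanced_star k by (auto simp: tropical_cycle_def Z_def)
 moreover have "adapted cells Z"
  unfolding adapted_def
 proof clarify
  fix \<tau> Y w Q P x assume Z: "(\<tau>, Y, w) \<in> set Z" and Q: "Q \<in> Y" and P: "(\<tau>, P) \<in> cells"
   and ne: "rel_interior P \<inter> Q \<noteq> {}" and x: "x \<in> P"
  have \<tau>: "\<tau> \<in> \<Sigma>" "Y = star_fan \<Sigma> \<tau>" using Z ts(1) by (auto simp: Z_def)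
  obtain \<sigma> \<eta> where f: "(\<tau>, \<sigma>) \<in> \<F>" "P = proj \<tau> ` \<sigma>" "(\<tau>, \<eta>) \<in> \<F>" "Q = proj \<tau> ` \<eta>"
   using P Q mem_star_fan[OF \<tau>(1)] by (auto simp: mem_cells \<tau>(2))
  show "x \<in> Q" using rel_interior_meets[OF f(1,3)] ne x face_of_imp_subset unfolding f(2,4) by blast
 qed
 moreover have "subdivide_chain \<Sigma> \<nu> cells cell_nu (stratum_combination p k) = cycle_chain cells cell_nu (d - p) Z"
 proof
  fix \<delta> :: "'n face"
  obtain \<tau> P where eq: "\<delta> = (\<tau>, P)" by (metis surj_pair)
  show "subdivide_chain \<Sigma> \<nu> cells cell_nu (stratum_combination p k) \<delta> = cycle_chain cells cell_nu (d - p) Z \<delta>"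
  proof (cases "\<delta> \<in> cells")
   case False
   then show ?thesis by (simp add: eq subdivide_chain_def cycle_chain_def)
  next
   case True
   then obtain \<sigma> where f: "(\<tau>, \<sigma>) \<in> \<F>" "P = proj \<tau> ` \<sigma>" by (auto simp: eq mem_cells)
   have m: "\<tau> \<in> \<Sigma>" "\<sigma> \<in> \<Sigma>" "\<tau> face_of \<sigma>" using f by (auto simp: faces_iff)
   note cd = star_cone(6)[OF f(1)] and le = dim_face_mono[OF m(3)]
   have sub: "P \<subseteq> proj \<tau> ` \<eta> \<longleftrightarrow> \<sigma> face_of \<eta>" if "(\<tau>, \<eta>) \<in> \<F>" for \<eta>
    using that proj_image_subset_iff[OF m(2) _ m(1,3), of \<eta>] by (simp add: f(2) faces_iff)
   have "{\<eta>. (\<tau>, \<eta>) \<in> \<F> \<and> P \<subseteq> proj \<tau> ` \<eta> \<and> face_dim (\<tau>, \<eta>) = cell_dim (\<tau>, P)} = {\<sigma>}" (is "?A = _")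
   proof
    show "{\<sigma>} \<subseteq> ?A" using f cd by (auto simp: face_dim_def)
    show "?A \<subseteq> {\<sigma>}"
    proof
     fix \<eta> assume \<eta>: "\<eta> \<in> ?A"
     then have "\<eta> \<in> \<Sigma>" "\<tau> face_of \<eta>" "\<sigma> face_of \<eta>" using sub by (auto simp: faces_iff)
     moreover have "dim \<eta> - dim \<tau> = dim \<sigma> - dim \<tau>" using \<eta> cd by (simp add: f(2) face_dim_def)
     then have "dim \<eta> = dim \<sigma>" using le dim_face_mono[OF \<open>\<tau> face_of \<eta>\<close>] by linarith
     ultimately show "\<eta> \<in> {\<sigma>}" using face_dim_eq[of \<eta> \<sigma>] m(2) by simp
    qed
   qed
   \<comment> \<open>The cell and the face carry the same generator, which is nonzero, so the
     comparison sign is 1.\<close>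
   moreover have "(THE s. s \<in> {1, - 1} \<and> cell_nu (\<tau>, P) = s *\<^sub>R \<nu> (\<tau>, \<sigma>)) = 1"
   proof (rule the_equality)
    show "1 \<in> {1, - 1} \<and> cell_nu (\<tau>, P) = 1 *\<^sub>R \<nu> (\<tau>, \<sigma>)" using cell_nu_eq[OF f(1)] f(2) by simp
    fix s :: real assume "s \<in> {1, - 1} \<and> cell_nu (\<tau>, P) = s *\<^sub>R \<nu> (\<tau>, \<sigma>)"
    then have "s *\<^sub>R \<nu> (\<tau>, \<sigma>) = 1 *\<^sub>R \<nu> (\<tau>, \<sigma>)" using cell_nu_eq[OF f(1)] f(2) by simp
    then show "s = 1" using nu_nonzero[OF f(1)] by (simp only: scaleR_cancel_right) simp
   qed
   ultimately have L: "subdivide_chain \<Sigma> \<nu> cells cell_nu (stratum_combination p k) \<delta> = stratum_combination p k (\<tau>, \<sigma>)"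
    using True by (simp add: eq subdivide_chain_def)
   show ?thesis
   proof (cases "dim \<sigma> - dim \<tau> = d - p")
    case False
    then have "\<not> (dim \<tau> = p \<and> dim \<sigma> = d)" by auto
    then show ?thesis unfolding L using False cd by (simp add: eq f(2) cycle_chain_def stratum_combination_apply(2))
   next
    case True2: True
    let ?w = "\<lambda>\<tau>'. if \<tau>' = \<tau> then \<Sum>Q | Q \<in> star_fan \<Sigma> \<tau>' \<and> aff_dim Q = int (d - p) \<and> P \<subseteq> Q. stratum_weight k \<tau>' Q else 0"
    have "cycle_chain cells cell_nu (d - p) Z \<delta> = (\<Sum>\<tau>'\<leftarrow>ts. ?w \<tau>') *\<^sub>R \<nu> (\<tau>, \<sigma>)"
     using True True2 cd cell_nu_eq[OF f(1)] by (simp add: eq cycle_chain_def f(2) Z_def o_def if_distrib cong: if_cong)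
    also have "(\<Sum>\<tau>'\<leftarrow>ts. ?w \<tau>') = (\<Sum>\<tau>'\<in>?T. ?w \<tau>')" by (simp add: sum_list_distinct_conv_sum_set ts)
    also have "\<dots> = (if dim \<tau> = p then \<Sum>Q | Q \<in> star_fan \<Sigma> \<tau> \<and> aff_dim Q = int (d - p) \<and> P \<subseteq> Q. stratum_weight k \<tau> Q else 0)"
     using m(1) \<open>finite ?T\<close> by (simp add: sum.delta)
    finally have R: "cycle_chain cells cell_nu (d - p) Z \<delta> = (if dim \<tau> = p then \<Sum>Q | Q \<in> star_fan \<Sigma> \<tau> \<and>
      aff_dim Q = int (d - p) \<and> P \<subseteq> Q. stratum_weight k \<tau> Q else 0) *\<^sub>R \<nu> (\<tau>, \<sigma>)" .
    show ?thesis
    proof (cases "dim \<tau> = p")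
     case False
     then show ?thesis unfolding L R by (simp add: stratum_combination_def)
    next
     case \<tau>p: True
     then have \<sigma>d: "dim \<sigma> = d" using True2 p le by linarith
     \<comment> \<open>A cone of dimension d is maximal, so the only top-dimensional member of the
       star fan containing P is P, and a single weight remains.\<close>
     have "{Q. Q \<in> star_fan \<Sigma> \<tau> \<and> aff_dim Q = int (d - p) \<and> P \<subseteq> Q} = {P}" (is "?B = _")
     proof
      show "{P} \<subseteq> ?B" using f mem_star_fan[OF m(1)] star_cone(5)[OF f(1)] True2 by auto
      show "?B \<subseteq> {P}"
      proof
       fix Q assume Q: "Q \<in> ?B"
       then obtain \<eta> where \<eta>: "(\<tau>, \<eta>) \<in> \<F>" "Q = proj \<tau> ` \<eta>" using mem_star_fan[OF m(1)] by blast
       then have "\<eta> \<in> \<Sigma>" "\<sigma> face_of \<eta>" using sub[OF \<eta>(1)] Q by (auto simp: faces_iff)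
       then have "\<eta> = \<sigma>" by (rule top_maximal[OF m(2) \<sigma>d])
       then show "Q \<in> {P}" using \<eta>(2) f(2) by simp
      qed
     qed
     then show ?thesis
      unfolding L R using \<tau>p \<sigma>d f(1) by (simp add: stratum_combination_apply stratum_weight_eq f(2))
    qed
   qed
  qed
 qed
 moreover have "0 \<in> cell_chains K N \<Sigma> cells (d - p) (Suc (d - p))"
  unfolding cell_chains_def by (auto simp: kmoduleD(1)[OF kmodule_ext_power[OF subK]])
 moreover have "cell_boundary N \<Sigma> cells cell_nu 0 = 0"
  by (simp add: fun_eq_iff cell_boundary_def ext_map_linear)
 ultimately show ?thesis
  unfolding is_cycle_class_def using h subdivision_cells cell_orientation_cells
  by (intro exI[of _ Z] conjI exI[of _ cells] exI[of _ cell_nu] bexI[of _ "stratum_combination p k"] bexI[of _ 0]) auto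
qed

end

section \<open>Dual coordinates from the hypotheses on the fan\<close>

context simplicial_lattice_fan
begin

text \<open>\<open>integral_dual_family\<close> gives forms dual up to a common positive integer c,
  which is invertible in \<rat>.\<close>

lemma dual_coords_Rats: "dual_coords \<rat>"
 unfolding dual_coords_def
proof
 fix \<sigma> assume \<sigma>: "\<sigma> \<in> \<Sigma>"
 obtain gs where gs: "set gs = gens \<sigma>" "distinct gs" using finite_distinct_list[OF gens(1)[OF \<sigma>]] by blast
 have "\<exists>c x. c > 0 \<and> c \<in> \<int> \<and> (\<forall>v\<in>set gs. linear (x v :: _ \<Rightarrow> real) \<and> x v ` N \<subseteq> \<int> \<and>
  (\<forall>w\<in>set gs. x v w = (if w = v then c else 0)))"
  using gens[OF \<sigma>] gs by (intro integral_dual_family[OF N_coordinatized]) auto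
 then obtain c x where c: "c > 0" "c \<in> \<int>" and x: "\<forall>v\<in>gens \<sigma>. linear (x v :: _ \<Rightarrow> real) \<and> x v ` N \<subseteq> \<int> \<and>
  (\<forall>w\<in>gens \<sigma>. x v w = (if w = v then c else 0))" unfolding gs(1) by (elim exE conjE)
 have km: "kmodule \<rat> (kspan \<rat> S)" for S :: "'n rvec set" by (rule kmodule_kspan[OF real_subring_Rats])
 show "\<exists>x. \<forall>\<rho>\<in>gens \<sigma>. linear (x \<rho>) \<and> (\<forall>\<rho>'\<in>gens \<sigma>. x \<rho> \<rho>' = (if \<rho>' = \<rho> then 1 else 0)) \<and>
  (\<forall>n\<in>N. x \<rho> n *\<^sub>R \<rho> \<in> kspan \<rat> (N \<inter> span {\<rho>}))"
 proof (intro exI[of _ "\<lambda>\<rho> z. (1 / c) * x \<rho> z"] ballI conjI)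
  fix \<rho> assume \<rho>: "\<rho> \<in> gens \<sigma>"
  show "linear (\<lambda>z. (1 / c) * x \<rho> z)" using linear_cmult x \<rho> by blast
  show "(1 / c) * x \<rho> \<rho>' = (if \<rho>' = \<rho> then 1 else 0)" if "\<rho>' \<in> gens \<sigma>" for \<rho>' using x \<rho> that c(1) by auto
  fix n assume n: "n \<in> N"
  have "x \<rho> n \<in> \<int>" using x \<rho> n by blast
  then have "(1 / c) * x \<rho> n \<in> \<rat>" using c(2) Ints_subset_Rats by (intro Rats_mult Rats_divide) auto
  moreover have "\<rho> \<in> kspan \<rat> (N \<inter> span {\<rho>})"
   using kspan_superset[of \<rat> "N \<inter> span {\<rho>}"] gens(2)[OF \<sigma>] \<rho> by (auto simp: span_base)
  ultimately show "((1 / c) * x \<rho> n) *\<^sub>R \<rho> \<in> kspan \<rat> (N \<inter> span {\<rho>})" by (rule kmoduleD(3)[OF km])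
 qed
qed

text \<open>\<open>gen\<close> fixes a lattice vector of the ray only up to a positive factor, so
  unimodularity, which speaks of primitive vectors, has to be transferred by rescaling.\<close>

lemma primitive_ray:
 assumes "\<sigma> \<in> \<Sigma>" "\<rho> \<in> gens \<sigma>"
 shows "\<exists>t>0. t *\<^sub>R \<rho> \<in> primitive N {0} ` rays \<sigma>"
proof -
 obtain r where r: "r \<in> rays \<sigma>" "\<rho> = gen r" using assms(2) by (auto simp: gens_def)
 have r\<Sigma>: "r \<in> \<Sigma>" "dim r = Suc (dim {0 :: 'n rvec})" using r(1) face_mem[OF assms(1)] by (auto simp: rays_def dim_eq_0)
 obtain u where u: "u \<notin> gens {0}" "gens r = insert u (gens {0})"
  using codim_one_gens[OF zero_cone(1) r\<Sigma>(1) zero_cone(2)[OF r\<Sigma>(1)] r\<Sigma>(2)] by blast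
 have "r face_of r" using r\<Sigma>(1) by (simp add: face_of_iff_gens)
 then have "r \<in> rays r" using r(1) by (simp add: rays_def)
 then have "gen r \<in> gens r" by (simp add: gens_def)
 then have "u = \<rho>" using u r(2) by (simp add: zero_cone(3))
 moreover obtain t where "t > 0" "primitive N {0} r = t *\<^sub>R proj {0} u"
  using primitive_facet(1)[OF zero_cone(1) r\<Sigma>(1) u(2,1)] by blast
 ultimately have "t > 0" "primitive N {0} r = t *\<^sub>R \<rho>" by simp_all
 then show ?thesis using r(1) by (metis imageI)
qed

text \<open>A lattice basis containing the primitive vectors of the rays has integral dual forms;
  these are rescaled to be dual to the chosen generators instead.\<close>

lemma dual_coords_Ints:
 assumes "unimodular_fan N \<Sigma>" shows "dual_coords \<int>"
 unfolding dual_coords_def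
proof
 fix \<sigma> assume \<sigma>: "\<sigma> \<in> \<Sigma>"
 obtain B where B: "independent B" "kspan \<int> B = N" "primitive N {0} ` rays \<sigma> \<subseteq> B"
  using assms \<sigma> unfolding unimodular_fan_def lattice_basis_def by blast
 have BN: "B \<subseteq> N" using kspan_superset[OF Ints_1, of B] B(2) by simp
 \<comment> \<open>The factor carrying the chosen generator to the primitive vector in B.\<close>
 define t where "t \<rho> = (SOME t. t > 0 \<and> t *\<^sub>R \<rho> \<in> B)" for \<rho>
 have t: "t \<rho> > 0" "t \<rho> *\<^sub>R \<rho> \<in> B" if "\<rho> \<in> gens \<sigma>" for \<rho>
 proof -
  have "t \<rho> > 0 \<and> t \<rho> *\<^sub>R \<rho> \<in> B"
   unfolding t_def by (rule someI_ex) (use primitive_ray[OF \<sigma> that] B(3) in blast)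
  then show "t \<rho> > 0" "t \<rho> *\<^sub>R \<rho> \<in> B" by simp_all
 qed
 have inj: "\<rho>' = \<rho>" if "\<rho> \<in> gens \<sigma>" "\<rho>' \<in> gens \<sigma>" "t \<rho>' *\<^sub>R \<rho>' = t \<rho> *\<^sub>R \<rho>" for \<rho> \<rho>'
 proof (rule ccontr)
  assume ne: "\<rho>' \<noteq> \<rho>"
  have "\<rho>' = (1 / t \<rho>') *\<^sub>R (t \<rho>' *\<^sub>R \<rho>')" using t(1)[OF that(2)] by simp
  also have "\<dots> = (1 / t \<rho>' * t \<rho>) *\<^sub>R \<rho>" unfolding that(3) by simp
  finally have eq: "\<rho>' = (1 / t \<rho>' * t \<rho>) *\<^sub>R \<rho>" .
  have "(1 / t \<rho>' * t \<rho>) *\<^sub>R \<rho> \<in> span (gens \<sigma> - {\<rho>'})"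
   using that(1) ne by (intro span_scale span_base) auto
  then have "\<rho>' \<in> span (gens \<sigma> - {\<rho>'})" using eq by simp
  then show False using gens(4)[OF \<sigma>] that(2) by (auto simp: dependent_def)
 qed
 define Q where "Q b f \<longleftrightarrow> linear f \<and> (\<forall>b'\<in>B. f b' = (if b' = b then 1 else 0))" for b and f :: "'n rvec \<Rightarrow> real"
 define y where "y b = (SOME f. Q b f)" for b
 have Q: "Q b (y b)" for b
  unfolding y_def
 proof (rule someI_ex[of "Q b"])
  show "\<exists>f. Q b f" unfolding Q_def by (rule linear_independent_extend[OF B(1)])
 qed
 then have y: "linear (y b)" "b' \<in> B \<Longrightarrow> y b b' = (if b' = b then 1 else 0)" for b b' unfolding Q_def by simp_all
 have yN: "y b n \<in> \<int>" if "n \<in> N" for b n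
 proof -
  have "kspan \<int> B \<subseteq> y b -` \<int>"
  proof (rule kspan_least)
   show "B \<subseteq> y b -` \<int>" using y(2) by auto
   show "kmodule \<int> (y b -` \<int>)" by (rule kmodule_vimage[OF y(1)]) (auto simp: kmodule_def)
  qed
  then show ?thesis using that B(2) by blast
 qed
 show "\<exists>x. \<forall>\<rho>\<in>gens \<sigma>. linear (x \<rho>) \<and> (\<forall>\<rho>'\<in>gens \<sigma>. x \<rho> \<rho>' = (if \<rho>' = \<rho> then 1 else 0)) \<and>
  (\<forall>n\<in>N. x \<rho> n *\<^sub>R \<rho> \<in> kspan \<int> (N \<inter> span {\<rho>}))"
 \<comment> \<open>The form dual to t \<rho> is multiplied by t to take the value 1 on \<rho>. The
   product x(n) \<rho> is then y(n) times t \<rho>, an integral multiple of the primitive vector,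
   even when x(n) is not an integer.\<close>
 proof (intro exI[of _ "\<lambda>\<rho> z. t \<rho> * y (t \<rho> *\<^sub>R \<rho>) z"] ballI conjI)
  fix \<rho> assume \<rho>: "\<rho> \<in> gens \<sigma>"
  let ?e = "t \<rho> *\<^sub>R \<rho>"
  show "linear (\<lambda>z. t \<rho> * y ?e z)" by (rule linear_cmult[OF y(1)])
  show "t \<rho> * y ?e \<rho>' = (if \<rho>' = \<rho> then 1 else 0)" if \<rho>': "\<rho>' \<in> gens \<sigma>" for \<rho>'
  proof -
   have "t \<rho>' * y ?e \<rho>' = (if t \<rho>' *\<^sub>R \<rho>' = ?e then 1 else 0)"
    using y(2)[OF t(2)[OF \<rho>'], of ?e] by (simp add: linear_scale[OF y(1)])
   then show ?thesis using inj[OF \<rho> \<rho>'] t(1)[OF \<rho>'] by (auto split: if_splits)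
  qed
  fix n assume n: "n \<in> N"
  have e: "?e \<in> kspan \<int> (N \<inter> span {\<rho>})"
   using kspan_superset[OF Ints_1, of "N \<inter> span {\<rho>}"] BN t(2)[OF \<rho>] by (auto simp: span_base span_scale)
  have "y ?e n *\<^sub>R ?e \<in> kspan \<int> (N \<inter> span {\<rho>})"
   by (rule kmoduleD(3)[OF kmodule_kspan[OF real_subring_Ints] yN[OF n] e])
  then show "(t \<rho> * y ?e n) *\<^sub>R \<rho> \<in> kspan \<int> (N \<inter> span {\<rho>})" by (simp add: mult.commute)
 qed
qed

end

section \<open>Duality and vanishing for both coefficient rings\<close>

context tropical_setting
begin

lemma homology_and_duality:
 assumes "tropical_homology_manifold K N \<Sigma> d \<omega>" "dual_coords K"
 shows "(\<forall>p\<le>d. \<forall>\<alpha>\<in>carrier (trop_cohomology K N \<Sigma> \<nu> p p). \<exists>Z.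
   tropical_cycle K N \<Sigma> (d - p) Z \<and>
   is_cycle_class K N \<Sigma> \<nu> (d - p) Z (poincare_dual K N \<Sigma> d \<omega> \<nu> p \<alpha>)) \<and>
  (\<forall>p q. p \<noteq> q \<longrightarrow> trivial_group (trop_homology K N \<Sigma> \<nu> p q))"
proof (intro conjI allI impI ballI)
 fix p \<alpha> assume p: "p \<le> d" and \<alpha>: "\<alpha> \<in> carrier (trop_cohomology K N \<Sigma> \<nu> p p)"
 show "\<exists>Z. tropical_cycle K N \<Sigma> (d - p) Z \<and>
   is_cycle_class K N \<Sigma> \<nu> (d - p) Z (poincare_dual K N \<Sigma> d \<omega> \<nu> p \<alpha>)"
  using poincare_dual_combination[OF p \<alpha>] combination_tropical_cycle[OF p] by blast
next
 fix p q :: nat assume "p \<noteq> q"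
 then consider "p < q" | "q < p" by linarith
 then show "trivial_group (trop_homology K N \<Sigma> \<nu> p q)"
  using homology_vanish_above[OF subK assms(2)] homology_vanish_below[OF subK pure assms(1)] by cases auto
qed

end

theorem theorem1p5:
 fixes N :: "'n::{finite,linorder} rvec set"
  and \<Sigma> :: "'n rvec set set"
  and d :: nat
  and \<omega> :: "'n rvec set \<Rightarrow> int"
  and \<nu> :: "'n face \<Rightarrow> 'n ext"
 assumes "is_lattice N"
  and "tropical_fan N \<Sigma> d \<omega>"
  and "orientation N \<Sigma> \<nu>"
 shows
  "(unimodular_fan N \<Sigma> \<and> tropical_homology_manifold \<int> N \<Sigma> d \<omega> \<longrightarrow>
    (\<forall>p\<le>d. \<forall>\<alpha>\<in>carrier (trop_cohomology \<int> N \<Sigma> \<nu> p p). \<exists>Z.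
      tropical_cycle \<int> N \<Sigma> (d - p) Z \<and>
      is_cycle_class \<int> N \<Sigma> \<nu> (d - p) Z (poincare_dual \<int> N \<Sigma> d \<omega> \<nu> p \<alpha>)) \<and>
    (\<forall>p q. p \<noteq> q \<longrightarrow> trivial_group (trop_homology \<int> N \<Sigma> \<nu> p q))) \<and>
   (simplicial_fan \<Sigma> \<and> tropical_homology_manifold \<rat> N \<Sigma> d \<omega> \<longrightarrow>
    (\<forall>p\<le>d. \<forall>\<alpha>\<in>carrier (trop_cohomology \<rat> N \<Sigma> \<nu> p p). \<exists>Z.
      tropical_cycle \<rat> N \<Sigma> (d - p) Z \<and>
      is_cycle_class \<rat> N \<Sigma> \<nu> (d - p) Z (poincare_dual \<rat> N \<Sigma> d \<omega> \<nu> p \<alpha>)) \<and>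
    (\<forall>p q. p \<noteq> q \<longrightarrow> trivial_group (trop_homology \<rat> N \<Sigma> \<nu> p q)))"
  (is "(?U \<longrightarrow> ?A) \<and> (?S \<longrightarrow> ?B)")
proof (intro conjI[of "_ \<longrightarrow> _" "_ \<longrightarrow> _"] impI)
 assume h: ?U
 interpret tropical_setting N \<Sigma> \<nu> \<int> d \<omega>
  using assms h by unfold_locales (auto simp: tropical_fan_def unimodular_fan_def)
 show ?A using h dual_coords_Ints by (intro homology_and_duality) auto
next
 assume h: ?S
 interpret tropical_setting N \<Sigma> \<nu> \<rat> d \<omega>
  using assms h by unfold_locales (auto simp: tropical_fan_def)
 show ?B using h dual_coords_Rats by (intro homology_and_duality) auto
qed

end
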